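(* Assume (A1), (A2), (A3) and (A4). Then $\gamma_n^{-1/2}(\theta_n-\theta_\star)$ converges in distribution, as $n\to\infty$, to a centered Gaussian distribution with covariance matrix $\sigma^2U_\star$, where $\sigma^2=d/2$ in case (A4)(i) and $\sigma^2=\gamma_\star d/(2\gamma_\star-d)$ in case (A4)(ii), and $$U_\star=\int_{\mathsf X}\Big\{\widehat H_{\theta_\star}(x)\widehat H_{\theta_\star}(x)^T-P_{\theta_\star}\widehat H_{\theta_\star}(x)\,\big(P_{\theta_\star}\widehat H_{\theta_\star}(x)\big)^T\Big\}\pi_{\theta_\star}(x)\lambda(dx),\qquad \widehat H_{\theta_\star}=\sum_{n\ge0}P^n_{\theta_\star}\big(H(\cdot,\theta_\star)-h(\theta_\star)\big).$$
   Context: Setting: $(\mathsf X,\mathcal X)$ Polish space with Borel $\sigma$-algebra and $\sigma$-finite reference measure $\lambda$; $\pi$ a probability density w.r.t. $\lambda$; $d\ge2$; $\mathsf X_1,\dots,\mathsf X_d$ a measurable partition of $\mathsf X$; $I(x)=i$ iff $x\in\mathsf X_i$; $\theta_\star(i)=\int_{\mathsf X_i}\pi\,d\lambda$; $\Theta=\{\theta\in(0,1)^d:\sum_i\theta(i)=1\}$; $\pi_\theta(x)=\big(\sum_{i}\theta_\star(i)/\theta(i)\big)^{-1}\sum_{i}\frac{\pi(x)}{\theta(i)}\mathbf 1_{\mathsf X_i}(x)$. (A1): $0<\inf\pi\le\sup\pi<\infty$ and $\min_i\theta_\star(i)>0$. (A2): $P_\theta$ is the Metropolis–Hastings kernel with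 target $\pi_\theta\,d\lambda$ and symmetric proposal density $q$ w.r.t. $\lambda$ with $\inf_{\mathsf X^2}q>0$. (A3): $\{\gamma_n\}_{n\ge1}$ deterministic, $[0,1)$-valued, non-increasing, $\gamma_n\to0$, $\sum\gamma_n=\infty$, $\sum\gamma_n^2<\infty$. (A4): $\lim_n\gamma_n\sqrt n=0$ and either (i) $\log(\gamma_n/\gamma_{n+1})=o(\gamma_n)$, or (ii) $\log(\gamma_n/\gamma_{n+1})\sim\gamma_n/\gamma_\star$ for some constant $\gamma_\star>d/2$. Field and mean field: $H_i(x,\theta)=\theta(i)(\mathbf 1_{\mathsf X_i}(x)-\theta(I(x)))$ (vector in $\mathbb R^d$), $h(\theta)=\int_{\mathsf X}H(x,\theta)\pi_\theta(x)\lambda(dx)$. Linearized Wang–Landau algorithm: $X_0\in\mathsf X$, $\theta_0\in\Theta$; $X_{n+1}\sim P_{\theta_n}(X_n,\cdot)$ conditionally on $\mathcal F_n=\sigma(\theta_0,X_0,\dots,X_n)$; $\theta_{n+1}=\theta_n+\gamma_{n+1}H(X_{n+1},\theta_n)$. *)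

theory Defs
  imports "HOL-Probability.Probability" "HOL-Library.Landau_Symbols"
begin

text \<open>Vectors in R^d are indexed by a finite type 'd (the partition index set);
the partition X_1..X_d of the state space 'x is encoded by the measurable
index map I :: 'x => 'd, with X_i = {x. I x = i}.\<close>

definition theta_star :: "'x measure \<Rightarrow> ('x \<Rightarrow> real) \<Rightarrow> ('x \<Rightarrow> 'd) \<Rightarrow> real ^ 'd" where
  "theta_star lam p I = (\<chi> i. \<integral>x. indicator {x. I x = i} x * p x \<partial>lam)"

definition Theta :: "(real ^ 'd) set" where
  "Theta = {th. (\<forall>i. 0 < th $ i \<and> th $ i < 1) \<and> (\<Sum>i\<in>UNIV. th $ i) = 1}"

definition pi_theta :: "'x measure \<Rightarrow> ('x \<Rightarrow> real) \<Rightarrow> ('x \<Rightarrow> 'd::finite) \<Rightarrow> real ^ 'd \<Rightarrow> 'x \<Rightarrow> real" where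
  "pi_theta lam p I th x =
     inverse (\<Sum>i\<in>UNIV. theta_star lam p I $ i / th $ i) * (\<Sum>i\<in>UNIV. p x / th $ i * indicator {y. I y = i} x)"

text \<open>Metropolis--Hastings kernel with target pi_theta d lambda and proposal density q,
  acting on (real- or vector-valued) functions:
  P f (x) = int alpha(x,y) q(x,y) f(y) lambda(dy) + (1 - int alpha(x,y) q(x,y) lambda(dy)) f(x),
  with alpha(x,y) = min(1, pi_theta(y)/pi_theta(x)).\<close>
definition mh_accept :: "'x measure \<Rightarrow> ('x \<Rightarrow> real) \<Rightarrow> ('x \<Rightarrow> 'd::finite) \<Rightarrow> real ^ 'd \<Rightarrow> 'x \<Rightarrow> 'x \<Rightarrow> real" where
  "mh_accept lam p I th x y = min 1 (pi_theta lam p I th y / pi_theta lam p I th x)"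

definition MH_op :: "'x measure \<Rightarrow> ('x \<Rightarrow> real) \<Rightarrow> ('x \<Rightarrow> 'd::finite) \<Rightarrow> ('x \<Rightarrow> 'x \<Rightarrow> real)
    \<Rightarrow> real ^ 'd \<Rightarrow> ('x \<Rightarrow> 'b::{banach, second_countable_topology}) \<Rightarrow> 'x \<Rightarrow> 'b" where
  "MH_op lam p I q th f x =
     (\<integral>y. (mh_accept lam p I th x y * q x y) *\<^sub>R f y \<partial>lam)
     + (1 - (\<integral>y. mh_accept lam p I th x y * q x y \<partial>lam)) *\<^sub>R f x"

definition MH_prob :: "'x measure \<Rightarrow> ('x \<Rightarrow> real) \<Rightarrow> ('x \<Rightarrow> 'd::finite) \<Rightarrow> ('x \<Rightarrow> 'x \<Rightarrow> real)
    \<Rightarrow> real ^ 'd \<Rightarrow> 'x \<Rightarrow> 'x set \<Rightarrow> real" where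
  "MH_prob lam p I q th x A = MH_op lam p I q th (indicator A :: 'x \<Rightarrow> real) x"

definition WL_field :: "('x \<Rightarrow> 'd::finite) \<Rightarrow> 'x \<Rightarrow> real ^ 'd \<Rightarrow> real ^ 'd" where
  "WL_field I x th = (\<chi> i. th $ i * (indicator {y. I y = i} x - th $ (I x)))"

definition mean_field :: "'x measure \<Rightarrow> ('x \<Rightarrow> real) \<Rightarrow> ('x \<Rightarrow> 'd::finite) \<Rightarrow> real ^ 'd \<Rightarrow> real ^ 'd" where
  "mean_field lam p I th = (\<integral>x. pi_theta lam p I th x *\<^sub>R WL_field I x th \<partial>lam)"

definition H_hat :: "'x measure \<Rightarrow> ('x \<Rightarrow> real) \<Rightarrow> ('x \<Rightarrow> 'd::finite) \<Rightarrow> ('x \<Rightarrow> 'x \<Rightarrow> real) \<Rightarrow> 'x \<Rightarrow> real ^ 'd" where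
  "H_hat lam p I q x =
     (let ts = theta_star lam p I;
          g = (\<lambda>y. WL_field I y ts - mean_field lam p I ts)
      in (\<Sum>n. ((MH_op lam p I q ts ^^ n) g) x))"

definition outer :: "real ^ 'd \<Rightarrow> real ^ 'd \<Rightarrow> real ^ 'd ^ 'd" where
  "outer u v = (\<chi> i j. u $ i * v $ j)"

definition U_star :: "'x measure \<Rightarrow> ('x \<Rightarrow> real) \<Rightarrow> ('x \<Rightarrow> 'd::finite) \<Rightarrow> ('x \<Rightarrow> 'x \<Rightarrow> real) \<Rightarrow> real ^ 'd ^ 'd" where
  "U_star lam p I q =
     (let ts = theta_star lam p I;
          Hh = H_hat lam p I q;
          PHh = MH_op lam p I q ts Hh
      in \<integral>x. pi_theta lam p I ts x *\<^sub>R (outer (Hh x) (Hh x) - outer (PHh x) (PHh x)) \<partial>lam)"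

text \<open>Centered Gaussian law on R^d with (possibly singular) covariance matrix S,
  characterised by its characteristic function.\<close>
definition centered_gaussian :: "(real ^ 'd) measure \<Rightarrow> real ^ 'd ^ 'd \<Rightarrow> bool" where
  "centered_gaussian mu S \<longleftrightarrow> prob_space mu \<and> sets mu = sets borel \<and>
     (\<forall>t. (\<integral>x. cis (t \<bullet> x) \<partial>mu) = complex_of_real (exp (- (t \<bullet> (S *v t)) / 2)))"

definition conv_in_distribution :: "'a measure \<Rightarrow> (nat \<Rightarrow> 'a \<Rightarrow> real ^ 'd) \<Rightarrow> (real ^ 'd) measure \<Rightarrow> bool" where
  "conv_in_distribution M Y mu \<longleftrightarrow>
     (\<forall>f :: real ^ 'd \<Rightarrow> real. continuous_on UNIV f \<and> bounded (range f) \<longrightarrow>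
        (\<lambda>n. \<integral>\<omega>. f (Y n \<omega>) \<partial>M) \<longlonglongrightarrow> (\<integral>x. f x \<partial>mu))"

definition nat_filtration :: "'a measure \<Rightarrow> ('a \<Rightarrow> real ^ 'd) \<Rightarrow> (nat \<Rightarrow> 'a \<Rightarrow> 'x::topological_space) \<Rightarrow> nat \<Rightarrow> 'a set set" where
  "nat_filtration M th0 X n = sigma_sets (space M)
     ({th0 -` B \<inter> space M | B. B \<in> sets (borel :: (real ^ 'd) measure)} \<union>
      (\<Union>k\<le>n. {X k -` A \<inter> space M | A. A \<in> sets (borel :: 'x measure)}))"

end

theory Submission
  imports Defs
begin

text \<open>Since \<open>p\<close> and \<open>q\<close> are bounded below, the kernels satisfy a Doeblin condition that is uniform over
  the whole open simplex, and they depend on the weights only through ratios of weights. Poisson solutions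
  are therefore bounded and Lipschitz in the log weights without any restriction to compact sets. The Lyapunov
  function \<open>V \<theta> = (\<Sum>i. (max 0 (ts i / \<theta> i - 1))\<^sup>2)\<close> bounds the squared error, and by Chebyshev's
  sum inequality it contracts everywhere on the simplex at the rate \<open>2/d\<close> of the linearised dynamics; this gives
  \<open>E (V (th n)) = O(gamma n)\<close> directly, with no separate proof of consistency. After adding the Poisson corrections
  for the field and for its conditional variance, the characteristic function of the rescaled error satisfies
  a perturbed contractive recursion whose limit is the Gaussian one. The Poisson corrections cost only
  \<open>o(gamma n)\<close> per step because (A4) forces \<open>gamma n - gamma (Suc n) = O((gamma n)\<^sup>2)\<close>.
  Initial weights that are not bounded away from 0 are treated by conditioning.\<close>

section \<open>Contractive recursions and Gaussian limits\<close>

text \<open>The constants come from the linearisation at \<open>ts\<close>. The mean field is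
  \<open>(ts - \<theta>) / ssum \<theta>\<close> and \<open>ssum ts = d\<close>, so the error
  contracts by \<open>1 - gamma / d\<close> per step. Passing from \<open>1 / sqrt (gamma n)\<close>
  to the next normalisation multiplies by about \<open>1 + rho * gamma / 2\<close>. The squared
  factor is thus about \<open>1 - (2/d - rho) * gamma\<close>, and balancing it against noise of
  variance \<open>gamma * U\<close> gives the covariance \<open>U / (2/d - rho)\<close>. Both cases
  of (A4) become the existence of one limit \<open>rho\<close>, namely 0 or \<open>1 / gs\<close>,
  and \<open>gs > d/2\<close> says that \<open>2/d - rho\<close> is positive. Two obstacles shape
  the estimates. No lower bound on the weights that is uniform in time is available, so every
  constant has to survive at the boundary of the simplex. And the limit is singular, since the
  components of the field sum to zero, so the noise cannot supply contraction in every direction.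
  The error of the characteristic function is therefore measured relative to \<open>abs s\<close>,
  and the shrinking of its argument is what contracts.\<close>

lemma contraction_bounded:
  fixes x g :: "nat \<Rightarrow> real"
  assumes rec: "\<And>n. n \<ge> N \<Longrightarrow> x (Suc n) \<le> (1 - k * g n) * x n + C * g n"
    and g: "\<And>n. n \<ge> N \<Longrightarrow> 0 \<le> g n" "\<And>n. n \<ge> N \<Longrightarrow> k * g n \<le> 1" and k: "0 < k"
  shows "\<exists>B. \<forall>n\<ge>N. x n \<le> B"
proof -
  \<comment> \<open>\<open>C / k\<close> is the level at which the drift
    \<open>- k * g n * x\<close> cancels the forcing \<open>C * g n\<close>, so no level above it
    can be crossed upwards.\<close>
  define B where "B = max (x N) (C / k)"
  have "x n \<le> B" if "n \<ge> N" for n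
    using that
  proof (induction rule: dec_induct)
    case base
    show ?case by (simp add: B_def)
  next
    case (step n)
    have "x (Suc n) \<le> (1 - k * g n) * B + C * g n"
      using rec[of n] g[of n] step mult_left_mono[of "x n" B "1 - k * g n"] by fastforce
    also have "C \<le> k * B"
      using k by (simp add: B_def max_def field_simps)
    hence "C * g n \<le> k * B * g n"
      using g(1)[of n] step by (intro mult_right_mono) auto
    finally show ?case by (simp add: algebra_simps)
  qed
  thus ?thesis by blast
qed

text \<open>Once \<open>e n\<close> is below \<open>k * h\<close>, the difference
  \<open>x n - h\<close> is multiplied by at most \<open>1 - k * g n <= exp (- k * g n)\<close>, and
  divergence of the sum of \<open>g\<close> sends the product of these factors to zero. As
  \<open>h\<close> is arbitrary, so does \<open>x\<close>.\<close>

lemma contraction_tendsto_0: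
  fixes x g e :: "nat \<Rightarrow> real"
  assumes rec: "\<And>n. n \<ge> N \<Longrightarrow> x (Suc n) \<le> (1 - k * g n) * x n + g n * e n"
    and g: "\<And>n. n \<ge> N \<Longrightarrow> 0 \<le> g n" "\<And>n. n \<ge> N \<Longrightarrow> k * g n \<le> 1" and k: "0 < k"
    and x: "\<And>n. n \<ge> N \<Longrightarrow> 0 \<le> x n"
    and e: "e \<longlonglongrightarrow> 0" and div: "\<not> summable g"
  shows "x \<longlonglongrightarrow> 0"
proof (rule LIMSEQ_I)
  fix r :: real assume r: "0 < r"
  define h where "h = r / 2"
  have h: "h > 0" using r by (simp add: h_def)
  have "eventually (\<lambda>n. e n < k * h) sequentially"
    using order_tendstoD(2)[OF e, of "k * h"] h k by simp
  then obtain N1 where N1: "\<And>n. n \<ge> N1 \<Longrightarrow> e n < k * h"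
    by (auto simp: eventually_sequentially)
  define L where "L = max N N1"
  \<comment> \<open>The absolute value at \<open>L\<close> makes the bound nonnegative, which is
    needed when \<open>1 - y <= exp (- y)\<close> is multiplied by it; \<open>x n - h\<close> itself
    may be negative.\<close>
  have step: "x n - h \<le> exp (- k * (\<Sum>j=L..<n. g j)) * \<bar>x L - h\<bar>" if "n \<ge> L" for n
    using that
  proof (induction rule: dec_induct)
    case base
    show ?case by simp
  next
    case (step n)
    have n: "n \<ge> N" "n \<ge> N1" using step by (auto simp: L_def)
    have "g n * e n \<le> g n * (k * h)"
      using g(1)[OF n(1)] N1[OF n(2)] by (intro mult_left_mono) auto
    hence "x (Suc n) - h \<le> (1 - k * g n) * (x n - h)"
      using rec[OF n(1)] by (simp add: algebra_simps)
    also have "\<dots> \<le> (1 - k * g n) * (exp (- k * (\<Sum>j=L..<n. g j)) * \<bar>x L - h\<bar>)"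
      using g(2)[OF n(1)] step.IH by (intro mult_left_mono) auto
    also have "\<dots> \<le> exp (- (k * g n)) * (exp (- k * (\<Sum>j=L..<n. g j)) * \<bar>x L - h\<bar>)"
      using exp_ge_add_one_self[of "- (k * g n)"] by (intro mult_right_mono) auto
    also have "\<dots> = exp (- k * (\<Sum>j=L..<Suc n. g j)) * \<bar>x L - h\<bar>"
      using step by (simp add: exp_add[symmetric] algebra_simps flip: mult.assoc)
    finally show ?case .
  qed
  have "filterlim (\<lambda>n. \<Sum>j=L..<n. g j) at_top sequentially"
  proof -
    have ns: "\<not> summable (\<lambda>j. g (j + L))"
      using div by (simp add: summable_iff_shift)
    have "\<not> Bseq (\<lambda>n. \<Sum>j<n. g (j + L))"
    proof
      assume "Bseq (\<lambda>n. \<Sum>j<n. g (j + L))"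
      then obtain K where K: "\<And>n. norm (\<Sum>j<n. g (j + L)) \<le> K" by (auto simp: Bseq_def)
      have "summable (\<lambda>j. g (j + L))"
        by (rule summableI_nonneg_bounded[where x=K]) (use K g(1) in \<open>auto simp: L_def abs_le_iff\<close>)
      thus False using ns by simp
    qed
    have inc: "incseq (\<lambda>n. \<Sum>j=L..<n. g j)"
    proof (rule incseq_SucI)
      fix n show "(\<Sum>j=L..<n. g j) \<le> (\<Sum>j=L..<Suc n. g j)"
        using g(1)[of n] by (auto simp: L_def)
    qed
    show ?thesis unfolding filterlim_at_top
    proof
      fix Z :: real
      have "\<exists>n. Z \<le> (\<Sum>j=L..<n. g j)"
      proof (rule ccontr)
        assume "\<not> ?thesis"
        hence *: "(\<Sum>j=L..<n. g j) < Z" for n by (metis not_le)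
        have "(\<Sum>j<n. g (j + L)) = (\<Sum>j=L..<n+L. g j)" for n
          using sum.shift_bounds_nat_ivl[of g 0 L n] by (simp add: atLeast0LessThan)
        moreover have "0 \<le> (\<Sum>j<n. g (j + L))" for n
          using g(1) by (intro sum_nonneg) (auto simp: L_def)
        ultimately have "norm (\<Sum>j<n. g (j + L)) \<le> Z" for n
          using *[of "n+L"] by (simp add: less_imp_le)
        hence "Bseq (\<lambda>n. \<Sum>j<n. g (j + L))" by (rule BseqI')
        thus False using \<open>\<not> Bseq _\<close> by simp
      qed
      then obtain n where "Z \<le> (\<Sum>j=L..<n. g j)" by blast
      thus "\<forall>\<^sub>F n in sequentially. Z \<le> (\<Sum>j=L..<n. g j)"
        using inc unfolding incseq_def eventually_sequentially by (meson order_trans)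
    qed
  qed
  hence "filterlim (\<lambda>n. k * (\<Sum>j=L..<n. g j)) at_top sequentially"
    by (rule filterlim_tendsto_pos_mult_at_top[OF tendsto_const k])
  hence "filterlim (\<lambda>n. - k * (\<Sum>j=L..<n. g j)) at_bot sequentially"
    by (simp add: filterlim_uminus_at_top)
  hence "(\<lambda>n. exp (- k * (\<Sum>j=L..<n. g j))) \<longlonglongrightarrow> 0"
    by (rule filterlim_compose[OF exp_at_bot])
  hence "(\<lambda>n. exp (- k * (\<Sum>j=L..<n. g j)) * \<bar>x L - h\<bar>) \<longlonglongrightarrow> 0"
    by (rule tendsto_mult_left_zero)
  from order_tendstoD(2)[OF this h]
  obtain N2 where N2: "\<And>n. n \<ge> N2 \<Longrightarrow> exp (- k * (\<Sum>j=L..<n. g j)) * \<bar>x L - h\<bar> < h"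
    by (auto simp: eventually_sequentially)
  have "norm (x n - 0) < r" if "n \<ge> max L N2" for n
    using step[of n] N2[of n] that x[of n] by (auto simp: h_def L_def)
  thus "\<exists>no. \<forall>n\<ge>no. norm (x n - 0) < r" by blast
qed

text \<open>The nonnegative products, summed over all ordered pairs, expand to twice the difference
  of the two sides.\<close>

lemma Chebyshev_sum_similarly_ordered:
  fixes f g :: "'i \<Rightarrow> real"
  assumes "\<And>i j. i \<in> A \<Longrightarrow> j \<in> A \<Longrightarrow> 0 \<le> (f i - f j) * (g i - g j)"
  shows "(\<Sum>i\<in>A. f i) * (\<Sum>i\<in>A. g i) \<le> card A * (\<Sum>i\<in>A. f i * g i)"
proof -
  have "0 \<le> (\<Sum>i\<in>A. \<Sum>j\<in>A. (f i - f j) * (g i - g j))"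
    by (intro sum_nonneg assms)
  also have "\<dots> = 2 * (card A * (\<Sum>i\<in>A. f i * g i)) - 2 * ((\<Sum>i\<in>A. f i) * (\<Sum>i\<in>A. g i))"
  proof -
    have "(\<Sum>i\<in>A. \<Sum>j\<in>A. (f i - f j) * (g i - g j)) =
        (\<Sum>i\<in>A. \<Sum>j\<in>A. f i * g i) + (\<Sum>i\<in>A. \<Sum>j\<in>A. f j * g j)
         - (\<Sum>i\<in>A. \<Sum>j\<in>A. f i * g j) - (\<Sum>i\<in>A. \<Sum>j\<in>A. f j * g i)"
      by (simp add: algebra_simps sum.distrib sum_subtractf)
    also have "(\<Sum>i\<in>A. \<Sum>j\<in>A. f j * g i) = (\<Sum>i\<in>A. \<Sum>j\<in>A. f i * g j)"
      by (rule sum.swap)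
    also have "(\<Sum>i\<in>A. \<Sum>j\<in>A. f i * g j) = (\<Sum>i\<in>A. f i) * (\<Sum>i\<in>A. g i)"
      by (simp add: sum_product)
    finally show ?thesis by (simp flip: sum_distrib_left)
  qed
  finally show ?thesis by simp
qed

section \<open>Existence of possibly singular Gaussian laws\<close>

text \<open>Gaussian elimination: subtracting the square of a pivot column clears one index at a time.\<close>

lemma psd_sum_outer:
  fixes S :: "real ^ 'd ^ 'd"
  assumes "finite J"
    and "\<And>i j. S $ i $ j = S $ j $ i"
    and "\<And>t. 0 \<le> t \<bullet> (S *v t)"
    and "\<And>i j. S $ i $ j \<noteq> 0 \<Longrightarrow> i \<in> J \<and> j \<in> J"
  shows "\<exists>v :: 'd \<Rightarrow> real ^ 'd. \<forall>t. t \<bullet> (S *v t) = (\<Sum>i\<in>J. (t \<bullet> v i)\<^sup>2)"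
  using assms
proof (induction J arbitrary: S rule: finite_induct)
  case empty
  have "S = 0" using empty(3) by (simp add: vec_eq_iff) blast
  thus ?case by simp
next
  case (insert k J)
  note sym = insert.prems(1) and psd = insert.prems(2) and supp = insert.prems(3)
  have ax: "S *v axis k 1 = (\<chi> i. S $ i $ k)"
    by (simp add: matrix_vector_mult_def axis_def vec_eq_iff if_distrib cong: if_cong)
  have kk: "axis k 1 \<bullet> (S *v axis k 1) = S $ k $ k"
    unfolding ax by (simp add: inner_axis' )
  have dot_sym: "x \<bullet> (S *v y) = y \<bullet> (S *v x)" for x y
  proof -
    have "transpose S = S" using sym by (simp add: transpose_def vec_eq_iff)
    thus ?thesis by (metis dot_lmul_matrix inner_commute vector_transpose_matrix)
  qed
  have quad: "(x + c *\<^sub>R axis k 1) \<bullet> (S *v (x + c *\<^sub>R axis k 1)) =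
      x \<bullet> (S *v x) + 2 * c * (x \<bullet> (\<chi> i. S $ i $ k)) + c\<^sup>2 * S $ k $ k" for x c
    using kk dot_sym[of "axis k 1" x]
    by (simp add: matrix_vector_right_distrib inner_add_left inner_add_right
        matrix_vector_mult_scaleR ax power2_eq_square algebra_simps)
  have Skk: "0 \<le> S $ k $ k" using psd[of "axis k 1"] kk by simp
  show ?case
  proof (cases "S $ k $ k = 0")
    case True
    have z: "x \<bullet> (\<chi> i. S $ i $ k) = 0" for x
    proof (rule ccontr)
      assume nz: "x \<bullet> (\<chi> i. S $ i $ k) \<noteq> 0"
      \<comment> \<open>With a vanishing pivot the form is affine in the shift \<open>c\<close>;
        this \<open>c\<close> would give it the value -1.\<close>
      define c where "c = - (x \<bullet> (S *v x) + 1) / (2 * (x \<bullet> (\<chi> i. S $ i $ k)))"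
      have "2 * c * (x \<bullet> (\<chi> i. S $ i $ k)) = - (x \<bullet> (S *v x) + 1)"
        using nz by (simp add: c_def)
      thus False using psd[of "x + c *\<^sub>R axis k 1"] quad[of x c] True by simp
    qed
    have col: "S $ i $ k = 0" for i
      using z[of "axis i 1"] by (simp add: inner_axis')
    have "\<And>i j. S $ i $ j \<noteq> 0 \<Longrightarrow> i \<in> J \<and> j \<in> J"
      using supp col sym by (metis insertE)
    from insert.IH[OF sym psd this]
    obtain v :: "'d \<Rightarrow> real ^ 'd" where v: "\<forall>t. t \<bullet> (S *v t) = (\<Sum>i\<in>J. (t \<bullet> v i)\<^sup>2)" by blast
    have "\<forall>t. t \<bullet> (S *v t) = (\<Sum>i\<in>insert k J. (t \<bullet> (v(k := 0)) i)\<^sup>2)"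
    proof
      fix t
      have "(\<Sum>i\<in>J. (t \<bullet> (v(k := 0)) i)\<^sup>2) = (\<Sum>i\<in>J. (t \<bullet> v i)\<^sup>2)"
        using insert.hyps by (intro sum.cong) auto
      thus "t \<bullet> (S *v t) = (\<Sum>i\<in>insert k J. (t \<bullet> (v(k := 0)) i)\<^sup>2)"
        using insert.hyps v by simp
    qed
    thus ?thesis by blast
  next
    case False
    define s where "s = S $ k $ k"
    have s: "s > 0" using False Skk by (simp add: s_def)
    define u :: "real ^ 'd" where "u = (\<chi> i. S $ i $ k)"
    define S' :: "real ^ 'd ^ 'd" where "S' = (\<chi> i j. S $ i $ j - u $ i * u $ j / s)"
    have q': "t \<bullet> (S' *v t) = t \<bullet> (S *v t) - (t \<bullet> u)\<^sup>2 / s" for t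
    proof -
      have "S' *v t = S *v t - ((t \<bullet> u) / s) *\<^sub>R u"
        by (simp add: vec_eq_iff S'_def matrix_vector_mult_def inner_vec_def algebra_simps
            sum_subtractf sum_distrib_left sum_divide_distrib)
      thus ?thesis by (simp add: inner_diff_right power2_eq_square)
    qed
    have sym': "S' $ i $ j = S' $ j $ i" for i j
      by (simp add: S'_def sym[of i j])
    have psd': "0 \<le> t \<bullet> (S' *v t)" for t
    proof -
      \<comment> \<open>The minimiser of the quadratic in \<open>c\<close>; its minimum is the
        quadratic form of the Schur complement \<open>S'\<close>.\<close>
      define c where "c = - (t \<bullet> u) / s"
      have "0 \<le> t \<bullet> (S *v t) + 2 * c * (t \<bullet> u) + c\<^sup>2 * s"
        using psd[of "t + c *\<^sub>R axis k 1"] quad[of t c] by (simp add: u_def s_def)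
      also have "\<dots> = t \<bullet> (S *v t) - (t \<bullet> u)\<^sup>2 / s"
        using s by (simp add: c_def field_simps power2_eq_square)
      finally show ?thesis by (simp add: q')
    qed
    have supp': "i \<in> J \<and> j \<in> J" if "S' $ i $ j \<noteq> 0" for i j
    proof -
      have "i \<noteq> k" using that s sym by (auto simp: S'_def u_def s_def)
      moreover have "j \<noteq> k" using that s sym by (auto simp: S'_def u_def s_def)
      moreover have "i \<in> insert k J \<and> j \<in> insert k J"
      proof (cases "S $ i $ j = 0")
        case True
        hence "S $ i $ k \<noteq> 0" "S $ j $ k \<noteq> 0" using that by (auto simp: S'_def u_def)
        thus ?thesis using supp by blast
      next
        case False
        thus ?thesis using supp by blast
      qed
      ultimately show ?thesis by blast
    qed
    from insert.IH[OF sym' psd' supp']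
    obtain v :: "'d \<Rightarrow> real ^ 'd" where v: "\<forall>t. t \<bullet> (S' *v t) = (\<Sum>i\<in>J. (t \<bullet> v i)\<^sup>2)" by blast
    have "\<forall>t. t \<bullet> (S *v t) = (\<Sum>i\<in>insert k J. (t \<bullet> (v(k := (1 / sqrt s) *\<^sub>R u)) i)\<^sup>2)"
    proof
      fix t
      have "(\<Sum>i\<in>J. (t \<bullet> (v(k := (1 / sqrt s) *\<^sub>R u)) i)\<^sup>2) = (\<Sum>i\<in>J. (t \<bullet> v i)\<^sup>2)"
        using insert.hyps by (intro sum.cong) auto
      thus "t \<bullet> (S *v t) = (\<Sum>i\<in>insert k J. (t \<bullet> (v(k := (1 / sqrt s) *\<^sub>R u)) i)\<^sup>2)"
        using insert.hyps v[rule_format, of t] q'[of t] s by (simp add: power_divide)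
    qed
    thus ?thesis by blast
  qed
qed

text \<open>Independent standard normals, combined linearly along the vectors of
  \<open>psd_sum_outer\<close>, have the required characteristic function by factorisation. Singular
  \<open>S\<close> has to be allowed: the quadratic form of \<open>U_star\<close> vanishes in the
  constant direction.\<close>

lemma centered_gaussian_exists:
  fixes S :: "real ^ 'd ^ 'd"
  assumes "\<And>i j. S $ i $ j = S $ j $ i" and "\<And>t. 0 \<le> t \<bullet> (S *v t)"
  shows "\<exists>mu. centered_gaussian mu S"
proof -
  obtain v :: "'d \<Rightarrow> real ^ 'd" where v: "\<And>t. t \<bullet> (S *v t) = (\<Sum>i\<in>UNIV. (t \<bullet> v i)\<^sup>2)"
    using psd_sum_outer[of UNIV S] assms by auto
  define N where "N = PiM (UNIV :: 'd set) (\<lambda>_. std_normal_distribution)"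
  interpret sn: prob_space std_normal_distribution
    by (rule real_dist_normal_dist[THEN real_distribution.axioms(1)])
  interpret N: product_prob_space "\<lambda>_::'d. std_normal_distribution" UNIV ..
  interpret N': prob_space N unfolding N_def by (rule prob_space_PiM) unfold_locales
  have m: "(\<lambda>g. \<Sum>i\<in>UNIV. g i *\<^sub>R v i) \<in> borel_measurable N"
    unfolding N_def by measurable
  define mu where "mu = distr N borel (\<lambda>g. \<Sum>i\<in>UNIV. g i *\<^sub>R v i)"
  have "(\<integral>x. cis (t \<bullet> x) \<partial>mu) = complex_of_real (exp (- (t \<bullet> (S *v t)) / 2))" for t
  proof -
    have [measurable]: "(\<lambda>x::real^'d. cis (t \<bullet> x)) \<in> borel_measurable borel"
      by (intro borel_measurable_continuous_onI continuous_intros)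
    have "(\<integral>x. cis (t \<bullet> x) \<partial>mu) = (\<integral>g. cis (t \<bullet> (\<Sum>i\<in>UNIV. g i *\<^sub>R v i)) \<partial>N)"
      unfolding mu_def by (rule integral_distr[OF m]) measurable
    also have "\<dots> = (\<integral>g. (\<Prod>i\<in>UNIV. iexp ((t \<bullet> v i) * g i)) \<partial>N)"
      by (intro Bochner_Integration.integral_cong refl)
        (simp add: inner_sum_right cis_conv_exp sum_distrib_left exp_sum[symmetric] mult_ac)
    also have "\<dots> = (\<Prod>i\<in>UNIV. (\<integral>x. iexp ((t \<bullet> v i) * x) \<partial>std_normal_distribution))"
      unfolding N_def
      by (rule N.product_integral_prod) (auto intro!: sn.integrable_const_bound[where B=1])
    also have "\<dots> = (\<Prod>i\<in>UNIV. complex_of_real (exp (- ((t \<bullet> v i)\<^sup>2) / 2)))"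
      using char_std_normal_distribution[unfolded char_def fun_eq_iff] by simp
    also have "\<dots> = complex_of_real (exp (- (t \<bullet> (S *v t)) / 2))"
      by (simp add: v exp_sum[symmetric] sum_negf sum_divide_distrib flip: of_real_prod)
    finally show ?thesis .
  qed
  moreover have "prob_space mu" unfolding mu_def by (rule N'.prob_space_distr[OF m])
  ultimately show ?thesis
    unfolding centered_gaussian_def by (intro exI[of _ mu]) (auto simp: mu_def)
qed

section \<open>Convergence in distribution from characteristic functions\<close>

text \<open>These functions have expectations determined by the characteristic function, and they
  also form an algebra; the phase \<open>b\<close> brings in the sines.\<close>

inductive trig_sum :: "(real ^ 'd \<Rightarrow> real) \<Rightarrow> bool" where
  cos: "trig_sum (\<lambda>x. r * cos (u \<bullet> x + b))"
| add: "trig_sum f \<Longrightarrow> trig_sum g \<Longrightarrow> trig_sum (\<lambda>x. f x + g x)"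

lemma trig_sum_const: "trig_sum (\<lambda>x. r)"
  using trig_sum.cos[of r 0 0] by simp

lemma trig_sum_sin: "trig_sum (\<lambda>x. r * sin (u \<bullet> x))"
  using trig_sum.cos[of r u "- (pi / 2)"] by (simp add: cos_diff)

lemma trig_sum_sum: "finite A \<Longrightarrow> (\<And>i. i \<in> A \<Longrightarrow> trig_sum (f i)) \<Longrightarrow> trig_sum (\<lambda>x. \<Sum>i\<in>A. f i x)"
  by (induction A rule: finite_induct) (auto intro: trig_sum_const trig_sum.add)

lemma trig_sum_mult:
  assumes "trig_sum f" "trig_sum g" shows "trig_sum (\<lambda>x. f x * g x)"
  using assms
proof (induction arbitrary: g)
  case (cos r u b)
  from cos.prems show ?case
  proof (induction)
    case (cos r' u' b')
    have "(\<lambda>x. (r * cos (u \<bullet> x + b)) * (r' * cos (u' \<bullet> x + b'))) =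
        (\<lambda>x. (r * r' / 2) * cos ((u - u') \<bullet> x + (b - b')) + (r * r' / 2) * cos ((u + u') \<bullet> x + (b + b')))"
    proof
      fix x
      have "cos (u \<bullet> x + b) * cos (u' \<bullet> x + b') =
          (cos ((u - u') \<bullet> x + (b - b')) + cos ((u + u') \<bullet> x + (b + b'))) / 2"
      proof -
        have e: "(u - u') \<bullet> x + (b - b') = (u \<bullet> x + b) - (u' \<bullet> x + b')"
          "(u + u') \<bullet> x + (b + b') = (u \<bullet> x + b) + (u' \<bullet> x + b')"
          by (simp_all add: inner_diff_left inner_add_left)
        show ?thesis unfolding e by (rule cos_times_cos)
      qed
      moreover have "(r * z) * (r' * z') = (r * r' / 2) * y + (r * r' / 2) * y'"
        if "z * z' = (y + y') / 2" for z z' y y'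
      proof -
        have "(r * z) * (r' * z') = (r * r') * (z * z')" by (simp only: mult_ac)
        thus ?thesis unfolding that by (simp add: field_simps)
      qed
      ultimately show "(r * cos (u \<bullet> x + b)) * (r' * cos (u' \<bullet> x + b')) =
         (r * r' / 2) * cos ((u - u') \<bullet> x + (b - b')) + (r * r' / 2) * cos ((u + u') \<bullet> x + (b + b'))"
        by blast
    qed
    thus ?case by (simp only: trig_sum.intros)
  next
    case (add f g)
    thus ?case by (simp add: distrib_left trig_sum.add)
  qed
next
  case (add f1 f2)
  thus ?case by (simp add: distrib_right trig_sum.add)
qed

text \<open>Closure under products makes any polynomial in sines of coordinates a finite sum of
  cosines; a linear function is first expanded in the coordinates.\<close>

lemma trig_sum_polynomial_sin:
  fixes g :: "real ^ 'd \<Rightarrow> real"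
  assumes "real_polynomial_function g"
  shows "trig_sum (\<lambda>x. g (\<chi> i. sin (c * x $ i)))"
  using assms
proof induction
  case (linear f)
  interpret bounded_linear f by fact
  have "f (\<chi> i. sin (c * x $ i)) = (\<Sum>i\<in>UNIV. f (axis i 1) * sin ((c *\<^sub>R axis i 1) \<bullet> x))" for x :: "real ^ 'd"
  proof -
    have "(\<chi> i. sin (c * x $ i)) = (\<Sum>i\<in>UNIV. sin (c * x $ i) *\<^sub>R axis i 1)"
      using basis_expansion[of "\<chi> i. sin (c * x $ i)"] by (simp add: scalar_mult_eq_scaleR)
    thus ?thesis by (simp add: sum scaleR inner_axis' mult.commute)
  qed
  moreover have "trig_sum (\<lambda>x. \<Sum>i\<in>UNIV. f (axis i 1) * sin ((c *\<^sub>R axis i 1) \<bullet> x))"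
    by (intro trig_sum_sum trig_sum_sin) simp
  ultimately show ?case by presburger
qed (auto intro: trig_sum_const trig_sum.add trig_sum_mult)

text \<open>Each cosine is the real part of a fixed multiple of \<open>cis (u \<bullet> x)\<close>.
  Measurability and boundedness are part of the conclusion because additivity of the integral needs
  them in the inductive step.\<close>

lemma trig_sum_expectation_tendsto:
  fixes Y :: "nat \<Rightarrow> 'a \<Rightarrow> real ^ 'd"
  assumes "prob_space M" "prob_space mu" and mu: "sets mu = sets borel"
    and Y: "\<And>n. Y n \<in> borel_measurable M"
    and char: "\<And>t. (\<lambda>n. \<integral>\<omega>. cis (t \<bullet> Y n \<omega>) \<partial>M) \<longlonglongrightarrow> (\<integral>x. cis (t \<bullet> x) \<partial>mu)"
    and "trig_sum f"
  shows "f \<in> borel_measurable borel \<and> (\<exists>B. \<forall>x. \<bar>f x\<bar> \<le> B) \<and>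
    (\<lambda>n. \<integral>\<omega>. f (Y n \<omega>) \<partial>M) \<longlonglongrightarrow> (\<integral>x. f x \<partial>mu)"
  using \<open>trig_sum f\<close>
proof induction
  interpret M: prob_space M by fact
  interpret mu: prob_space mu by fact
  note [measurable] = Y
  note [measurable_cong] = mu
  {
    case (cos r u b)
    have [measurable]: "(\<lambda>x::real^'d. cis (u \<bullet> x)) \<in> borel_measurable borel"
      by (intro borel_measurable_continuous_onI continuous_intros)
    have Re: "r * cos (u \<bullet> x + b) = Re (of_real r * cis b * cis (u \<bullet> x))" for x
      by (simp add: cos_add algebra_simps)
    have 1: "(\<integral>\<omega>. r * cos (u \<bullet> Y n \<omega> + b) \<partial>M) = Re (of_real r * cis b * (\<integral>\<omega>. cis (u \<bullet> Y n \<omega>) \<partial>M))" for n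
      unfolding Re
      by (subst integral_Re) (auto intro!: integrable_mult_right M.integrable_const_bound[where B=1])
    have 2: "(\<integral>x. r * cos (u \<bullet> x + b) \<partial>mu) = Re (of_real r * cis b * (\<integral>x. cis (u \<bullet> x) \<partial>mu))"
      unfolding Re
      by (subst integral_Re) (auto intro!: integrable_mult_right mu.integrable_const_bound[where B=1])
    have "\<bar>r * cos (u \<bullet> x + b)\<bar> \<le> \<bar>r\<bar>" for x
      using abs_cos_le_one by (simp add: abs_mult mult_left_le)
    thus ?case unfolding 1 2 by (intro conjI exI[of _ "\<bar>r\<bar>"] tendsto_intros char) auto
  next
    case (add f g)
    then obtain B1 B2 where B: "\<And>x. \<bar>f x\<bar> \<le> B1" "\<And>x. \<bar>g x\<bar> \<le> B2" by blast
    have [measurable]: "f \<in> borel_measurable borel" "g \<in> borel_measurable borel" using add by auto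
    have i: "integrable M (\<lambda>\<omega>. f (Y n \<omega>))" "integrable M (\<lambda>\<omega>. g (Y n \<omega>))" for n
      by (rule M.integrable_const_bound[where B=B1], use B in simp, measurable)
        (rule M.integrable_const_bound[where B=B2], use B in simp, measurable)
    have i2: "integrable mu f" "integrable mu g"
      by (rule mu.integrable_const_bound[where B=B1], use B in simp, measurable)
        (rule mu.integrable_const_bound[where B=B2], use B in simp, measurable)
    have "\<bar>f x + g x\<bar> \<le> B1 + B2" for x using B[of x] by linarith
    thus ?case using add i i2 by (auto intro!: tendsto_add)
  }
qed

lemma (in prob_space) abs_expectation_le_tail:
  fixes h :: "'c::euclidean_space \<Rightarrow> real"
  assumes [measurable]: "h \<in> borel_measurable borel" "Z \<in> borel_measurable M"
    and h: "\<And>x. norm x \<le> R \<Longrightarrow> \<bar>h x\<bar> \<le> e" "\<And>x. \<bar>h x\<bar> \<le> C" and "0 \<le> e" "0 \<le> C"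
  shows "\<bar>expectation (\<lambda>\<omega>. h (Z \<omega>))\<bar> \<le> e + C * prob {\<omega>\<in>space M. R < norm (Z \<omega>)}"
proof -
  have le: "\<bar>h (Z \<omega>)\<bar> \<le> e + C * indicator {\<omega>\<in>space M. R < norm (Z \<omega>)} \<omega>" if "\<omega> \<in> space M" for \<omega>
    using h[of "Z \<omega>"] \<open>0 \<le> e\<close> \<open>0 \<le> C\<close> that by (auto simp: indicator_def not_less)
  have ig: "integrable M (\<lambda>\<omega>. h (Z \<omega>))" by (rule integrable_const_bound[where B=C]) (auto simp: h)
  have "\<bar>expectation (\<lambda>\<omega>. h (Z \<omega>))\<bar> \<le> expectation (\<lambda>\<omega>. \<bar>h (Z \<omega>)\<bar>)" by (rule integral_abs_bound)
  also have "\<dots> \<le> expectation (\<lambda>\<omega>. e + C * indicator {\<omega>\<in>space M. R < norm (Z \<omega>)} \<omega>)"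
    using ig le by (intro integral_mono) (auto intro!: integrable_real_indicator simp: emeasure_eq_measure)
  also have "\<dots> = e + C * prob {\<omega>\<in>space M. R < norm (Z \<omega>)}"
    by (subst Bochner_Integration.integral_add)
      (auto intro!: integrable_real_indicator simp: emeasure_eq_measure prob_space)
  finally show ?thesis .
qed

text \<open>Levy continuity with tightness given. On a large ball \<open>f\<close> is a continuous
  function of the sines of the rescaled coordinates, hence by Stone-Weierstrass uniformly close to a
  trigonometric sum, for which convergence is known; tightness makes the outside of the ball
  negligible.\<close>

lemma conv_in_distribution_of_char:
  fixes Y :: "nat \<Rightarrow> 'a \<Rightarrow> real ^ 'd"
  assumes "prob_space M" "prob_space mu" and mu: "sets mu = sets borel"
    and Y: "\<And>n. Y n \<in> borel_measurable M"
    and char: "\<And>t. (\<lambda>n. \<integral>\<omega>. cis (t \<bullet> Y n \<omega>) \<partial>M) \<longlonglongrightarrow> (\<integral>x. cis (t \<bullet> x) \<partial>mu)"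
    and tight: "\<And>e. 0 < e \<Longrightarrow> \<exists>R. eventually (\<lambda>n. measure M {\<omega>\<in>space M. R < norm (Y n \<omega>)} \<le> e) sequentially"
  shows "conv_in_distribution M Y mu"
  unfolding conv_in_distribution_def
proof (intro allI impI, elim conjE)
  interpret M: prob_space M by fact
  interpret mu: prob_space mu by fact
  note [measurable] = Y
  note [measurable_cong] = mu
  have sp: "space mu = UNIV" using sets_eq_imp_space_eq[OF mu] by simp
  fix f :: "real ^ 'd \<Rightarrow> real"
  assume cont: "continuous_on UNIV f" and bdd: "bounded (range f)"
  have [measurable]: "f \<in> borel_measurable borel" by (rule borel_measurable_continuous_onI[OF cont])
  obtain B where B: "\<And>x. \<bar>f x\<bar> \<le> B" and B0: "B > 0"
    using bdd unfolding bounded_pos by auto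
  \<comment> \<open>A single law is tight: the complements of balls decrease to the empty
    set.\<close>
  have mu_tight: "\<exists>R. measure mu {x. R < norm x} \<le> e" if "0 < e" for e
  proof -
    have "(\<lambda>n. measure mu {x. real n < norm x}) \<longlonglongrightarrow> measure mu (\<Inter>n. {x. real n < norm x})"
    proof (rule mu.finite_Lim_measure_decseq)
      show "range (\<lambda>n. {x. real n < norm x}) \<subseteq> sets mu" by (auto simp: mu)
      show "decseq (\<lambda>n. {x::real^'d. real n < norm x})" by (auto simp: decseq_def intro: le_less_trans)
    qed
    moreover have "(\<Inter>n. {x::real^'d. real n < norm x}) = {}"
      using reals_Archimedean2 by (auto, metis not_less_iff_gr_or_eq)
    ultimately have "(\<lambda>n. measure mu {x. real n < norm x}) \<longlonglongrightarrow> 0" by simp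
    from order_tendstoD(2)[OF this that] obtain n where "measure mu {x. real n < norm x} < e"
      by (auto simp: eventually_sequentially)
    thus ?thesis by (intro exI[of _ "real n"]) auto
  qed
  show "(\<lambda>n. \<integral>\<omega>. f (Y n \<omega>) \<partial>M) \<longlonglongrightarrow> (\<integral>x. f x \<partial>mu)"
  proof (rule LIMSEQ_I)
    fix r :: real assume r: "0 < r"
    \<comment> \<open>The two comparisons of \<open>f\<close> with \<open>T\<close> cost
      \<open>e + (2 * B + 1) * e\<close> each and the convergence for \<open>T\<close> costs
      \<open>e\<close>; the sum is at most \<open>8 * (B + 1) * e\<close>.\<close>
    define e where "e = min 1 (r / (8 * (B + 1)))"
    have "r / (8 * (B + 1)) * (8 * (B + 1)) = r" using B0 by simp
    hence e: "0 < e" "e \<le> 1" "e * (8 * (B + 1)) \<le> r"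
      using B0 r mult_right_mono[of e "r / (8 * (B + 1))" "8 * (B + 1)"] by (auto simp: e_def)
    obtain R1 where R1: "eventually (\<lambda>n. measure M {\<omega>\<in>space M. R1 < norm (Y n \<omega>)} \<le> e) sequentially"
      using tight[OF e(1)] by blast
    obtain R2 where R2: "measure mu {x. R2 < norm x} \<le> e" using mu_tight[OF e(1)] by blast
    define R where "R = max 1 (max R1 R2)"
    have R: "R \<ge> 1" by (simp add: R_def)
    have R1': "eventually (\<lambda>n. measure M {\<omega>\<in>space M. R < norm (Y n \<omega>)} \<le> e) sequentially"
      using R1
      by eventually_elim (erule order_trans[rotated], intro M.finite_measure_mono, auto simp: R_def)
    have "measure mu {x. R < norm x} \<le> measure mu {x. R2 < norm x}"
      by (intro mu.finite_measure_mono) (auto simp: R_def mu)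
    hence R2': "measure mu {x\<in>space mu. R < norm x} \<le> e" using R2 by (simp add: sp)
    \<comment> \<open>On the ball of radius \<open>R\<close> the quotients \<open>x $ i / R\<close>
      lie in [-1, 1], where \<open>arcsin\<close> inverts \<open>sin\<close>; so there
      \<open>f\<close> is \<open>F\<close> evaluated at the sines, and \<open>F\<close> is
      continuous on a compact cube.\<close>
    define F :: "real ^ 'd \<Rightarrow> real" where "F = (\<lambda>v. f (\<chi> i. R * arcsin (v $ i)))"
    have "compact (cbox (- 1) (1 :: real ^ 'd))" by simp
    moreover have "continuous_on (cbox (- 1) 1) F"
      unfolding F_def
      by (rule continuous_on_compose2[OF cont])
        (auto intro!: continuous_intros simp: mem_box_cart)
    ultimately obtain g where g: "real_polynomial_function g"
        "\<And>v. v \<in> cbox (- 1) 1 \<Longrightarrow> \<bar>F v - g v\<bar> < e"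
      using Stone_Weierstrass_real_polynomial_function e(1) by metis
    define T where "T = (\<lambda>x::real^'d. g (\<chi> i. sin ((1 / R) * x $ i)))"
    have TT: "trig_sum T" unfolding T_def by (rule trig_sum_polynomial_sin[OF g(1)])
    note T = trig_sum_expectation_tendsto[OF assms(1,2) mu Y char TT]
    have [measurable]: "T \<in> borel_measurable borel" using T by simp
    obtain BT where BT: "\<And>x. \<bar>T x\<bar> \<le> BT" using T by blast
    have TF: "\<bar>F (\<chi> i. sin ((1 / R) * x $ i)) - T x\<bar> < e" for x
      unfolding T_def by (rule g(2)) (simp add: mem_box_cart)
    \<comment> \<open>No restriction on \<open>x\<close> here: sines always lie in the cube, so
      \<open>T\<close> stays within \<open>e\<close> of a function bounded by \<open>B\<close>, even
      far away from the ball.\<close>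
    have d2: "\<bar>f x - T x\<bar> \<le> 2 * B + 1" for x
      using TF[of x] B[of x] B[of "\<chi> i. R * arcsin ((\<chi> i. sin ((1 / R) * x $ i)) $ i)"] e(2)
      unfolding F_def by linarith
    have d1: "\<bar>f x - T x\<bar> \<le> e" if "norm x \<le> R" for x
    proof -
      have "(\<chi> i. R * arcsin ((\<chi> i. sin ((1 / R) * x $ i)) $ i)) = x"
      proof (subst vec_eq_iff, rule allI)
        fix i
        have "\<bar>x $ i\<bar> \<le> R" using component_le_norm_cart[of x i] that by linarith
        hence "\<bar>(1 / R) * x $ i\<bar> \<le> 1" using R by (simp add: abs_mult field_simps)
        hence "arcsin (sin ((1 / R) * x $ i)) = (1 / R) * x $ i"
          using pi_ge_two by (intro arcsin_sin) linarith+
        thus "(\<chi> i. R * arcsin ((\<chi> i. sin ((1 / R) * x $ i)) $ i)) $ i = x $ i" using R by simp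
      qed
      hence "F (\<chi> i. sin ((1 / R) * x $ i)) = f x" by (simp add: F_def)
      thus ?thesis using TF[of x] by simp
    qed
    have if1: "integrable M (\<lambda>\<omega>. f (Y n \<omega>))" "integrable M (\<lambda>\<omega>. T (Y n \<omega>))" for n
      by (rule M.integrable_const_bound[where B=B], use B in simp, measurable)
        (rule M.integrable_const_bound[where B=BT], use BT in simp, measurable)
    have if2: "integrable mu f" "integrable mu T"
      by (rule mu.integrable_const_bound[where B=B], use B in simp, measurable)
        (rule mu.integrable_const_bound[where B=BT], use BT in simp, measurable)
    have "eventually (\<lambda>n. norm ((\<integral>\<omega>. T (Y n \<omega>) \<partial>M) - (\<integral>x. T x \<partial>mu)) < e) sequentially"
      using T e(1) by (simp add: tendsto_iff dist_norm)
    with R1' have "eventually (\<lambda>n. norm ((\<integral>\<omega>. f (Y n \<omega>) \<partial>M) - (\<integral>x. f x \<partial>mu)) < r) sequentially"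
    proof eventually_elim
      case (elim n)
      have "\<bar>\<integral>\<omega>. (\<lambda>x. f x - T x) (Y n \<omega>) \<partial>M\<bar> \<le> e + (2*B+1) * measure M {\<omega>\<in>space M. R < norm (Y n \<omega>)}"
        by (rule M.abs_expectation_le_tail) (use d1 d2 e B0 in auto)
      also have "\<dots> \<le> e + (2*B+1) * e" using elim B0 by (intro add_left_mono mult_left_mono) auto
      finally have A: "\<bar>(\<integral>\<omega>. f (Y n \<omega>) \<partial>M) - (\<integral>\<omega>. T (Y n \<omega>) \<partial>M)\<bar> \<le> e + (2*B+1) * e"
        using if1 by simp
      have "\<bar>\<integral>\<omega>. (\<lambda>x. f x - T x) (id \<omega>) \<partial>mu\<bar> \<le> e + (2*B+1) * measure mu {\<omega>\<in>space mu. R < norm (id \<omega>)}"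
        by (rule mu.abs_expectation_le_tail) (use d1 d2 e B0 in auto)
      also have "\<dots> \<le> e + (2*B+1) * e" using R2' B0 by (intro add_left_mono mult_left_mono) auto
      finally have A2: "\<bar>(\<integral>x. f x \<partial>mu) - (\<integral>x. T x \<partial>mu)\<bar> \<le> e + (2*B+1) * e"
        using if2 by simp
      have "\<bar>(\<integral>\<omega>. f (Y n \<omega>) \<partial>M) - (\<integral>x. f x \<partial>mu)\<bar> < 2 * (e + (2*B+1) * e) + e"
      proof -
        have "\<bar>a - b\<bar> < 2 * Q + e" if "\<bar>a - a'\<bar> \<le> Q" "\<bar>b - b'\<bar> \<le> Q" "\<bar>a' - b'\<bar> < e" for a b a' b' Q :: real
          using that by linarith
        from this[OF A A2] elim show ?thesis by simp
      qed
      also have "\<dots> \<le> e * (8 * (B + 1))" using e B0 by (simp add: algebra_simps)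
      finally show ?case using e(3) by simp
    qed
    thus "\<exists>no. \<forall>n\<ge>no. norm ((\<integral>\<omega>. f (Y n \<omega>) \<partial>M) - (\<integral>x. f x \<partial>mu)) < r"
      by (auto simp: eventually_sequentially)
  qed
qed

section \<open>The family of Metropolis-Hastings kernels\<close>

text \<open>A bound on the logarithms of \<open>u $ i / v $ i\<close>, written without logarithms.
  An update moves every weight by a relative amount of order \<open>gamma\<close>, however small the
  weight is, so this is the distance in which steps are uniformly small.\<close>

definition ratio_close :: "real \<Rightarrow> real ^ 'd \<Rightarrow> real ^ 'd \<Rightarrow> bool" where
  "ratio_close \<delta> u v \<longleftrightarrow> (\<forall>i. v $ i \<le> (1 + \<delta>) * u $ i \<and> u $ i \<le> (1 + \<delta>) * v $ i)"

lemma ratio_close_sym: "ratio_close \<delta> u v \<Longrightarrow> ratio_close \<delta> v u"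
  by (auto simp: ratio_close_def)

lemma borel_measurable_vec_nth_comp [measurable (raw)]:
  "f \<in> borel_measurable N \<Longrightarrow> (\<lambda>w. (f w :: real ^ 'd) $ i) \<in> borel_measurable N"
  by (rule measurable_compose[where N=borel]) (auto intro!: borel_measurable_continuous_onI continuous_intros)

lemma one_plus_sq_le: "0 \<le> \<delta> \<Longrightarrow> \<delta> \<le> 1 \<Longrightarrow> (1 + \<delta>)\<^sup>2 \<le> 1 + 3 * (\<delta>::real)"
  using mult_left_mono[of \<delta> 1 \<delta>] by (simp add: power2_eq_square algebra_simps)

lemma Theta_pos: "\<theta> \<in> Theta \<Longrightarrow> 0 < \<theta> $ i"
  and Theta_less_1: "\<theta> \<in> Theta \<Longrightarrow> \<theta> $ i < 1"
  and Theta_sum: "\<theta> \<in> Theta \<Longrightarrow> (\<Sum>i\<in>UNIV. \<theta> $ i) = 1"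
  by (auto simp: Theta_def)

section \<open>Biased targets and the Doeblin minorisation\<close>

locale wl_model =
  fixes lam :: "'x::polish_space measure"
    and p :: "'x \<Rightarrow> real"
    and I :: "'x \<Rightarrow> 'd::finite"
    and q :: "'x \<Rightarrow> 'x \<Rightarrow> real"
    and a b c :: real
  assumes lam_sets: "sets lam = sets borel"
    and pi_meas: "p \<in> borel_measurable lam"
    and pi_dens: "(\<integral>\<^sup>+ x. ennreal (p x) \<partial>lam) = 1"
    and I_meas: "I \<in> measurable lam (count_space UNIV)"
    and a_pos: "0 < a"
    and p_ge: "\<And>x. a \<le> p x"
    and p_le: "\<And>x. p x \<le> b"
    and ts_pos: "\<And>i. 0 < theta_star lam p I $ i"
    and q_meas: "(\<lambda>(x, y). q x y) \<in> borel_measurable (lam \<Otimes>\<^sub>M lam)"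
    and q_sym: "\<And>x y. q x y = q y x"
    and q_dens: "\<And>x. (\<integral>\<^sup>+ y. ennreal (q x y) \<partial>lam) = 1"
    and c_pos: "0 < c"
    and q_ge: "\<And>x y. c \<le> q x y"
begin

abbreviation ts :: "real ^ 'd" where "ts \<equiv> theta_star lam p I"
abbreviation pit :: "real ^ 'd \<Rightarrow> 'x \<Rightarrow> real" where "pit \<equiv> pi_theta lam p I"
abbreviation P :: "real ^ 'd \<Rightarrow> ('x \<Rightarrow> real) \<Rightarrow> 'x \<Rightarrow> real" where "P \<equiv> MH_op lam p I q"

text \<open>The normalising constant of the biased target. Its value at \<open>ts\<close> is the
  number of cells, which is where the rate \<open>1/d\<close> comes from.\<close>

definition ssum :: "real ^ 'd \<Rightarrow> real" where "ssum \<theta> = (\<Sum>i\<in>UNIV. ts $ i / \<theta> $ i)"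
definition ker :: "real ^ 'd \<Rightarrow> 'x \<Rightarrow> 'x \<Rightarrow> real" where
  "ker \<theta> x y = mh_accept lam p I \<theta> x y * q x y"
text \<open>A bound for all biased densities at once, by way of
  \<open>ts $ i \<le> \<theta> $ i * ssum \<theta>\<close>; \<open>eps\<close> is the Doeblin
  constant that results from it.\<close>

definition pmax :: real where "pmax = b / Min (range (\<lambda>i. ts $ i))"
definition eps :: real where "eps = c / pmax"

declare lam_sets [measurable_cong]

lemma space_lam [simp]: "space lam = UNIV"
  using sets_eq_imp_space_eq[OF lam_sets] by simp

lemma p_measurable [measurable]: "p \<in> borel_measurable borel"
  using pi_meas by measurable

lemma I_measurable [measurable]: "I \<in> measurable borel (count_space UNIV)"
  using I_meas by measurable

lemma q_measurable [measurable (raw)]: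
  assumes [measurable]: "f \<in> measurable N borel" "h \<in> measurable N borel"
  shows "(\<lambda>w. q (f w) (h w)) \<in> borel_measurable N"
proof -
  have "(\<lambda>w. (f w, h w)) \<in> measurable N (lam \<Otimes>\<^sub>M lam)" by measurable
  from measurable_compose[OF this q_meas] show ?thesis by simp
qed

lemma p_pos: "0 < p x" using a_pos p_ge[of x] by linarith
lemma q_pos: "0 < q x y" using c_pos q_ge[of x y] by linarith

text \<open>A probability density bounded below by \<open>a\<close> forces total mass at most
  \<open>1 / a\<close>. From here on bounded measurable functions are integrable.\<close>

lemma emeasure_lam_finite: "emeasure lam (space lam) \<noteq> \<infinity>"
proof -
  have "ennreal a * emeasure lam (space lam) = (\<integral>\<^sup>+ x. ennreal a \<partial>lam)" by simp
  also have "\<dots> \<le> (\<integral>\<^sup>+ x. ennreal (p x) \<partial>lam)"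
    by (intro nn_integral_mono ennreal_leI p_ge)
  finally have "ennreal a * emeasure lam (space lam) \<le> 1" by (simp add: pi_dens)
  thus ?thesis using a_pos by (auto simp: ennreal_mult_top top_unique)
qed

sublocale lam: finite_measure lam
  by (rule finite_measureI[OF emeasure_lam_finite])

lemma integral_p: "(\<integral>x. p x \<partial>lam) = 1"
  using pi_dens p_pos by (subst integral_eq_nn_integral) (auto simp: less_imp_le)

lemma integrable_q: "integrable lam (q x)"
  using q_dens[of x] q_pos by (intro integrableI_nonneg) (auto simp: less_imp_le)

lemma integral_q: "(\<integral>y. q x y \<partial>lam) = 1"
  using q_dens q_pos by (subst integral_eq_nn_integral) (auto simp: less_imp_le)

lemma sum_indicator_I: "(\<Sum>i\<in>UNIV. indicator {y. I y = i} x * f i) = (f (I x) :: real)"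
  by (simp add: indicator_def if_distrib[of "\<lambda>u. u * _"] cong: if_cong)

lemma pit_eq: "pit \<theta> x = p x / (\<theta> $ I x * ssum \<theta>)"
proof -
  have "(\<Sum>i\<in>UNIV. p x / \<theta> $ i * indicator {y. I y = i} x) = p x / \<theta> $ I x"
    using sum_indicator_I[of x "\<lambda>i. p x / \<theta> $ i"] by (simp add: mult.commute)
  thus ?thesis by (simp add: pi_theta_def ssum_def[symmetric] field_simps)
qed

lemma ssum_measurable [measurable (raw)]:
  assumes [measurable]: "f \<in> borel_measurable N" shows "(\<lambda>w. ssum (f w)) \<in> borel_measurable N"
  unfolding ssum_def by measurable

lemma pit_measurable [measurable (raw)]:
  assumes [measurable]: "f \<in> borel_measurable N" "h \<in> measurable N borel"
  shows "(\<lambda>w. pit (f w) (h w)) \<in> borel_measurable N"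
  unfolding pit_eq by measurable

lemma ker_measurable [measurable (raw)]:
  assumes [measurable]: "f \<in> borel_measurable N" "g \<in> measurable N borel" "h \<in> measurable N borel"
  shows "(\<lambda>w. ker (f w) (g w) (h w)) \<in> borel_measurable N"
  unfolding ker_def mh_accept_def by measurable

lemma ts_sum: "(\<Sum>i\<in>UNIV. ts $ i) = 1"
proof -
  have "(\<Sum>i\<in>UNIV. ts $ i) = (\<integral>x. (\<Sum>i\<in>UNIV. indicator {x. I x = i} x * p x) \<partial>lam)"
    unfolding theta_star_def
    by (subst Bochner_Integration.integral_sum)
      (auto intro!: lam.integrable_const_bound[where B=b] simp: indicator_def p_pos p_le less_imp_le order_trans[OF less_imp_le[OF p_pos] p_le])
  thus ?thesis by (simp add: sum_indicator_I[of _ "\<lambda>_. p _"] integral_p)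
qed

lemma ssum_ge: "\<theta> \<in> Theta \<Longrightarrow> ts $ i / \<theta> $ i \<le> ssum \<theta>"
  unfolding ssum_def using less_imp_le[OF ts_pos] less_imp_le[OF Theta_pos]
  by (intro member_le_sum divide_nonneg_nonneg) auto

lemma ssum_pos: "\<theta> \<in> Theta \<Longrightarrow> 0 < ssum \<theta>"
  using ssum_ge[of \<theta> undefined] ts_pos[of undefined] Theta_pos[of \<theta> undefined]
  by (meson divide_pos_pos less_le_trans)

text \<open>A small weight is compensated by its own term in \<open>ssum\<close>; this inequality
  keeps the estimates valid up to the boundary of the simplex.\<close>

lemma theta_ssum_ge: "\<theta> \<in> Theta \<Longrightarrow> ts $ i \<le> \<theta> $ i * ssum \<theta>"
  using ssum_ge[of \<theta> i] Theta_pos[of \<theta> i] by (simp add: field_simps)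

lemma ts_less_1: assumes "CARD('d) \<ge> 2" shows "ts $ i < 1"
proof -
  have "UNIV \<noteq> {i}"
  proof
    assume "UNIV = {i}"
    from arg_cong[OF this, of card] assms show False by simp
  qed
  then obtain j where "j \<noteq> i" by blast
  hence "(\<Sum>i\<in>{i, j}. ts $ i) \<le> (\<Sum>i\<in>UNIV. ts $ i)"
    using ts_pos by (intro sum_mono2) (auto simp: less_imp_le)
  thus ?thesis using \<open>j \<noteq> i\<close> ts_sum ts_pos[of j] by simp
qed

lemma ts_Theta: "CARD('d) \<ge> 2 \<Longrightarrow> ts \<in> Theta"
  using ts_pos ts_less_1 ts_sum by (auto simp: Theta_def)

lemma pit_pos: "\<theta> \<in> Theta \<Longrightarrow> 0 < pit \<theta> x"
  unfolding pit_eq by (intro divide_pos_pos mult_pos_pos p_pos ssum_pos Theta_pos)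

lemma pit_nonneg: "\<theta> \<in> Theta \<Longrightarrow> 0 \<le> pit \<theta> x" using pit_pos less_imp_le by blast

lemma ts_ge_Min: "Min (range (\<lambda>i. ts $ i)) \<le> ts $ i" by simp
lemma Min_ts_pos: "0 < Min (range (\<lambda>i. ts $ i))" using ts_pos by simp
lemma b_pos: "0 < b" using p_pos p_le less_le_trans by blast
lemma pmax_pos: "0 < pmax" using b_pos Min_ts_pos by (simp add: pmax_def)
lemma eps_pos: "0 < eps" using c_pos pmax_pos by (simp add: eps_def)

lemma pit_le: assumes "\<theta> \<in> Theta" shows "pit \<theta> x \<le> pmax"
  unfolding pit_eq pmax_def
  using order_trans[OF ts_ge_Min theta_ssum_ge[OF assms], of "I x"] Min_ts_pos p_pos[of x] p_le[of x]
  by (intro frac_le) linarith+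

lemma integrable_pit: "\<theta> \<in> Theta \<Longrightarrow> integrable lam (pit \<theta>)"
  by (rule lam.integrable_const_bound[where B=pmax]) (auto simp: pit_le pit_nonneg)

text \<open>Under the biased target the cell index has probabilities proportional to
  \<open>ts $ i / \<theta> $ i\<close>; the mean fields are computed from this.\<close>

lemma integral_pit_comp_I:
  "(\<integral>x. pit \<theta> x * u (I x) \<partial>lam) = (\<Sum>i\<in>UNIV. ts $ i / \<theta> $ i * u i) / ssum \<theta>"
proof -
  have "(\<integral>x. pit \<theta> x * u (I x) \<partial>lam) =
      (\<integral>x. (\<Sum>i\<in>UNIV. indicator {x. I x = i} x * p x * (u i / (\<theta> $ i * ssum \<theta>))) \<partial>lam)"
  proof (intro Bochner_Integration.integral_cong refl)
    fix x
    show "pit \<theta> x * u (I x) = (\<Sum>i\<in>UNIV. indicator {x. I x = i} x * p x * (u i / (\<theta> $ i * ssum \<theta>)))"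
      unfolding mult.assoc sum_indicator_I by (simp add: pit_eq)
  qed
  also have "\<dots> = (\<Sum>i\<in>UNIV. ts $ i * (u i / (\<theta> $ i * ssum \<theta>)))"
  proof (subst Bochner_Integration.integral_sum)
    have i: "integrable lam (\<lambda>x. indicator {x. I x = i} x * p x)" for i
      by (rule lam.integrable_const_bound[where B=b])
        (auto simp: indicator_def p_le less_imp_le[OF p_pos] order_trans[OF less_imp_le[OF p_pos] p_le])
    show "integrable lam (\<lambda>x. indicator {x. I x = i} x * p x * (u i / (\<theta> $ i * ssum \<theta>)))" for i
      by (rule integrable_mult_left[OF i])
    show "(\<Sum>i\<in>UNIV. \<integral>x. indicator {x. I x = i} x * p x * (u i / (\<theta> $ i * ssum \<theta>)) \<partial>lam) =
        (\<Sum>i\<in>UNIV. ts $ i * (u i / (\<theta> $ i * ssum \<theta>)))"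
      unfolding theta_star_def vec_lambda_beta
      by (intro sum.cong refl Bochner_Integration.integral_mult_left i)
  qed
  also have "\<dots> = (\<Sum>i\<in>UNIV. ts $ i / \<theta> $ i * u i) / ssum \<theta>"
    by (simp add: sum_divide_distrib)
  finally show ?thesis .
qed

lemma integral_pit: "\<theta> \<in> Theta \<Longrightarrow> (\<integral>x. pit \<theta> x \<partial>lam) = 1"
  using integral_pit_comp_I[of \<theta> "\<lambda>_. 1"] ssum_pos[of \<theta>] by (simp add: ssum_def)

lemma integrable_pit_mult:
  assumes "\<theta> \<in> Theta" and [measurable]: "f \<in> borel_measurable borel" and f: "\<And>x. \<bar>f x\<bar> \<le> K"
  shows "integrable lam (\<lambda>x. pit \<theta> x * f x)"
  by (rule lam.integrable_const_bound[where B="pmax * K"])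
    (use assms in \<open>auto simp: abs_mult pit_nonneg pit_le intro!: mult_mono less_imp_le[OF pmax_pos]\<close>)

lemma abs_integral_pit_le:
  assumes "\<theta> \<in> Theta" and [measurable]: "f \<in> borel_measurable borel" and f: "\<And>x. \<bar>f x\<bar> \<le> K"
  shows "\<bar>\<integral>x. pit \<theta> x * f x \<partial>lam\<bar> \<le> K"
proof -
  have "\<bar>\<integral>x. pit \<theta> x * f x \<partial>lam\<bar> \<le> (\<integral>x. \<bar>pit \<theta> x * f x\<bar> \<partial>lam)" by (rule integral_abs_bound)
  also have "\<dots> \<le> (\<integral>x. pit \<theta> x * K \<partial>lam)"
    using integrable_abs[OF integrable_pit_mult[OF assms]] integrable_pit[OF assms(1)] f assms(1)
    by (intro integral_mono integrable_mult_left) (auto simp: abs_mult pit_nonneg intro!: mult_left_mono)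
  also have "\<dots> = K" using integral_pit[OF assms(1)] by simp
  finally show ?thesis .
qed

lemma accept_bounds: "\<theta> \<in> Theta \<Longrightarrow> 0 < mh_accept lam p I \<theta> x y \<and> mh_accept lam p I \<theta> x y \<le> 1"
  unfolding mh_accept_def using pit_pos by simp

lemma ker_nonneg: "\<theta> \<in> Theta \<Longrightarrow> 0 \<le> ker \<theta> x y"
  unfolding ker_def using accept_bounds q_pos by (simp add: less_imp_le)

lemma ker_le: "\<theta> \<in> Theta \<Longrightarrow> ker \<theta> x y \<le> q x y"
  unfolding ker_def using accept_bounds[of \<theta> x y] q_pos[of x y] by (simp add: mult_left_le_one_le less_imp_le)

text \<open>The acceptance probability is at least \<open>pit \<theta> y / pmax\<close>. The
  minorising measure is a multiple of the invariant one, so it drops out on functions of mean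
  zero.\<close>

lemma ker_ge: assumes "\<theta> \<in> Theta" shows "eps * pit \<theta> y \<le> ker \<theta> x y"
proof -
  have "pit \<theta> y / pmax \<le> mh_accept lam p I \<theta> x y"
    unfolding mh_accept_def
  proof (rule min.boundedI)
    show "pit \<theta> y / pmax \<le> 1" using pit_le[OF assms] pmax_pos by simp
    show "pit \<theta> y / pmax \<le> pit \<theta> y / pit \<theta> x"
      using pit_le[OF assms] pit_pos[OF assms] pmax_pos
      by (intro divide_left_mono) (auto simp: less_imp_le)
  qed
  hence "pit \<theta> y / pmax * c \<le> mh_accept lam p I \<theta> x y * q x y"
    using q_ge c_pos pit_nonneg[OF assms] pmax_pos accept_bounds[OF assms]
    by (intro mult_mono) (auto intro: less_imp_le)
  thus ?thesis by (simp add: ker_def eps_def mult.commute)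
qed

text \<open>Density times acceptance probability is the symmetric expression
  \<open>min (pit \<theta> x) (pit \<theta> y)\<close>.\<close>

lemma ker_reversible: assumes "\<theta> \<in> Theta" shows "pit \<theta> x * ker \<theta> x y = pit \<theta> y * ker \<theta> y x"
proof -
  have "pit \<theta> x * mh_accept lam p I \<theta> x y = min (pit \<theta> x) (pit \<theta> y)" for x y
    unfolding mh_accept_def using pit_pos[OF assms, of x] by (auto simp: min_def pos_le_divide_eq)
  from this[of x y] this[of y x] show ?thesis
    unfolding ker_def mult.assoc[symmetric] by (simp only: q_sym[of x y] min.commute)
qed

lemma integrable_ker_mult:
  assumes "\<theta> \<in> Theta" and [measurable]: "f \<in> borel_measurable borel" and f: "\<And>x. \<bar>f x\<bar> \<le> K"
  shows "integrable lam (\<lambda>y. ker \<theta> x y * f y)"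
  by (rule Bochner_Integration.integrable_bound[OF integrable_mult_left[OF integrable_q[of x], of K]])
    (use assms order_trans[OF f abs_ge_self] in \<open>auto simp: abs_mult ker_nonneg abs_of_pos[OF q_pos]
       less_imp_le[OF q_pos] intro!: mult_mono ker_le AE_I2\<close>)

lemma integrable_ker: "\<theta> \<in> Theta \<Longrightarrow> integrable lam (ker \<theta> x)"
  using integrable_ker_mult[of \<theta> "\<lambda>_. 1" 1 x] by simp

lemma integral_ker_le_1: "\<theta> \<in> Theta \<Longrightarrow> (\<integral>y. ker \<theta> x y \<partial>lam) \<le> 1"
  using integral_mono[OF integrable_ker integrable_q, of \<theta> x x] ker_le[of \<theta> x] integral_q by simp

lemma integral_ker_nonneg: "\<theta> \<in> Theta \<Longrightarrow> 0 \<le> (\<integral>y. ker \<theta> x y \<partial>lam)"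
  by (simp add: ker_nonneg)

lemma integral_ker_ge: assumes "\<theta> \<in> Theta" shows "eps \<le> (\<integral>y. ker \<theta> x y \<partial>lam)"
proof -
  have "(\<integral>y. eps * pit \<theta> y \<partial>lam) \<le> (\<integral>y. ker \<theta> x y \<partial>lam)"
    using assms by (intro integral_mono integrable_ker integrable_mult_right integrable_pit ker_ge)
  thus ?thesis using integral_pit[OF assms] by simp
qed

lemma P_eq: "P \<theta> f x = (\<integral>y. ker \<theta> x y * f y \<partial>lam) + (1 - (\<integral>y. ker \<theta> x y \<partial>lam)) * f x"
  by (simp add: MH_op_def ker_def)

lemma P_measurable [measurable (raw)]:
  assumes g: "(\<lambda>(\<theta>, x). g \<theta> x) \<in> borel_measurable (borel \<Otimes>\<^sub>M borel)"
    and [measurable]: "f \<in> borel_measurable N" "h \<in> measurable N borel"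
  shows "(\<lambda>w. P (f w) (g (f w)) (h w)) \<in> borel_measurable N"
proof -
  have [measurable]: "(\<lambda>w. g (f' w) (h' w)) \<in> borel_measurable N'"
    if [measurable]: "f' \<in> borel_measurable N'" "h' \<in> measurable N' borel" for f' h' N'
  proof -
    have "(\<lambda>w. (f' w, h' w)) \<in> measurable N' (borel \<Otimes>\<^sub>M borel)" by measurable
    from measurable_compose[OF this g] show ?thesis by simp
  qed
  show ?thesis unfolding P_eq by measurable
qed

lemma P_const: "P \<theta> (\<lambda>_. r) x = r"
  by (simp add: P_eq algebra_simps)

lemma P_diff:
  assumes "\<theta> \<in> Theta" and [measurable]: "f \<in> borel_measurable borel" "g \<in> borel_measurable borel"
    and f: "\<And>x. \<bar>f x\<bar> \<le> K" and g: "\<And>x. \<bar>g x\<bar> \<le> L"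
  shows "P \<theta> (\<lambda>x. f x - g x) x = P \<theta> f x - P \<theta> g x"
  using integrable_ker_mult[OF assms(1,2) f] integrable_ker_mult[OF assms(1,3) g]
  by (simp add: P_eq right_diff_distrib)

lemma P_add:
  assumes "\<theta> \<in> Theta" and [measurable]: "f \<in> borel_measurable borel" "g \<in> borel_measurable borel"
    and f: "\<And>x. \<bar>f x\<bar> \<le> K" and g: "\<And>x. \<bar>g x\<bar> \<le> L"
  shows "P \<theta> (\<lambda>x. f x + g x) x = P \<theta> f x + P \<theta> g x"
  using integrable_ker_mult[OF assms(1,2) f] integrable_ker_mult[OF assms(1,3) g]
  by (simp add: P_eq distrib_left)

text \<open>Doeblin: subtracting the minorising part of the kernel leaves total mass \<open>1 - eps\<close>.\<close>

lemma P_residual_le: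
  assumes th: "\<theta> \<in> Theta" and [measurable]: "f \<in> borel_measurable borel" and f: "\<And>x. \<bar>f x\<bar> \<le> K"
  shows "\<bar>P \<theta> f x - eps * (\<integral>y. pit \<theta> y * f y \<partial>lam)\<bar> \<le> (1 - eps) * K"
proof -
  define r where "r = (\<lambda>y. ker \<theta> x y - eps * pit \<theta> y)"
  have r0: "0 \<le> r y" for y using ker_ge[OF th] by (simp add: r_def)
  have ri: "integrable lam r" unfolding r_def
    using th by (intro Bochner_Integration.integrable_diff integrable_ker integrable_mult_right integrable_pit)
  have rf: "integrable lam (\<lambda>y. r y * f y)"
    unfolding r_def left_diff_distrib mult.assoc
    using integrable_ker_mult[OF assms, of x] integrable_pit_mult[OF assms] by simp
  have eq: "(\<integral>y. r y * f y \<partial>lam) = (\<integral>y. ker \<theta> x y * f y \<partial>lam) - eps * (\<integral>y. pit \<theta> y * f y \<partial>lam)"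
    unfolding r_def left_diff_distrib mult.assoc
    using integrable_ker_mult[OF assms, of x] integrable_pit_mult[OF assms] by simp
  have rint: "(\<integral>y. r y \<partial>lam) = (\<integral>y. ker \<theta> x y \<partial>lam) - eps"
    unfolding r_def using integrable_ker[OF th, of x] integrable_pit[OF th] integral_pit[OF th] by simp
  have "\<bar>\<integral>y. r y * f y \<partial>lam\<bar> \<le> (\<integral>y. \<bar>r y * f y\<bar> \<partial>lam)" by (rule integral_abs_bound)
  also have "\<dots> \<le> (\<integral>y. r y * K \<partial>lam)"
    using integrable_abs[OF rf] ri f r0
    by (intro integral_mono integrable_mult_left) (auto simp: abs_mult intro!: mult_left_mono)
  also have "\<dots> = ((\<integral>y. ker \<theta> x y \<partial>lam) - eps) * K" using rint by simp
  finally have 1: "\<bar>\<integral>y. r y * f y \<partial>lam\<bar> \<le> ((\<integral>y. ker \<theta> x y \<partial>lam) - eps) * K" .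
  have 2: "\<bar>(1 - (\<integral>y. ker \<theta> x y \<partial>lam)) * f x\<bar> \<le> (1 - (\<integral>y. ker \<theta> x y \<partial>lam)) * K"
    using f integral_ker_le_1[OF th, of x] by (simp add: abs_mult mult_left_mono)
  have "P \<theta> f x - eps * (\<integral>y. pit \<theta> y * f y \<partial>lam) = (\<integral>y. r y * f y \<partial>lam) + (1 - (\<integral>y. ker \<theta> x y \<partial>lam)) * f x"
    by (simp add: P_eq eq)
  hence "\<bar>P \<theta> f x - eps * (\<integral>y. pit \<theta> y * f y \<partial>lam)\<bar> \<le>
      ((\<integral>y. ker \<theta> x y \<partial>lam) - eps) * K + (1 - (\<integral>y. ker \<theta> x y \<partial>lam)) * K"
    using 1 2 by linarith
  also have "\<dots> = (1 - eps) * K" by (simp only: distrib_right[symmetric]) simp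
  finally show ?thesis .
qed

lemma eps_le_1: "(\<theta> :: real ^ 'd) \<in> Theta \<Longrightarrow> eps \<le> 1"
  by (rule order_trans[OF integral_ker_ge integral_ker_le_1])

lemma abs_P_le:
  assumes th: "\<theta> \<in> Theta" and [measurable]: "f \<in> borel_measurable borel" and f: "\<And>x. \<bar>f x\<bar> \<le> K"
  shows "\<bar>P \<theta> f x\<bar> \<le> K"
proof -
  have "\<bar>eps * (\<integral>y. pit \<theta> y * f y \<partial>lam)\<bar> \<le> eps * K"
    using abs_integral_pit_le[OF assms] eps_pos by (simp add: abs_mult)
  moreover have "(1 - eps) * K = K - eps * K" by (simp add: algebra_simps)
  ultimately show ?thesis using P_residual_le[OF assms, of x] by linarith
qed

text \<open>Detailed balance and Fubini move the accepted mass from one argument to the other, where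
  it makes up for the rejected mass.\<close>

lemma pit_invariant:
  assumes th: "\<theta> \<in> Theta" and [measurable]: "f \<in> borel_measurable borel" and f: "\<And>x. \<bar>f x\<bar> \<le> K"
  shows "(\<integral>x. pit \<theta> x * P \<theta> f x \<partial>lam) = (\<integral>x. pit \<theta> x * f x \<partial>lam)"
proof -
  interpret pair_sigma_finite lam lam ..
  have K: "0 \<le> K" using f[of undefined] by linarith
  define F where "F = (\<lambda>x y. pit \<theta> x * (ker \<theta> x y * f y))"
  have Fm: "case_prod F \<in> borel_measurable (lam \<Otimes>\<^sub>M lam)" unfolding F_def by measurable
  have Fb: "\<bar>F x y\<bar> \<le> pmax * K * q x y" for x y
  proof -
    have "\<bar>F x y\<bar> = pit \<theta> x * (ker \<theta> x y * \<bar>f y\<bar>)"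
      by (simp add: F_def abs_mult pit_nonneg[OF th] ker_nonneg[OF th])
    also have "\<dots> \<le> pmax * (q x y * K)"
      using pit_nonneg[OF th] pit_le[OF th] ker_nonneg[OF th] ker_le[OF th] f K less_imp_le[OF q_pos] less_imp_le[OF pmax_pos]
      by (intro mult_mono mult_nonneg_nonneg) auto
    finally show ?thesis by (simp add: mult_ac)
  qed
  \<comment> \<open>Integrability on the product space: \<open>q x\<close> has integral one for
    every \<open>x\<close>, and \<open>lam\<close> is finite.\<close>
  have Fi: "integrable (lam \<Otimes>\<^sub>M lam) (case_prod F)"
  proof (rule integrableI_bounded[OF Fm])
    have "(\<integral>\<^sup>+ z. ennreal (norm (case_prod F z)) \<partial>(lam \<Otimes>\<^sub>M lam)) = (\<integral>\<^sup>+ x. \<integral>\<^sup>+ y. ennreal \<bar>F x y\<bar> \<partial>lam \<partial>lam)"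
      using Fm by (subst lam.nn_integral_fst[symmetric]) auto
    also have "\<dots> \<le> (\<integral>\<^sup>+ x. \<integral>\<^sup>+ y. ennreal (pmax * K) * ennreal (q x y) \<partial>lam \<partial>lam)"
      using Fb K pmax_pos q_pos by (intro nn_integral_mono) (simp add: ennreal_mult'[symmetric] less_imp_le)
    also have "\<dots> = ennreal (pmax * K) * emeasure lam (space lam)"
      by (simp add: nn_integral_cmult q_dens)
    also have "\<dots> < \<infinity>"
      unfolding infinity_ennreal_def
      by (rule ennreal_mult_less_top[THEN iffD2])
        (use emeasure_lam_finite in \<open>simp only: infinity_ennreal_def less_top ennreal_less_top simp_thms\<close>)
    finally show "(\<integral>\<^sup>+ z. ennreal (norm (case_prod F z)) \<partial>(lam \<Otimes>\<^sub>M lam)) < \<infinity>" .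
  qed
  have "(\<integral>x. pit \<theta> x * (\<integral>y. ker \<theta> x y * f y \<partial>lam) \<partial>lam) = (\<integral>x. \<integral>y. F x y \<partial>lam \<partial>lam)"
    unfolding F_def by (simp only: integral_mult_right_zero)
  also have "\<dots> = (\<integral>y. \<integral>x. F x y \<partial>lam \<partial>lam)" by (rule Fubini_integral[OF Fi, symmetric])
  also have "\<dots> = (\<integral>y. pit \<theta> y * f y * (\<integral>x. ker \<theta> y x \<partial>lam) \<partial>lam)"
  proof (intro Bochner_Integration.integral_cong refl)
    fix y
    have "F x y = (pit \<theta> x * ker \<theta> x y) * f y" for x
      by (simp add: F_def)
    also have "(pit \<theta> x * ker \<theta> x y) * f y = pit \<theta> y * f y * ker \<theta> y x" for x
      unfolding ker_reversible[OF th, of x y] by simp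
    finally have "(\<lambda>x. F x y) = (\<lambda>x. pit \<theta> y * f y * ker \<theta> y x)" by (intro ext)
    thus "(\<integral>x. F x y \<partial>lam) = pit \<theta> y * f y * (\<integral>x. ker \<theta> y x \<partial>lam)" by simp
  qed
  finally have eq: "(\<integral>x. pit \<theta> x * (\<integral>y. ker \<theta> x y * f y \<partial>lam) \<partial>lam) =
    (\<integral>x. pit \<theta> x * (f x * (\<integral>y. ker \<theta> x y \<partial>lam)) \<partial>lam)" by (simp add: mult_ac)
  have b1: "\<bar>\<integral>y. ker \<theta> x y * f y \<partial>lam\<bar> \<le> K" for x
  proof -
    have "\<bar>\<integral>y. ker \<theta> x y * f y \<partial>lam\<bar> \<le> (\<integral>y. \<bar>ker \<theta> x y * f y\<bar> \<partial>lam)" by (rule integral_abs_bound)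
    also have "\<dots> \<le> (\<integral>y. ker \<theta> x y * K \<partial>lam)"
      using integrable_abs[OF integrable_ker_mult[OF assms, of x]] integrable_ker[OF th, of x] f
      by (intro integral_mono integrable_mult_left) (auto simp: abs_mult ker_nonneg[OF th] intro!: mult_left_mono)
    also have "\<dots> \<le> K" using integral_ker_le_1[OF th, of x] K integral_ker_nonneg[OF th, of x]
      by (simp add: mult_left_le_one_le)
    finally show ?thesis .
  qed
  have b2: "\<bar>f x * (\<integral>y. ker \<theta> x y \<partial>lam)\<bar> \<le> K" for x
    using mult_mono[OF f[of x] integral_ker_le_1[OF th, of x]] integral_ker_nonneg[OF th, of x] K
    by (simp add: abs_mult)
  have i1: "integrable lam (\<lambda>x. pit \<theta> x * (\<integral>y. ker \<theta> x y * f y \<partial>lam))"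
    by (rule integrable_pit_mult[OF th _ b1]) measurable
  have i2: "integrable lam (\<lambda>x. pit \<theta> x * (f x * (\<integral>y. ker \<theta> x y \<partial>lam)))"
    by (rule integrable_pit_mult[OF th _ b2]) measurable
  have i3: "integrable lam (\<lambda>x. pit \<theta> x * f x)"
    by (rule integrable_pit_mult[OF assms])
  have "(\<integral>x. pit \<theta> x * P \<theta> f x \<partial>lam) = (\<integral>x. pit \<theta> x * (\<integral>y. ker \<theta> x y * f y \<partial>lam) + pit \<theta> x * f x
      - pit \<theta> x * (f x * (\<integral>y. ker \<theta> x y \<partial>lam)) \<partial>lam)"
  proof -
    have "u * (A + (1 - k) * v) = u * A + u * v - u * (v * k)" for u A k v :: real
      by (simp add: algebra_simps)
    thus ?thesis unfolding P_eq by (simp only:)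
  qed
  also have "\<dots> = (\<integral>x. pit \<theta> x * f x \<partial>lam)"
    using i1 i2 i3 by (simp add: eq)
  finally show ?thesis .
qed

section \<open>The Poisson equation\<close>

text \<open>Regular families are bounded and, uniformly over all of \<open>Theta\<close>, Lipschitz in the
  ratios of the weights. The kernel depends on the weights only through such ratios, which is
  why no compactness away from the boundary is needed.\<close>

definition regular :: "(real ^ 'd \<Rightarrow> 'x \<Rightarrow> real) \<Rightarrow> bool" where
  "regular g \<longleftrightarrow> (\<lambda>(\<theta>, x). g \<theta> x) \<in> borel_measurable (borel \<Otimes>\<^sub>M borel) \<and>
    (\<exists>K\<ge>0. \<forall>\<theta>\<in>Theta. (\<forall>x. \<bar>g \<theta> x\<bar> \<le> K) \<and>
      (\<forall>\<theta>'\<in>Theta. \<forall>\<delta>. 0 \<le> \<delta> \<longrightarrow> \<delta> \<le> 1 \<longrightarrow> ratio_close \<delta> \<theta> \<theta>' \<longrightarrow> (\<forall>x. \<bar>g \<theta> x - g \<theta>' x\<bar> \<le> K * \<delta>)))"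

lemma regularI:
  assumes "(\<lambda>(\<theta>, x). g \<theta> x) \<in> borel_measurable (borel \<Otimes>\<^sub>M borel)" "0 \<le> K"
    and "\<And>\<theta> x. \<theta> \<in> Theta \<Longrightarrow> \<bar>g \<theta> x\<bar> \<le> K"
    and "\<And>\<theta> \<theta>' \<delta> x. \<theta> \<in> Theta \<Longrightarrow> \<theta>' \<in> Theta \<Longrightarrow> 0 \<le> \<delta> \<Longrightarrow> \<delta> \<le> 1 \<Longrightarrow> ratio_close \<delta> \<theta> \<theta>' \<Longrightarrow>
      \<bar>g \<theta> x - g \<theta>' x\<bar> \<le> K * \<delta>"
  shows "regular g"
  unfolding regular_def using assms by blast

lemma regularE:
  assumes "regular g"
  obtains K where "0 \<le> K" "\<And>\<theta> x. \<theta> \<in> Theta \<Longrightarrow> \<bar>g \<theta> x\<bar> \<le> K"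
    "\<And>\<theta> \<theta>' \<delta> x. \<theta> \<in> Theta \<Longrightarrow> \<theta>' \<in> Theta \<Longrightarrow> 0 \<le> \<delta> \<Longrightarrow> \<delta> \<le> 1 \<Longrightarrow> ratio_close \<delta> \<theta> \<theta>' \<Longrightarrow>
      \<bar>g \<theta> x - g \<theta>' x\<bar> \<le> K * \<delta>"
  using assms unfolding regular_def by blast

lemma regular_measurable_pair: "regular g \<Longrightarrow> (\<lambda>(\<theta>, x). g \<theta> x) \<in> borel_measurable (borel \<Otimes>\<^sub>M borel)"
  by (simp add: regular_def)

lemma regular_measurable:
  assumes "regular g" and [measurable]: "f \<in> borel_measurable N" "h \<in> measurable N borel"
  shows "(\<lambda>w. g (f w) (h w)) \<in> borel_measurable N"
proof -
  have "(\<lambda>w. (f w, h w)) \<in> measurable N (borel \<Otimes>\<^sub>M borel)" by measurable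
  from measurable_compose[OF this regular_measurable_pair[OF assms(1)]] show ?thesis by simp
qed

lemma regular_measurable_x: "regular g \<Longrightarrow> g \<theta> \<in> borel_measurable borel"
  using regular_measurable[of g "\<lambda>_. \<theta>" borel "\<lambda>x. x"] by simp

lemma regular_indicator: "regular (\<lambda>\<theta>. indicator {x. I x = i})"
  by (rule regularI[where K=1]) (auto simp: split_beta indicator_def)

lemma regular_const: "regular (\<lambda>\<theta> x. r)"
  by (rule regularI[where K="\<bar>r\<bar>"]) auto

lemma regular_weight: "regular (\<lambda>\<theta> x. \<theta> $ i)"
proof (rule regularI[where K=1])
  fix \<theta> \<theta>' :: "real ^ 'd" and \<delta> :: real
  assume th: "\<theta> \<in> Theta" "\<theta>' \<in> Theta" and d: "0 \<le> \<delta>" "ratio_close \<delta> \<theta> \<theta>'"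
  have "\<theta>' $ i \<le> \<theta> $ i + \<delta> * \<theta> $ i" "\<theta> $ i \<le> \<theta>' $ i + \<delta> * \<theta>' $ i"
    using d(2) by (auto simp: ratio_close_def algebra_simps)
  moreover have "\<delta> * \<theta> $ i \<le> \<delta>" "\<delta> * \<theta>' $ i \<le> \<delta>"
    using d(1) Theta_less_1[OF th(1), of i] Theta_less_1[OF th(2), of i] by (auto intro!: mult_left_le)
  ultimately show "\<bar>\<theta> $ i - \<theta>' $ i\<bar> \<le> 1 * \<delta>" by linarith
next
  fix \<theta> :: "real ^ 'd" and x :: 'x assume "\<theta> \<in> Theta"
  from Theta_pos[OF this, of i] Theta_less_1[OF this, of i] show "\<bar>\<theta> $ i\<bar> \<le> 1" by linarith
qed (auto simp: split_beta)

lemma regular_mult: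
  assumes f: "regular f" and g: "regular g" shows "regular (\<lambda>\<theta> x. f \<theta> x * g \<theta> x)"
proof -
  obtain K where K: "0 \<le> K" "\<And>\<theta> x. \<theta> \<in> Theta \<Longrightarrow> \<bar>f \<theta> x\<bar> \<le> K"
    "\<And>\<theta> \<theta>' \<delta> x. \<theta> \<in> Theta \<Longrightarrow> \<theta>' \<in> Theta \<Longrightarrow> 0 \<le> \<delta> \<Longrightarrow> \<delta> \<le> 1 \<Longrightarrow> ratio_close \<delta> \<theta> \<theta>' \<Longrightarrow>
      \<bar>f \<theta> x - f \<theta>' x\<bar> \<le> K * \<delta>" using regularE[OF f] by blast
  obtain L where L: "0 \<le> L" "\<And>\<theta> x. \<theta> \<in> Theta \<Longrightarrow> \<bar>g \<theta> x\<bar> \<le> L"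
    "\<And>\<theta> \<theta>' \<delta> x. \<theta> \<in> Theta \<Longrightarrow> \<theta>' \<in> Theta \<Longrightarrow> 0 \<le> \<delta> \<Longrightarrow> \<delta> \<le> 1 \<Longrightarrow> ratio_close \<delta> \<theta> \<theta>' \<Longrightarrow>
      \<bar>g \<theta> x - g \<theta>' x\<bar> \<le> L * \<delta>" using regularE[OF g] by blast
  show ?thesis
  proof (rule regularI[where K="2 * K * L"])
    show "(\<lambda>(\<theta>, x). f \<theta> x * g \<theta> x) \<in> borel_measurable (borel \<Otimes>\<^sub>M borel)"
      using regular_measurable_pair[OF f] regular_measurable_pair[OF g] by (simp add: split_beta)
  next
    fix \<theta> :: "real ^ 'd" and x assume th: "\<theta> \<in> Theta"
    have "\<bar>f \<theta> x * g \<theta> x\<bar> \<le> K * L"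
      unfolding abs_mult by (intro mult_mono K(2) L(2) th K(1) abs_ge_zero)
    moreover have "K * L \<ge> 0" using K L by simp
    ultimately show "\<bar>f \<theta> x * g \<theta> x\<bar> \<le> 2 * K * L" by linarith
  next
    fix \<theta> \<theta>' :: "real ^ 'd" and \<delta> :: real and x assume th: "\<theta> \<in> Theta" "\<theta>' \<in> Theta" "0 \<le> \<delta>" "\<delta> \<le> 1" "ratio_close \<delta> \<theta> \<theta>'"
    have "\<bar>f \<theta> x * g \<theta> x - f \<theta>' x * g \<theta>' x\<bar> = \<bar>f \<theta> x * (g \<theta> x - g \<theta>' x) + (f \<theta> x - f \<theta>' x) * g \<theta>' x\<bar>"
      by (simp add: algebra_simps)
    also have "\<dots> \<le> \<bar>f \<theta> x\<bar> * \<bar>g \<theta> x - g \<theta>' x\<bar> + \<bar>f \<theta> x - f \<theta>' x\<bar> * \<bar>g \<theta>' x\<bar>"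
      by (metis abs_mult abs_triangle_ineq)
    also have "\<dots> \<le> K * (L * \<delta>) + (K * \<delta>) * L"
      using K L th by (intro add_mono mult_mono) auto
    finally show "\<bar>f \<theta> x * g \<theta> x - f \<theta>' x * g \<theta>' x\<bar> \<le> 2 * K * L * \<delta>" by (simp add: mult_ac)
  qed (use K L in auto)
qed

lemma regular_add:
  assumes f: "regular f" and g: "regular g" shows "regular (\<lambda>\<theta> x. f \<theta> x + g \<theta> x)"
proof -
  obtain K where K: "0 \<le> K" "\<And>\<theta> x. \<theta> \<in> Theta \<Longrightarrow> \<bar>f \<theta> x\<bar> \<le> K"
    "\<And>\<theta> \<theta>' \<delta> x. \<theta> \<in> Theta \<Longrightarrow> \<theta>' \<in> Theta \<Longrightarrow> 0 \<le> \<delta> \<Longrightarrow> \<delta> \<le> 1 \<Longrightarrow> ratio_close \<delta> \<theta> \<theta>' \<Longrightarrow>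
      \<bar>f \<theta> x - f \<theta>' x\<bar> \<le> K * \<delta>" using regularE[OF f] by blast
  obtain L where L: "0 \<le> L" "\<And>\<theta> x. \<theta> \<in> Theta \<Longrightarrow> \<bar>g \<theta> x\<bar> \<le> L"
    "\<And>\<theta> \<theta>' \<delta> x. \<theta> \<in> Theta \<Longrightarrow> \<theta>' \<in> Theta \<Longrightarrow> 0 \<le> \<delta> \<Longrightarrow> \<delta> \<le> 1 \<Longrightarrow> ratio_close \<delta> \<theta> \<theta>' \<Longrightarrow>
      \<bar>g \<theta> x - g \<theta>' x\<bar> \<le> L * \<delta>" using regularE[OF g] by blast
  show ?thesis
  proof (rule regularI[where K="K + L"])
    show "(\<lambda>(\<theta>, x). f \<theta> x + g \<theta> x) \<in> borel_measurable (borel \<Otimes>\<^sub>M borel)"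
      using regular_measurable_pair[OF f] regular_measurable_pair[OF g] by (simp add: split_beta)
  next
    fix \<theta> :: "real ^ 'd" and x assume th: "\<theta> \<in> Theta"
    show "\<bar>f \<theta> x + g \<theta> x\<bar> \<le> K + L" using K(2)[OF th, of x] L(2)[OF th, of x] by linarith
  next
    fix \<theta> \<theta>' :: "real ^ 'd" and \<delta> :: real and x assume th: "\<theta> \<in> Theta" "\<theta>' \<in> Theta" "0 \<le> \<delta>" "\<delta> \<le> 1" "ratio_close \<delta> \<theta> \<theta>'"
    show "\<bar>f \<theta> x + g \<theta> x - (f \<theta>' x + g \<theta>' x)\<bar> \<le> (K + L) * \<delta>"
      using K(3)[OF th, of x] L(3)[OF th, of x] unfolding distrib_right by linarith
  qed (use K L in auto)
qed

lemma regular_diff: "regular f \<Longrightarrow> regular g \<Longrightarrow> regular (\<lambda>\<theta> x. f \<theta> x - g \<theta> x)"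
  using regular_add[OF _ regular_mult[OF regular_const[of "-1"]], of f g] by simp

lemma regular_sum: "finite A \<Longrightarrow> (\<And>i. i \<in> A \<Longrightarrow> regular (f i)) \<Longrightarrow> regular (\<lambda>\<theta> x. \<Sum>i\<in>A. f i \<theta> x)"
  by (induction A rule: finite_induct) (auto intro: regular_const regular_add)

lemma regular_power2: "regular f \<Longrightarrow> regular (\<lambda>\<theta> x. (f \<theta> x)\<^sup>2)"
  unfolding power2_eq_square by (rule regular_mult)

section \<open>Dependence of kernel and target on the weights\<close>

text \<open>Above 1 the minimum no longer changes, and below 1 a relative error \<open>k\<close> is
  an absolute error of at most \<open>k\<close>.\<close>

lemma abs_min_1_diff_le:
  fixes u v :: real
  assumes "0 \<le> u" "0 \<le> v" "v \<le> (1 + k) * u" "u \<le> (1 + k) * v" "0 \<le> k"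
  shows "\<bar>min 1 u - min 1 v\<bar> \<le> k"
proof -
  have *: "min 1 v' - min 1 u' \<le> k" if "0 \<le> u'" "v' \<le> (1 + k) * u'" for u' v' :: real
  proof (cases "u' \<le> 1")
    case True
    have "k * u' \<le> k" using True assms(5) by (simp add: mult_left_le)
    thus ?thesis using that True by (simp add: algebra_simps min_def)
  qed (use assms(5) in auto)
  from *[of u v] *[of v u] assms show ?thesis by linarith
qed

text \<open>Numerator and denominator each cost a factor \<open>1 + \<delta>\<close>, and its square
  is at most \<open>1 + 3 * \<delta>\<close> for \<open>\<delta>\<close> up to 1.\<close>

lemma ratio_close_quot:
  assumes "\<theta> \<in> Theta" "\<theta>' \<in> Theta" "0 \<le> \<delta>" "\<delta> \<le> 1" "ratio_close \<delta> \<theta> \<theta>'"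
  shows "\<theta>' $ i / \<theta>' $ j \<le> (1 + 3 * \<delta>) * (\<theta> $ i / \<theta> $ j)"
proof -
  note pos = Theta_pos[OF assms(1)] Theta_pos[OF assms(2)]
  have "1 / \<theta>' $ j \<le> (1 + \<delta>) / \<theta> $ j"
    using assms(5) pos[of j] by (auto simp: ratio_close_def field_simps)
  hence "\<theta>' $ i * (1 / \<theta>' $ j) \<le> ((1 + \<delta>) * \<theta> $ i) * ((1 + \<delta>) / \<theta> $ j)"
    using assms(5) pos[of j] pos[of i] assms(3)
    by (intro mult_mono) (auto simp: ratio_close_def)
  also have "\<dots> = (1 + \<delta>)\<^sup>2 * (\<theta> $ i / \<theta> $ j)" by (simp add: power2_eq_square)
  also have "\<dots> \<le> (1 + 3 * \<delta>) * (\<theta> $ i / \<theta> $ j)"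
    using one_plus_sq_le[OF assms(3,4)] pos[of j] pos[of i] by (intro mult_right_mono) (auto simp: less_imp_le)
  finally show ?thesis by simp
qed

text \<open>The normalisation \<open>ssum\<close> cancels, which leaves the weights only in a
  quotient of two of them.\<close>

lemma accept_eq:
  assumes "\<theta> \<in> Theta"
  shows "mh_accept lam p I \<theta> x y = min 1 ((p y / p x) * (\<theta> $ I x / \<theta> $ I y))"
proof -
  have "u / (v * s) / (u' / (v' * s)) = (u / u') * (v' / v)" if "s \<noteq> 0" for u v u' v' s :: real
    using that by (simp add: divide_divide_eq_left' mult_ac)
  thus ?thesis unfolding mh_accept_def pit_eq using ssum_pos[OF assms] by (metis less_irrefl)
qed

lemma ker_diff_le:
  assumes "\<theta> \<in> Theta" "\<theta>' \<in> Theta" "0 \<le> \<delta>" "\<delta> \<le> 1" "ratio_close \<delta> \<theta> \<theta>'"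
  shows "\<bar>ker \<theta> x y - ker \<theta>' x y\<bar> \<le> 3 * \<delta> * q x y"
proof -
  have pp: "0 < p y / p x" using p_pos by simp
  have nn: "0 \<le> \<theta>'' $ I x / \<theta>'' $ I y" if "\<theta>'' \<in> Theta" for \<theta>''
    using Theta_pos[OF that] by (simp add: less_imp_le)
  have q: "(p y / p x) * (\<theta>' $ I x / \<theta>' $ I y) \<le> (1 + 3 * \<delta>) * ((p y / p x) * (\<theta> $ I x / \<theta> $ I y))"
    if "\<theta> \<in> Theta" "\<theta>' \<in> Theta" "ratio_close \<delta> \<theta> \<theta>'" for \<theta> \<theta>'
    using mult_left_mono[OF ratio_close_quot[OF that(1,2) assms(3,4) that(3), of "I x" "I y"] less_imp_le[OF pp]]
    by (simp only: mult_ac)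
  have "\<bar>mh_accept lam p I \<theta> x y - mh_accept lam p I \<theta>' x y\<bar> \<le> 3 * \<delta>"
    unfolding accept_eq[OF assms(1)] accept_eq[OF assms(2)]
    using q[OF assms(1,2,5)] q[OF assms(2,1) ratio_close_sym[OF assms(5)]] assms(3)
      mult_nonneg_nonneg[OF less_imp_le[OF pp] nn[OF assms(1)]] mult_nonneg_nonneg[OF less_imp_le[OF pp] nn[OF assms(2)]]
    by (intro abs_min_1_diff_le) auto
  hence "\<bar>mh_accept lam p I \<theta> x y - mh_accept lam p I \<theta>' x y\<bar> * q x y \<le> 3 * \<delta> * q x y"
    using q_pos[of x y] by (intro mult_right_mono) auto
  thus ?thesis unfolding ker_def left_diff_distrib[symmetric] abs_mult using q_pos[of x y] by simp
qed

text \<open>One half of \<open>6 * K * \<delta>\<close> is the change of the accepted part, the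
  other half the change of the rejection probability.\<close>

lemma P_diff_theta_le:
  assumes th: "\<theta> \<in> Theta" "\<theta>' \<in> Theta" "0 \<le> \<delta>" "\<delta> \<le> 1" "ratio_close \<delta> \<theta> \<theta>'"
    and [measurable]: "f \<in> borel_measurable borel" and f: "\<And>x. \<bar>f x\<bar> \<le> K"
  shows "\<bar>P \<theta> f x - P \<theta>' f x\<bar> \<le> 6 * K * \<delta>"
proof -
  have K: "0 \<le> K" using f[of undefined] by linarith
  have main: "\<bar>(\<integral>y. ker \<theta> x y * g y \<partial>lam) - (\<integral>y. ker \<theta>' x y * g y \<partial>lam)\<bar> \<le> 3 * \<delta> * L"
    if [measurable]: "g \<in> borel_measurable borel" and g: "\<And>x. \<bar>g x\<bar> \<le> L" for g L
  proof -
    have i: "integrable lam (\<lambda>y. ker \<theta> x y * g y)" "integrable lam (\<lambda>y. ker \<theta>' x y * g y)"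
      by (rule integrable_ker_mult[OF th(1) that], rule integrable_ker_mult[OF th(2) that])
    have e: "(\<integral>y. ker \<theta> x y * g y \<partial>lam) - (\<integral>y. ker \<theta>' x y * g y \<partial>lam)
        = (\<integral>y. (ker \<theta> x y - ker \<theta>' x y) * g y \<partial>lam)"
      using i by (simp add: left_diff_distrib)
    have "\<bar>\<integral>y. (ker \<theta> x y - ker \<theta>' x y) * g y \<partial>lam\<bar> \<le> (\<integral>y. \<bar>(ker \<theta> x y - ker \<theta>' x y) * g y\<bar> \<partial>lam)" by (rule integral_abs_bound)
    also have "\<dots> \<le> (\<integral>y. q x y * (3 * \<delta> * L) \<partial>lam)"
    proof (rule integral_mono)
      show "integrable lam (\<lambda>y. q x y * (3 * \<delta> * L))" using integrable_q by simp
      show "integrable lam (\<lambda>y. \<bar>(ker \<theta> x y - ker \<theta>' x y) * g y\<bar>)"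
        unfolding left_diff_distrib by (intro integrable_abs Bochner_Integration.integrable_diff i)
      fix y
      have "\<bar>ker \<theta> x y - ker \<theta>' x y\<bar> * \<bar>g y\<bar> \<le> (3 * \<delta> * q x y) * L"
        using ker_diff_le[OF th, of x y] g th(3) q_pos[of x y] by (intro mult_mono) auto
      thus "\<bar>(ker \<theta> x y - ker \<theta>' x y) * g y\<bar> \<le> q x y * (3 * \<delta> * L)" by (simp add: abs_mult mult_ac)
    qed
    also have "\<dots> = 3 * \<delta> * L" using integral_q by simp
    finally show ?thesis unfolding e .
  qed
  have 1: "\<bar>(\<integral>y. ker \<theta> x y * f y \<partial>lam) - (\<integral>y. ker \<theta>' x y * f y \<partial>lam)\<bar> \<le> 3 * \<delta> * K"
    by (rule main[OF assms(6) f])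
  have 2: "\<bar>(\<integral>y. ker \<theta> x y \<partial>lam) - (\<integral>y. ker \<theta>' x y \<partial>lam)\<bar> \<le> 3 * \<delta>"
    using main[of "\<lambda>_. 1" 1] by simp
  have 3: "\<bar>((\<integral>y. ker \<theta> x y \<partial>lam) - (\<integral>y. ker \<theta>' x y \<partial>lam)) * f x\<bar> \<le> 3 * \<delta> * K"
    unfolding abs_mult using 2 f[of x] th(3) K by (intro mult_mono) auto
  have "P \<theta> f x - P \<theta>' f x = ((\<integral>y. ker \<theta> x y * f y \<partial>lam) - (\<integral>y. ker \<theta>' x y * f y \<partial>lam))
    - ((\<integral>y. ker \<theta> x y \<partial>lam) - (\<integral>y. ker \<theta>' x y \<partial>lam)) * f x"
  proof -
    have "(A + (1 - k) * v) - (B + (1 - k') * v) = (A - B) - (k - k') * v" for A B k k' v :: real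
      by (simp add: algebra_simps)
    thus ?thesis unfolding P_eq by (simp only:)
  qed
  hence "\<bar>P \<theta> f x - P \<theta>' f x\<bar> \<le> 3 * \<delta> * K + 3 * \<delta> * K" using 1 3 by linarith
  thus ?thesis by (simp add: mult_ac)
qed

text \<open>The bound is relative to the densities themselves, so that it integrates to
  \<open>6 * \<delta>\<close>, whatever the mass of \<open>lam\<close>.\<close>

lemma pit_diff_le:
  assumes th: "\<theta> \<in> Theta" "\<theta>' \<in> Theta" "0 \<le> \<delta>" "\<delta> \<le> 1" "ratio_close \<delta> \<theta> \<theta>'"
  shows "\<bar>pit \<theta> x - pit \<theta>' x\<bar> \<le> 3 * \<delta> * (pit \<theta> x + pit \<theta>' x)"
proof -
  have le: "pit \<theta> x \<le> (1 + 3 * \<delta>) * pit \<theta>' x"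
    if th: "\<theta> \<in> Theta" "\<theta>' \<in> Theta" "ratio_close \<delta> \<theta> \<theta>'" for \<theta> \<theta>'
  proof -
    \<comment> \<open>The denominator of \<open>pit\<close> is again a combination of quotients of
      weights.\<close>
    have e: "\<theta> $ I x * ssum \<theta> = (\<Sum>i\<in>UNIV. ts $ i * (\<theta> $ I x / \<theta> $ i))" for \<theta>
      by (simp add: ssum_def sum_distrib_left mult_ac)
    have "\<theta>' $ I x * ssum \<theta>' \<le> (\<Sum>i\<in>UNIV. ts $ i * ((1 + 3 * \<delta>) * (\<theta> $ I x / \<theta> $ i)))"
      unfolding e using ratio_close_quot[OF th(1,2) assms(3,4) th(3)] ts_pos
      by (intro sum_mono mult_left_mono) (auto simp: less_imp_le)
    also have "\<dots> = (1 + 3 * \<delta>) * (\<theta> $ I x * ssum \<theta>)"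
      unfolding e sum_distrib_left by (intro sum.cong refl) (simp only: mult_ac)
    finally have l: "\<theta>' $ I x * ssum \<theta>' \<le> (1 + 3 * \<delta>) * (\<theta> $ I x * ssum \<theta>)" .
    have pos: "0 < \<theta>' $ I x * ssum \<theta>'" "0 < \<theta> $ I x * ssum \<theta>"
      by (intro mult_pos_pos Theta_pos ssum_pos th)+
    have "1 / (\<theta> $ I x * ssum \<theta>) \<le> (1 + 3 * \<delta>) / (\<theta>' $ I x * ssum \<theta>')"
      using l pos by (simp add: divide_simps)
    from mult_left_mono[OF this less_imp_le[OF p_pos[of x]]] show ?thesis
      unfolding pit_eq by (simp add: mult_ac)
  qed
  have nn: "0 \<le> 3 * \<delta> * pit \<theta> x" "0 \<le> 3 * \<delta> * pit \<theta>' x" using pit_nonneg th by simp_all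
  show ?thesis
    using le[OF th(1,2,5)] le[OF th(2,1) ratio_close_sym[OF th(5)]] nn
    unfolding distrib_right distrib_left by linarith
qed

lemma integral_pit_diff_le:
  assumes th: "\<theta> \<in> Theta" "\<theta>' \<in> Theta" "0 \<le> \<delta>" "\<delta> \<le> 1" "ratio_close \<delta> \<theta> \<theta>'"
    and [measurable]: "f \<in> borel_measurable borel" and f: "\<And>x. \<bar>f x\<bar> \<le> K"
  shows "\<bar>(\<integral>x. pit \<theta> x * f x \<partial>lam) - (\<integral>x. pit \<theta>' x * f x \<partial>lam)\<bar> \<le> 6 * K * \<delta>"
proof -
  have i: "integrable lam (\<lambda>x. pit \<theta> x * f x)" "integrable lam (\<lambda>x. pit \<theta>' x * f x)"
    by (rule integrable_pit_mult[OF th(1) assms(6) f], rule integrable_pit_mult[OF th(2) assms(6) f])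
  have e: "(\<integral>x. pit \<theta> x * f x \<partial>lam) - (\<integral>x. pit \<theta>' x * f x \<partial>lam) = (\<integral>x. (pit \<theta> x - pit \<theta>' x) * f x \<partial>lam)"
    using i by (simp add: left_diff_distrib)
  have "\<bar>\<integral>x. (pit \<theta> x - pit \<theta>' x) * f x \<partial>lam\<bar> \<le> (\<integral>x. \<bar>(pit \<theta> x - pit \<theta>' x) * f x\<bar> \<partial>lam)" by (rule integral_abs_bound)
  also have "\<dots> \<le> (\<integral>x. (pit \<theta> x + pit \<theta>' x) * (3 * \<delta> * K) \<partial>lam)"
  proof (rule integral_mono)
    show "integrable lam (\<lambda>x. (pit \<theta> x + pit \<theta>' x) * (3 * \<delta> * K))"
      using integrable_pit[OF th(1)] integrable_pit[OF th(2)] by simp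
    show "integrable lam (\<lambda>x. \<bar>(pit \<theta> x - pit \<theta>' x) * f x\<bar>)"
      unfolding left_diff_distrib by (intro integrable_abs Bochner_Integration.integrable_diff i)
    fix x
    have "\<bar>pit \<theta> x - pit \<theta>' x\<bar> * \<bar>f x\<bar> \<le> (3 * \<delta> * (pit \<theta> x + pit \<theta>' x)) * K"
      using pit_diff_le[OF th, of x] f th(3) pit_nonneg[OF th(1)] pit_nonneg[OF th(2)] by (intro mult_mono) auto
    thus "\<bar>(pit \<theta> x - pit \<theta>' x) * f x\<bar> \<le> (pit \<theta> x + pit \<theta>' x) * (3 * \<delta> * K)" by (simp add: abs_mult mult_ac)
  qed
  also have "\<dots> = 6 * K * \<delta>"
    using integral_pit[OF th(1)] integral_pit[OF th(2)] integrable_pit[OF th(1)] integrable_pit[OF th(2)] by simp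
  finally show ?thesis unfolding e .
qed

lemma regular_P: assumes g: "regular g" shows "regular (\<lambda>\<theta>. P \<theta> (g \<theta>))"
proof -
  obtain K where K: "0 \<le> K" "\<And>\<theta> x. \<theta> \<in> Theta \<Longrightarrow> \<bar>g \<theta> x\<bar> \<le> K"
    "\<And>\<theta> \<theta>' \<delta> x. \<theta> \<in> Theta \<Longrightarrow> \<theta>' \<in> Theta \<Longrightarrow> 0 \<le> \<delta> \<Longrightarrow> \<delta> \<le> 1 \<Longrightarrow> ratio_close \<delta> \<theta> \<theta>' \<Longrightarrow>
      \<bar>g \<theta> x - g \<theta>' x\<bar> \<le> K * \<delta>" using regularE[OF g] by blast
  note [measurable] = regular_measurable_x[OF g]
  show ?thesis
  \<comment> \<open>\<open>K\<close> for the change of \<open>g\<close> and \<open>6 * K\<close> for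
    the change of the kernel.\<close>
  proof (rule regularI[where K="7 * K"])
    show "(\<lambda>(\<theta>, x). P \<theta> (g \<theta>) x) \<in> borel_measurable (borel \<Otimes>\<^sub>M borel)"
      unfolding split_beta by (rule P_measurable[OF regular_measurable_pair[OF g]]) measurable
  next
    fix \<theta> :: "real ^ 'd" and x assume th: "\<theta> \<in> Theta"
    have "\<bar>P \<theta> (g \<theta>) x\<bar> \<le> K" by (rule abs_P_le[OF th _ K(2)[OF th]]) measurable
    thus "\<bar>P \<theta> (g \<theta>) x\<bar> \<le> 7 * K" using K(1) by linarith
  next
    fix \<theta> \<theta>' :: "real ^ 'd" and \<delta> :: real and x assume th: "\<theta> \<in> Theta" "\<theta>' \<in> Theta" "0 \<le> \<delta>" "\<delta> \<le> 1" "ratio_close \<delta> \<theta> \<theta>'"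
    have "\<bar>P \<theta> (\<lambda>x. g \<theta> x - g \<theta>' x) x\<bar> \<le> K * \<delta>"
      by (rule abs_P_le[OF th(1) _ K(3)[OF th]]) measurable
    moreover have "P \<theta> (\<lambda>x. g \<theta> x - g \<theta>' x) x = P \<theta> (g \<theta>) x - P \<theta> (g \<theta>') x"
      by (rule P_diff[OF th(1) _ _ K(2)[OF th(1)] K(2)[OF th(2)]]) measurable
    moreover have "\<bar>P \<theta> (g \<theta>') x - P \<theta>' (g \<theta>') x\<bar> \<le> 6 * K * \<delta>"
      by (rule P_diff_theta_le[OF th _ K(2)[OF th(2)]]) measurable
    ultimately show "\<bar>P \<theta> (g \<theta>) x - P \<theta>' (g \<theta>') x\<bar> \<le> 7 * K * \<delta>" by linarith
  qed (use K in auto)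
qed

section \<open>Centred iterates and their sum\<close>

definition mean :: "(real ^ 'd \<Rightarrow> 'x \<Rightarrow> real) \<Rightarrow> real ^ 'd \<Rightarrow> real" where
  "mean g \<theta> = (\<integral>x. pit \<theta> x * g \<theta> x \<partial>lam)"

lemma regular_mean: assumes g: "regular g" shows "regular (\<lambda>\<theta> x. mean g \<theta>)"
proof -
  obtain K where K: "0 \<le> K" "\<And>\<theta> x. \<theta> \<in> Theta \<Longrightarrow> \<bar>g \<theta> x\<bar> \<le> K"
    "\<And>\<theta> \<theta>' \<delta> x. \<theta> \<in> Theta \<Longrightarrow> \<theta>' \<in> Theta \<Longrightarrow> 0 \<le> \<delta> \<Longrightarrow> \<delta> \<le> 1 \<Longrightarrow> ratio_close \<delta> \<theta> \<theta>' \<Longrightarrow>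
      \<bar>g \<theta> x - g \<theta>' x\<bar> \<le> K * \<delta>" using regularE[OF g] by blast
  note [measurable] = regular_measurable_x[OF g]
  show ?thesis
  proof (rule regularI[where K="7 * K"])
    note regular_measurable[OF g, measurable]
    show "(\<lambda>(\<theta>, x :: 'x). mean g \<theta>) \<in> borel_measurable (borel \<Otimes>\<^sub>M borel)"
      unfolding split_beta mean_def by measurable
  next
    fix \<theta> :: "real ^ 'd" and x assume th: "\<theta> \<in> Theta"
    have "\<bar>mean g \<theta>\<bar> \<le> K" unfolding mean_def by (rule abs_integral_pit_le[OF th _ K(2)[OF th]]) measurable
    thus "\<bar>mean g \<theta>\<bar> \<le> 7 * K" using K(1) by linarith
  next
    fix \<theta> \<theta>' :: "real ^ 'd" and \<delta> :: real and x assume th: "\<theta> \<in> Theta" "\<theta>' \<in> Theta" "0 \<le> \<delta>" "\<delta> \<le> 1" "ratio_close \<delta> \<theta> \<theta>'"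
    have "\<bar>\<integral>x. pit \<theta> x * (g \<theta> x - g \<theta>' x) \<partial>lam\<bar> \<le> K * \<delta>"
      by (rule abs_integral_pit_le[OF th(1) _ K(3)[OF th]]) measurable
    moreover have "(\<integral>x. pit \<theta> x * (g \<theta> x - g \<theta>' x) \<partial>lam) = mean g \<theta> - (\<integral>x. pit \<theta> x * g \<theta>' x \<partial>lam)"
      unfolding mean_def right_diff_distrib
      using integrable_pit_mult[OF th(1) _ K(2)[OF th(1)]] integrable_pit_mult[OF th(1) _ K(2)[OF th(2)]] by simp
    moreover have "\<bar>(\<integral>x. pit \<theta> x * g \<theta>' x \<partial>lam) - mean g \<theta>'\<bar> \<le> 6 * K * \<delta>"
      unfolding mean_def by (rule integral_pit_diff_le[OF th _ K(2)[OF th(2)]]) measurable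
    ultimately show "\<bar>mean g \<theta> - mean g \<theta>'\<bar> \<le> 7 * K * \<delta>" by linarith
  qed (use K in auto)
qed

text \<open>Neumann series for the solution of the Poisson equation; centring \<open>g\<close> makes
  the terms decay like \<open>(1 - eps) ^ n\<close>.\<close>

definition poisson :: "(real ^ 'd \<Rightarrow> 'x \<Rightarrow> real) \<Rightarrow> real ^ 'd \<Rightarrow> 'x \<Rightarrow> real" where
  "poisson g \<theta> x = (\<Sum>n. (P \<theta> ^^ n) (\<lambda>x. g \<theta> x - mean g \<theta>) x)"

lemma regular_iterate: "regular g \<Longrightarrow> regular (\<lambda>\<theta>. (P \<theta> ^^ n) (\<lambda>x. g \<theta> x - mean g \<theta>))"
  by (induction n) (auto intro: regular_P regular_diff regular_mean)

context
  fixes g K \<theta>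
  assumes g: "regular g" and K: "\<And>x. \<bar>g \<theta> x\<bar> \<le> K" and th: "\<theta> \<in> Theta"
begin

private abbreviation "it n \<equiv> (P \<theta> ^^ n) (\<lambda>x. g \<theta> x - mean g \<theta>)"

lemma iterate_measurable [measurable]: "it n \<in> borel_measurable borel"
  using regular_measurable_x[OF regular_iterate[OF g]] .

text \<open>Invariance keeps every iterate centred, so the mean term in \<open>P_residual_le\<close>
  vanishes and each application of the kernel gains a factor \<open>1 - eps\<close>.\<close>

lemma iterate_bound: "(\<forall>x. \<bar>it n x\<bar> \<le> (1 - eps) ^ n * (2 * K)) \<and> (\<integral>x. pit \<theta> x * it n x \<partial>lam) = 0"
proof (induction n)
  case 0
  note [measurable] = regular_measurable_x[OF g]
  have m: "\<bar>mean g \<theta>\<bar> \<le> K" unfolding mean_def by (rule abs_integral_pit_le[OF th _ K]) measurable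
  have "\<bar>g \<theta> x - mean g \<theta>\<bar> \<le> 2 * K" for x using m K[of x] by linarith
  moreover have "(\<integral>x. pit \<theta> x * (g \<theta> x - mean g \<theta>) \<partial>lam) = 0"
    using integrable_pit_mult[OF th _ K] integrable_pit[OF th] integral_pit[OF th]
    by (simp add: right_diff_distrib mean_def)
  ultimately show ?case by simp
next
  case (Suc n)
  hence b: "\<bar>it n x\<bar> \<le> (1 - eps) ^ n * (2 * K)" for x by blast
  have "\<bar>P \<theta> (it n) x\<bar> \<le> (1 - eps) * ((1 - eps) ^ n * (2 * K))" for x
    using P_residual_le[OF th iterate_measurable[of n] b, of x] Suc by simp
  moreover have "(\<integral>x. pit \<theta> x * P \<theta> (it n) x \<partial>lam) = 0"
    using pit_invariant[OF th iterate_measurable[of n] b] Suc by simp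
  ultimately show ?case by (simp add: mult.assoc)
qed

lemma abs_iterate_le: "norm (it n x) \<le> (1 - eps) ^ n * (2 * K)"
  using iterate_bound[of n] unfolding real_norm_def by blast

lemma eps_sums: "(\<lambda>n. (1 - eps) ^ n * (2 * K)) sums (2 * K / eps)"
proof -
  have "norm (1 - eps) < 1" using eps_le_1[OF th] eps_pos by simp
  from sums_mult2[OF geometric_sums[OF this], of "2 * K"] show ?thesis by simp
qed

lemma summable_iterate: "summable (\<lambda>n. it n x)"
  by (rule summable_comparison_test'[OF sums_summable[OF eps_sums] abs_iterate_le])

lemma poisson_le: "\<bar>poisson g \<theta> x\<bar> \<le> 2 * K / eps"
proof -
  have "norm (poisson g \<theta> x) \<le> (\<Sum>n. (1 - eps) ^ n * (2 * K))"
    unfolding poisson_def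
    by (rule norm_suminf_le[OF abs_iterate_le sums_summable[OF eps_sums]])
  thus ?thesis unfolding sums_unique[OF eps_sums, symmetric] real_norm_def .
qed

lemma poisson_measurable_x [measurable]: "poisson g \<theta> \<in> borel_measurable borel"
  unfolding poisson_def[abs_def] by measurable

lemma poisson_tail: "\<bar>poisson g \<theta> x - (\<Sum>n<m. it n x)\<bar> \<le> (1 - eps) ^ m * (2 * K / eps)"
proof -
  have "(\<lambda>n. (1 - eps) ^ m * ((1 - eps) ^ n * (2 * K))) sums ((1 - eps) ^ m * (2 * K / eps))"
    by (rule sums_mult[OF eps_sums])
  also have "(\<lambda>n. (1 - eps) ^ m * ((1 - eps) ^ n * (2 * K))) = (\<lambda>n. (1 - eps) ^ (n + m) * (2 * K))"
    by (simp only: power_add mult_ac)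
  finally have s: "(\<lambda>n. (1 - eps) ^ (n + m) * (2 * K)) sums ((1 - eps) ^ m * (2 * K / eps))" .
  have e: "poisson g \<theta> x - (\<Sum>n<m. it n x) = (\<Sum>n. it (n + m) x)"
    unfolding poisson_def using suminf_split_initial_segment[OF summable_iterate, of x m] by simp
  have "norm (\<Sum>n. it (n + m) x) \<le> (\<Sum>n. (1 - eps) ^ (n + m) * (2 * K))"
    by (rule norm_suminf_le[OF abs_iterate_le sums_summable[OF s]])
  also have "\<dots> = (1 - eps) ^ m * (2 * K / eps)" by (rule sums_unique[OF s, symmetric])
  finally show ?thesis unfolding e real_norm_def .
qed

lemma tail_tendsto_0: "(\<lambda>m. (1 - eps) ^ m * C) \<longlonglongrightarrow> 0"
  by (rule tendsto_mult_left_zero[OF LIMSEQ_power_zero]) (use eps_le_1[OF th] eps_pos in simp)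

lemma partial_sum_bound: "\<exists>B. \<forall>x. \<bar>\<Sum>n<m. it n x\<bar> \<le> B"
proof
  show "\<forall>x. \<bar>\<Sum>n<m. it n x\<bar> \<le> (\<Sum>n<m. (1 - eps) ^ n * (2 * K))"
    by (intro allI order_trans[OF sum_abs] sum_mono abs_iterate_le[unfolded real_norm_def])
qed

lemma P_partial_sum: "P \<theta> (\<lambda>x. \<Sum>n<m. it n x) x = (\<Sum>n<m. it (Suc n) x)"
proof (induction m)
  case 0
  show ?case using P_const[of \<theta> 0 x] by simp
next
  case (Suc m)
  obtain B where B: "\<And>x. \<bar>\<Sum>n<m. it n x\<bar> \<le> B" using partial_sum_bound by blast
  have "P \<theta> (\<lambda>x. (\<Sum>n<m. it n x) + it m x) x = P \<theta> (\<lambda>x. \<Sum>n<m. it n x) x + P \<theta> (it m) x"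
    by (rule P_add[OF th _ _ B iterate_bound[THEN conjunct1, rule_format]]) measurable
  thus ?case using Suc by simp
qed

text \<open>On partial sums the kernel merely shifts the index; the uniform bound on the tails
  carries this over to the series.\<close>

lemma poisson_eq: "P \<theta> (poisson g \<theta>) x = poisson g \<theta> x - (g \<theta> x - mean g \<theta>)"
proof -
  have "(\<lambda>m. P \<theta> (\<lambda>x. \<Sum>n<m. it n x) x - P \<theta> (poisson g \<theta>) x) \<longlonglongrightarrow> 0"
  proof (rule Lim_null_comparison[OF _ tail_tendsto_0[of "2 * K / eps"]], rule always_eventually, rule allI)
    fix m
    obtain B where B: "\<And>x. \<bar>\<Sum>n<m. it n x\<bar> \<le> B" using partial_sum_bound by blast
    have "P \<theta> (\<lambda>x. (\<Sum>n<m. it n x) - poisson g \<theta> x) x = P \<theta> (\<lambda>x. \<Sum>n<m. it n x) x - P \<theta> (poisson g \<theta>) x"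
      by (rule P_diff[OF th _ _ B poisson_le]) measurable
    moreover have "\<bar>P \<theta> (\<lambda>x. (\<Sum>n<m. it n x) - poisson g \<theta> x) x\<bar> \<le> (1 - eps) ^ m * (2 * K / eps)"
      by (rule abs_P_le[OF th]) (measurable, subst abs_minus_commute, rule poisson_tail)
    ultimately show "norm (P \<theta> (\<lambda>x. \<Sum>n<m. it n x) x - P \<theta> (poisson g \<theta>) x) \<le> (1 - eps) ^ m * (2 * K / eps)"
      by simp
  qed
  hence "(\<lambda>m. \<Sum>n<m. it (Suc n) x) \<longlonglongrightarrow> P \<theta> (poisson g \<theta>) x"
    unfolding P_partial_sum by (rule LIM_zero_cancel)
  moreover have "(\<lambda>m. \<Sum>n<m. it (Suc n) x) \<longlonglongrightarrow> poisson g \<theta> x - it 0 x"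
  proof -
    have "(\<lambda>n. it (Suc n) x) sums (poisson g \<theta> x - it 0 x)"
      unfolding poisson_def by (subst sums_Suc_iff) (use summable_sums[OF summable_iterate, of x] in simp)
    thus ?thesis by (simp add: sums_def)
  qed
  ultimately have "P \<theta> (poisson g \<theta>) x = poisson g \<theta> x - it 0 x" by (rule LIMSEQ_unique)
  thus ?thesis by simp
qed

text \<open>The Poisson equation leaves an additive constant free. Centring fixes it, and this is
  what makes solutions for different weights comparable.\<close>

lemma mean_poisson: "mean (poisson g) \<theta> = 0"
proof -
  have "(\<lambda>m. (\<integral>x. pit \<theta> x * (\<Sum>n<m. it n x) \<partial>lam) - mean (poisson g) \<theta>) \<longlonglongrightarrow> 0"
  proof (rule Lim_null_comparison[OF _ tail_tendsto_0[of "2 * K / eps"]], rule always_eventually, rule allI)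
    fix m
    obtain B where B: "\<And>x. \<bar>\<Sum>n<m. it n x\<bar> \<le> B" using partial_sum_bound by blast
    have "(\<integral>x. pit \<theta> x * ((\<Sum>n<m. it n x) - poisson g \<theta> x) \<partial>lam) =
        (\<integral>x. pit \<theta> x * (\<Sum>n<m. it n x) \<partial>lam) - mean (poisson g) \<theta>"
      unfolding mean_def[of "poisson g"] right_diff_distrib
      by (rule Bochner_Integration.integral_diff[OF integrable_pit_mult[OF th _ B] integrable_pit_mult[OF th poisson_measurable_x poisson_le]]) measurable
    moreover have "\<bar>\<integral>x. pit \<theta> x * ((\<Sum>n<m. it n x) - poisson g \<theta> x) \<partial>lam\<bar> \<le> (1 - eps) ^ m * (2 * K / eps)"
      by (rule abs_integral_pit_le[OF th]) (measurable, subst abs_minus_commute, rule poisson_tail)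
    ultimately show "norm ((\<integral>x. pit \<theta> x * (\<Sum>n<m. it n x) \<partial>lam) - mean (poisson g) \<theta>) \<le> (1 - eps) ^ m * (2 * K / eps)"
      by simp
  qed
  moreover have "(\<integral>x. pit \<theta> x * (\<Sum>n<m. it n x) \<partial>lam) = 0" for m
  proof -
    have "integrable lam (\<lambda>x. pit \<theta> x * it n x)" for n
      by (rule integrable_pit_mult[OF th iterate_measurable iterate_bound[THEN conjunct1, rule_format]])
    thus ?thesis using iterate_bound[THEN conjunct2]
      by (simp add: sum_distrib_left Bochner_Integration.integral_sum)
  qed
  ultimately have "(\<lambda>m. - mean (poisson g) \<theta>) \<longlonglongrightarrow> 0" by simp
  thus ?thesis by (simp add: LIMSEQ_const_iff)
qed

end

text \<open>The difference \<open>D\<close> of two solutions satisfies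
  \<open>D = P \<theta> D\<close> up to errors of order \<open>\<delta>\<close>, and its mean under
  \<open>pit \<theta>\<close> is also of order \<open>\<delta>\<close>, because each solution is
  centred for its own weights. The Doeblin estimate then bounds the supremum of
  \<open>D\<close>.\<close>

lemma regular_poisson: assumes g: "regular g" shows "regular (poisson g)"
proof -
  have rc: "regular (\<lambda>\<theta> x. g \<theta> x - mean g \<theta>)" by (intro regular_diff regular_mean g)
  obtain K where K: "0 \<le> K" "\<And>\<theta> x. \<theta> \<in> Theta \<Longrightarrow> \<bar>g \<theta> x\<bar> \<le> K"
    by (rule regularE[OF g]) (rule that)
  obtain L where L: "0 \<le> L"
    "\<And>\<theta> \<theta>' \<delta> x. \<theta> \<in> Theta \<Longrightarrow> \<theta>' \<in> Theta \<Longrightarrow> 0 \<le> \<delta> \<Longrightarrow> \<delta> \<le> 1 \<Longrightarrow> ratio_close \<delta> \<theta> \<theta>' \<Longrightarrow>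
      \<bar>(g \<theta> x - mean g \<theta>) - (g \<theta>' x - mean g \<theta>')\<bar> \<le> L * \<delta>"
    by (rule regularE[OF rc]) (rule that)
  define B where "B = 2 * K / eps"
  have B0: "0 \<le> B" using K eps_pos by (simp add: B_def)
  have pb: "\<bar>poisson g \<theta> x\<bar> \<le> B" if "\<theta> \<in> Theta" for \<theta> x
    unfolding B_def by (rule poisson_le[OF g K(2)[OF that] that])
  have pm [measurable]: "poisson g \<theta> \<in> borel_measurable borel" if "\<theta> \<in> Theta" for \<theta>
    by (rule poisson_measurable_x[OF g K(2)[OF that] that])
  \<comment> \<open>\<open>L\<close> for the change of the centred function, \<open>6 * B\<close>
    for the mean of the second solution under the first target, \<open>6 * B\<close> for the change
    of the kernel; division by \<open>eps\<close> solves the inequality for the supremum.\<close>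
  define C where "C = (L + 12 * B) / eps"
  show ?thesis
  proof (rule regularI[where K="B + C"])
    note [measurable] = regular_measurable_pair[OF regular_iterate[OF g], unfolded split_beta]
    show "(\<lambda>(\<theta>, x). poisson g \<theta> x) \<in> borel_measurable (borel \<Otimes>\<^sub>M borel)"
      unfolding poisson_def split_beta by measurable
    have C0: "0 \<le> C" using L(1) B0 eps_pos by (simp add: C_def)
    show "0 \<le> B + C" using B0 C0 by simp
    show "\<bar>poisson g \<theta> x\<bar> \<le> B + C" if "\<theta> \<in> Theta" for \<theta> x using pb[OF that, of x] C0 by linarith
    fix \<theta> \<theta>' :: "real ^ 'd" and \<delta> :: real and x assume th: "\<theta> \<in> Theta" "\<theta>' \<in> Theta" "0 \<le> \<delta>" "\<delta> \<le> 1" "ratio_close \<delta> \<theta> \<theta>'"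
    note [measurable] = pm[OF th(1)] pm[OF th(2)]
    define D where "D = (\<lambda>x. poisson g \<theta> x - poisson g \<theta>' x)"
    have Dm [measurable]: "D \<in> borel_measurable borel" unfolding D_def by measurable
    have Db: "\<bar>D x\<bar> \<le> 2 * B" for x unfolding D_def using pb[OF th(1), of x] pb[OF th(2), of x] by linarith
    \<comment> \<open>Finite because both solutions are bounded, so \<open>(1 - eps) * S\<close> may
      be subtracted from both sides below.\<close>
    define S where "S = (SUP x. \<bar>D x\<bar>)"
    have bdd: "bdd_above (range (\<lambda>x. \<bar>D x\<bar>))" using Db by (auto intro!: bdd_aboveI)
    have DS: "\<bar>D x\<bar> \<le> S" for x unfolding S_def by (rule cSUP_upper[OF _ bdd]) simp
    have "\<bar>D x\<bar> \<le> (1 - eps) * S + (L + 12 * B) * \<delta>" for x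
    proof -
      have PD: "P \<theta> D x = P \<theta> (poisson g \<theta>) x - P \<theta> (poisson g \<theta>') x"
        unfolding D_def by (rule P_diff[OF th(1) _ _ pb[OF th(1)] pb[OF th(2)]]) measurable
      have mD: "(\<integral>x. pit \<theta> x * D x \<partial>lam) = - (\<integral>x. pit \<theta> x * poisson g \<theta>' x \<partial>lam)"
        unfolding D_def right_diff_distrib
        using integrable_pit_mult[OF th(1) _ pb[OF th(1)]] integrable_pit_mult[OF th(1) _ pb[OF th(2)]]
          mean_poisson[OF g K(2)[OF th(1)] th(1)] by (simp add: mean_def)
      have m1: "\<bar>(\<integral>x. pit \<theta> x * poisson g \<theta>' x \<partial>lam)\<bar> \<le> 6 * B * \<delta>"
        using integral_pit_diff_le[OF th pm[OF th(2)] pb[OF th(2)]] mean_poisson[OF g K(2)[OF th(2)] th(2)]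
        by (simp add: mean_def)
      have "eps * \<bar>(\<integral>x. pit \<theta> x * poisson g \<theta>' x \<partial>lam)\<bar> \<le> 1 * (6 * B * \<delta>)"
        using m1 eps_le_1[OF th(1)] eps_pos by (intro mult_mono) auto
      hence m: "\<bar>eps * (\<integral>x. pit \<theta> x * D x \<partial>lam)\<bar> \<le> 6 * B * \<delta>"
        unfolding mD using eps_pos by (simp add: abs_mult)
      have r: "\<bar>P \<theta> D x - eps * (\<integral>x. pit \<theta> x * D x \<partial>lam)\<bar> \<le> (1 - eps) * S"
        by (rule P_residual_le[OF th(1) Dm DS])
      have pd: "\<bar>P \<theta> (poisson g \<theta>') x - P \<theta>' (poisson g \<theta>') x\<bar> \<le> 6 * B * \<delta>"
        by (rule P_diff_theta_le[OF th _ pb[OF th(2)]]) measurable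
      have e: "D x = ((g \<theta> x - mean g \<theta>) - (g \<theta>' x - mean g \<theta>')) + P \<theta> D x
          + (P \<theta> (poisson g \<theta>') x - P \<theta>' (poisson g \<theta>') x)"
        using poisson_eq[OF g K(2)[OF th(1)] th(1), of x] poisson_eq[OF g K(2)[OF th(2)] th(2), of x] PD
        by (simp add: D_def)
      show ?thesis using e L(2)[OF th, of x] m r pd unfolding distrib_right by linarith
    qed
    hence "S \<le> (1 - eps) * S + (L + 12 * B) * \<delta>"
      unfolding S_def by (intro cSUP_least) auto
    hence "S * eps \<le> (L + 12 * B) * \<delta>" by (simp add: algebra_simps)
    hence "S \<le> C * \<delta>" using eps_pos by (simp add: C_def pos_le_divide_eq)
    moreover have "0 \<le> B * \<delta>" using B0 th(3) by simp
    ultimately show "\<bar>poisson g \<theta> x - poisson g \<theta>' x\<bar> \<le> (B + C) * \<delta>"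
      using DS[of x] unfolding D_def distrib_right by linarith
  qed
qed

section \<open>Mean field and asymptotic covariance\<close>

abbreviation wfield :: "real ^ 'd \<Rightarrow> real ^ 'd \<Rightarrow> 'x \<Rightarrow> real" where
  "wfield t \<theta> x \<equiv> t \<bullet> WL_field I x \<theta>"

text \<open>The relative increment of weight \<open>i\<close>: the update multiplies it by one plus
  \<open>gamma\<close> times this. Its modulus is at most 1 on the whole simplex.\<close>

definition growth :: "'d \<Rightarrow> real ^ 'd \<Rightarrow> 'x \<Rightarrow> real" where
  "growth i \<theta> x = indicator {y. I y = i} x - \<theta> $ (I x)"

lemma regular_growth: "regular (growth i)"
proof -
  have "growth i = (\<lambda>\<theta> x. indicator {y. I y = i} x - (\<Sum>j\<in>UNIV. indicator {y. I y = j} x * \<theta> $ j))"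
    by (intro ext) (simp add: growth_def sum_indicator_I)
  thus ?thesis
    by (simp only:) (intro regular_diff regular_indicator regular_sum regular_mult regular_weight finite)
qed

lemma wfield_eq: "wfield t \<theta> x = (\<Sum>i\<in>UNIV. t $ i * (\<theta> $ i * growth i \<theta> x))"
  by (simp add: WL_field_def inner_vec_def growth_def)

lemma regular_wfield: "regular (wfield t)"
  unfolding wfield_eq by (intro regular_sum regular_mult regular_const regular_weight regular_growth finite)

lemma mean_growth:
  assumes th: "\<theta> \<in> Theta"
  shows "mean (growth i) \<theta> = (ts $ i / \<theta> $ i - 1) / ssum \<theta>"
proof -
  have "mean (growth i) \<theta> = (\<integral>x. pit \<theta> x * (\<lambda>j. (if j = i then 1 else 0) - \<theta> $ j) (I x) \<partial>lam)"
    unfolding mean_def growth_def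
    by (intro Bochner_Integration.integral_cong refl) (simp add: indicator_def)
  also have "\<dots> = (\<Sum>j\<in>UNIV. ts $ j / \<theta> $ j * ((if j = i then 1 else 0) - \<theta> $ j)) / ssum \<theta>"
    by (rule integral_pit_comp_I)
  also have "(\<Sum>j\<in>UNIV. ts $ j / \<theta> $ j * ((if j = i then 1 else 0) - \<theta> $ j)) =
      (\<Sum>j\<in>UNIV. (if j = i then ts $ j / \<theta> $ j else 0) - ts $ j)"
    using Theta_pos[OF th] less_imp_neq[OF Theta_pos[OF th]]
    by (intro sum.cong refl) (auto simp: right_diff_distrib)
  also have "\<dots> = ts $ i / \<theta> $ i - 1" by (simp add: sum_subtractf ts_sum)
  finally show ?thesis .
qed

lemma mean_weighted_sum:
  assumes th: "\<theta> \<in> Theta" and g: "\<And>i. regular (g i)"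
  shows "mean (\<lambda>\<theta> x. \<Sum>i\<in>UNIV. w i \<theta> * g i \<theta> x) \<theta> = (\<Sum>i\<in>(UNIV :: 'd set). w i \<theta> * mean (g i) \<theta>)"
proof -
  have ig: "integrable lam (\<lambda>x. pit \<theta> x * g i \<theta> x)" for i
  proof -
    obtain K where K: "\<And>\<theta> x. \<theta> \<in> Theta \<Longrightarrow> \<bar>g i \<theta> x\<bar> \<le> K"
      by (rule regularE[OF g[of i]]) (rule that)
    show ?thesis by (rule integrable_pit_mult[OF th regular_measurable_x[OF g] K[OF th]])
  qed
  have "mean (\<lambda>\<theta> x. \<Sum>i\<in>UNIV. w i \<theta> * g i \<theta> x) \<theta> = (\<integral>x. (\<Sum>i\<in>UNIV. w i \<theta> * (pit \<theta> x * g i \<theta> x)) \<partial>lam)"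
    unfolding mean_def sum_distrib_left by (simp only: mult_ac)
  also have "\<dots> = (\<Sum>i\<in>UNIV. w i \<theta> * mean (g i) \<theta>)"
    unfolding mean_def by (subst Bochner_Integration.integral_sum) (use ig in auto)
  finally show ?thesis .
qed

text \<open>The factor \<open>\<theta> $ i\<close> of the field cancels the denominator in the mean
  growth, so the mean field points straight at \<open>ts\<close>; the only nonlinearity is the
  scalar speed \<open>1 / ssum \<theta>\<close>.\<close>

lemma mean_wfield:
  assumes th: "\<theta> \<in> Theta"
  shows "mean (wfield t) \<theta> = (t \<bullet> (ts - \<theta>)) / ssum \<theta>"
proof -
  have "mean (wfield t) \<theta> = mean (\<lambda>\<theta> x. \<Sum>i\<in>UNIV. (t $ i * \<theta> $ i) * growth i \<theta> x) \<theta>"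
    unfolding wfield_eq mult.assoc ..
  also have "\<dots> = (\<Sum>i\<in>UNIV. (t $ i * \<theta> $ i) * mean (growth i) \<theta>)"
    by (rule mean_weighted_sum[OF th regular_growth])
  also have "\<dots> = (\<Sum>i\<in>UNIV. t $ i * (ts $ i - \<theta> $ i) / ssum \<theta>)"
  proof (intro sum.cong refl)
    fix i
    have "u * v * ((w / v - 1) / s) = u * (w - v) / s" if "v \<noteq> 0" for u v w s :: real
      using that by (simp add: right_diff_distrib)
    thus "(t $ i * \<theta> $ i) * mean (growth i) \<theta> = t $ i * (ts $ i - \<theta> $ i) / ssum \<theta>"
      unfolding mean_growth[OF th] using Theta_pos[OF th, of i] by simp
  qed
  also have "\<dots> = (t \<bullet> (ts - \<theta>)) / ssum \<theta>"
    by (simp add: inner_vec_def sum_divide_distrib)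
  finally show ?thesis .
qed

section \<open>Conditional variance of the martingale increments\<close>

definition corr :: "real ^ 'd \<Rightarrow> real ^ 'd \<Rightarrow> 'x \<Rightarrow> real" where
  "corr t \<theta> = P \<theta> (poisson (wfield t) \<theta>)"

text \<open>The variance of the Poisson solution at the next position, given the present one;
  \<open>corr\<close> is the corresponding conditional expectation.\<close>

definition var_fun :: "real ^ 'd \<Rightarrow> real ^ 'd \<Rightarrow> 'x \<Rightarrow> real" where
  "var_fun t \<theta> x = P \<theta> (\<lambda>y. (poisson (wfield t) \<theta> y)\<^sup>2) x - (corr t \<theta> x)\<^sup>2"

lemma regular_corr: "regular (corr t)"
  unfolding corr_def[abs_def] by (intro regular_P regular_poisson regular_wfield)

lemma regular_var_fun: "regular (var_fun t)"
  unfolding var_fun_def[abs_def]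
  by (intro regular_diff regular_P regular_power2 regular_poisson regular_wfield regular_corr)

lemma P_nonneg:
  assumes th: "\<theta> \<in> Theta" and f: "\<And>x. 0 \<le> f x"
  shows "0 \<le> P \<theta> f x"
  unfolding P_eq using integral_ker_le_1[OF th, of x] f ker_nonneg[OF th]
  by (intro add_nonneg_nonneg mult_nonneg_nonneg Bochner_Integration.integral_nonneg) auto

text \<open>Conditional Jensen inequality, from expanding the nonnegative image of the square of
  \<open>f y - r\<close> at \<open>r = P \<theta> f x\<close>.\<close>

lemma P_power2_le:
  assumes th: "\<theta> \<in> Theta" and [measurable]: "f \<in> borel_measurable borel" and f: "\<And>x. \<bar>f x\<bar> \<le> K"
  shows "(P \<theta> f x)\<^sup>2 \<le> P \<theta> (\<lambda>y. (f y)\<^sup>2) x"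
proof -
  define r where "r = P \<theta> f x"
  have f2: "\<bar>(f y)\<^sup>2\<bar> \<le> K\<^sup>2" for y
    using f[of y] by (simp add: abs_le_square_iff[symmetric])
  have b2: "\<bar>2 * r * f y - r\<^sup>2\<bar> \<le> 2 * \<bar>r\<bar> * K + r\<^sup>2" for y
    using mult_left_mono[OF f[of y], of "2 * \<bar>r\<bar>"] abs_triangle_ineq4[of "2 * r * f y" "r\<^sup>2"]
    by (simp add: abs_mult)
  have lin: "P \<theta> (\<lambda>y. 2 * r * f y - r\<^sup>2) x = 2 * r * P \<theta> f x - r\<^sup>2"
  proof -
    have "P \<theta> (\<lambda>y. 2 * r * f y - r\<^sup>2) x = P \<theta> (\<lambda>y. 2 * r * f y) x - P \<theta> (\<lambda>_. r\<^sup>2) x"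
    proof (rule P_diff[OF th])
      show "\<bar>2 * r * f y\<bar> \<le> 2 * \<bar>r\<bar> * K" for y
        using mult_left_mono[OF f[of y], of "2 * \<bar>r\<bar>"] by (simp add: abs_mult)
      show "\<bar>r\<^sup>2\<bar> \<le> r\<^sup>2" by simp
    qed measurable
    also have "P \<theta> (\<lambda>y. 2 * r * f y) x = 2 * r * P \<theta> f x"
    proof -
      have e: "ker \<theta> x y * (2 * r * f y) = (2 * r) * (ker \<theta> x y * f y)" for y by simp
      show ?thesis unfolding P_eq e integral_mult_right_zero distrib_left by simp
    qed
    finally show ?thesis by (simp add: P_const)
  qed
  have "0 \<le> P \<theta> (\<lambda>y. (f y - r)\<^sup>2) x" by (rule P_nonneg[OF th]) simp
  also have "(\<lambda>y. (f y - r)\<^sup>2) = (\<lambda>y. (f y)\<^sup>2 - (2 * r * f y - r\<^sup>2))"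
    by (intro ext) (simp add: power2_eq_square algebra_simps)
  also have "P \<theta> (\<lambda>y. (f y)\<^sup>2 - (2 * r * f y - r\<^sup>2)) x = P \<theta> (\<lambda>y. (f y)\<^sup>2) x - P \<theta> (\<lambda>y. 2 * r * f y - r\<^sup>2) x"
    by (rule P_diff[OF th _ _ f2 b2]) measurable
  finally show ?thesis unfolding lin r_def[symmetric] by (simp add: power2_eq_square)
qed

lemma var_fun_nonneg: assumes th: "\<theta> \<in> Theta" shows "0 \<le> var_fun t \<theta> x"
proof -
  have r: "regular (poisson (wfield t))" by (intro regular_poisson regular_wfield)
  obtain K where K: "\<And>\<theta> x. \<theta> \<in> Theta \<Longrightarrow> \<bar>poisson (wfield t) \<theta> x\<bar> \<le> K"
    by (rule regularE[OF r]) (rule that)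
  show ?thesis unfolding var_fun_def corr_def
    using P_power2_le[OF th regular_measurable_x[OF r] K[OF th], of x] by simp
qed

lemma mean_nonneg: "\<theta> \<in> Theta \<Longrightarrow> (\<And>x. 0 \<le> g \<theta> x) \<Longrightarrow> 0 \<le> mean g \<theta>"
  unfolding mean_def by (intro Bochner_Integration.integral_nonneg) (simp add: pit_nonneg)

text \<open>Averaging removes the kernel in front of the squared Poisson solution by invariance;
  this is how the integrand of \<open>U_star\<close> arises.\<close>

lemma mean_var_fun:
  assumes th: "\<theta> \<in> Theta"
  shows "mean (var_fun t) \<theta> = (\<integral>x. pit \<theta> x * ((poisson (wfield t) \<theta> x)\<^sup>2 - (corr t \<theta> x)\<^sup>2) \<partial>lam)"
proof -
  have r: "regular (\<lambda>\<theta> x. (poisson (wfield t) \<theta> x)\<^sup>2)" "regular (\<lambda>\<theta> x. (corr t \<theta> x)\<^sup>2)"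
    by (intro regular_power2 regular_poisson regular_wfield regular_corr)+
  obtain K where K: "\<And>\<theta> x. \<theta> \<in> Theta \<Longrightarrow> \<bar>(poisson (wfield t) \<theta> x)\<^sup>2\<bar> \<le> K"
    by (rule regularE[OF r(1)]) (rule that)
  obtain L where L: "\<And>\<theta> x. \<theta> \<in> Theta \<Longrightarrow> \<bar>(corr t \<theta> x)\<^sup>2\<bar> \<le> L"
    by (rule regularE[OF r(2)]) (rule that)
  note m = regular_measurable_x[OF r(1)] regular_measurable_x[OF r(2)] regular_measurable_x[OF regular_P[OF r(1)]]
  have i1: "integrable lam (\<lambda>x. pit \<theta> x * (poisson (wfield t) \<theta> x)\<^sup>2)"
    by (rule integrable_pit_mult[OF th m(1) K[OF th]])
  have i2: "integrable lam (\<lambda>x. pit \<theta> x * (corr t \<theta> x)\<^sup>2)"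
    by (rule integrable_pit_mult[OF th m(2) L[OF th]])
  have i3: "integrable lam (\<lambda>x. pit \<theta> x * P \<theta> (\<lambda>y. (poisson (wfield t) \<theta> y)\<^sup>2) x)"
    by (rule integrable_pit_mult[OF th m(3) abs_P_le[OF th m(1) K[OF th]]])
  show ?thesis
    unfolding mean_def[of "var_fun t"] var_fun_def right_diff_distrib
      Bochner_Integration.integral_diff[OF i3 i2] Bochner_Integration.integral_diff[OF i1 i2]
      pit_invariant[OF th m(1) K[OF th]] ..
qed

section \<open>Vector-valued kernels and the covariance matrix\<close>

text \<open>Testing with \<open>t\<close> reduces the operator to the scalar one, once the Bochner
  integral is known to exist. The factor \<open>CARD('d)\<close> comes from bounding the norm by the
  sum of the coordinates.\<close>

lemma MH_op_vector:
  fixes f :: "'x \<Rightarrow> real ^ 'd" and K :: real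
  assumes th: "\<theta> \<in> Theta" and f [measurable]: "f \<in> borel_measurable borel" and K: "\<And>x. norm (f x) \<le> (K :: real)"
  shows inner_MH_op: "t \<bullet> MH_op lam p I q \<theta> f x = P \<theta> (\<lambda>x. t \<bullet> f x) x"
    and MH_op_vector_measurable: "MH_op lam p I q \<theta> f \<in> borel_measurable borel"
    and MH_op_vector_bounded: "norm (MH_op lam p I q \<theta> f x) \<le> CARD('d) * K"
proof -
  have i: "integrable lam (\<lambda>y. ker \<theta> x y *\<^sub>R f y)" for x
  proof (rule Bochner_Integration.integrable_bound)
    show "integrable lam (\<lambda>y. q x y * K)" using integrable_q by simp
    have "norm (ker \<theta> x y *\<^sub>R f y) \<le> norm (q x y * K)" for y
      using mult_mono[OF ker_le[OF th, of x y] K[of y] less_imp_le[OF q_pos]] ker_nonneg[OF th, of x y] by simp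
    thus "AE y in lam. norm (ker \<theta> x y *\<^sub>R f y) \<le> norm (q x y * K)" by simp
  qed measurable
  have e: "t \<bullet> MH_op lam p I q \<theta> f x = P \<theta> (\<lambda>x. t \<bullet> f x) x" for t x
    unfolding MH_op_def[of _ _ _ _ _ f] P_eq ker_def[symmetric] inner_add_right
    using integral_inner_right[OF i[of x], of t] by simp
  show "t \<bullet> MH_op lam p I q \<theta> f x = P \<theta> (\<lambda>x. t \<bullet> f x) x" by (rule e)
  show "MH_op lam p I q \<theta> f \<in> borel_measurable borel"
    unfolding borel_measurable_euclidean_space[of "MH_op lam p I q \<theta> f"] inner_commute[of "MH_op lam p I q \<theta> f _"] e
    by measurable
  have "norm (MH_op lam p I q \<theta> f x) \<le> (\<Sum>i\<in>UNIV. \<bar>MH_op lam p I q \<theta> f x $ i\<bar>)" by (rule norm_le_l1_cart)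
  also have "\<dots> \<le> (\<Sum>i\<in>(UNIV::'d set). K)"
  proof (intro sum_mono)
    fix i :: 'd
    have "\<bar>P \<theta> (\<lambda>x. axis i 1 \<bullet> f x) x\<bar> \<le> K"
    proof (rule abs_P_le[OF th])
      show "\<bar>axis i 1 \<bullet> f x\<bar> \<le> K" for x
        using component_le_norm_cart[of "f x" i] K[of x] by (simp add: inner_axis')
    qed measurable
    thus "\<bar>MH_op lam p I q \<theta> f x $ i\<bar> \<le> K" using e[of "axis i 1" x] by (simp add: inner_axis')
  qed
  finally show "norm (MH_op lam p I q \<theta> f x) \<le> CARD('d) * K" by simp
qed

lemma WL_field_bounded: "\<exists>B. \<forall>x. norm (WL_field I x ts) \<le> B"
proof (intro exI allI)
  fix x
  have "norm (WL_field I x ts) \<le> (\<Sum>i\<in>UNIV. \<bar>WL_field I x ts $ i\<bar>)" by (rule norm_le_l1_cart)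
  also have "\<dots> \<le> (\<Sum>i\<in>(UNIV::'d set). \<bar>ts $ i\<bar> * (1 + (\<Sum>j\<in>UNIV. \<bar>ts $ j\<bar>)))"
  proof (intro sum_mono)
    fix i
    have "\<bar>ts $ I x\<bar> \<le> (\<Sum>j\<in>UNIV. \<bar>ts $ j\<bar>)" by (rule member_le_sum) auto
    hence "\<bar>indicator {y. I y = i} x - ts $ I x\<bar> \<le> 1 + (\<Sum>j\<in>UNIV. \<bar>ts $ j\<bar>)"
      by (auto simp: indicator_def)
    thus "\<bar>WL_field I x ts $ i\<bar> \<le> \<bar>ts $ i\<bar> * (1 + (\<Sum>j\<in>UNIV. \<bar>ts $ j\<bar>))"
      by (simp add: WL_field_def abs_mult mult_left_mono)
  qed
  finally show "norm (WL_field I x ts) \<le> (\<Sum>i\<in>(UNIV::'d set). \<bar>ts $ i\<bar> * (1 + (\<Sum>j\<in>UNIV. \<bar>ts $ j\<bar>)))" .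
qed

lemma WL_field_measurable [measurable (raw)]:
  assumes [measurable]: "f \<in> borel_measurable N" "h \<in> measurable N borel"
  shows "(\<lambda>w. WL_field I (h w) (f w)) \<in> borel_measurable N"
proof -
  have "(\<lambda>w. WL_field I (h w) (f w)) = (\<lambda>w. \<Sum>i\<in>UNIV. (f w $ i * (indicator {y. I y = i} (h w) - f w $ (I (h w)))) *\<^sub>R axis i 1)"
    by (intro ext, subst basis_expansion[symmetric]) (simp add: WL_field_def scalar_mult_eq_scaleR)
  thus ?thesis by simp
qed

definition Hhat :: "'x \<Rightarrow> real ^ 'd" where "Hhat = H_hat lam p I q"

context
  assumes ts: "ts \<in> Theta"
begin

private abbreviation "G \<equiv> (\<lambda>y. WL_field I y ts - mean_field lam p I ts)"

lemma inner_mean_field: "t \<bullet> mean_field lam p I ts = mean (wfield t) ts"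
proof -
  obtain B where B: "\<And>x. norm (WL_field I x ts) \<le> B" using WL_field_bounded by blast
  have "integrable lam (\<lambda>x. pit ts x *\<^sub>R WL_field I x ts)"
  proof (rule Bochner_Integration.integrable_bound)
    show "integrable lam (\<lambda>x. pit ts x * B)" using integrable_pit[OF ts] by simp
    have "norm (pit ts x *\<^sub>R WL_field I x ts) \<le> norm (pit ts x * B)" for x
      using mult_left_mono[OF B[of x] pit_nonneg[OF ts, of x]] pit_nonneg[OF ts, of x] abs_ge_self[of "pit ts x * B"]
      by simp
    thus "AE x in lam. norm (pit ts x *\<^sub>R WL_field I x ts) \<le> norm (pit ts x * B)" by simp
  qed measurable
  from integral_inner_right[OF this, of t] show ?thesis by (simp add: mean_field_def mean_def)
qed

text \<open>Measurability and boundedness travel along because each further application of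
  \<open>inner_MH_op\<close> needs them.\<close>

lemma iterate_vector:
  "(MH_op lam p I q ts ^^ n) G \<in> borel_measurable borel \<and> (\<exists>B. \<forall>x. norm ((MH_op lam p I q ts ^^ n) G x) \<le> B) \<and>
   (\<forall>t x. t \<bullet> (MH_op lam p I q ts ^^ n) G x = (P ts ^^ n) (\<lambda>x. wfield t ts x - mean (wfield t) ts) x)"
proof (induction n)
  case 0
  obtain B where B: "\<And>x. norm (WL_field I x ts) \<le> B" using WL_field_bounded by blast
  have "norm (G x) \<le> B + norm (mean_field lam p I ts)" for x
    using norm_triangle_ineq4[of "WL_field I x ts" "mean_field lam p I ts"] B[of x] by linarith
  moreover have "G \<in> borel_measurable borel" by measurable
  ultimately show ?case by (auto simp: inner_diff_right inner_mean_field)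
next
  case (Suc n)
  define F where "F = (MH_op lam p I q ts ^^ n) G"
  from Suc obtain B where F: "F \<in> borel_measurable borel" "\<And>x. norm (F x) \<le> B"
    "\<And>t x. t \<bullet> F x = (P ts ^^ n) (\<lambda>x. wfield t ts x - mean (wfield t) ts) x" unfolding F_def by blast
  have "t \<bullet> MH_op lam p I q ts F x = P ts ((P ts ^^ n) (\<lambda>x. wfield t ts x - mean (wfield t) ts)) x" for t x
    using inner_MH_op[OF ts F(1,2), of t x] unfolding F(3) .
  moreover have "MH_op lam p I q ts F \<in> borel_measurable borel" by (rule MH_op_vector_measurable[OF ts F(1,2)])
  moreover have "\<forall>x. norm (MH_op lam p I q ts F x) \<le> CARD('d) * B" using MH_op_vector_bounded[OF ts F(1,2)] by blast
  ultimately show ?case unfolding F_def by auto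
qed

text \<open>Coordinatewise convergence suffices in finite dimension. It shows that the series in
  \<open>H_hat\<close> converges, so that its value there is a genuine sum and not a
  default.\<close>

lemma iterate_vector_sums: "(\<lambda>n. (MH_op lam p I q ts ^^ n) G x) sums (\<chi> i. poisson (wfield (axis i 1)) ts x)"
proof -
  have "(\<lambda>n. t \<bullet> (MH_op lam p I q ts ^^ n) G x) sums poisson (wfield t) ts x" for t
  proof -
    obtain K where K: "\<And>\<theta> x. \<theta> \<in> Theta \<Longrightarrow> \<bar>wfield t \<theta> x\<bar> \<le> K"
      by (rule regularE[OF regular_wfield]) (rule that)
    show ?thesis using iterate_vector summable_sums[OF summable_iterate[OF regular_wfield K[OF ts] ts]]
      by (simp add: poisson_def)
  qed
  from this[of "axis _ 1"] show ?thesis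
    unfolding sums_def by (intro vec_tendstoI) (simp add: inner_axis')
qed

lemma inner_Hhat: "t \<bullet> Hhat x = poisson (wfield t) ts x"
proof -
  have "Hhat x = (\<chi> i. poisson (wfield (axis i 1)) ts x)"
    unfolding Hhat_def H_hat_def Let_def using sums_unique[OF iterate_vector_sums] by simp
  hence "(\<lambda>n. (MH_op lam p I q ts ^^ n) G x) sums Hhat x" using iterate_vector_sums by simp
  from bounded_linear.sums[OF bounded_linear_inner_right this, of t]
  show ?thesis using iterate_vector unfolding poisson_def by (simp add: sums_iff)
qed

lemma Hhat_measurable [measurable]: "Hhat \<in> borel_measurable borel"
  unfolding borel_measurable_euclidean_space[of Hhat] inner_commute[of "Hhat _"] inner_Hhat
  using regular_measurable_x[OF regular_poisson[OF regular_wfield]] by blast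

lemma Hhat_bounded: "\<exists>B. \<forall>x. norm (Hhat x) \<le> B"
proof -
  have "\<exists>K. \<forall>x. \<bar>Hhat x $ i\<bar> \<le> K" for i
  proof -
    obtain K where K: "\<And>\<theta> x. \<theta> \<in> Theta \<Longrightarrow> \<bar>poisson (wfield (axis i 1)) \<theta> x\<bar> \<le> K"
      by (rule regularE[OF regular_poisson[OF regular_wfield]]) (rule that)
    show ?thesis using K[OF ts] inner_Hhat[of "axis i 1"] by (auto simp: inner_axis')
  qed
  then obtain K where K: "\<And>i x. \<bar>Hhat x $ i\<bar> \<le> K i" by metis
  have "norm (Hhat x) \<le> (\<Sum>i\<in>UNIV. K i)" for x
    by (rule order_trans[OF norm_le_l1_cart sum_mono]) (rule K)
  thus ?thesis by blast
qed

lemma outer_measurable [measurable (raw)]: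
  fixes f h :: "'n \<Rightarrow> real ^ 'd"
  assumes "f \<in> borel_measurable N" "h \<in> borel_measurable N"
  shows "(\<lambda>w. outer (f w) (h w)) \<in> borel_measurable N"
proof (rule borel_measurable_continuous_Pair[OF assms])
  show "continuous_on UNIV (\<lambda>x. outer (fst x) (snd x :: real ^ 'd) :: real ^ 'd ^ 'd)"
    unfolding outer_def by (intro continuous_intros)
qed

lemma norm_outer_le: "norm (outer u v :: real ^ 'd ^ 'd) \<le> CARD('d) * (CARD('d) * (norm u * norm v))"
proof -
  have "norm (outer u v) \<le> (\<Sum>i\<in>UNIV. norm (outer u v $ i))"
    by (simp add: norm_vec_def L2_set_le_sum)
  also have "\<dots> \<le> (\<Sum>i\<in>(UNIV::'d set). CARD('d) * (norm u * norm v))"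
  proof (intro sum_mono)
    fix i :: 'd
    have "norm (outer u v $ i) \<le> (\<Sum>j\<in>UNIV. \<bar>outer u v $ i $ j\<bar>)" by (rule norm_le_l1_cart)
    also have "\<dots> \<le> (\<Sum>j\<in>(UNIV::'d set). norm u * norm v)"
      by (intro sum_mono) (auto simp: outer_def abs_mult intro!: mult_mono component_le_norm_cart)
    finally show "norm (outer u v $ i) \<le> CARD('d) * (norm u * norm v)" by simp
  qed
  finally show ?thesis by simp
qed

lemma integrable_outer:
  assumes [measurable]: "u \<in> borel_measurable borel" and u: "\<And>x. norm (u x) \<le> B"
  shows "integrable lam (\<lambda>x. pit ts x *\<^sub>R (outer (u x) (u x) :: real ^ 'd ^ 'd))"
proof (rule Bochner_Integration.integrable_bound)
  define C where "C = real CARD('d) * (CARD('d) * (B * B))"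
  show "integrable lam (\<lambda>x. pit ts x * C)" using integrable_pit[OF ts] by simp
  have B: "0 \<le> B" using u[of undefined] norm_ge_zero order_trans by blast
  have "norm (outer (u x) (u x)) \<le> C" for x
    unfolding C_def
    by (rule order_trans[OF norm_outer_le]) (intro mult_left_mono mult_mono u B norm_ge_zero of_nat_0_le_iff)
  hence "norm (pit ts x *\<^sub>R outer (u x) (u x)) \<le> norm (pit ts x * C)" for x
    using pit_nonneg[OF ts, of x] by (simp add: abs_mult mult_left_mono order_trans[OF _ abs_ge_self])
  thus "AE x in lam. norm (pit ts x *\<^sub>R outer (u x) (u x)) \<le> norm (pit ts x * C)" by simp
qed measurable

lemma U_star_integrable:
  "integrable lam (\<lambda>x. pit ts x *\<^sub>R (outer (Hhat x) (Hhat x) - outer (MH_op lam p I q ts Hhat x) (MH_op lam p I q ts Hhat x)))"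
proof -
  obtain B where B: "\<And>x. norm (Hhat x) \<le> B" using Hhat_bounded by blast
  show ?thesis unfolding scaleR_diff_right
    by (intro Bochner_Integration.integrable_diff integrable_outer[OF Hhat_measurable B]
      integrable_outer[OF MH_op_vector_measurable[OF ts Hhat_measurable B] MH_op_vector_bounded[OF ts Hhat_measurable B]])
qed

text \<open>Bounded linear functionals pass through the Bochner integral; both the quadratic form
  and the entries of \<open>U_star\<close> are read off in this way.\<close>

lemma U_star_apply:
  assumes "bounded_linear L"
  shows "L (U_star lam p I q) = (\<integral>x. pit ts x *\<^sub>R (L (outer (Hhat x) (Hhat x)) -
    L (outer (MH_op lam p I q ts Hhat x) (MH_op lam p I q ts Hhat x))) \<partial>lam)"
proof -
  interpret bounded_linear L by fact
  show ?thesis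
    using integral_bounded_linear[OF assms U_star_integrable]
    by (simp add: U_star_def Let_def Hhat_def scaleR diff)
qed

lemma inner_outer: "t \<bullet> (outer u u *v t) = (t \<bullet> u)\<^sup>2"
proof -
  have "outer u u *v t = (u \<bullet> t) *\<^sub>R u"
    by (simp add: vec_eq_iff outer_def matrix_vector_mult_def inner_vec_def sum_distrib_left mult_ac)
  thus ?thesis by (simp add: inner_commute power2_eq_square)
qed

text \<open>The characteristic function sees the matrix only through these values, so the analysis
  can stay with one direction \<open>t\<close> at a time.\<close>

lemma U_star_quadratic: "t \<bullet> (U_star lam p I q *v t) = mean (var_fun t) ts"
proof -
  obtain B where B: "\<And>x. norm (Hhat x) \<le> B" using Hhat_bounded by blast
  have bl: "bounded_linear (\<lambda>A :: real ^ 'd ^ 'd. t \<bullet> (A *v t))"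
    by (intro linear_conv_bounded_linear[THEN iffD1] linearI)
      (simp_all add: matrix_vector_mult_add_rdistrib inner_add_right scaleR_matrix_vector_assoc[symmetric])
  have "t \<bullet> MH_op lam p I q ts Hhat x = corr t ts x" for x
    using inner_MH_op[OF ts Hhat_measurable B, of t x] unfolding inner_Hhat corr_def .
  thus ?thesis
    unfolding U_star_apply[OF bl] inner_outer mean_var_fun[OF ts] inner_Hhat by simp
qed

lemma U_star_sym: "U_star lam p I q $ i $ j = U_star lam p I q $ j $ i"
proof -
  have bl: "bounded_linear (\<lambda>A :: real ^ 'd ^ 'd. A $ i $ j)" for i j
    using bounded_linear_compose[OF bounded_linear_vec_nth bounded_linear_vec_nth] .
  show ?thesis unfolding U_star_apply[OF bl] by (simp add: outer_def mult.commute)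
qed

lemma U_star_psd: "0 \<le> t \<bullet> (U_star lam p I q *v t)"
  unfolding U_star_quadratic by (rule mean_nonneg[OF ts], rule var_fun_nonneg[OF ts])

end

section \<open>The Markov property\<close>

text \<open>The kernel acting on the second argument of \<open>F\<close>, for nonnegative functions; the state \<open>z\<close> is a pair of
  weights and position.\<close>

definition Pnn :: "((real ^ 'd) \<times> 'x \<Rightarrow> 'x \<Rightarrow> ennreal) \<Rightarrow> (real ^ 'd) \<times> 'x \<Rightarrow> ennreal" where
  "Pnn F z = (\<integral>\<^sup>+ y. ennreal (ker (fst z) (snd z) y) * F z y \<partial>lam) +
     ennreal (1 - (\<integral>y. ker (fst z) (snd z) y \<partial>lam)) * F z (snd z)"

lemma Pnn_measurable:
  assumes [measurable]: "case_prod F \<in> borel_measurable ((borel \<Otimes>\<^sub>M borel) \<Otimes>\<^sub>M borel)"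
  shows "Pnn F \<in> borel_measurable (borel \<Otimes>\<^sub>M borel)"
  unfolding Pnn_def[abs_def] by measurable

lemma Pnn_comp_measurable [measurable (raw)]:
  assumes "case_prod F \<in> borel_measurable ((borel \<Otimes>\<^sub>M borel) \<Otimes>\<^sub>M borel)"
    and [measurable]: "u \<in> borel_measurable N" "v \<in> measurable N borel"
  shows "(\<lambda>w. Pnn F (u w, v w)) \<in> borel_measurable N"
  by (rule measurable_compose[OF _ Pnn_measurable[OF assms(1)]]) measurable

lemma section_measurable:
  "case_prod F \<in> borel_measurable ((borel \<Otimes>\<^sub>M borel) \<Otimes>\<^sub>M borel) \<Longrightarrow>
    F (z :: (real ^ 'd) \<times> 'x) \<in> borel_measurable (borel :: 'x measure)"
  using measurable_Pair2[of "case_prod F" "borel \<Otimes>\<^sub>M borel" borel borel z] by (simp add: space_pair_measure)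

text \<open>The factor \<open>r\<close> is there to carry a weight determined by the present
  state.\<close>

lemma Pnn_eq_P:
  assumes th: "\<theta> \<in> Theta" and [measurable]: "f \<in> borel_measurable borel"
    and f: "\<And>y. 0 \<le> f y" "\<And>y. f y \<le> K" and r: "0 \<le> r"
  shows "Pnn (\<lambda>z y. ennreal (r * f y)) (\<theta>, x) = ennreal (r * P \<theta> f x)"
proof -
  have b: "\<bar>r * f y\<bar> \<le> r * K" for y using f r by (simp add: mult_left_mono)
  have "(\<integral>\<^sup>+ y. ennreal (ker \<theta> x y) * ennreal (r * f y) \<partial>lam) = (\<integral>\<^sup>+ y. ennreal (ker \<theta> x y * (r * f y)) \<partial>lam)"
    using ker_nonneg[OF th] by (simp add: ennreal_mult')
  also have "\<dots> = ennreal (\<integral>y. ker \<theta> x y * (r * f y) \<partial>lam)"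
    by (rule nn_integral_eq_integral[OF integrable_ker_mult[OF th _ b]])
      (use ker_nonneg[OF th] f r in auto)
  also have "(\<integral>y. ker \<theta> x y * (r * f y) \<partial>lam) = r * (\<integral>y. ker \<theta> x y * f y \<partial>lam)"
    by (subst integral_mult_right_zero[symmetric]) (simp only: mult_ac)
  finally have 1: "(\<integral>\<^sup>+ y. ennreal (ker \<theta> x y) * ennreal (r * f y) \<partial>lam) = ennreal (r * (\<integral>y. ker \<theta> x y * f y \<partial>lam))" .
  have 2: "ennreal (1 - (\<integral>y. ker \<theta> x y \<partial>lam)) * ennreal (r * f x) = ennreal (r * ((1 - (\<integral>y. ker \<theta> x y \<partial>lam)) * f x))"
    using integral_ker_le_1[OF th, of x] f r by (simp add: ennreal_mult'[symmetric] mult_ac)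
  have "0 \<le> r * (\<integral>y. ker \<theta> x y * f y \<partial>lam)" "0 \<le> r * ((1 - (\<integral>y. ker \<theta> x y \<partial>lam)) * f x)"
    using integral_ker_le_1[OF th, of x] f r ker_nonneg[OF th]
    by (auto intro!: mult_nonneg_nonneg Bochner_Integration.integral_nonneg)
  thus ?thesis unfolding Pnn_def P_eq fst_conv snd_conv 1 2 distrib_left by simp
qed

lemma Pnn_cmult:
  assumes [measurable]: "case_prod F \<in> borel_measurable ((borel \<Otimes>\<^sub>M borel) \<Otimes>\<^sub>M borel)"
  shows "Pnn (\<lambda>z y. r * F z y) z = r * Pnn F z"
proof -
  note [measurable] = section_measurable[OF assms, of z]
  have "(\<integral>\<^sup>+ y. ennreal (ker (fst z) (snd z) y) * (r * F z y) \<partial>lam) = (\<integral>\<^sup>+ y. r * (ennreal (ker (fst z) (snd z) y) * F z y) \<partial>lam)"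
    by (simp only: mult_ac)
  also have "\<dots> = r * (\<integral>\<^sup>+ y. ennreal (ker (fst z) (snd z) y) * F z y \<partial>lam)"
    by (rule nn_integral_cmult) measurable
  finally show ?thesis unfolding Pnn_def by (simp add: distrib_left mult.left_commute)
qed

lemma Pnn_add:
  assumes [measurable]: "case_prod F \<in> borel_measurable ((borel \<Otimes>\<^sub>M borel) \<Otimes>\<^sub>M borel)"
    "case_prod H \<in> borel_measurable ((borel \<Otimes>\<^sub>M borel) \<Otimes>\<^sub>M borel)"
  shows "Pnn (\<lambda>z y. F z y + H z y) z = Pnn F z + Pnn H z"
proof -
  note [measurable] = section_measurable[OF assms(1), of z] section_measurable[OF assms(2), of z]
  have "(\<integral>\<^sup>+ y. ennreal (ker (fst z) (snd z) y) * (F z y + H z y) \<partial>lam) =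
     (\<integral>\<^sup>+ y. ennreal (ker (fst z) (snd z) y) * F z y \<partial>lam) + (\<integral>\<^sup>+ y. ennreal (ker (fst z) (snd z) y) * H z y \<partial>lam)"
    unfolding distrib_left by (rule nn_integral_add) measurable
  thus ?thesis unfolding Pnn_def by (simp add: distrib_left add_ac)
qed

lemma Pnn_SUP:
  assumes [measurable]: "\<And>i::nat. case_prod (F i) \<in> borel_measurable ((borel \<Otimes>\<^sub>M borel) \<Otimes>\<^sub>M borel)"
    and inc: "\<And>z y. incseq (\<lambda>i. F i z y)"
  shows "Pnn (\<lambda>z y. SUP i. F i z y) z = (SUP i. Pnn (F i) z)"
proof -
  note [measurable] = section_measurable[OF assms(1)]
  have "(\<integral>\<^sup>+ y. ennreal (ker (fst z) (snd z) y) * (SUP i. F i z y) \<partial>lam) =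
     (\<integral>\<^sup>+ y. (SUP i. ennreal (ker (fst z) (snd z) y) * F i z y) \<partial>lam)"
    by (simp add: SUP_mult_left_ennreal)
  also have "\<dots> = (SUP i. \<integral>\<^sup>+ y. ennreal (ker (fst z) (snd z) y) * F i z y \<partial>lam)"
    by (rule nn_integral_monotone_convergence_SUP)
      (auto simp: incseq_def le_fun_def intro!: mult_left_mono incseqD[OF inc])
  finally have 1: "(\<integral>\<^sup>+ y. ennreal (ker (fst z) (snd z) y) * (SUP i. F i z y) \<partial>lam) =
    (SUP i. \<integral>\<^sup>+ y. ennreal (ker (fst z) (snd z) y) * F i z y \<partial>lam)" .
  have i1: "incseq (\<lambda>i. \<integral>\<^sup>+ y. ennreal (ker (fst z) (snd z) y) * F i z y \<partial>lam)"
    by (intro incseq_SucI nn_integral_mono mult_left_mono incseq_SucD[OF inc]) simp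
  have i2: "incseq (\<lambda>i. ennreal (1 - (\<integral>y. ker (fst z) (snd z) y \<partial>lam)) * F i z (snd z))"
    by (intro incseq_SucI mult_left_mono incseq_SucD[OF inc]) simp
  show ?thesis
    unfolding Pnn_def 1 unfolding SUP_mult_left_ennreal by (rule ennreal_SUP_add[OF i1 i2, symmetric])
qed

lemma Pnn_incseq: "(\<And>z y. incseq (\<lambda>i. F i z y)) \<Longrightarrow> incseq (\<lambda>i. Pnn (F i) z)"
  unfolding Pnn_def incseq_def by (intro allI impI add_mono nn_integral_mono mult_left_mono) auto

end

section \<open>Expectations along the process, with initial weights bounded below\<close>

text \<open>The transition law is stated for events of the current pair of weights and position,
  since the multipliers used below are functions of that pair. \<open>gamma_ratio\<close> is the
  common form of the two cases of (A4), and \<open>m0\<close> makes quantities that are singular at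
  the boundary bounded at each fixed time.\<close>

locale wl_process = wl_model lam p I q a b c + prob_space M
  for lam :: "'x::polish_space measure" and p and I :: "'x \<Rightarrow> 'd::finite" and q a b c
    and M :: "'a measure" +
  fixes gamma :: "nat \<Rightarrow> real" and X :: "nat \<Rightarrow> 'a \<Rightarrow> 'x" and th :: "nat \<Rightarrow> 'a \<Rightarrow> real ^ 'd"
    and m0 rho :: real
  assumes d2: "CARD('d) \<ge> 2"
    and gamma_pos: "\<And>n. n \<ge> 1 \<Longrightarrow> 0 < gamma n"
    and gamma_less_1: "\<And>n. n \<ge> 1 \<Longrightarrow> gamma n < 1"
    and gamma_mono: "\<And>n. n \<ge> 1 \<Longrightarrow> gamma (Suc n) \<le> gamma n"
    and gamma_lim: "gamma \<longlonglongrightarrow> 0"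
    and gamma_div: "\<not> summable (\<lambda>n. gamma (Suc n))"
    and gamma_ratio: "(\<lambda>n. (gamma n / gamma (Suc n) - 1) / gamma (Suc n)) \<longlonglongrightarrow> rho"
    and rho_less: "rho < 2 / CARD('d)"
    and X_meas [measurable]: "\<And>n. X n \<in> measurable M borel"
    and th_meas [measurable]: "\<And>n. th n \<in> borel_measurable M"
    and th_Theta: "\<And>n \<omega>. \<omega> \<in> space M \<Longrightarrow> th n \<omega> \<in> Theta"
    and m0_pos: "0 < m0"
    and th0_ge: "\<And>\<omega> i. \<omega> \<in> space M \<Longrightarrow> m0 \<le> th 0 \<omega> $ i"
    and trans: "\<And>n B A. B \<in> sets (borel \<Otimes>\<^sub>M borel) \<Longrightarrow> A \<in> sets borel \<Longrightarrow>
      measure M {\<omega>\<in>space M. (th n \<omega>, X n \<omega>) \<in> B \<and> X (Suc n) \<omega> \<in> A} =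
      (\<integral>\<omega>. indicator B (th n \<omega>, X n \<omega>) * MH_op lam p I q (th n \<omega>) (indicator A) (X n \<omega>) \<partial>M)"
    and th_rec: "\<And>n \<omega>. \<omega> \<in> space M \<Longrightarrow>
      th (Suc n) \<omega> = th n \<omega> + gamma (Suc n) *\<^sub>R WL_field I (X (Suc n) \<omega>) (th n \<omega>)"
begin

lemma ts_in: "ts \<in> Theta" by (rule ts_Theta[OF d2])

lemma markov_rectangle:
  assumes B: "B \<in> sets (borel \<Otimes>\<^sub>M borel)" and A: "A \<in> sets borel"
  shows "(\<integral>\<^sup>+ \<omega>. indicator (B \<times> A) ((th n \<omega>, X n \<omega>), X (Suc n) \<omega>) \<partial>M) =
    (\<integral>\<^sup>+ \<omega>. Pnn (\<lambda>z y. indicator (B \<times> A) (z, y)) (th n \<omega>, X n \<omega>) \<partial>M)"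
proof -
  note [measurable] = B A
  have Pm: "(\<lambda>\<omega>. P (th n \<omega>) (indicator A) (X n \<omega>)) \<in> borel_measurable M"
    by (rule P_measurable[where g="\<lambda>_. indicator A"]) measurable
  have bnd: "0 \<le> P \<theta> (indicator A) x" "\<bar>P \<theta> (indicator A) x\<bar> \<le> 1" if "\<theta> \<in> Theta" for \<theta> x
    using P_nonneg[OF that, of "indicator A"] abs_P_le[OF that, of "indicator A" 1] by (auto simp: indicator_def)
  have "(\<integral>\<^sup>+ \<omega>. indicator (B \<times> A) ((th n \<omega>, X n \<omega>), X (Suc n) \<omega>) \<partial>M) =
     (\<integral>\<^sup>+ \<omega>. indicator {\<omega>\<in>space M. (th n \<omega>, X n \<omega>) \<in> B \<and> X (Suc n) \<omega> \<in> A} \<omega> \<partial>M)"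
    by (intro nn_integral_cong) (simp add: indicator_def)
  also have "\<dots> = ennreal (measure M {\<omega>\<in>space M. (th n \<omega>, X n \<omega>) \<in> B \<and> X (Suc n) \<omega> \<in> A})"
    by (subst nn_integral_indicator) (auto simp: emeasure_eq_measure)
  also have "\<dots> = ennreal (\<integral>\<omega>. indicator B (th n \<omega>, X n \<omega>) * P (th n \<omega>) (indicator A) (X n \<omega>) \<partial>M)"
    by (simp add: trans[OF B A])
  also have "\<dots> = (\<integral>\<^sup>+ \<omega>. ennreal (indicator B (th n \<omega>, X n \<omega>) * P (th n \<omega>) (indicator A) (X n \<omega>)) \<partial>M)"
  proof (rule nn_integral_eq_integral[symmetric])
    show "integrable M (\<lambda>\<omega>. indicator B (th n \<omega>, X n \<omega>) * P (th n \<omega>) (indicator A) (X n \<omega>))"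
      using bnd th_Theta Pm
      by (intro integrable_const_bound[where B=1] AE_I2) (auto simp: indicator_def intro!: borel_measurable_times)
    show "AE \<omega> in M. 0 \<le> indicator B (th n \<omega>, X n \<omega>) * P (th n \<omega>) (indicator A) (X n \<omega>)"
      using bnd th_Theta by (intro AE_I2) auto
  qed
  also have "\<dots> = (\<integral>\<^sup>+ \<omega>. Pnn (\<lambda>z y. indicator (B \<times> A) (z, y)) (th n \<omega>, X n \<omega>) \<partial>M)"
  proof (rule nn_integral_cong)
    fix \<omega> assume w: "\<omega> \<in> space M"
    have "Pnn (\<lambda>z y. indicator (B \<times> A) (z, y)) (th n \<omega>, X n \<omega>) =
        Pnn (\<lambda>z y. ennreal (indicator B (th n \<omega>, X n \<omega>) * indicator A y)) (th n \<omega>, X n \<omega>)"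
      unfolding Pnn_def by (auto simp: indicator_def intro!: arg_cong2[where f="(+)"] nn_integral_cong)
    also have "\<dots> = ennreal (indicator B (th n \<omega>, X n \<omega>) * P (th n \<omega>) (indicator A) (X n \<omega>))"
      by (rule Pnn_eq_P[OF th_Theta[OF w], where K=1]) (auto simp: indicator_def)
    finally show "ennreal (indicator B (th n \<omega>, X n \<omega>) * P (th n \<omega>) (indicator A) (X n \<omega>)) =
       Pnn (\<lambda>z y. indicator (B \<times> A) (z, y)) (th n \<omega>, X n \<omega>)" by simp
  qed
  finally show ?thesis .
qed

lemma Pnn_one: "\<omega> \<in> space M \<Longrightarrow> Pnn (\<lambda>z y. 1) (th n \<omega>, X n \<omega>) = 1"
  using Pnn_eq_P[OF th_Theta, of \<omega> "\<lambda>_. 1" 1 1 n "X n \<omega>"] by (simp add: P_const)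

text \<open>Extension from rectangles by the pi-lambda theorem: complements by subtraction from the
  total mass one, disjoint unions by countable additivity of both sides.\<close>

lemma markov_set:
  assumes C: "C \<in> sets ((borel \<Otimes>\<^sub>M borel) \<Otimes>\<^sub>M borel)"
  shows "(\<integral>\<^sup>+ \<omega>. indicator C ((th n \<omega>, X n \<omega>), X (Suc n) \<omega>) \<partial>M) =
    (\<integral>\<^sup>+ \<omega>. Pnn (\<lambda>z y. indicator C (z, y)) (th n \<omega>, X n \<omega>) \<partial>M)"
proof -
  let ?G = "{B \<times> A |B A. B \<in> sets (borel \<Otimes>\<^sub>M borel :: ((real ^ 'd) \<times> 'x) measure) \<and> A \<in> sets (borel :: 'x measure)}"
  let ?S = "space (borel \<Otimes>\<^sub>M borel :: ((real ^ 'd) \<times> 'x) measure) \<times> space (borel :: 'x measure)"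
  have gen: "sets ((borel \<Otimes>\<^sub>M borel) \<Otimes>\<^sub>M borel) = sigma_sets ?S ?G" by (rule sets_pair_measure)
  from C have "C \<in> sigma_sets ?S ?G" unfolding gen .
  with Int_stable_pair_measure_generator pair_measure_closed show ?thesis
  proof (induction rule: sigma_sets_induct_disjoint)
    case (basic A)
    thus ?case using markov_rectangle by blast
  next
    case empty
    show ?case by (simp add: Pnn_def)
  next
    case (compl A)
    have A [measurable]: "A \<in> sets ((borel \<Otimes>\<^sub>M borel) \<Otimes>\<^sub>M borel)" using compl unfolding gen by simp
    have A' [measurable]: "?S - A \<in> sets ((borel \<Otimes>\<^sub>M borel) \<Otimes>\<^sub>M borel)"
      using sets.compl_sets[OF A] by (simp add: space_pair_measure)
    have 1: "indicator A (z, y) + indicator (?S - A) (z, y) = (1 :: ennreal)" for z y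
      by (auto simp: indicator_def space_pair_measure)
    have L: "(\<integral>\<^sup>+ \<omega>. indicator A ((th n \<omega>, X n \<omega>), X (Suc n) \<omega>) \<partial>M) +
        (\<integral>\<^sup>+ \<omega>. indicator (?S - A) ((th n \<omega>, X n \<omega>), X (Suc n) \<omega>) \<partial>M) = 1"
    proof -
      have "(\<integral>\<^sup>+ \<omega>. indicator A ((th n \<omega>, X n \<omega>), X (Suc n) \<omega>) \<partial>M) +
          (\<integral>\<^sup>+ \<omega>. indicator (?S - A) ((th n \<omega>, X n \<omega>), X (Suc n) \<omega>) \<partial>M) = (\<integral>\<^sup>+ \<omega>. 1 \<partial>M)"
        by (subst nn_integral_add[symmetric], measurable) (simp only: 1)
      thus ?thesis by (simp add: emeasure_space_1)
    qed
    have R: "(\<integral>\<^sup>+ \<omega>. Pnn (\<lambda>z y. indicator A (z, y)) (th n \<omega>, X n \<omega>) \<partial>M) +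
        (\<integral>\<^sup>+ \<omega>. Pnn (\<lambda>z y. indicator (?S - A) (z, y)) (th n \<omega>, X n \<omega>) \<partial>M) = 1"
    proof -
      have "(\<integral>\<^sup>+ \<omega>. Pnn (\<lambda>z y. indicator A (z, y)) (th n \<omega>, X n \<omega>) \<partial>M) +
        (\<integral>\<^sup>+ \<omega>. Pnn (\<lambda>z y. indicator (?S - A) (z, y)) (th n \<omega>, X n \<omega>) \<partial>M) =
        (\<integral>\<^sup>+ \<omega>. Pnn (\<lambda>z y. indicator A (z, y)) (th n \<omega>, X n \<omega>) +
          Pnn (\<lambda>z y. indicator (?S - A) (z, y)) (th n \<omega>, X n \<omega>) \<partial>M)"
        by (subst nn_integral_add) measurable
      also have "\<dots> = (\<integral>\<^sup>+ \<omega>. Pnn (\<lambda>z y. 1) (th n \<omega>, X n \<omega>) \<partial>M)"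
        by (intro nn_integral_cong, subst Pnn_add[symmetric], measurable) (simp only: 1)
      also have "\<dots> = (\<integral>\<^sup>+ \<omega>. 1 \<partial>M)" by (intro nn_integral_cong) (simp add: Pnn_one)
      finally show ?thesis by (simp add: emeasure_space_1)
    qed
    \<comment> \<open>Cancellation in \<open>ennreal\<close> needs a finite summand.\<close>
    have fin: "(\<integral>\<^sup>+ \<omega>. Pnn (\<lambda>z y. indicator A (z, y)) (th n \<omega>, X n \<omega>) \<partial>M) \<noteq> \<top>"
      using R by (metis ennreal_add_eq_top ennreal_one_neq_top)
    from L R have "(\<integral>\<^sup>+ \<omega>. Pnn (\<lambda>z y. indicator A (z, y)) (th n \<omega>, X n \<omega>) \<partial>M) +
        (\<integral>\<^sup>+ \<omega>. indicator (?S - A) ((th n \<omega>, X n \<omega>), X (Suc n) \<omega>) \<partial>M) =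
      (\<integral>\<^sup>+ \<omega>. Pnn (\<lambda>z y. indicator A (z, y)) (th n \<omega>, X n \<omega>) \<partial>M) +
        (\<integral>\<^sup>+ \<omega>. Pnn (\<lambda>z y. indicator (?S - A) (z, y)) (th n \<omega>, X n \<omega>) \<partial>M)"
      unfolding compl.IH by (simp only:)
    with fin show ?case unfolding ennreal_add_left_cancel infinity_ennreal_def by blast
  next
    case (union A)
    have [measurable]: "A i \<in> sets ((borel \<Otimes>\<^sub>M borel) \<Otimes>\<^sub>M borel)" for i using union unfolding gen by auto
    have s: "indicator (\<Union>i. A i) z = (\<Sum>i. indicator (A i) z :: ennreal)" for z
      using suminf_indicator[OF union(1)] by simp
    have P: "Pnn (\<lambda>z y. indicator (\<Union>i. A i) (z, y)) z = (\<Sum>i. Pnn (\<lambda>z y. indicator (A i) (z, y)) z)" for z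
    proof -
      have "(\<integral>\<^sup>+ y. ennreal (ker (fst z) (snd z) y) * (\<Sum>i. indicator (A i) (z, y)) \<partial>lam) =
        (\<integral>\<^sup>+ y. (\<Sum>i. ennreal (ker (fst z) (snd z) y) * indicator (A i) (z, y)) \<partial>lam)"
        by (simp only: ennreal_suminf_cmult)
      also have "\<dots> = (\<Sum>i. \<integral>\<^sup>+ y. ennreal (ker (fst z) (snd z) y) * indicator (A i) (z, y) \<partial>lam)"
        by (rule nn_integral_suminf) (use section_measurable[of "\<lambda>z y. indicator (A _) (z, y)" z] in measurable)
      finally show ?thesis
        unfolding Pnn_def s by (simp only: ennreal_suminf_cmult[symmetric] suminf_add[OF summableI summableI])
    qed
    have "(\<integral>\<^sup>+ \<omega>. (\<Sum>i. indicator (A i) ((th n \<omega>, X n \<omega>), X (Suc n) \<omega>)) \<partial>M) =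
        (\<Sum>i. \<integral>\<^sup>+ \<omega>. indicator (A i) ((th n \<omega>, X n \<omega>), X (Suc n) \<omega>) \<partial>M)"
      by (rule nn_integral_suminf) measurable
    moreover have "(\<integral>\<^sup>+ \<omega>. (\<Sum>i. Pnn (\<lambda>z y. indicator (A i) (z, y)) (th n \<omega>, X n \<omega>)) \<partial>M) =
        (\<Sum>i. \<integral>\<^sup>+ \<omega>. Pnn (\<lambda>z y. indicator (A i) (z, y)) (th n \<omega>, X n \<omega>) \<partial>M)"
      by (rule nn_integral_suminf) measurable
    ultimately show ?case unfolding P unfolding s by (simp only: union.IH)
  qed
qed

text \<open>Both sides respect multiples, sums and increasing limits, so the statement for sets
  extends to all nonnegative measurable \<open>F\<close>.\<close>

lemma markov_nn:
  assumes "F \<in> borel_measurable ((borel \<Otimes>\<^sub>M borel) \<Otimes>\<^sub>M borel)"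
  shows "(\<integral>\<^sup>+ \<omega>. F ((th n \<omega>, X n \<omega>), X (Suc n) \<omega>) \<partial>M) =
    (\<integral>\<^sup>+ \<omega>. Pnn (\<lambda>z y. F (z, y)) (th n \<omega>, X n \<omega>) \<partial>M)"
  using assms
proof (induction F rule: borel_measurable_induct)
  case (cong f g)
  have "f z = g z" for z using cong(3)[of z] by (simp add: space_pair_measure)
  thus ?case using cong by simp
next
  case (set A)
  thus ?case by (rule markov_set)
next
  case (mult u c)
  have [measurable]: "u \<in> borel_measurable ((borel \<Otimes>\<^sub>M borel) \<Otimes>\<^sub>M borel)" by fact
  have e: "Pnn (\<lambda>z y. c * u (z, y)) z = c * Pnn (\<lambda>z y. u (z, y)) z" for z
    by (rule Pnn_cmult) simp
  show ?case unfolding e using mult by (subst (1 2) nn_integral_cmult) auto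
next
  case (add u v)
  have [measurable]: "u \<in> borel_measurable ((borel \<Otimes>\<^sub>M borel) \<Otimes>\<^sub>M borel)"
    "v \<in> borel_measurable ((borel \<Otimes>\<^sub>M borel) \<Otimes>\<^sub>M borel)" by fact+
  have e: "Pnn (\<lambda>z y. u (z, y) + v (z, y)) z = Pnn (\<lambda>z y. u (z, y)) z + Pnn (\<lambda>z y. v (z, y)) z" for z
    by (rule Pnn_add) simp_all
  have e': "Pnn (\<lambda>z y. v (z, y) + u (z, y)) z = Pnn (\<lambda>z y. v (z, y)) z + Pnn (\<lambda>z y. u (z, y)) z" for z
    by (rule Pnn_add) simp_all
  show ?case unfolding e e' by (subst (1 2) nn_integral_add) (auto simp: add.IH)
next
  case (seq U)
  have [measurable]: "U i \<in> borel_measurable ((borel \<Otimes>\<^sub>M borel) \<Otimes>\<^sub>M borel)" for i by fact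
  have inc: "incseq (\<lambda>i. U i z)" for z by (intro incseq_SucI le_funD[OF incseq_SucD[OF seq.hyps(3)]])
  have e: "Pnn (\<lambda>z y. SUP i. U i (z, y)) z = (SUP i. Pnn (\<lambda>z y. U i (z, y)) z)" for z
    by (rule Pnn_SUP) (simp_all add: inc)
  have inc': "incseq (\<lambda>i. Pnn (\<lambda>z y. U i (z, y)) z)" for z by (rule Pnn_incseq) (rule inc)
  have "(\<integral>\<^sup>+ \<omega>. (SUP i. U i ((th n \<omega>, X n \<omega>), X (Suc n) \<omega>)) \<partial>M) =
      (SUP i. \<integral>\<^sup>+ \<omega>. U i ((th n \<omega>, X n \<omega>), X (Suc n) \<omega>) \<partial>M)"
    by (rule nn_integral_monotone_convergence_SUP)
      (intro incseq_SucI le_funI incseq_SucD[OF inc], measurable)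
  moreover have "(\<integral>\<^sup>+ \<omega>. (SUP i. Pnn (\<lambda>z y. U i (z, y)) (th n \<omega>, X n \<omega>)) \<partial>M) =
      (SUP i. \<integral>\<^sup>+ \<omega>. Pnn (\<lambda>z y. U i (z, y)) (th n \<omega>, X n \<omega>) \<partial>M)"
    by (rule nn_integral_monotone_convergence_SUP)
      (intro incseq_SucI le_funI incseq_SucD[OF inc'], measurable)
  ultimately show ?case unfolding SUP_apply e by (simp only: seq.IH)
qed

lemma markov_nonneg:
  assumes A: "(\<lambda>(\<theta>, x). A \<theta> x) \<in> borel_measurable (borel \<Otimes>\<^sub>M borel)"
    and f: "(\<lambda>(\<theta>, x). f \<theta> x) \<in> borel_measurable (borel \<Otimes>\<^sub>M borel)"
    and A0: "\<And>\<omega>. \<omega> \<in> space M \<Longrightarrow> 0 \<le> A (th n \<omega>) (X n \<omega>) \<and> A (th n \<omega>) (X n \<omega>) \<le> L"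
    and f0: "\<And>\<theta> x. \<theta> \<in> Theta \<Longrightarrow> 0 \<le> f \<theta> x \<and> f \<theta> x \<le> K"
  shows "expectation (\<lambda>\<omega>. A (th n \<omega>) (X n \<omega>) * f (th n \<omega>) (X (Suc n) \<omega>)) =
    expectation (\<lambda>\<omega>. A (th n \<omega>) (X n \<omega>) * P (th n \<omega>) (f (th n \<omega>)) (X n \<omega>))"
proof -
  have [measurable]: "(\<lambda>w. A (u w) (v w)) \<in> borel_measurable N" "(\<lambda>w. f (u w) (v w)) \<in> borel_measurable N"
    if [measurable]: "u \<in> borel_measurable N" "v \<in> measurable N borel" for u v and N :: "'n measure"
  proof -
    have m: "(\<lambda>w. (u w, v w)) \<in> measurable N (borel \<Otimes>\<^sub>M borel)" by measurable
    show "(\<lambda>w. A (u w) (v w)) \<in> borel_measurable N" using measurable_compose[OF m A] by simp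
    show "(\<lambda>w. f (u w) (v w)) \<in> borel_measurable N" using measurable_compose[OF m f] by simp
  qed
  have fm: "f \<theta> \<in> borel_measurable borel" for \<theta>
  proof -
    have m: "(\<lambda>x. (\<theta>, x)) \<in> measurable borel (borel \<Otimes>\<^sub>M borel)" by measurable
    show ?thesis using measurable_compose[OF m f] by simp
  qed
  have Am: "(\<lambda>\<omega>. A (th n \<omega>) (X n \<omega>)) \<in> borel_measurable M"
  proof -
    have m: "(\<lambda>\<omega>. (th n \<omega>, X n \<omega>)) \<in> measurable M (borel \<Otimes>\<^sub>M borel)" by measurable
    show ?thesis using measurable_compose[OF m A] by simp
  qed
  have fXm: "(\<lambda>\<omega>. f (th n \<omega>) (X (Suc n) \<omega>)) \<in> borel_measurable M"
  proof -
    have m: "(\<lambda>\<omega>. (th n \<omega>, X (Suc n) \<omega>)) \<in> measurable M (borel \<Otimes>\<^sub>M borel)" by measurable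
    show ?thesis using measurable_compose[OF m f] by simp
  qed
  have Pm: "(\<lambda>\<omega>. P (th n \<omega>) (f (th n \<omega>)) (X n \<omega>)) \<in> borel_measurable M"
    by (rule P_measurable[OF f]) measurable
  have Fm: "(\<lambda>(z, y). ennreal (A (fst z) (snd z) * f (fst z) y)) \<in> borel_measurable ((borel \<Otimes>\<^sub>M borel) \<Otimes>\<^sub>M borel)"
  proof -
    have "(\<lambda>w. A (fst (fst w)) (snd (fst w))) \<in> borel_measurable ((borel \<Otimes>\<^sub>M borel) \<Otimes>\<^sub>M borel)"
      using measurable_compose[OF measurable_fst A] by (simp add: split_beta)
    moreover have "(\<lambda>w. f (fst (fst w)) (snd w)) \<in> borel_measurable ((borel \<Otimes>\<^sub>M borel) \<Otimes>\<^sub>M borel)"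
    proof -
      have m: "(\<lambda>w. (fst (fst w), snd w)) \<in> measurable ((borel \<Otimes>\<^sub>M borel) \<Otimes>\<^sub>M borel) (borel \<Otimes>\<^sub>M borel)" by measurable
      show ?thesis using measurable_compose[OF m f] by simp
    qed
    ultimately show ?thesis by (simp add: split_beta)
  qed
  have P0: "0 \<le> P \<theta> (f \<theta>) x" if "\<theta> \<in> Theta" for \<theta> x using P_nonneg[OF that] f0[OF that] by simp
  have "(\<integral>\<^sup>+ \<omega>. ennreal (A (th n \<omega>) (X n \<omega>) * f (th n \<omega>) (X (Suc n) \<omega>)) \<partial>M) =
    (\<integral>\<^sup>+ \<omega>. Pnn (\<lambda>z y. ennreal (A (fst z) (snd z) * f (fst z) y)) (th n \<omega>, X n \<omega>) \<partial>M)"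
    using markov_nn[OF Fm, of n] by simp
  also have "\<dots> = (\<integral>\<^sup>+ \<omega>. ennreal (A (th n \<omega>) (X n \<omega>) * P (th n \<omega>) (f (th n \<omega>)) (X n \<omega>)) \<partial>M)"
  proof (rule nn_integral_cong)
    fix \<omega> assume w: "\<omega> \<in> space M"
    have "Pnn (\<lambda>z y. ennreal (A (fst z) (snd z) * f (fst z) y)) (th n \<omega>, X n \<omega>) =
      Pnn (\<lambda>z y. ennreal (A (th n \<omega>) (X n \<omega>) * f (th n \<omega>) y)) (th n \<omega>, X n \<omega>)" by (simp add: Pnn_def)
    also have "\<dots> = ennreal (A (th n \<omega>) (X n \<omega>) * P (th n \<omega>) (f (th n \<omega>)) (X n \<omega>))"
      by (rule Pnn_eq_P[OF th_Theta[OF w] fm, where K=K]) (use f0[OF th_Theta[OF w]] A0[OF w] in auto)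
    finally show "Pnn (\<lambda>z y. ennreal (A (fst z) (snd z) * f (fst z) y)) (th n \<omega>, X n \<omega>) =
      ennreal (A (th n \<omega>) (X n \<omega>) * P (th n \<omega>) (f (th n \<omega>)) (X n \<omega>))" .
  qed
  finally have eq: "(\<integral>\<^sup>+ \<omega>. ennreal (A (th n \<omega>) (X n \<omega>) * f (th n \<omega>) (X (Suc n) \<omega>)) \<partial>M) =
    (\<integral>\<^sup>+ \<omega>. ennreal (A (th n \<omega>) (X n \<omega>) * P (th n \<omega>) (f (th n \<omega>)) (X n \<omega>)) \<partial>M)" .
  have "expectation (\<lambda>\<omega>. A (th n \<omega>) (X n \<omega>) * f (th n \<omega>) (X (Suc n) \<omega>)) =
     enn2real (\<integral>\<^sup>+ \<omega>. ennreal (A (th n \<omega>) (X n \<omega>) * f (th n \<omega>) (X (Suc n) \<omega>)) \<partial>M)"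
    using A0 f0 th_Theta Am fXm by (intro integral_eq_nn_integral AE_I2) auto
  also have "\<dots> = expectation (\<lambda>\<omega>. A (th n \<omega>) (X n \<omega>) * P (th n \<omega>) (f (th n \<omega>)) (X n \<omega>))"
    unfolding eq using A0 P0 th_Theta Am Pm by (intro integral_eq_nn_integral[symmetric] AE_I2) auto
  finally show ?thesis .
qed

text \<open>Shifting \<open>A\<close> by \<open>L\<close> and \<open>f\<close> by \<open>K\<close>
  makes both nonnegative. Of the terms of the expanded product, those in \<open>A\<close> alone
  agree trivially and those in \<open>f\<close> alone by the case \<open>A = 1\<close>.\<close>

lemma markov:
  assumes A: "(\<lambda>(\<theta>, x). A \<theta> x) \<in> borel_measurable (borel \<Otimes>\<^sub>M borel)"
    and A_le: "\<And>\<omega>. \<omega> \<in> space M \<Longrightarrow> \<bar>A (th n \<omega>) (X n \<omega>)\<bar> \<le> L"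
    and f: "regular f"
  shows "expectation (\<lambda>\<omega>. A (th n \<omega>) (X n \<omega>) * f (th n \<omega>) (X (Suc n) \<omega>)) =
    expectation (\<lambda>\<omega>. A (th n \<omega>) (X n \<omega>) * P (th n \<omega>) (f (th n \<omega>)) (X n \<omega>))"
proof -
  obtain K where K: "\<And>\<theta> x. \<theta> \<in> Theta \<Longrightarrow> \<bar>f \<theta> x\<bar> \<le> K" by (rule regularE[OF f]) (rule that)
  have L: "0 \<le> L" using not_empty A_le by (meson abs_ge_zero ex_in_conv order_trans)
  have [measurable]: "(\<lambda>\<omega>. f (th n \<omega>) (X m \<omega>)) \<in> borel_measurable M" for m
    by (rule regular_measurable[OF f]) measurable
  have [measurable]: "(\<lambda>\<omega>. A (th n \<omega>) (X n \<omega>)) \<in> borel_measurable M"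
    using measurable_compose[OF measurable_Pair[OF th_meas X_meas] A] by simp
  have [measurable]: "(\<lambda>\<omega>. P (th n \<omega>) (f (th n \<omega>)) (X n \<omega>)) \<in> borel_measurable M"
    by (rule P_measurable[OF regular_measurable_pair[OF f]]) measurable
  have PK: "\<bar>P \<theta> (f \<theta>) x\<bar> \<le> K" if "\<theta> \<in> Theta" for \<theta> x
    by (rule abs_P_le[OF that regular_measurable_x[OF f] K[OF that]])
  have fm: "(\<lambda>(\<theta>, x). f \<theta> x + K) \<in> borel_measurable (borel \<Otimes>\<^sub>M borel)"
    using regular_measurable_pair[OF f] by (simp add: split_beta)
  have PfK: "P \<theta> (\<lambda>x. f \<theta> x + K) x = P \<theta> (f \<theta>) x + K" if "\<theta> \<in> Theta" for \<theta> x
  proof -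
    have "P \<theta> (\<lambda>x. f \<theta> x + K) x = P \<theta> (f \<theta>) x + P \<theta> (\<lambda>_. K) x"
      by (rule P_add[OF that regular_measurable_x[OF f] _ K[OF that], where L="\<bar>K\<bar>"]) auto
    thus ?thesis by (simp add: P_const)
  qed
  have f0: "0 \<le> f \<theta> x + K \<and> f \<theta> x + K \<le> 2 * K" if "\<theta> \<in> Theta" for \<theta> x using K[OF that, of x] by linarith
  have Kpos: "0 \<le> K" using K[OF ts_in] abs_ge_zero order_trans by blast
  note ib = integrable_const_bound
  have i: "integrable M (\<lambda>\<omega>. f (th n \<omega>) (X m \<omega>))" for m
    by (rule ib[where B=K]) (auto intro!: AE_I2 K th_Theta)
  have iP: "integrable M (\<lambda>\<omega>. P (th n \<omega>) (f (th n \<omega>)) (X n \<omega>))"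
    by (rule ib[where B=K]) (auto intro!: AE_I2 PK th_Theta)
  have iA: "integrable M (\<lambda>\<omega>. A (th n \<omega>) (X n \<omega>))"
    by (rule ib[where B=L]) (auto intro!: AE_I2 A_le)
  have iAf: "integrable M (\<lambda>\<omega>. A (th n \<omega>) (X n \<omega>) * f (th n \<omega>) (X m \<omega>))" for m
    by (rule ib[where B="L * K"]) (auto intro!: AE_I2 mult_mono K A_le th_Theta L simp: abs_mult)
  have iAP: "integrable M (\<lambda>\<omega>. A (th n \<omega>) (X n \<omega>) * P (th n \<omega>) (f (th n \<omega>)) (X n \<omega>))"
    by (rule ib[where B="L * K"]) (auto intro!: AE_I2 mult_mono PK A_le th_Theta L simp: abs_mult)
  have 1: "expectation (\<lambda>\<omega>. 1 * (f (th n \<omega>) (X (Suc n) \<omega>) + K)) =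
     expectation (\<lambda>\<omega>. 1 * P (th n \<omega>) (\<lambda>x. f (th n \<omega>) x + K) (X n \<omega>))"
    by (rule markov_nonneg[where A="\<lambda>_ _. 1" and L=1 and K="2 * K", OF _ fm]) (use f0 in auto)
  have "expectation (\<lambda>\<omega>. 1 * P (th n \<omega>) (\<lambda>x. f (th n \<omega>) x + K) (X n \<omega>)) =
      expectation (\<lambda>\<omega>. P (th n \<omega>) (f (th n \<omega>)) (X n \<omega>) + K)"
    by (intro Bochner_Integration.integral_cong refl) (simp add: PfK[OF th_Theta])
  with 1 have e1: "expectation (\<lambda>\<omega>. f (th n \<omega>) (X (Suc n) \<omega>)) = expectation (\<lambda>\<omega>. P (th n \<omega>) (f (th n \<omega>)) (X n \<omega>))"
    using i iP by (simp add: prob_space)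
  have Am: "(\<lambda>(\<theta>, x). A \<theta> x + L) \<in> borel_measurable (borel \<Otimes>\<^sub>M borel)"
    using A by (simp add: split_beta)
  have 2: "expectation (\<lambda>\<omega>. (A (th n \<omega>) (X n \<omega>) + L) * (f (th n \<omega>) (X (Suc n) \<omega>) + K)) =
     expectation (\<lambda>\<omega>. (A (th n \<omega>) (X n \<omega>) + L) * P (th n \<omega>) (\<lambda>x. f (th n \<omega>) x + K) (X n \<omega>))"
    by (rule markov_nonneg[OF Am fm, where L="2 * L" and K="2 * K"])
      (use A_le f0 in \<open>force simp: abs_le_iff\<close>)+
  have 3: "expectation (\<lambda>\<omega>. (A (th n \<omega>) (X n \<omega>) + L) * P (th n \<omega>) (\<lambda>x. f (th n \<omega>) x + K) (X n \<omega>)) =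
    expectation (\<lambda>\<omega>. (A (th n \<omega>) (X n \<omega>) + L) * (P (th n \<omega>) (f (th n \<omega>)) (X n \<omega>) + K))"
    by (intro Bochner_Integration.integral_cong refl) (simp add: PfK[OF th_Theta])
  have 4: "expectation (\<lambda>\<omega>. (A (th n \<omega>) (X n \<omega>) + L) * (f (th n \<omega>) (X (Suc n) \<omega>) + K)) =
    expectation (\<lambda>\<omega>. A (th n \<omega>) (X n \<omega>) * f (th n \<omega>) (X (Suc n) \<omega>)) + K * expectation (\<lambda>\<omega>. A (th n \<omega>) (X n \<omega>))
     + L * expectation (\<lambda>\<omega>. f (th n \<omega>) (X (Suc n) \<omega>)) + L * K"
    unfolding distrib_left distrib_right using iAf iA i by (simp add: prob_space mult_ac)
  have 5: "expectation (\<lambda>\<omega>. (A (th n \<omega>) (X n \<omega>) + L) * (P (th n \<omega>) (f (th n \<omega>)) (X n \<omega>) + K)) =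
    expectation (\<lambda>\<omega>. A (th n \<omega>) (X n \<omega>) * P (th n \<omega>) (f (th n \<omega>)) (X n \<omega>)) + K * expectation (\<lambda>\<omega>. A (th n \<omega>) (X n \<omega>))
     + L * expectation (\<lambda>\<omega>. P (th n \<omega>) (f (th n \<omega>)) (X n \<omega>)) + L * K"
    unfolding distrib_left distrib_right using iAP iA iP by (simp add: prob_space mult_ac)
  show ?thesis using 2 3 4 5 e1 by simp
qed

end

section \<open>A global Lyapunov function\<close>

text \<open>Only \<open>w > 1\<close> is penalised, that is, cells whose weight is too small; as the
  total weight is fixed, they control the others. One-sidedness makes the function nondecreasing in
  \<open>w\<close>, which the sum inequality for the drift requires, and the square makes it
  differentiable.\<close>

definition excess :: "real \<Rightarrow> real" where "excess w = (max 0 (w - 1))\<^sup>2"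

text \<open>\<open>slope\<close> is minus the derivative of \<open>excess (ts i / \<theta> i)\<close> with respect to \<open>ln (\<theta> i)\<close>.\<close>

definition slope :: "real \<Rightarrow> real" where "slope w = 2 * max 0 (w - 1) * w"

lemma excess_nonneg: "0 \<le> excess w" by (simp add: excess_def)

lemma sq_le_excess: assumes "0 \<le> w" shows "w\<^sup>2 \<le> 2 * (1 + excess w)"
proof -
  define u where "u = max 0 (w - 1)"
  have "w \<le> 1 + u" by (simp add: u_def)
  hence "w\<^sup>2 \<le> (1 + u)\<^sup>2" using assms by (intro power_mono) auto
  also have "\<dots> \<le> 2 * (1 + u\<^sup>2)"
    using zero_le_power2[of "1 - u"] by (simp add: power2_eq_square algebra_simps)
  finally show ?thesis by (simp add: excess_def u_def)
qed

lemma slope_bounds: assumes "0 \<le> w" shows "0 \<le> slope w" "slope w \<le> 4 * (1 + excess w)"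
proof -
  have u: "0 \<le> max 0 (w - 1)" "max 0 (w - 1) \<le> w" using assms by auto
  show "0 \<le> slope w" using u assms by (simp add: slope_def)
  have "max 0 (w - 1) * w \<le> w * w" using u assms by (intro mult_right_mono) auto
  thus "slope w \<le> 4 * (1 + excess w)" using sq_le_excess[OF assms] by (simp add: slope_def power2_eq_square)
qed

lemma slope_mult: "slope w * (w - 1) = 2 * (w * excess w)"
  by (auto simp: slope_def excess_def max_def power2_eq_square)

text \<open>An update replaces \<open>w = ts i / \<theta> i\<close> by
  \<open>w / (1 + g * G)\<close> with \<open>G\<close> the relative growth. The errors are relative
  to \<open>w\<close>, so they remain useful for arbitrarily large \<open>w\<close>;
  \<open>g \<le> 1/2\<close> keeps the denominator above \<open>1/2\<close>.\<close>

lemma ratio_step: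
  fixes w g G :: real
  assumes "0 < w" "\<bar>G\<bar> \<le> 1" "0 \<le> g" "g \<le> 1/2"
  defines "w' \<equiv> w / (1 + g * G)"
  shows "\<bar>w' - w\<bar> \<le> 2 * g * w" "\<bar>w' - w + g * (G * w)\<bar> \<le> 2 * g\<^sup>2 * w" "0 < w'" "w' \<le> 2 * w"
proof -
  have gG: "\<bar>g * G\<bar> \<le> g" using assms(2,3) by (simp add: abs_mult mult_left_le)
  hence d: "1 / 2 \<le> 1 + g * G" using assms(4) by linarith
  show "0 < w'" using d assms(1) by (simp add: w'_def)
  have e: "w' * (1 + g * G) = w" using d by (simp add: w'_def)
  have "w' * (1 / 2) \<le> w' * (1 + g * G)" using d \<open>0 < w'\<close> by (intro mult_left_mono) auto
  thus w2: "w' \<le> 2 * w" using e by simp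
  have e1: "w' - w = - (g * G) * w'" using e by (simp add: algebra_simps)
  have "\<bar>w' - w\<bar> \<le> g * (2 * w)"
    unfolding e1 abs_mult[of "- (g * G)"] abs_minus_cancel using gG w2 \<open>0 < w'\<close> assms(3) by (intro mult_mono) auto
  thus 1: "\<bar>w' - w\<bar> \<le> 2 * g * w" by (simp add: mult_ac)
  have e2: "w' - w + g * (G * w) = (g * G) * (w - w')" using e1 by (simp add: algebra_simps)
  have "\<bar>g * G\<bar> * \<bar>w - w'\<bar> \<le> g * (2 * g * w)" using gG 1 by (intro mult_mono) auto
  thus "\<bar>w' - w + g * (G * w)\<bar> \<le> 2 * g\<^sup>2 * w" unfolding e2 abs_mult[of "g * G"] by (simp add: power2_eq_square mult_ac)
qed

text \<open>The second-order part of the quotient and the squared increment cost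
  \<open>4 * g^2 * w^2\<close> each, and \<open>w^2 \<le> 2 * (1 + excess w)\<close> turns this into
  16. For \<open>slope\<close> the product rule gives \<open>12 * g * w^2\<close>, hence 24.\<close>

lemma excess_step:
  fixes w g G :: real
  assumes w: "0 < w" "\<bar>G\<bar> \<le> 1" "0 \<le> g" "g \<le> 1/2"
  defines "w' \<equiv> w / (1 + g * G)"
  shows "excess w' \<le> excess w - g * (slope w * G) + 16 * g\<^sup>2 * (1 + excess w)"
    and "\<bar>slope w' - slope w\<bar> \<le> 24 * g * (1 + excess w)"
proof -
  note r = ratio_step[OF w, folded w'_def]
  define u u' where "u = max 0 (w - 1)" and "u' = max 0 (w' - 1)"
  have u: "0 \<le> u" "u \<le> w" "0 \<le> u'" "u' \<le> w'" "\<bar>u' - u\<bar> \<le> \<bar>w' - w\<bar>"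
    using w(1) r(3) by (auto simp: u_def u'_def)
  have conv: "u'\<^sup>2 \<le> u\<^sup>2 + 2 * u * (w' - w) + (w' - w)\<^sup>2"
  proof -
    \<comment> \<open>Because \<open>u\<close> is at least \<open>w - 1\<close>, adding
      \<open>w' - w\<close> gives at least \<open>w' - 1\<close>.\<close>
    have "u' \<le> \<bar>u + (w' - w)\<bar>" unfolding u_def u'_def by (auto simp: max_def)
    hence "u'\<^sup>2 \<le> \<bar>u + (w' - w)\<bar>\<^sup>2" using u(3) by (intro power_mono)
    thus ?thesis by (simp add: power2_eq_square algebra_simps)
  qed
  have w2: "w * w \<le> 2 * (1 + excess w)" using sq_le_excess[of w] w by (simp add: power2_eq_square)
  have g2: "0 \<le> g\<^sup>2" by simp
  have a: "2 * u * (w' - w) \<le> - g * (slope w * G) + 4 * g\<^sup>2 * (w * w)"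
  proof -
    have "w' - w \<le> - (g * (G * w)) + 2 * g\<^sup>2 * w" using r(2) by linarith
    hence "2 * u * (w' - w) \<le> 2 * u * (- (g * (G * w)) + 2 * g\<^sup>2 * w)"
      using u by (intro mult_left_mono) auto
    also have "\<dots> = - g * (slope w * G) + 4 * g\<^sup>2 * (u * w)"
      by (simp add: slope_def u_def[symmetric] algebra_simps)
    also have "\<dots> \<le> - g * (slope w * G) + 4 * g\<^sup>2 * (w * w)"
      using u w(1) g2 by (intro add_left_mono mult_left_mono mult_right_mono) auto
    finally show ?thesis .
  qed
  have b: "(w' - w)\<^sup>2 \<le> 4 * g\<^sup>2 * (w * w)"
  proof -
    have "\<bar>w' - w\<bar>\<^sup>2 \<le> (2 * g * w)\<^sup>2" using r(1) by (intro power_mono) auto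
    thus ?thesis by (simp add: power2_eq_square mult_ac)
  qed
  have c: "8 * g\<^sup>2 * (w * w) \<le> 8 * g\<^sup>2 * (2 * (1 + excess w))" using w2 by (intro mult_left_mono) auto
  have "excess w' \<le> excess w + (- g * (slope w * G) + 4 * g\<^sup>2 * (w * w)) + 4 * g\<^sup>2 * (w * w)"
    using conv a b unfolding excess_def u_def[symmetric] u'_def[symmetric] by linarith
  moreover have "4 * g\<^sup>2 * (w * w) + 4 * g\<^sup>2 * (w * w) \<le> 16 * g\<^sup>2 * (1 + excess w)" using c by linarith
  ultimately show "excess w' \<le> excess w - g * (slope w * G) + 16 * g\<^sup>2 * (1 + excess w)" by linarith
  have e: "slope w' - slope w = 2 * ((u' - u) * w') + 2 * (u * (w' - w))"
    by (simp add: slope_def u_def[symmetric] u'_def[symmetric] algebra_simps)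
  have 1: "\<bar>(u' - u) * w'\<bar> \<le> (2 * g * w) * (2 * w)"
    unfolding abs_mult using u(5) r(1,3,4) w by (intro mult_mono) auto
  have 2: "\<bar>u * (w' - w)\<bar> \<le> w * (2 * g * w)"
    unfolding abs_mult using u r(1) w by (intro mult_mono) auto
  have 3: "12 * g * (w * w) \<le> 12 * g * (2 * (1 + excess w))" using w2 w(3) by (intro mult_left_mono) auto
  have "\<bar>slope w' - slope w\<bar> \<le> 2 * ((2 * g * w) * (2 * w)) + 2 * (w * (2 * g * w))"
    unfolding e using 1 2 by linarith
  also have "\<dots> = 12 * g * (w * w)" by simp
  also have "\<dots> \<le> 24 * g * (1 + excess w)" using 3 by linarith
  finally show "\<bar>slope w' - slope w\<bar> \<le> 24 * g * (1 + excess w)" .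
qed

section \<open>Calculus of bounded random variables\<close>

context prob_space
begin

text \<open>The random variables of the later estimates have this form at each fixed time; closure
  under algebraic operations disposes of their integrability.\<close>

definition bdd_rv :: "('a \<Rightarrow> real) \<Rightarrow> bool" where
  "bdd_rv A \<longleftrightarrow> A \<in> borel_measurable M \<and> (\<exists>L. \<forall>\<omega>\<in>space M. \<bar>A \<omega>\<bar> \<le> L)"

lemma bdd_rvI: "A \<in> borel_measurable M \<Longrightarrow> (\<And>\<omega>. \<omega> \<in> space M \<Longrightarrow> \<bar>A \<omega>\<bar> \<le> L) \<Longrightarrow> bdd_rv A"
  unfolding bdd_rv_def by blast

lemma bdd_rv_integrable: "bdd_rv A \<Longrightarrow> integrable M A"
  unfolding bdd_rv_def by (auto intro!: integrable_const_bound AE_I2)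

lemma bdd_rv_const: "bdd_rv (\<lambda>_. r)" by (rule bdd_rvI[where L="\<bar>r\<bar>"]) auto

lemma bdd_rv_add: assumes "bdd_rv A" "bdd_rv B" shows "bdd_rv (\<lambda>\<omega>. A \<omega> + B \<omega>)"
proof -
  obtain K L where "\<forall>\<omega>\<in>space M. \<bar>A \<omega>\<bar> \<le> K" "\<forall>\<omega>\<in>space M. \<bar>B \<omega>\<bar> \<le> L"
    using assms unfolding bdd_rv_def by blast
  thus ?thesis using assms unfolding bdd_rv_def
    by (intro conjI exI[of _ "K + L"] ballI) (auto intro: order_trans[OF abs_triangle_ineq add_mono])
qed

lemma bdd_rv_mult: assumes "bdd_rv A" "bdd_rv B" shows "bdd_rv (\<lambda>\<omega>. A \<omega> * B \<omega>)"
proof -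
  obtain K L where "\<forall>\<omega>\<in>space M. \<bar>A \<omega>\<bar> \<le> K" "\<forall>\<omega>\<in>space M. \<bar>B \<omega>\<bar> \<le> L"
    using assms unfolding bdd_rv_def by blast
  hence "\<forall>\<omega>\<in>space M. \<bar>A \<omega> * B \<omega>\<bar> \<le> \<bar>K\<bar> * L"
    unfolding abs_mult by (intro ballI mult_mono) (auto intro: order_trans[OF _ abs_ge_self])
  thus ?thesis using assms unfolding bdd_rv_def by (intro conjI exI[of _ "\<bar>K\<bar> * L"]) auto
qed

lemma bdd_rv_minus: "bdd_rv A \<Longrightarrow> bdd_rv (\<lambda>\<omega>. - A \<omega>)"
  using bdd_rv_mult[OF bdd_rv_const[of "-1"]] by simp

lemma bdd_rv_diff: "bdd_rv A \<Longrightarrow> bdd_rv B \<Longrightarrow> bdd_rv (\<lambda>\<omega>. A \<omega> - B \<omega>)"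
  using bdd_rv_add[OF _ bdd_rv_minus] by fastforce

lemma bdd_rv_abs: "bdd_rv A \<Longrightarrow> bdd_rv (\<lambda>\<omega>. \<bar>A \<omega>\<bar>)" unfolding bdd_rv_def by auto

lemma bdd_rv_power2: "bdd_rv A \<Longrightarrow> bdd_rv (\<lambda>\<omega>. (A \<omega>)\<^sup>2)"
  unfolding power2_eq_square by (rule bdd_rv_mult)

lemma bdd_rv_sum: "finite S \<Longrightarrow> (\<And>i. i \<in> S \<Longrightarrow> bdd_rv (A i)) \<Longrightarrow> bdd_rv (\<lambda>\<omega>. \<Sum>i\<in>S. A i \<omega>)"
  by (induction S rule: finite_induct) (auto intro: bdd_rv_const bdd_rv_add)

lemmas bdd_rv_intros = bdd_rv_const bdd_rv_add bdd_rv_mult bdd_rv_diff bdd_rv_minus bdd_rv_abs bdd_rv_power2 bdd_rv_sum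

lemma expectation_mono_bdd:
  "bdd_rv A \<Longrightarrow> bdd_rv B \<Longrightarrow> (\<And>\<omega>. \<omega> \<in> space M \<Longrightarrow> A \<omega> \<le> B \<omega>) \<Longrightarrow> expectation A \<le> expectation B"
  by (intro integral_mono bdd_rv_integrable)

lemma expectation_add_bdd:
  "bdd_rv A \<Longrightarrow> bdd_rv B \<Longrightarrow> expectation (\<lambda>\<omega>. A \<omega> + B \<omega>) = expectation A + expectation B"
  by (intro Bochner_Integration.integral_add bdd_rv_integrable)

lemma expectation_diff_bdd:
  "bdd_rv A \<Longrightarrow> bdd_rv B \<Longrightarrow> expectation (\<lambda>\<omega>. A \<omega> - B \<omega>) = expectation A - expectation B"
  by (intro Bochner_Integration.integral_diff bdd_rv_integrable)

lemma abs_expectation_le_bdd: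
  assumes "bdd_rv A" "bdd_rv B" "\<And>\<omega>. \<omega> \<in> space M \<Longrightarrow> \<bar>A \<omega>\<bar> \<le> B \<omega>"
  shows "\<bar>expectation A\<bar> \<le> expectation B"
  by (rule order_trans[OF integral_abs_bound expectation_mono_bdd[OF bdd_rv_abs]]) (use assms in auto)

end

section \<open>One step of the weights\<close>

context wl_process
begin

lemma growth_le_1: "\<theta> \<in> Theta \<Longrightarrow> \<bar>growth i \<theta> x\<bar> \<le> 1"
  using Theta_pos[of \<theta> "I x"] Theta_less_1[of \<theta> "I x"] by (auto simp: growth_def indicator_def abs_le_iff)

lemma th_step: "\<omega> \<in> space M \<Longrightarrow> th (Suc n) \<omega> $ i = th n \<omega> $ i * (1 + gamma (Suc n) * growth i (th n \<omega>) (X (Suc n) \<omega>))"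
  by (simp add: th_rec WL_field_def growth_def algebra_simps)

lemma abs_gamma_growth: "\<omega> \<in> space M \<Longrightarrow> \<bar>gamma (Suc n) * growth i (th n \<omega>) x\<bar> \<le> gamma (Suc n)"
  using growth_le_1[OF th_Theta, of \<omega> i n x] gamma_pos[of "Suc n"] by (simp add: abs_mult mult_left_le)

text \<open>The bound deteriorates by \<open>1 - gamma\<close> at each step. Its purpose is
  boundedness of \<open>ts i / \<theta> i\<close> at each fixed time, so that the expectations of
  \<open>V\<close> are finite.\<close>

lemma th_lower_bound: "\<exists>m>0. \<forall>\<omega>\<in>space M. \<forall>i. m \<le> th n \<omega> $ i"
proof (induction n)
  case 0
  show ?case using m0_pos th0_ge by blast
next
  case (Suc n)
  then obtain m where m: "m > 0" "\<And>\<omega> i. \<omega> \<in> space M \<Longrightarrow> m \<le> th n \<omega> $ i" by blast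
  have g: "0 < 1 - gamma (Suc n)" using gamma_less_1[of "Suc n"] by simp
  have "m * (1 - gamma (Suc n)) \<le> th (Suc n) \<omega> $ i" if w: "\<omega> \<in> space M" for \<omega> i
    unfolding th_step[OF w] using abs_gamma_growth[OF w, of n i "X (Suc n) \<omega>"] m(2)[OF w, of i] m(1) g
    by (intro mult_mono) auto
  thus ?case using m(1) g by (intro exI[of _ "m * (1 - gamma (Suc n))"]) auto
qed

lemma th_step_close:
  assumes w: "\<omega> \<in> space M" and g: "gamma (Suc n) \<le> 1/2"
  shows "ratio_close (2 * gamma (Suc n)) (th n \<omega>) (th (Suc n) \<omega>)"
  unfolding ratio_close_def
proof (intro allI conjI)
  fix i
  define g where "g = gamma (Suc n)"
  define z where "z = gamma (Suc n) * growth i (th n \<omega>) (X (Suc n) \<omega>)"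
  have z: "\<bar>z\<bar> \<le> g" using abs_gamma_growth[OF w] by (simp add: z_def g_def)
  have g01: "0 \<le> g" "g \<le> 1 / 2" using gamma_pos[of "Suc n"] assms by (auto simp: g_def)
  have t: "0 < th n \<omega> $ i" using Theta_pos[OF th_Theta[OF w]] .
  have e: "th (Suc n) \<omega> $ i = (1 + z) * th n \<omega> $ i" by (simp add: th_step[OF w] z_def)
  show "th (Suc n) \<omega> $ i \<le> (1 + 2 * gamma (Suc n)) * th n \<omega> $ i"
    unfolding e g_def[symmetric] using z t g01 by (intro mult_right_mono) auto
  \<comment> \<open>This is where \<open>gamma \<le> 1/2\<close> enters: the product is
    \<open>1 + g * (1 - 2 * g)\<close>.\<close>
  have "1 \<le> (1 + 2 * g) * (1 - g)"
    using mult_left_mono[OF g01(2) g01(1)] by (simp add: algebra_simps)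
  also have "\<dots> \<le> (1 + 2 * g) * (1 + z)" using z g01 by (intro mult_left_mono) auto
  finally have "1 * th n \<omega> $ i \<le> ((1 + 2 * g) * (1 + z)) * th n \<omega> $ i"
    using t by (intro mult_right_mono) auto
  thus "th n \<omega> $ i \<le> (1 + 2 * gamma (Suc n)) * th (Suc n) \<omega> $ i"
    unfolding e g_def[symmetric] by (simp add: mult.assoc)
qed

lemma bdd_rv_regular: assumes f: "regular f" shows "bdd_rv (\<lambda>\<omega>. f (th n \<omega>) (X m \<omega>))"
proof -
  obtain K where K: "\<And>\<theta> x. \<theta> \<in> Theta \<Longrightarrow> \<bar>f \<theta> x\<bar> \<le> K" by (rule regularE[OF f]) (rule that)
  show ?thesis by (rule bdd_rvI[OF regular_measurable[OF f]]) (measurable, rule K[OF th_Theta])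
qed

lemma bdd_rv_mean: "regular f \<Longrightarrow> bdd_rv (\<lambda>\<omega>. mean f (th n \<omega>))"
  by (rule bdd_rv_regular[OF regular_mean])

definition wr :: "'d \<Rightarrow> real ^ 'd \<Rightarrow> real" where "wr i \<theta> = ts $ i / \<theta> $ i"

definition V :: "real ^ 'd \<Rightarrow> real" where "V \<theta> = (\<Sum>i\<in>UNIV. excess (wr i \<theta>))"

lemma V_nonneg: "0 \<le> V \<theta>" unfolding V_def by (intro sum_nonneg excess_nonneg)
lemma excess_le_V: "excess (wr i \<theta>) \<le> V \<theta>"
  unfolding V_def by (intro member_le_sum excess_nonneg) auto

lemma wr_pos: "\<theta> \<in> Theta \<Longrightarrow> 0 < wr i \<theta>" unfolding wr_def by (rule divide_pos_pos[OF ts_pos Theta_pos])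

lemma wr_measurable [measurable (raw)]: "f \<in> borel_measurable N \<Longrightarrow> (\<lambda>\<omega>. wr i (f \<omega>)) \<in> borel_measurable N"
  unfolding wr_def by measurable

lemma slope_measurable [measurable (raw)]: "f \<in> borel_measurable N \<Longrightarrow> (\<lambda>\<omega>. slope (f \<omega>)) \<in> borel_measurable N"
  unfolding slope_def by (rule borel_measurable_times borel_measurable_max borel_measurable_diff borel_measurable_const | assumption)+

lemma bdd_rv_wr: "bdd_rv (\<lambda>\<omega>. wr i (th n \<omega>))"
proof -
  obtain m where m: "m > 0" "\<And>\<omega> i. \<omega> \<in> space M \<Longrightarrow> m \<le> th n \<omega> $ i" using th_lower_bound by blast
  have "\<bar>wr i (th n \<omega>)\<bar> \<le> ts $ i / m" if w: "\<omega> \<in> space M" for \<omega>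
    using wr_pos[OF th_Theta[OF w], of i n] m(2)[OF w, of i] m(1) ts_pos[of i]
    by (simp add: wr_def divide_left_mono)
  thus ?thesis by (intro bdd_rvI) auto
qed

lemma bdd_rv_slope: "bdd_rv (\<lambda>\<omega>. slope (wr i (th n \<omega>)))"
proof -
  have b: "bdd_rv (\<lambda>\<omega>. 4 * (1 + excess (wr i (th n \<omega>))))"
  proof -
    have m: "bdd_rv (\<lambda>\<omega>. max 0 (wr i (th n \<omega>) - 1))"
    proof -
      from bdd_rv_diff[OF bdd_rv_wr bdd_rv_const, of i n 1] obtain L where
        "\<forall>\<omega>\<in>space M. \<bar>wr i (th n \<omega>) - 1\<bar> \<le> L" unfolding bdd_rv_def by blast
      thus ?thesis by (intro bdd_rvI[where L=L]) (auto simp: abs_le_iff)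
    qed
    show ?thesis unfolding excess_def by (intro bdd_rv_intros m)
  qed
  then obtain L where L: "\<forall>\<omega>\<in>space M. \<bar>4 * (1 + excess (wr i (th n \<omega>)))\<bar> \<le> L" unfolding bdd_rv_def by blast
  show ?thesis
  proof (rule bdd_rvI[where L=L])
    fix \<omega> assume w: "\<omega> \<in> space M"
    show "\<bar>slope (wr i (th n \<omega>))\<bar> \<le> L"
      using slope_bounds[OF less_imp_le[OF wr_pos[OF th_Theta[OF w]]], of i n] L[rule_format, OF w] by linarith
  qed measurable
qed

lemma bdd_rv_excess: "bdd_rv (\<lambda>\<omega>. excess (wr i (th n \<omega>)))"
proof -
  from bdd_rv_diff[OF bdd_rv_wr bdd_rv_const, of i n 1] obtain L where
    L: "\<forall>\<omega>\<in>space M. \<bar>wr i (th n \<omega>) - 1\<bar> \<le> L" unfolding bdd_rv_def by blast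
  have "bdd_rv (\<lambda>\<omega>. max 0 (wr i (th n \<omega>) - 1))"
    by (rule bdd_rvI[where L=L]) (use L in \<open>auto simp: abs_le_iff\<close>)
  thus ?thesis unfolding excess_def by (rule bdd_rv_power2)
qed

lemma bdd_rv_V: "bdd_rv (\<lambda>\<omega>. V (th n \<omega>))"
  unfolding V_def by (intro bdd_rv_sum bdd_rv_excess finite)

section \<open>Replacing fields by their stationary means\<close>

text \<open>Moving the weights inside \<open>D\<close> from time \<open>n\<close> to
  \<open>n + 1\<close> costs its Lipschitz constant times the relative step
  \<open>2 * gamma\<close>; changing the multiplier costs the supremum of \<open>D\<close>. This is
  the summation by parts behind the Poisson corrections, with a \<open>K\<close> independent of the
  multipliers and of time.\<close>

lemma telescope:
  assumes D: "regular D"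
  obtains K where "0 \<le> K" "\<And>\<theta> x. \<theta> \<in> Theta \<Longrightarrow> \<bar>D \<theta> x\<bar> \<le> K"
    "\<And>n A A'. gamma (Suc n) \<le> 1/2 \<Longrightarrow> bdd_rv A \<Longrightarrow> bdd_rv A' \<Longrightarrow>
      \<bar>expectation (\<lambda>\<omega>. A' \<omega> * D (th (Suc n) \<omega>) (X (Suc n) \<omega>)) - expectation (\<lambda>\<omega>. A \<omega> * D (th n \<omega>) (X (Suc n) \<omega>))\<bar>
      \<le> K * expectation (\<lambda>\<omega>. \<bar>A' \<omega> - A \<omega>\<bar>) + 2 * K * gamma (Suc n) * expectation (\<lambda>\<omega>. \<bar>A \<omega>\<bar>)"
proof -
  obtain K where K: "0 \<le> K" "\<And>\<theta> x. \<theta> \<in> Theta \<Longrightarrow> \<bar>D \<theta> x\<bar> \<le> K"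
    "\<And>\<theta> \<theta>' \<delta> x. \<theta> \<in> Theta \<Longrightarrow> \<theta>' \<in> Theta \<Longrightarrow> 0 \<le> \<delta> \<Longrightarrow> \<delta> \<le> 1 \<Longrightarrow> ratio_close \<delta> \<theta> \<theta>' \<Longrightarrow>
      \<bar>D \<theta> x - D \<theta>' x\<bar> \<le> K * \<delta>" using regularE[OF D] by blast
  show ?thesis
  proof (rule that[OF K(1,2)])
    fix n A A' assume g: "gamma (Suc n) \<le> 1/2" and A: "bdd_rv A" "bdd_rv A'"
    let ?D1 = "\<lambda>\<omega>. D (th (Suc n) \<omega>) (X (Suc n) \<omega>)" and ?D0 = "\<lambda>\<omega>. D (th n \<omega>) (X (Suc n) \<omega>)"
    note bD = bdd_rv_regular[OF D]
    have "\<bar>expectation (\<lambda>\<omega>. A' \<omega> * ?D1 \<omega> - A \<omega> * ?D0 \<omega>)\<bar> \<le>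
       expectation (\<lambda>\<omega>. K * \<bar>A' \<omega> - A \<omega>\<bar> + 2 * K * gamma (Suc n) * \<bar>A \<omega>\<bar>)"
    proof (rule abs_expectation_le_bdd)
      fix \<omega> assume w: "\<omega> \<in> space M"
      have 1: "\<bar>?D1 \<omega>\<bar> \<le> K" by (rule K(2)[OF th_Theta[OF w]])
      have 2: "\<bar>?D0 \<omega> - ?D1 \<omega>\<bar> \<le> K * (2 * gamma (Suc n))"
        using g gamma_pos[of "Suc n"] by (intro K(3) th_Theta w th_step_close) auto
      have e: "A' \<omega> * ?D1 \<omega> - A \<omega> * ?D0 \<omega> = (A' \<omega> - A \<omega>) * ?D1 \<omega> - A \<omega> * (?D0 \<omega> - ?D1 \<omega>)"
        by (simp add: algebra_simps)
      have 3: "\<bar>(A' \<omega> - A \<omega>) * ?D1 \<omega>\<bar> \<le> K * \<bar>A' \<omega> - A \<omega>\<bar>"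
        unfolding abs_mult mult.commute[of K] using 1 by (intro mult_left_mono) auto
      have "\<bar>A \<omega> * (?D0 \<omega> - ?D1 \<omega>)\<bar> \<le> \<bar>A \<omega>\<bar> * (K * (2 * gamma (Suc n)))"
        unfolding abs_mult using 2 by (intro mult_left_mono) auto
      hence 4: "\<bar>A \<omega> * (?D0 \<omega> - ?D1 \<omega>)\<bar> \<le> 2 * K * gamma (Suc n) * \<bar>A \<omega>\<bar>" by (simp add: mult_ac)
      show "\<bar>A' \<omega> * ?D1 \<omega> - A \<omega> * ?D0 \<omega>\<bar> \<le> K * \<bar>A' \<omega> - A \<omega>\<bar> + 2 * K * gamma (Suc n) * \<bar>A \<omega>\<bar>"
        unfolding e using 3 4 by linarith
    qed (intro bdd_rv_intros A bD)+
    moreover have "expectation (\<lambda>\<omega>. A' \<omega> * ?D1 \<omega> - A \<omega> * ?D0 \<omega>) = expectation (\<lambda>\<omega>. A' \<omega> * ?D1 \<omega>) - expectation (\<lambda>\<omega>. A \<omega> * ?D0 \<omega>)"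
      by (intro expectation_diff_bdd bdd_rv_intros A bD)
    moreover have "expectation (\<lambda>\<omega>. K * \<bar>A' \<omega> - A \<omega>\<bar> + 2 * K * gamma (Suc n) * \<bar>A \<omega>\<bar>) =
       K * expectation (\<lambda>\<omega>. \<bar>A' \<omega> - A \<omega>\<bar>) + 2 * K * gamma (Suc n) * expectation (\<lambda>\<omega>. \<bar>A \<omega>\<bar>)"
      by (subst expectation_add_bdd) (intro bdd_rv_intros A | simp)+
    ultimately show "\<bar>expectation (\<lambda>\<omega>. A' \<omega> * ?D1 \<omega>) - expectation (\<lambda>\<omega>. A \<omega> * ?D0 \<omega>)\<bar>
      \<le> K * expectation (\<lambda>\<omega>. \<bar>A' \<omega> - A \<omega>\<bar>) + 2 * K * gamma (Suc n) * expectation (\<lambda>\<omega>. \<bar>A \<omega>\<bar>)"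
      by (simp only:)
  qed
qed

lemma poisson_identity:
  assumes g: "regular g" and th: "\<theta> \<in> Theta"
  shows "g \<theta> x = mean g \<theta> + poisson g \<theta> x - P \<theta> (poisson g \<theta>) x"
proof -
  obtain K where K: "\<And>\<theta> x. \<theta> \<in> Theta \<Longrightarrow> \<bar>g \<theta> x\<bar> \<le> K" by (rule regularE[OF g]) (rule that)
  show ?thesis using poisson_eq[OF g K[OF th] th, of x] by simp
qed

text \<open>Insert the Poisson equation at the new position and apply the Markov property to the
  Poisson solution. What remains beside the mean is a difference in position at frozen weights,
  which \<open>telescope\<close> turns into a difference in time.\<close>

lemma average_next:
  assumes g: "regular g" and A: "(\<lambda>(\<theta>, x). A \<theta> x) \<in> borel_measurable (borel \<Otimes>\<^sub>M borel)"
    and bA: "bdd_rv (\<lambda>\<omega>. A (th n \<omega>) (X n \<omega>))"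
  defines "D \<equiv> \<lambda>\<theta>. P \<theta> (poisson g \<theta>)"
  shows "expectation (\<lambda>\<omega>. A (th n \<omega>) (X n \<omega>) * g (th n \<omega>) (X (Suc n) \<omega>)) =
    expectation (\<lambda>\<omega>. A (th n \<omega>) (X n \<omega>) * mean g (th n \<omega>))
    + expectation (\<lambda>\<omega>. A (th n \<omega>) (X n \<omega>) * D (th n \<omega>) (X n \<omega>))
    - expectation (\<lambda>\<omega>. A (th n \<omega>) (X n \<omega>) * D (th n \<omega>) (X (Suc n) \<omega>))"
proof -
  obtain L where L: "\<And>\<omega>. \<omega> \<in> space M \<Longrightarrow> \<bar>A (th n \<omega>) (X n \<omega>)\<bar> \<le> L" using bA unfolding bdd_rv_def by blast
  have rD: "regular D" unfolding D_def by (intro regular_P regular_poisson g)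
  have "expectation (\<lambda>\<omega>. A (th n \<omega>) (X n \<omega>) * g (th n \<omega>) (X (Suc n) \<omega>)) =
    expectation (\<lambda>\<omega>. A (th n \<omega>) (X n \<omega>) * mean g (th n \<omega>) + A (th n \<omega>) (X n \<omega>) * poisson g (th n \<omega>) (X (Suc n) \<omega>)
      - A (th n \<omega>) (X n \<omega>) * D (th n \<omega>) (X (Suc n) \<omega>))"
  proof (rule Bochner_Integration.integral_cong[OF refl])
    fix \<omega> assume "\<omega> \<in> space M"
    note e = poisson_identity[OF g th_Theta[OF this], of n "X (Suc n) \<omega>"]
    show "A (th n \<omega>) (X n \<omega>) * g (th n \<omega>) (X (Suc n) \<omega>) = A (th n \<omega>) (X n \<omega>) * mean g (th n \<omega>) +
      A (th n \<omega>) (X n \<omega>) * poisson g (th n \<omega>) (X (Suc n) \<omega>) - A (th n \<omega>) (X n \<omega>) * D (th n \<omega>) (X (Suc n) \<omega>)"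
      unfolding e D_def by (simp only: distrib_left right_diff_distrib)
  qed
  also have "\<dots> = expectation (\<lambda>\<omega>. A (th n \<omega>) (X n \<omega>) * mean g (th n \<omega>)) +
      expectation (\<lambda>\<omega>. A (th n \<omega>) (X n \<omega>) * poisson g (th n \<omega>) (X (Suc n) \<omega>))
      - expectation (\<lambda>\<omega>. A (th n \<omega>) (X n \<omega>) * D (th n \<omega>) (X (Suc n) \<omega>))"
    unfolding expectation_diff_bdd[OF bdd_rv_add[OF bdd_rv_mult[OF bA bdd_rv_mean[OF g]]
        bdd_rv_mult[OF bA bdd_rv_regular[OF regular_poisson[OF g]]]] bdd_rv_mult[OF bA bdd_rv_regular[OF rD]]]
      expectation_add_bdd[OF bdd_rv_mult[OF bA bdd_rv_mean[OF g]] bdd_rv_mult[OF bA bdd_rv_regular[OF regular_poisson[OF g]]]] ..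
  also have "expectation (\<lambda>\<omega>. A (th n \<omega>) (X n \<omega>) * poisson g (th n \<omega>) (X (Suc n) \<omega>)) =
      expectation (\<lambda>\<omega>. A (th n \<omega>) (X n \<omega>) * D (th n \<omega>) (X n \<omega>))"
    unfolding D_def by (rule markov[OF A L regular_poisson[OF g]])
  finally show ?thesis .
qed

text \<open>The analogue at the present position, with the Markov property used in the opposite
  direction: the image under the kernel becomes the Poisson solution at the next position.\<close>

lemma average_now:
  assumes g: "regular g" and A: "(\<lambda>(\<theta>, x). A \<theta> x) \<in> borel_measurable (borel \<Otimes>\<^sub>M borel)"
    and bA: "bdd_rv (\<lambda>\<omega>. A (th n \<omega>) (X n \<omega>))"
  shows "expectation (\<lambda>\<omega>. A (th n \<omega>) (X n \<omega>) * g (th n \<omega>) (X n \<omega>)) =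
    expectation (\<lambda>\<omega>. A (th n \<omega>) (X n \<omega>) * mean g (th n \<omega>))
    + expectation (\<lambda>\<omega>. A (th n \<omega>) (X n \<omega>) * poisson g (th n \<omega>) (X n \<omega>))
    - expectation (\<lambda>\<omega>. A (th n \<omega>) (X n \<omega>) * poisson g (th n \<omega>) (X (Suc n) \<omega>))"
proof -
  obtain L where L: "\<And>\<omega>. \<omega> \<in> space M \<Longrightarrow> \<bar>A (th n \<omega>) (X n \<omega>)\<bar> \<le> L" using bA unfolding bdd_rv_def by blast
  have rD: "regular (\<lambda>\<theta>. P \<theta> (poisson g \<theta>))" by (intro regular_P regular_poisson g)
  have "expectation (\<lambda>\<omega>. A (th n \<omega>) (X n \<omega>) * g (th n \<omega>) (X n \<omega>)) =
    expectation (\<lambda>\<omega>. A (th n \<omega>) (X n \<omega>) * mean g (th n \<omega>) + A (th n \<omega>) (X n \<omega>) * poisson g (th n \<omega>) (X n \<omega>)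
      - A (th n \<omega>) (X n \<omega>) * P (th n \<omega>) (poisson g (th n \<omega>)) (X n \<omega>))"
  proof (rule Bochner_Integration.integral_cong[OF refl])
    fix \<omega> assume "\<omega> \<in> space M"
    note e = poisson_identity[OF g th_Theta[OF this], of n "X n \<omega>"]
    show "A (th n \<omega>) (X n \<omega>) * g (th n \<omega>) (X n \<omega>) = A (th n \<omega>) (X n \<omega>) * mean g (th n \<omega>) +
      A (th n \<omega>) (X n \<omega>) * poisson g (th n \<omega>) (X n \<omega>) - A (th n \<omega>) (X n \<omega>) * P (th n \<omega>) (poisson g (th n \<omega>)) (X n \<omega>)"
      unfolding e by (simp only: distrib_left right_diff_distrib)
  qed
  also have "\<dots> = expectation (\<lambda>\<omega>. A (th n \<omega>) (X n \<omega>) * mean g (th n \<omega>)) +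
      expectation (\<lambda>\<omega>. A (th n \<omega>) (X n \<omega>) * poisson g (th n \<omega>) (X n \<omega>))
      - expectation (\<lambda>\<omega>. A (th n \<omega>) (X n \<omega>) * P (th n \<omega>) (poisson g (th n \<omega>)) (X n \<omega>))"
    unfolding expectation_diff_bdd[OF bdd_rv_add[OF bdd_rv_mult[OF bA bdd_rv_mean[OF g]]
        bdd_rv_mult[OF bA bdd_rv_regular[OF regular_poisson[OF g]]]] bdd_rv_mult[OF bA bdd_rv_regular[OF rD]]]
      expectation_add_bdd[OF bdd_rv_mult[OF bA bdd_rv_mean[OF g]] bdd_rv_mult[OF bA bdd_rv_regular[OF regular_poisson[OF g]]]] ..
  also have "expectation (\<lambda>\<omega>. A (th n \<omega>) (X n \<omega>) * P (th n \<omega>) (poisson g (th n \<omega>)) (X n \<omega>)) =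
      expectation (\<lambda>\<omega>. A (th n \<omega>) (X n \<omega>) * poisson g (th n \<omega>) (X (Suc n) \<omega>))"
    by (rule markov[OF A L regular_poisson[OF g], symmetric])
  finally show ?thesis .
qed

text \<open>Chebyshev's sum inequality gives exactly the linearised rate \<open>2/d\<close>, globally.\<close>

lemma V_drift:
  assumes th: "\<theta> \<in> Theta"
  shows "2 / CARD('d) * V \<theta> \<le> (\<Sum>i\<in>UNIV. slope (wr i \<theta>) * mean (growth i) \<theta>)"
proof -
  have S: "ssum \<theta> = (\<Sum>i\<in>UNIV. wr i \<theta>)" by (simp add: ssum_def wr_def)
  have mono: "0 \<le> (x - y) * (excess x - excess y)" for x y
  proof -
    have "excess x \<le> excess y" if "x \<le> y" for x y
      unfolding excess_def using that by (intro power_mono) auto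
    thus ?thesis by (cases "x \<le> y") (auto intro!: mult_nonpos_nonpos)
  qed
  have "ssum \<theta> * V \<theta> \<le> CARD('d) * (\<Sum>i\<in>UNIV. wr i \<theta> * excess (wr i \<theta>))"
    unfolding S V_def by (rule Chebyshev_sum_similarly_ordered) (rule mono)
  hence "2 / CARD('d) * V \<theta> \<le> 2 * (\<Sum>i\<in>UNIV. wr i \<theta> * excess (wr i \<theta>)) / ssum \<theta>"
    using ssum_pos[OF th] by (simp add: field_simps)
  also have "\<dots> = (\<Sum>i\<in>UNIV. slope (wr i \<theta>) * mean (growth i) \<theta>)"
    unfolding mean_growth[OF th] wr_def[symmetric] times_divide_eq_right slope_mult
    by (simp add: sum_distrib_left sum_divide_distrib)
  finally show ?thesis .
qed

lemma V_step:
  assumes w: "\<omega> \<in> space M" and g: "gamma (Suc n) \<le> 1/2"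
  shows "V (th (Suc n) \<omega>) \<le> V (th n \<omega>)
      - gamma (Suc n) * (\<Sum>i\<in>UNIV. slope (wr i (th n \<omega>)) * growth i (th n \<omega>) (X (Suc n) \<omega>))
      + 16 * (gamma (Suc n))\<^sup>2 * (CARD('d) + V (th n \<omega>))"
    and "\<bar>slope (wr i (th (Suc n) \<omega>)) - slope (wr i (th n \<omega>))\<bar> \<le> 24 * gamma (Suc n) * (1 + excess (wr i (th n \<omega>)))"
proof -
  have e: "wr i (th (Suc n) \<omega>) = wr i (th n \<omega>) / (1 + gamma (Suc n) * growth i (th n \<omega>) (X (Suc n) \<omega>))" for i
    by (simp add: wr_def th_step[OF w])
  note s = excess_step[OF wr_pos[OF th_Theta[OF w]] growth_le_1[OF th_Theta[OF w]] less_imp_le[OF gamma_pos] g, simplified]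
  have "V (th (Suc n) \<omega>) \<le> (\<Sum>i\<in>UNIV. excess (wr i (th n \<omega>))
      - gamma (Suc n) * (slope (wr i (th n \<omega>)) * growth i (th n \<omega>) (X (Suc n) \<omega>))
      + 16 * (gamma (Suc n))\<^sup>2 * (1 + excess (wr i (th n \<omega>))))"
    unfolding V_def e by (intro sum_mono s(1))
  thus "V (th (Suc n) \<omega>) \<le> V (th n \<omega>)
      - gamma (Suc n) * (\<Sum>i\<in>UNIV. slope (wr i (th n \<omega>)) * growth i (th n \<omega>) (X (Suc n) \<omega>))
      + 16 * (gamma (Suc n))\<^sup>2 * (CARD('d) + V (th n \<omega>))"
  proof -
    have "(\<Sum>i\<in>UNIV. e i - g * a i + k * (1 + e i)) = (\<Sum>i\<in>UNIV. e i) - g * (\<Sum>i\<in>UNIV. a i) + k * (CARD('d) + (\<Sum>i\<in>UNIV. e i))"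
      for e a :: "'d \<Rightarrow> real" and g k
      by (simp add: sum.distrib sum_subtractf sum_distrib_left[symmetric])
    with \<open>V (th (Suc n) \<omega>) \<le> _\<close> show ?thesis unfolding V_def by (simp only:)
  qed
  show "\<bar>slope (wr i (th (Suc n) \<omega>)) - slope (wr i (th n \<omega>))\<bar> \<le> 24 * gamma (Suc n) * (1 + excess (wr i (th n \<omega>)))"
    unfolding e by (rule s(2))
qed

definition v :: "nat \<Rightarrow> real" where "v n = expectation (\<lambda>\<omega>. V (th n \<omega>))"

lemma v_nonneg: "0 \<le> v n" unfolding v_def by (intro Bochner_Integration.integral_nonneg V_nonneg)

text \<open>\<open>C n\<close> is the boundary term of the summation by parts. The multiplier
  \<open>slope\<close> is unbounded on the simplex, but it and its change in one step are controlled
  by \<open>1 + V\<close>, so the error is proportional to \<open>1 + v n\<close>.\<close>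

lemma slope_growth_term:
  obtains K C where "0 \<le> K" "\<And>n. \<bar>C n\<bar> \<le> K * (1 + v n)"
    "\<And>n. gamma (Suc n) \<le> 1/2 \<Longrightarrow>
      expectation (\<lambda>\<omega>. slope (wr i (th n \<omega>)) * mean (growth i) (th n \<omega>)) + C n - C (Suc n) - K * gamma (Suc n) * (1 + v n)
      \<le> expectation (\<lambda>\<omega>. slope (wr i (th n \<omega>)) * growth i (th n \<omega>) (X (Suc n) \<omega>))"
proof -
  define D where "D = (\<lambda>\<theta>. P \<theta> (poisson (growth i) \<theta>))"
  have rD: "regular D" unfolding D_def by (intro regular_P regular_poisson regular_growth)
  obtain K where K: "0 \<le> K" "\<And>\<theta> x. \<theta> \<in> Theta \<Longrightarrow> \<bar>D \<theta> x\<bar> \<le> K"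
    "\<And>n A A'. gamma (Suc n) \<le> 1/2 \<Longrightarrow> bdd_rv A \<Longrightarrow> bdd_rv A' \<Longrightarrow>
      \<bar>expectation (\<lambda>\<omega>. A' \<omega> * D (th (Suc n) \<omega>) (X (Suc n) \<omega>)) - expectation (\<lambda>\<omega>. A \<omega> * D (th n \<omega>) (X (Suc n) \<omega>))\<bar>
      \<le> K * expectation (\<lambda>\<omega>. \<bar>A' \<omega> - A \<omega>\<bar>) + 2 * K * gamma (Suc n) * expectation (\<lambda>\<omega>. \<bar>A \<omega>\<bar>)"
    by (rule telescope[OF rD]) (rule that)
  define C where "C = (\<lambda>n. expectation (\<lambda>\<omega>. slope (wr i (th n \<omega>)) * D (th n \<omega>) (X n \<omega>)))"
  have sl: "\<bar>slope (wr i (th n \<omega>))\<bar> \<le> 4 * (1 + V (th n \<omega>))" if w: "\<omega> \<in> space M" for n \<omega>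
  proof -
    have "slope (wr i (th n \<omega>)) \<le> 4 * (1 + excess (wr i (th n \<omega>)))" "0 \<le> slope (wr i (th n \<omega>))"
      by (intro slope_bounds less_imp_le wr_pos th_Theta w)+
    moreover have "4 * (1 + excess (wr i (th n \<omega>))) \<le> 4 * (1 + V (th n \<omega>))" using excess_le_V by simp
    ultimately show ?thesis by simp
  qed
  have Esl: "expectation (\<lambda>\<omega>. \<bar>slope (wr i (th n \<omega>))\<bar>) \<le> 4 * (1 + v n)" for n
  proof -
    have "expectation (\<lambda>\<omega>. \<bar>slope (wr i (th n \<omega>))\<bar>) \<le> expectation (\<lambda>\<omega>. 4 * (1 + V (th n \<omega>)))"
      by (intro expectation_mono_bdd bdd_rv_intros bdd_rv_slope bdd_rv_V sl)
    also have "\<dots> = 4 * (1 + v n)"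
      using bdd_rv_integrable[OF bdd_rv_V] by (simp add: v_def prob_space)
    finally show ?thesis .
  qed
  show ?thesis
  \<comment> \<open>\<open>4 * K\<close> bounds \<open>C n\<close>; \<open>24 * K\<close> for the
    change of \<open>slope\<close> and \<open>8 * K\<close> for that of the weights make up
    \<open>32 * K\<close>.\<close>
  proof (rule that[of "4 * K + 32 * K" C])
    show "0 \<le> 4 * K + 32 * K" using K(1) by simp
    fix n
    have "\<bar>C n\<bar> \<le> expectation (\<lambda>\<omega>. K * \<bar>slope (wr i (th n \<omega>))\<bar>)"
      unfolding C_def
    proof (rule abs_expectation_le_bdd)
      fix \<omega> assume "\<omega> \<in> space M"
      from K(2)[OF th_Theta[OF this], of n "X n \<omega>"]
      show "\<bar>slope (wr i (th n \<omega>)) * D (th n \<omega>) (X n \<omega>)\<bar> \<le> K * \<bar>slope (wr i (th n \<omega>))\<bar>"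
        unfolding abs_mult mult.commute[of K] by (intro mult_left_mono) auto
    qed (intro bdd_rv_intros bdd_rv_slope bdd_rv_regular[OF rD])+
    also have "\<dots> \<le> K * (4 * (1 + v n))" using mult_left_mono[OF Esl K(1)] by simp
    also have "\<dots> \<le> (4 * K + 32 * K) * (1 + v n)" using K(1) v_nonneg[of n] by (simp add: algebra_simps)
    finally show "\<bar>C n\<bar> \<le> (4 * K + 32 * K) * (1 + v n)" .
    assume g: "gamma (Suc n) \<le> 1/2"
    have g0: "0 \<le> gamma (Suc n)" using gamma_pos[of "Suc n"] by simp
    have dsl: "expectation (\<lambda>\<omega>. \<bar>slope (wr i (th (Suc n) \<omega>)) - slope (wr i (th n \<omega>))\<bar>) \<le> 24 * gamma (Suc n) * (1 + v n)"
    proof -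
      have "expectation (\<lambda>\<omega>. \<bar>slope (wr i (th (Suc n) \<omega>)) - slope (wr i (th n \<omega>))\<bar>) \<le>
        expectation (\<lambda>\<omega>. 24 * gamma (Suc n) * (1 + V (th n \<omega>)))"
      proof (intro expectation_mono_bdd bdd_rv_intros bdd_rv_slope bdd_rv_V)
        fix \<omega> assume w: "\<omega> \<in> space M"
        have "24 * gamma (Suc n) * (1 + excess (wr i (th n \<omega>))) \<le> 24 * gamma (Suc n) * (1 + V (th n \<omega>))"
          using excess_le_V[of i "th n \<omega>"] g0 by (intro mult_left_mono) auto
        thus "\<bar>slope (wr i (th (Suc n) \<omega>)) - slope (wr i (th n \<omega>))\<bar> \<le> 24 * gamma (Suc n) * (1 + V (th n \<omega>))"
          using V_step(2)[OF w g, of i] by linarith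
      qed
      also have "\<dots> = 24 * gamma (Suc n) * (1 + v n)"
        using bdd_rv_integrable[OF bdd_rv_V] by (simp add: v_def prob_space)
      finally show ?thesis .
    qed
    have t: "\<bar>C (Suc n) - expectation (\<lambda>\<omega>. slope (wr i (th n \<omega>)) * D (th n \<omega>) (X (Suc n) \<omega>))\<bar> \<le>
      K * (24 * gamma (Suc n) * (1 + v n)) + 2 * K * gamma (Suc n) * (4 * (1 + v n))"
      unfolding C_def
      by (rule order_trans[OF K(3)[OF g bdd_rv_slope bdd_rv_slope]])
        (use K(1) g0 in \<open>intro add_mono mult_left_mono dsl Esl, auto\<close>)
    have m: "(\<lambda>(\<theta>, x :: 'x). slope (wr i \<theta>)) \<in> borel_measurable (borel \<Otimes>\<^sub>M borel)"
      unfolding split_beta by measurable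
    have av: "expectation (\<lambda>\<omega>. slope (wr i (th n \<omega>)) * growth i (th n \<omega>) (X (Suc n) \<omega>)) =
      expectation (\<lambda>\<omega>. slope (wr i (th n \<omega>)) * mean (growth i) (th n \<omega>)) + C n
      - expectation (\<lambda>\<omega>. slope (wr i (th n \<omega>)) * D (th n \<omega>) (X (Suc n) \<omega>))"
      unfolding C_def D_def by (rule average_next[OF regular_growth m bdd_rv_slope])
    have "0 \<le> K * gamma (Suc n) * (1 + v n)" using K(1) g0 v_nonneg[of n] by simp
    moreover have "K * (24 * gamma (Suc n) * (1 + v n)) + 2 * K * gamma (Suc n) * (4 * (1 + v n)) =
      32 * (K * gamma (Suc n) * (1 + v n))" by (simp add: algebra_simps)
    moreover have "(4 * K + 32 * K) * gamma (Suc n) * (1 + v n) = 36 * (K * gamma (Suc n) * (1 + v n))" by (simp add: algebra_simps)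
    ultimately show "expectation (\<lambda>\<omega>. slope (wr i (th n \<omega>)) * mean (growth i) (th n \<omega>)) + C n - C (Suc n)
        - (4 * K + 32 * K) * gamma (Suc n) * (1 + v n)
      \<le> expectation (\<lambda>\<omega>. slope (wr i (th n \<omega>)) * growth i (th n \<omega>) (X (Suc n) \<omega>))"
      unfolding av using t by linarith
  qed
qed

text \<open>The increments of \<open>C\<close> are a priori of order one, so \<open>gamma\<close>
  times them competes with the drift; they are kept in telescoping form and absorbed later.\<close>

lemma v_recursion:
  obtains K C where "0 \<le> K" "\<And>n. \<bar>C n\<bar> \<le> K * (1 + v n)"
    "\<And>n. gamma (Suc n) \<le> 1/2 \<Longrightarrow>
      v (Suc n) \<le> (1 - 2 / CARD('d) * gamma (Suc n)) * v n - gamma (Suc n) * (C n - C (Suc n))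
        + K * (gamma (Suc n))\<^sup>2 * (1 + v n)"
proof -
  \<comment> \<open>\<open>Q\<close> packages the three conclusions, so that constants can be chosen
    for all cells at once.\<close>
  define Q where "Q i K C \<longleftrightarrow> 0 \<le> K \<and> (\<forall>n. \<bar>C n\<bar> \<le> K * (1 + v n)) \<and> (\<forall>n. gamma (Suc n) \<le> 1/2 \<longrightarrow>
      expectation (\<lambda>\<omega>. slope (wr i (th n \<omega>)) * mean (growth i) (th n \<omega>)) + C n - C (Suc n) - K * gamma (Suc n) * (1 + v n)
      \<le> expectation (\<lambda>\<omega>. slope (wr i (th n \<omega>)) * growth i (th n \<omega>) (X (Suc n) \<omega>)))" for i K C
  have "\<exists>K C. Q i K C" for i
    unfolding Q_def by (rule slope_growth_term[of i]) blast
  then obtain Ki Ci where Q: "\<And>i. Q i (Ki i) (Ci i)" by metis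
  note Ki = Q[unfolded Q_def, THEN conjunct1] Q[unfolded Q_def, THEN conjunct2, THEN conjunct1, rule_format]
    Q[unfolded Q_def, THEN conjunct2, THEN conjunct2, rule_format]
  define S where "S = (\<Sum>i\<in>UNIV. Ki i)"
  define C where "C = (\<lambda>n. \<Sum>i\<in>UNIV. Ci i n)"
  have S0: "0 \<le> S" unfolding S_def using Ki(1) by (intro sum_nonneg) auto
  show ?thesis
  proof (rule that[of "S + 16 * real CARD('d)" C])
    show "0 \<le> S + 16 * real CARD('d)" using S0 by simp
    fix n
    have "\<bar>C n\<bar> \<le> (\<Sum>i\<in>UNIV. Ki i * (1 + v n))"
      unfolding C_def by (rule order_trans[OF sum_abs sum_mono]) (rule Ki(2))
    also have "\<dots> = S * (1 + v n)" by (simp add: S_def sum_distrib_right)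
    also have "\<dots> \<le> (S + 16 * real CARD('d)) * (1 + v n)" using v_nonneg[of n] by (intro mult_right_mono) auto
    finally show "\<bar>C n\<bar> \<le> (S + 16 * real CARD('d)) * (1 + v n)" .
    assume g: "gamma (Suc n) \<le> 1/2"
    have g0: "0 \<le> gamma (Suc n)" using gamma_pos[of "Suc n"] by simp
    note bd = bdd_rv_intros bdd_rv_V bdd_rv_slope bdd_rv_regular[OF regular_growth] bdd_rv_mean[OF regular_growth] finite
    have "v (Suc n) \<le> expectation (\<lambda>\<omega>. V (th n \<omega>)
      - gamma (Suc n) * (\<Sum>i\<in>UNIV. slope (wr i (th n \<omega>)) * growth i (th n \<omega>) (X (Suc n) \<omega>))
      + 16 * (gamma (Suc n))\<^sup>2 * (CARD('d) + V (th n \<omega>)))"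
      unfolding v_def by (rule expectation_mono_bdd) ((intro bd)+, rule V_step(1)[OF _ g])
    also have "\<dots> = v n - gamma (Suc n) * (\<Sum>i\<in>UNIV. expectation (\<lambda>\<omega>. slope (wr i (th n \<omega>)) * growth i (th n \<omega>) (X (Suc n) \<omega>)))
      + 16 * (gamma (Suc n))\<^sup>2 * (CARD('d) + v n)"
    proof -
      have 1: "expectation (\<lambda>\<omega>. \<Sum>i\<in>UNIV. slope (wr i (th n \<omega>)) * growth i (th n \<omega>) (X (Suc n) \<omega>)) =
        (\<Sum>i\<in>UNIV. expectation (\<lambda>\<omega>. slope (wr i (th n \<omega>)) * growth i (th n \<omega>) (X (Suc n) \<omega>)))"
        by (rule Bochner_Integration.integral_sum) (intro bdd_rv_integrable bd)
      have 2: "expectation (\<lambda>\<omega>. CARD('d) + V (th n \<omega>)) = CARD('d) + v n"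
        using bdd_rv_integrable[OF bdd_rv_V] by (simp add: v_def prob_space)
      show ?thesis
        by (subst expectation_add_bdd, (intro bd)+, subst expectation_diff_bdd, (intro bd)+)
          (simp only: integral_mult_right_zero 1 2 v_def)
    qed
    also have "\<dots> \<le> v n - gamma (Suc n) * (2 / CARD('d) * v n + (C n - C (Suc n)) - S * gamma (Suc n) * (1 + v n))
      + 16 * (gamma (Suc n))\<^sup>2 * (CARD('d) + v n)"
    proof -
      have "2 / CARD('d) * v n = expectation (\<lambda>\<omega>. 2 / CARD('d) * V (th n \<omega>))" by (simp add: v_def)
      also have "\<dots> \<le> expectation (\<lambda>\<omega>. \<Sum>i\<in>UNIV. slope (wr i (th n \<omega>)) * mean (growth i) (th n \<omega>))"
        by (rule expectation_mono_bdd) ((intro bd)+, rule V_drift[OF th_Theta])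
      also have "\<dots> = (\<Sum>i\<in>UNIV. expectation (\<lambda>\<omega>. slope (wr i (th n \<omega>)) * mean (growth i) (th n \<omega>)))"
        by (rule Bochner_Integration.integral_sum) (intro bdd_rv_integrable bd)
      finally have dr: "2 / CARD('d) * v n \<le> (\<Sum>i\<in>UNIV. expectation (\<lambda>\<omega>. slope (wr i (th n \<omega>)) * mean (growth i) (th n \<omega>)))" .
      have "(\<Sum>i\<in>UNIV. expectation (\<lambda>\<omega>. slope (wr i (th n \<omega>)) * mean (growth i) (th n \<omega>)) + Ci i n - Ci i (Suc n) - Ki i * gamma (Suc n) * (1 + v n))
        \<le> (\<Sum>i\<in>UNIV. expectation (\<lambda>\<omega>. slope (wr i (th n \<omega>)) * growth i (th n \<omega>) (X (Suc n) \<omega>)))"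
        by (intro sum_mono Ki(3)[OF g])
      moreover have "(\<Sum>i\<in>UNIV. expectation (\<lambda>\<omega>. slope (wr i (th n \<omega>)) * mean (growth i) (th n \<omega>)) + Ci i n - Ci i (Suc n) - Ki i * gamma (Suc n) * (1 + v n)) =
        (\<Sum>i\<in>UNIV. expectation (\<lambda>\<omega>. slope (wr i (th n \<omega>)) * mean (growth i) (th n \<omega>))) + C n - C (Suc n) - S * gamma (Suc n) * (1 + v n)"
        by (simp add: C_def S_def sum.distrib sum_subtractf sum_distrib_right)
      ultimately have "2 / CARD('d) * v n + (C n - C (Suc n)) - S * gamma (Suc n) * (1 + v n) \<le>
        (\<Sum>i\<in>UNIV. expectation (\<lambda>\<omega>. slope (wr i (th n \<omega>)) * growth i (th n \<omega>) (X (Suc n) \<omega>)))"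
        using dr by linarith
      from mult_left_mono[OF this g0] show ?thesis by linarith
    qed
    also have "\<dots> = (1 - 2 / CARD('d) * gamma (Suc n)) * v n - gamma (Suc n) * (C n - C (Suc n))
        + S * (gamma (Suc n))\<^sup>2 * (1 + v n) + 16 * (gamma (Suc n))\<^sup>2 * (CARD('d) + v n)"
      by (simp add: algebra_simps power2_eq_square)
    also have "\<dots> \<le> (1 - 2 / CARD('d) * gamma (Suc n)) * v n - gamma (Suc n) * (C n - C (Suc n))
        + S * (gamma (Suc n))\<^sup>2 * (1 + v n) + 16 * (gamma (Suc n))\<^sup>2 * (CARD('d) * (1 + v n))"
    proof -
      have "real CARD('d) + v n \<le> CARD('d) * (1 + v n)"
        using mult_right_mono[of 1 "real CARD('d)" "v n"] d2 v_nonneg[of n] by (simp add: distrib_left)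
      thus ?thesis by (intro add_left_mono mult_left_mono) auto
    qed
    also have "\<dots> = (1 - 2 / CARD('d) * gamma (Suc n)) * v n - gamma (Suc n) * (C n - C (Suc n))
        + (S + 16 * real CARD('d)) * (gamma (Suc n))\<^sup>2 * (1 + v n)"
      by (simp only: distrib_right mult.assoc) (simp only: mult.left_commute)
    finally show "v (Suc n) \<le> (1 - 2 / CARD('d) * gamma (Suc n)) * v n - gamma (Suc n) * (C n - C (Suc n))
        + (S + 16 * real CARD('d)) * (gamma (Suc n))\<^sup>2 * (1 + v n)" .
  qed
qed

section \<open>Mean-square rate of convergence\<close>

text \<open>The relative decrease of the step size per unit of step size. Its limit
  \<open>rho\<close> is the expansion rate caused by renormalising; \<open>kap\<close> is the
  contraction rate left for the squared rescaled error.\<close>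

definition rr :: "nat \<Rightarrow> real" where "rr n = (gamma n / gamma (Suc n) - 1) / gamma (Suc n)"
definition kap :: real where "kap = 2 / CARD('d) - rho"

lemma kap_pos: "0 < kap" using rho_less by (simp add: kap_def)

lemma gamma_rr: "gamma n = gamma (Suc n) * (1 + rr n * gamma (Suc n))"
  using gamma_pos[of "Suc n"] by (simp add: rr_def)

lemma rr_nonneg: "n \<ge> 1 \<Longrightarrow> 0 \<le> rr n"
  unfolding rr_def using gamma_mono[of n] gamma_pos[of "Suc n"] by (simp add: pos_le_divide_eq)

lemma gamma_Suc_lim: "(\<lambda>n. gamma (Suc n)) \<longlonglongrightarrow> 0"
  using gamma_lim by (rule LIMSEQ_Suc)

lemma rr_lim: "rr \<longlonglongrightarrow> rho"
  unfolding rr_def[abs_def] by (rule gamma_ratio)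

lemma rr_bounded: obtains R where "0 \<le> R" "\<And>n. \<bar>rr n\<bar> \<le> R"
proof -
  have "Bseq rr" using convergent_imp_Bseq[of rr] rr_lim by (auto simp: convergent_def)
  then obtain R where "0 < R" "\<And>n. norm (rr n) \<le> R" by (auto simp: Bseq_def)
  thus ?thesis using that[of R] by simp
qed

lemma inv_card_le: "2 / real CARD('d) \<le> 1" "1 / real CARD('d) \<le> 1" "0 < 1 / real CARD('d)"
  using d2 by (auto simp: field_simps)

text \<open>Subtracting \<open>gamma n * C n\<close> absorbs the telescoping term, and division by
  \<open>gamma n\<close> lowers the rate from \<open>2/d\<close> to \<open>kap\<close>. Since
  \<open>kap\<close> is positive, the quotient stays bounded.\<close>

lemma v_le_gamma:
  obtains B R N where "0 \<le> B" "0 \<le> R" "1 \<le> N"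
    "\<And>n. n \<ge> N \<Longrightarrow> gamma n \<le> 1/2" "\<And>n. n \<ge> N \<Longrightarrow> gamma n \<le> 2 * gamma (Suc n)"
    "\<And>n. n \<ge> N \<Longrightarrow> v n \<le> B * gamma n" "\<And>n. n \<ge> N \<Longrightarrow> 0 \<le> rr n \<and> rr n \<le> R"
proof -
  obtain K C where K: "0 \<le> K" "\<And>n. \<bar>C n\<bar> \<le> K * (1 + v n)"
    "\<And>n. gamma (Suc n) \<le> 1/2 \<Longrightarrow>
      v (Suc n) \<le> (1 - 2 / CARD('d) * gamma (Suc n)) * v n - gamma (Suc n) * (C n - C (Suc n))
        + K * (gamma (Suc n))\<^sup>2 * (1 + v n)"
    by (rule v_recursion) (rule that)
  obtain R where R: "0 \<le> R" "\<And>n. \<bar>rr n\<bar> \<le> R" by (rule rr_bounded) (rule that)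
  define K1 where "K1 = K * (R + 2) + K"
  have K1: "0 \<le> K1" using K R by (simp add: K1_def)
  define a where "a = 2 / real CARD('d)"
  have a: "0 < a" "a \<le> 1" using inv_card_le by (simp_all add: a_def)
  \<comment> \<open>Chosen so that
    \<open>(1 - a * g + 2 * K1 * g^2) * (1 + rr n * g) = 1 - kn n * g\<close> for
    \<open>g = gamma (Suc n)\<close>.\<close>
  define kn where "kn n = a - rr n - 2 * K1 * gamma (Suc n) + a * (rr n * gamma (Suc n)) - 2 * K1 * (rr n * (gamma (Suc n))\<^sup>2)" for n
  have kn: "kn \<longlonglongrightarrow> kap"
  proof -
    have "kn \<longlonglongrightarrow> a - rho - 2 * K1 * 0 + a * (rho * 0) - 2 * K1 * (rho * 0\<^sup>2)"
      unfolding kn_def[abs_def] by (intro tendsto_intros rr_lim gamma_Suc_lim)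
    thus ?thesis by (simp add: kap_def a_def)
  qed
  have rg: "(\<lambda>n. rr n * gamma (Suc n)) \<longlonglongrightarrow> 0"
    using tendsto_mult[OF rr_lim gamma_Suc_lim] by simp
  have Kg: "(\<lambda>n. K * gamma n) \<longlonglongrightarrow> 0" using tendsto_mult[OF tendsto_const gamma_lim] by simp
  have kg: "(\<lambda>n. kap * gamma (Suc n)) \<longlonglongrightarrow> 0" using tendsto_mult[OF tendsto_const gamma_Suc_lim] by simp
  have "eventually (\<lambda>n. 1 \<le> n \<and> gamma n < 1/2 \<and> rr n * gamma (Suc n) < 1 \<and> K * gamma n < 1/2 \<and> kap / 2 < kn n \<and> kn n < 2 * kap
      \<and> kap * gamma (Suc n) < 1) sequentially"
    using kap_pos
    by (intro eventually_conj eventually_ge_at_top order_tendstoD(2)[OF gamma_lim] order_tendstoD(2)[OF rg]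
      order_tendstoD(2)[OF Kg] order_tendstoD[OF kn] order_tendstoD(2)[OF kg]) auto
  then obtain N where N: "\<And>n. n \<ge> N \<Longrightarrow> 1 \<le> n \<and> gamma n < 1/2 \<and> rr n * gamma (Suc n) < 1 \<and> K * gamma n < 1/2 \<and>
      kap / 2 < kn n \<and> kn n < 2 * kap \<and> kap * gamma (Suc n) < 1"
    by (auto simp: eventually_sequentially)
  \<comment> \<open>The correction carries \<open>gamma n\<close>, whereas the recursion has
    \<open>gamma (Suc n)\<close>; the mismatch is of order \<open>g^2\<close> because
    \<open>rr\<close> is bounded.\<close>
  define u where "u n = v n - gamma n * C n" for n
  have gC: "\<bar>gamma n * C n\<bar> \<le> K * gamma n + v n / 2" if n: "n \<ge> N" for n
  proof -
    have g: "0 < gamma n" using gamma_pos N[OF n] by simp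
    have "\<bar>gamma n * C n\<bar> \<le> gamma n * (K * (1 + v n))"
      unfolding abs_mult using K(2)[of n] g by (intro mult_mono) auto
    also have "\<dots> = K * gamma n + (K * gamma n) * v n" by (simp add: algebra_simps)
    also have "(K * gamma n) * v n \<le> 1/2 * v n"
      using N[OF n] v_nonneg[of n] by (intro mult_right_mono) auto
    finally show ?thesis by simp
  qed
  have u_ge: "- (K * gamma n) \<le> u n" "v n \<le> 2 * u n + 2 * (K * gamma n)" if n: "n \<ge> N" for n
  proof -
    have "gamma n * C n \<le> K * gamma n + v n / 2" using gC[OF n] abs_ge_self order_trans by blast
    thus "- (K * gamma n) \<le> u n" "v n \<le> 2 * u n + 2 * (K * gamma n)"
      using v_nonneg[of n] unfolding u_def by (simp_all add: algebra_simps)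
  qed
  have u_rec: "u (Suc n) \<le> (1 - a * gamma (Suc n) + 2 * K1 * (gamma (Suc n))\<^sup>2) * u n + 2 * K1 * (gamma (Suc n))\<^sup>2"
    if n: "n \<ge> N" for n
  proof -
    define g where "g = gamma (Suc n)"
    have g: "0 < g" "g \<le> gamma n" "gamma n = g * (1 + rr n * g)"
      using gamma_pos[of "Suc n"] gamma_mono[of n] N[OF n] gamma_rr[of n] by (auto simp: g_def)
    have g2: "gamma n \<le> 2 * g" using g(1) N[OF n] mult_left_mono[of "1 + rr n * g" 2 g] unfolding g(3) g_def by simp
    have vn: "1 + v n \<le> 2 + 2 * u n" using u_ge(2)[OF n] N[OF n] by linarith
    have "v (Suc n) \<le> (1 - a * g) * v n - g * (C n - C (Suc n)) + K * g\<^sup>2 * (1 + v n)"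
      unfolding g_def a_def using N[OF n] g(2) by (intro K(3)) (simp add: g_def)
    hence "u (Suc n) \<le> (1 - a * g) * v n - g * C n + K * g\<^sup>2 * (1 + v n)"
      by (simp add: u_def g_def[symmetric] algebra_simps)
    also have "\<dots> = (1 - a * g) * u n + ((1 - a * g) * gamma n - g) * C n + K * g\<^sup>2 * (1 + v n)"
      by (simp add: u_def algebra_simps)
    also have "((1 - a * g) * gamma n - g) * C n \<le> ((R + 2) * g\<^sup>2) * (K * (1 + v n))"
    proof -
      have "\<bar>(1 - a * g) * gamma n - g\<bar> \<le> (R + 2) * g\<^sup>2"
      proof -
        have e: "(1 - a * g) * gamma n - g = rr n * g\<^sup>2 - a * g * gamma n"
          using g(3) by (simp add: algebra_simps power2_eq_square)
        have "\<bar>rr n * g\<^sup>2\<bar> \<le> R * g\<^sup>2" unfolding abs_mult using R(2)[of n] by (intro mult_mono) auto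
        moreover have "a * g * gamma n \<le> 1 * g * (2 * g)" using a g g2 by (intro mult_mono) auto
        moreover have "0 \<le> a * g * gamma n" using a g by simp
        ultimately show ?thesis unfolding e by (simp add: power2_eq_square algebra_simps abs_le_iff)
      qed
      hence "\<bar>((1 - a * g) * gamma n - g) * C n\<bar> \<le> ((R + 2) * g\<^sup>2) * (K * (1 + v n))"
        unfolding abs_mult using K(2)[of n] R(1) by (intro mult_mono) auto
      thus ?thesis by linarith
    qed
    also have "(1 - a * g) * u n + ((R + 2) * g\<^sup>2) * (K * (1 + v n)) + K * g\<^sup>2 * (1 + v n) = (1 - a * g) * u n + (K1 * g\<^sup>2) * (1 + v n)"
      by (simp add: K1_def algebra_simps)
    also have "(K1 * g\<^sup>2) * (1 + v n) \<le> (K1 * g\<^sup>2) * (2 + 2 * u n)" using vn K1 by (intro mult_left_mono) auto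
    finally have "u (Suc n) \<le> (1 - a * g) * u n + (K1 * g\<^sup>2) * (2 + 2 * u n)" by simp
    thus ?thesis unfolding g_def[symmetric] by (simp add: algebra_simps)
  qed
  define x where "x n = u n / gamma n" for n
  have x_rec: "x (Suc n) \<le> (1 - kap / 2 * gamma (Suc n)) * x n + (2 * kap * K + 2 * K1) * gamma (Suc n)" if n: "n \<ge> N" for n
  proof -
    define g where "g = gamma (Suc n)"
    have g: "0 < g" "0 < gamma n" "gamma n = g * (1 + rr n * g)"
      using gamma_pos[of "Suc n"] gamma_pos[of n] N[OF n] gamma_rr[of n] by (auto simp: g_def)
    have "u n = gamma n * x n" using g(2) by (simp add: x_def)
    hence ux: "u n = g * ((1 + rr n * g) * x n)" by (simp only: g(3) mult.assoc)
    have "x (Suc n) = u (Suc n) / g" by (simp add: x_def g_def)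
    also have "\<dots> \<le> ((1 - a * g + 2 * K1 * g\<^sup>2) * u n + 2 * K1 * g\<^sup>2) / g"
      using u_rec[OF n] g(1) unfolding g_def[symmetric] by (intro divide_right_mono) auto
    also have "\<dots> = (1 - a * g + 2 * K1 * g\<^sup>2) * ((1 + rr n * g) * x n) + 2 * K1 * g"
      unfolding ux using g(1) by (simp add: field_simps power2_eq_square)
    also have "\<dots> = (1 - kn n * g) * x n + 2 * K1 * g"
      by (simp add: kn_def g_def[symmetric] algebra_simps power2_eq_square)
    \<comment> \<open>\<open>x n\<close> may be negative but not below \<open>- K\<close>, so
      lowering the rate from \<open>kn n\<close> to \<open>kap / 2\<close> costs at most a constant
      times \<open>g\<close>.\<close>
    also have "\<dots> = (1 - kap / 2 * g) * x n + ((kn n - kap / 2) * g) * (- x n) + 2 * K1 * g"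
      by (simp add: algebra_simps)
    also have "((kn n - kap / 2) * g) * (- x n) \<le> (2 * kap * g) * K"
    proof (cases "- x n \<le> 0")
      case True
      hence "((kn n - kap / 2) * g) * (- x n) \<le> 0" using N[OF n] g(1) by (intro mult_nonneg_nonpos) auto
      also have "0 \<le> (2 * kap * g) * K" using kap_pos g K(1) by simp
      finally show ?thesis .
    next
      case False
      have "- x n \<le> K" using u_ge(1)[OF n] g(2) by (simp add: x_def field_simps)
      thus ?thesis using False N[OF n] g(1) kap_pos by (intro mult_mono) auto
    qed
    finally show ?thesis unfolding g_def[symmetric] by (simp add: algebra_simps)
  qed
  have "\<exists>B. \<forall>n\<ge>N. x n \<le> B"
  proof (rule contraction_bounded[where g="\<lambda>n. gamma (Suc n)" and k="kap/2" and C="2 * kap * K + 2 * K1"])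
    fix n assume n: "n \<ge> N"
    show "0 \<le> gamma (Suc n)" using gamma_pos[of "Suc n"] by simp
    show "kap / 2 * gamma (Suc n) \<le> 1" using N[OF n] mult_pos_pos[OF kap_pos gamma_pos[of "Suc n"]] by simp
  qed (use x_rec kap_pos in auto)
  then obtain B where B: "\<And>n. n \<ge> N \<Longrightarrow> x n \<le> B" by blast
  show ?thesis
  proof (rule that[of "2 * max B 0 + 2 * K" R "max N 1"])
    show "0 \<le> 2 * max B 0 + 2 * K" using K(1) by simp
    fix n assume "n \<ge> max N 1"
    hence n: "n \<ge> N" "n \<ge> 1" by auto
    have g: "0 < gamma n" "0 < gamma (Suc n)" using gamma_pos n by auto
    show "gamma n \<le> 1/2" using N[OF n(1)] by simp
    show "gamma n \<le> 2 * gamma (Suc n)"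
      using gamma_rr[of n] N[OF n(1)] g mult_left_mono[of "1 + rr n * gamma (Suc n)" 2 "gamma (Suc n)"] by simp
    show "0 \<le> rr n \<and> rr n \<le> R" using rr_nonneg[OF n(2)] R(2)[of n] by simp
    have "u n \<le> max B 0 * gamma n" using B[OF n(1)] g by (simp add: x_def pos_divide_le_eq) (meson max.cobounded1 mult_right_mono less_imp_le order_trans)
    thus "v n \<le> (2 * max B 0 + 2 * K) * gamma n" using u_ge(2)[OF n(1)] by (simp add: algebra_simps)
  qed (use R in auto)
qed

section \<open>Error norms controlled by the Lyapunov function\<close>

definition l1 :: "real ^ 'd \<Rightarrow> real" where "l1 \<theta> = (\<Sum>i\<in>UNIV. \<bar>\<theta> $ i - ts $ i\<bar>)"

lemma l1_nonneg: "0 \<le> l1 \<theta>" unfolding l1_def by (intro sum_nonneg) simp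

text \<open>Both vectors have total mass one, so their \<open>l1\<close> distance is twice the mass
  \<open>m\<close> missing in the underweighted cells. This \<open>m\<close> is the mean of
  \<open>z\<close> under the weights, and its square is at most the mean of the squares.\<close>

lemma l1_sq_le: assumes th: "\<theta> \<in> Theta" shows "(l1 \<theta>)\<^sup>2 \<le> 4 * V \<theta>"
proof -
  define z where "z i = max 0 (wr i \<theta> - 1)" for i
  define m where "m = (\<Sum>i\<in>UNIV. \<theta> $ i * z i)"
  have pos: "max 0 (ts $ i - \<theta> $ i) = \<theta> $ i * z i" for i
    using Theta_pos[OF th, of i] by (auto simp: z_def wr_def max_def field_simps)
  have "l1 \<theta> = (\<Sum>i\<in>UNIV. 2 * max 0 (ts $ i - \<theta> $ i) + (\<theta> $ i - ts $ i))"
    unfolding l1_def by (intro sum.cong refl) (simp add: abs_if max_def)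
  also have "\<dots> = 2 * m + ((\<Sum>i\<in>UNIV. \<theta> $ i) - (\<Sum>i\<in>UNIV. ts $ i))"
    unfolding pos by (simp add: sum.distrib sum_subtractf sum_distrib_left m_def)
  finally have l1: "l1 \<theta> = 2 * m" using Theta_sum[OF th] ts_sum by simp
  have "0 \<le> (\<Sum>i\<in>UNIV. \<theta> $ i * (z i - m)\<^sup>2)" using Theta_pos[OF th] by (intro sum_nonneg) (simp add: less_imp_le)
  also have "\<dots> = (\<Sum>i\<in>UNIV. \<theta> $ i * (z i)\<^sup>2 - 2 * m * (\<theta> $ i * z i) + m\<^sup>2 * \<theta> $ i)"
    by (intro sum.cong refl) (simp add: power2_eq_square algebra_simps)
  also have "\<dots> = (\<Sum>i\<in>UNIV. \<theta> $ i * (z i)\<^sup>2) - 2 * m * m + m\<^sup>2 * (\<Sum>i\<in>UNIV. \<theta> $ i)"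
    by (simp add: sum.distrib sum_subtractf sum_distrib_left[symmetric] m_def)
  finally have "m\<^sup>2 \<le> (\<Sum>i\<in>UNIV. \<theta> $ i * (z i)\<^sup>2)"
    using Theta_sum[OF th] by (simp add: power2_eq_square)
  also have "\<dots> \<le> (\<Sum>i\<in>UNIV. 1 * (z i)\<^sup>2)"
    using Theta_less_1[OF th] by (intro sum_mono mult_right_mono) (auto simp: less_imp_le)
  also have "\<dots> = V \<theta>" by (simp add: V_def excess_def z_def)
  finally show ?thesis unfolding l1 by (simp add: power_mult_distrib)
qed

lemma inner_le_l1: "\<bar>t \<bullet> (\<theta> - ts)\<bar> \<le> norm t * l1 \<theta>"
proof -
  have "\<bar>t \<bullet> (\<theta> - ts)\<bar> \<le> (\<Sum>i\<in>UNIV. \<bar>t $ i * (\<theta> $ i - ts $ i)\<bar>)"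
    unfolding inner_vec_def by (simp add: sum_abs)
  also have "\<dots> \<le> (\<Sum>i\<in>UNIV. norm t * \<bar>\<theta> $ i - ts $ i\<bar>)"
    unfolding abs_mult by (intro sum_mono mult_right_mono component_le_norm_cart) simp
  finally show ?thesis by (simp add: l1_def sum_distrib_left)
qed

definition tmin :: real where "tmin = Min (range (\<lambda>i. ts $ i))"

lemma tmin: "0 < tmin" "tmin \<le> ts $ i" "tmin \<le> 1"
  using Min_ts_pos ts_ge_Min[of i] ts_ge_Min[of undefined] Theta_less_1[OF ts_in, of undefined]
  unfolding tmin_def by linarith+

text \<open>After division by \<open>ssum\<close>, the term of cell \<open>i\<close> has denominator
  \<open>\<theta> $ i * ssum \<theta>\<close>, which is at least \<open>ts $ i\<close>; the
  singularity at the boundary cancels and the bound is global.\<close>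

lemma inv_ssum_diff: assumes th: "\<theta> \<in> Theta" shows "\<bar>1 / CARD('d) - 1 / ssum \<theta>\<bar> \<le> l1 \<theta> / tmin"
proof -
  note S = ssum_pos[OF th]
  have d: "1 \<le> real CARD('d)" using d2 by simp
  have "\<bar>1 / CARD('d) - 1 / ssum \<theta>\<bar> = \<bar>ssum \<theta> - CARD('d)\<bar> / (CARD('d) * ssum \<theta>)"
    using S d by (simp add: field_simps abs_divide abs_mult)
  also have "\<dots> \<le> \<bar>ssum \<theta> - CARD('d)\<bar> / ssum \<theta>"
    using S d by (intro divide_left_mono) (auto simp: mult_le_cancel_right1)
  also have "ssum \<theta> - CARD('d) = (\<Sum>i\<in>UNIV. ts $ i / \<theta> $ i - 1)" by (simp add: ssum_def sum_subtractf)
  also have "\<bar>\<dots>\<bar> / ssum \<theta> \<le> (\<Sum>i\<in>UNIV. \<bar>ts $ i / \<theta> $ i - 1\<bar>) / ssum \<theta>"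
    using S by (intro divide_right_mono sum_abs) simp
  also have "\<dots> = (\<Sum>i\<in>UNIV. \<bar>ts $ i / \<theta> $ i - 1\<bar> / ssum \<theta>)" by (simp add: sum_divide_distrib)
  also have "\<dots> \<le> (\<Sum>i\<in>UNIV. \<bar>\<theta> $ i - ts $ i\<bar> / tmin)"
  proof (intro sum_mono)
    fix i
    have p: "0 < \<theta> $ i" by (rule Theta_pos[OF th])
    have "\<bar>ts $ i / \<theta> $ i - 1\<bar> = \<bar>\<theta> $ i - ts $ i\<bar> / \<theta> $ i"
    proof -
      have "ts $ i / \<theta> $ i - 1 = - ((\<theta> $ i - ts $ i) / \<theta> $ i)" using p by (simp add: field_simps)
      thus ?thesis using p by simp
    qed
    hence "\<bar>ts $ i / \<theta> $ i - 1\<bar> / ssum \<theta> = \<bar>\<theta> $ i - ts $ i\<bar> / (\<theta> $ i * ssum \<theta>)" by simp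
    also have "\<dots> \<le> \<bar>\<theta> $ i - ts $ i\<bar> / tmin"
      using theta_ssum_ge[OF th, of i] tmin(1) tmin(2)[of i] by (intro divide_left_mono mult_pos_pos p S) auto
    finally show "\<bar>ts $ i / \<theta> $ i - 1\<bar> / ssum \<theta> \<le> \<bar>\<theta> $ i - ts $ i\<bar> / tmin" .
  qed
  also have "\<dots> = l1 \<theta> / tmin" by (simp add: l1_def sum_divide_distrib)
  finally show ?thesis .
qed

text \<open>The nonlinear part of the drift is a product of two first-order errors, so its
  expectation is \<open>O(gamma)\<close> by the mean-square rate; no convergence of paths is
  involved.\<close>

lemma nonlinearity_le:
  assumes th: "\<theta> \<in> Theta"
  shows "\<bar>(t \<bullet> (\<theta> - ts)) * (1 / CARD('d) - 1 / ssum \<theta>)\<bar> \<le> 4 * norm t / tmin * V \<theta>"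
proof -
  have "\<bar>(t \<bullet> (\<theta> - ts)) * (1 / CARD('d) - 1 / ssum \<theta>)\<bar> \<le> (norm t * l1 \<theta>) * (l1 \<theta> / tmin)"
    unfolding abs_mult by (intro mult_mono inner_le_l1 inv_ssum_diff[OF th]) (auto simp: l1_nonneg)
  also have "\<dots> = norm t / tmin * (l1 \<theta>)\<^sup>2" by (simp add: power2_eq_square)
  also have "\<dots> \<le> norm t / tmin * (4 * V \<theta>)"
    using tmin(1) by (intro mult_left_mono l1_sq_le[OF th]) simp
  finally show ?thesis by (simp add: mult_ac)
qed

lemma mean_diff_le:
  assumes g: "regular g"
  obtains C where "0 \<le> C" "\<And>\<theta>. \<theta> \<in> Theta \<Longrightarrow> \<bar>mean g \<theta> - mean g ts\<bar> \<le> C * sqrt (V \<theta>)"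
proof -
  obtain K where K: "0 \<le> K" "\<And>\<theta> (x::'x). \<theta> \<in> Theta \<Longrightarrow> \<bar>mean g \<theta>\<bar> \<le> K"
    "\<And>\<theta> \<theta>' \<delta> (x::'x). \<theta> \<in> Theta \<Longrightarrow> \<theta>' \<in> Theta \<Longrightarrow> 0 \<le> \<delta> \<Longrightarrow> \<delta> \<le> 1 \<Longrightarrow> ratio_close \<delta> \<theta> \<theta>' \<Longrightarrow>
      \<bar>mean g \<theta> - mean g \<theta>'\<bar> \<le> K * \<delta>"
    by (rule regularE[OF regular_mean[OF g]]) (rule that)
  show ?thesis
  proof (rule that[of "2 * K * (2 / tmin)"])
    show "0 \<le> 2 * K * (2 / tmin)" using K(1) tmin(1) by simp
    fix \<theta> :: "real ^ 'd" assume th: "\<theta> \<in> Theta"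
    \<comment> \<open>With this \<open>\<delta>\<close>, \<open>V\<close> bounds the quotients
      \<open>ts $ i / \<theta> $ i\<close> directly and their inverses through
      \<open>l1 \<theta> \<le> 2 * sqrt (V \<theta>)\<close>.\<close>
    define \<delta> where "\<delta> = 2 / tmin * sqrt (V \<theta>)"
    have tm: "1 \<le> 2 / tmin" using tmin(1,3) by (simp add: field_simps)
    have d0: "0 \<le> \<delta>" using tmin(1) V_nonneg[of \<theta>] by (simp add: \<delta>_def)
    have sV: "sqrt (V \<theta>) \<le> \<delta>"
      unfolding \<delta>_def using mult_right_mono[OF tm, of "sqrt (V \<theta>)"] V_nonneg[of \<theta>] by simp
    have close: "ratio_close \<delta> \<theta> ts"
      unfolding ratio_close_def
    proof (intro allI conjI)
      fix i
      note p = Theta_pos[OF th, of i]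
      have "(max 0 (wr i \<theta> - 1))\<^sup>2 \<le> V \<theta>" using excess_le_V[of i \<theta>] by (simp add: excess_def)
      hence "max 0 (wr i \<theta> - 1) \<le> sqrt (V \<theta>)" by (rule real_le_rsqrt)
      hence "wr i \<theta> \<le> 1 + \<delta>" using sV by linarith
      thus "ts $ i \<le> (1 + \<delta>) * \<theta> $ i" using p by (simp add: wr_def pos_divide_le_eq)
      have "(l1 \<theta>) \<le> sqrt (4 * V \<theta>)" by (rule real_le_rsqrt[OF l1_sq_le[OF th]])
      hence l: "l1 \<theta> \<le> 2 * sqrt (V \<theta>)" by (simp add: real_sqrt_mult)
      have "\<theta> $ i - ts $ i \<le> l1 \<theta>"
        unfolding l1_def
        using member_le_sum[of i UNIV "\<lambda>i. \<bar>\<theta> $ i - ts $ i\<bar>"] abs_ge_self[of "\<theta> $ i - ts $ i"] by simp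
      also have "\<dots> \<le> tmin * \<delta>" using l tmin(1) by (simp add: \<delta>_def)
      also have "\<dots> \<le> ts $ i * \<delta>" using tmin(2) d0 by (intro mult_right_mono) auto
      finally show "\<theta> $ i \<le> (1 + \<delta>) * ts $ i" by (simp add: algebra_simps)
    qed
    have "\<bar>mean g \<theta> - mean g ts\<bar> \<le> 2 * K * \<delta>"
    proof (cases "\<delta> \<le> 1")
      case True
      have "\<bar>mean g \<theta> - mean g ts\<bar> \<le> K * \<delta>" by (rule K(3)[OF th ts_in d0 True close])
      also have "\<dots> \<le> 2 * K * \<delta>" using K(1) d0 by simp
      finally show ?thesis .
    next
      \<comment> \<open>The two points are far apart, and boundedness of \<open>mean g\<close>
        already gives the estimate.\<close>
      case False
      have "\<bar>mean g \<theta> - mean g ts\<bar> \<le> 2 * K" using K(2)[OF th] K(2)[OF ts_in] by linarith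
      also have "\<dots> \<le> 2 * K * \<delta>" using mult_left_mono[of 1 \<delta> "2 * K"] K(1) False by simp
      finally show ?thesis .
    qed
    thus "\<bar>mean g \<theta> - mean g ts\<bar> \<le> 2 * K * (2 / tmin) * sqrt (V \<theta>)" by (simp add: \<delta>_def)
  qed
qed

end

section \<open>Recursion for the characteristic function\<close>

text \<open>Real part of the Taylor estimate for \<open>iexp\<close>, with the factor 1/6 weakened
  to 1.\<close>

lemma cos_taylor2: "\<bar>cos (x + h) - (cos x - h * sin x - h\<^sup>2 / 2 * cos x)\<bar> \<le> \<bar>h\<bar> ^ 3" for x h :: real
proof -
  have s: "(\<Sum>k\<le>2. (\<i> * complex_of_real h) ^ k / fact k) = 1 + \<i> * h - h\<^sup>2 / 2"
    by (simp add: numeral_2_eq_2 power2_eq_square field_simps)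
  have "cmod (iexp h - (1 + \<i> * h - h\<^sup>2 / 2)) \<le> \<bar>h\<bar> ^ Suc 2 / fact (Suc 2)"
    using iexp_approx1[of h 2] unfolding s .
  also have "\<dots> \<le> \<bar>h\<bar> ^ Suc 2 / 1" by (intro divide_left_mono fact_ge_1) auto
  also have "\<dots> = \<bar>h\<bar> ^ 3" by (simp add: numeral_3_eq_3 numeral_2_eq_2)
  finally have 1: "cmod (iexp h - (1 + \<i> * h - h\<^sup>2 / 2)) \<le> \<bar>h\<bar> ^ 3" .
  have "cos (x + h) - (cos x - h * sin x - h\<^sup>2 / 2 * cos x) = Re (cis x * (iexp h - (1 + \<i> * h - h\<^sup>2 / 2)))"
    unfolding cis_conv_exp[symmetric] by (simp add: cos_add algebra_simps power2_eq_square)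
  also have "\<bar>Re (cis x * (iexp h - (1 + \<i> * h - h\<^sup>2 / 2)))\<bar> \<le> cmod (cis x * (iexp h - (1 + \<i> * h - h\<^sup>2 / 2)))"
    by (rule abs_Re_le_cmod)
  finally show ?thesis using 1 by (simp add: norm_mult)
qed

lemma abs_cos_diff_le: "\<bar>cos x - cos y\<bar> \<le> \<bar>x - y\<bar>" for x y :: real
proof -
  have "\<bar>cos x - cos y\<bar> = 2 * \<bar>sin ((x + y) / 2)\<bar> * \<bar>sin ((y - x) / 2)\<bar>"
    unfolding cos_diff_cos by (simp add: abs_mult)
  also have "\<dots> \<le> 2 * 1 * \<bar>(y - x) / 2\<bar>"
    by (intro mult_mono abs_sin_x_le_abs_x) auto
  finally show ?thesis by simp
qed

context wl_process
begin

context
  fixes t :: "real ^ 'd" and ph :: real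
begin

text \<open>\<open>corrected\<close> adds the Poisson term that turns the increments into martingale differences \<open>mincr\<close> up to
  the negligible \<open>rem\<close>, and \<open>phit\<close> subtracts the Poisson correction for the conditional variance of \<open>mincr\<close>.
  The phases \<open>ph = 0\<close> and \<open>ph = - pi / 2\<close> give the real and imaginary parts of the characteristic function.\<close>

definition ghat :: "real ^ 'd \<Rightarrow> 'x \<Rightarrow> real" where "ghat = poisson (wfield t)"
definition vhat :: "real ^ 'd \<Rightarrow> 'x \<Rightarrow> real" where "vhat = poisson (var_fun t)"
definition corrected :: "nat \<Rightarrow> 'a \<Rightarrow> real" where "corrected n \<omega> = t \<bullet> (th n \<omega> - ts) + gamma n * corr t (th n \<omega>) (X n \<omega>)"
definition scaled :: "nat \<Rightarrow> 'a \<Rightarrow> real" where "scaled n \<omega> = corrected n \<omega> / sqrt (gamma n)"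
definition mincr :: "nat \<Rightarrow> 'a \<Rightarrow> real" where
  "mincr n \<omega> = ghat (th n \<omega>) (X (Suc n) \<omega>) - corr t (th n \<omega>) (X n \<omega>)"
text \<open>The drift factor of the unscaled error times the change of normalisation; its square is
  \<open>1 - kap * gamma\<close> up to \<open>o(gamma)\<close>.\<close>

definition be :: "nat \<Rightarrow> real" where
  "be n = (1 - gamma (Suc n) / CARD('d)) * (sqrt (gamma n) / sqrt (gamma (Suc n)))"
definition rem :: "nat \<Rightarrow> 'a \<Rightarrow> real" where
  "rem n \<omega> = corrected (Suc n) \<omega> - (1 - gamma (Suc n) / CARD('d)) * corrected n \<omega> - gamma (Suc n) * mincr n \<omega>"
definition phi :: "nat \<Rightarrow> real \<Rightarrow> real" where "phi n s = expectation (\<lambda>\<omega>. cos (s * scaled n \<omega> + ph))"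
definition cc :: "nat \<Rightarrow> real \<Rightarrow> real" where
  "cc n s = expectation (\<lambda>\<omega>. cos (s * scaled n \<omega> + ph) * vhat (th n \<omega>) (X n \<omega>))"
definition uu :: real where "uu = mean (var_fun t) ts"
definition phit :: "nat \<Rightarrow> real \<Rightarrow> real" where "phit n s = phi n s - s\<^sup>2 * gamma n / 2 * cc n s"

lemma regular_ghat: "regular ghat" unfolding ghat_def by (intro regular_poisson regular_wfield)
lemma regular_vhat: "regular vhat" unfolding vhat_def by (intro regular_poisson regular_var_fun)

lemma uu_nonneg: "0 \<le> uu" unfolding uu_def by (rule mean_nonneg[OF ts_in], rule var_fun_nonneg[OF ts_in])

lemma scaled_rec: "n \<ge> 1 \<Longrightarrow> scaled (Suc n) \<omega> = be n * scaled n \<omega> + sqrt (gamma (Suc n)) * mincr n \<omega> + rem n \<omega> / sqrt (gamma (Suc n))"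
proof -
  assume n: "n \<ge> 1"
  define s where "s = sqrt (gamma (Suc n))"
  have s: "0 < s" "gamma (Suc n) = s * s" using gamma_pos[of "Suc n"] by (auto simp: s_def)
  have s': "0 < sqrt (gamma n)" using gamma_pos[OF n] by simp
  have "corrected (Suc n) \<omega> = (1 - gamma (Suc n) / CARD('d)) * corrected n \<omega> + s * s * mincr n \<omega> + rem n \<omega>"
    by (simp add: rem_def s(2)[symmetric])
  hence "scaled (Suc n) \<omega> = ((1 - gamma (Suc n) / CARD('d)) * corrected n \<omega> + s * s * mincr n \<omega> + rem n \<omega>) / s"
    by (simp add: scaled_def s_def[symmetric])
  also have "\<dots> = (1 - gamma (Suc n) / CARD('d)) * corrected n \<omega> / s + s * mincr n \<omega> + rem n \<omega> / s"
    using s(1) by (simp add: add_divide_distrib)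
  also have "(1 - gamma (Suc n) / CARD('d)) * corrected n \<omega> / s = be n * scaled n \<omega>"
    unfolding be_def scaled_def s_def[symmetric] using s(1) s' by simp
  finally show ?thesis by (simp add: s_def)
qed

text \<open>Three sources: the variation of \<open>1 / ssum\<close>, the mismatch of step sizes in
  the correction, and the motion of the weights inside it. Each is \<open>O(gamma^2)\<close> in
  mean, hence \<open>o(gamma)\<close> even after division by \<open>sqrt gamma\<close>.\<close>

lemma rem_eq:
  assumes w: "\<omega> \<in> space M"
  shows "rem n \<omega> = gamma (Suc n) * ((t \<bullet> (th n \<omega> - ts)) * (1 / CARD('d) - 1 / ssum (th n \<omega>)))
    + (gamma (Suc n) - gamma n + gamma (Suc n) * gamma n / CARD('d)) * corr t (th n \<omega>) (X n \<omega>)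
    + gamma (Suc n) * (corr t (th (Suc n) \<omega>) (X (Suc n) \<omega>) - corr t (th n \<omega>) (X (Suc n) \<omega>))"
proof -
  have f: "wfield t (th n \<omega>) (X (Suc n) \<omega>) = (t \<bullet> (ts - th n \<omega>)) / ssum (th n \<omega>)
      + ghat (th n \<omega>) (X (Suc n) \<omega>) - corr t (th n \<omega>) (X (Suc n) \<omega>)"
    using poisson_identity[OF regular_wfield[of t] th_Theta[OF w, of n], of "X (Suc n) \<omega>"]
    by (simp add: ghat_def corr_def mean_wfield[OF th_Theta[OF w]])
  have "t \<bullet> (th (Suc n) \<omega> - ts) = t \<bullet> (th n \<omega> - ts) + gamma (Suc n) * wfield t (th n \<omega>) (X (Suc n) \<omega>)"
    by (simp add: th_rec[OF w] inner_diff_right inner_add_right)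
  moreover have "t \<bullet> (ts - th n \<omega>) = - (t \<bullet> (th n \<omega> - ts))" by (simp add: inner_diff_right)
  moreover have alg: "(D + g * (- D * k + G - C2)) + g * C3 - (1 - g * j) * (D + h * C1) - g * (G - C1) =
      g * (D * (j - k)) + (g - h + g * h * j) * C1 + g * (C3 - C2)" for D g k G C1 C2 C3 j h :: real
    by (simp add: algebra_simps)
  ultimately show ?thesis
    using alg[of "t \<bullet> (th n \<omega> - ts)" "gamma (Suc n)" "1 / ssum (th n \<omega>)" "ghat (th n \<omega>) (X (Suc n) \<omega>)"
      "corr t (th n \<omega>) (X (Suc n) \<omega>)" "corr t (th (Suc n) \<omega>) (X (Suc n) \<omega>)" "1 / CARD('d)" "gamma n"
      "corr t (th n \<omega>) (X n \<omega>)"]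
    unfolding rem_def corrected_def mincr_def f by simp
qed

lemma bdd_rv_Delta: "bdd_rv (\<lambda>\<omega>. t \<bullet> (th n \<omega> - ts))"
  unfolding inner_vec_def vector_minus_component inner_real_def
  by (intro bdd_rv_sum bdd_rv_mult bdd_rv_diff bdd_rv_const bdd_rv_regular[OF regular_weight] finite)

lemma bdd_rv_corrected: "bdd_rv (corrected n)"
  unfolding corrected_def by (intro bdd_rv_intros bdd_rv_Delta bdd_rv_regular[OF regular_corr])

lemma bdd_rv_scaled: "bdd_rv (scaled n)"
  using bdd_rv_mult[OF bdd_rv_const[of "1 / sqrt (gamma n)"] bdd_rv_corrected[of n]] by (simp add: scaled_def[abs_def])

lemma bdd_rv_mincr: "bdd_rv (mincr n)"
  unfolding mincr_def by (intro bdd_rv_intros bdd_rv_regular[OF regular_corr] bdd_rv_regular[OF regular_ghat])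

lemma bdd_rv_rem: "bdd_rv (rem n)"
  unfolding rem_def by (intro bdd_rv_intros bdd_rv_corrected bdd_rv_mincr)

lemma bdd_rv_measurable: "bdd_rv A \<Longrightarrow> A \<in> borel_measurable M" by (simp add: bdd_rv_def)

lemma bdd_rv_cos: "bdd_rv A \<Longrightarrow> bdd_rv (\<lambda>\<omega>. cos (A \<omega>))"
  by (rule bdd_rvI[where L=1]) (auto dest: bdd_rv_measurable)

lemma bdd_rv_sin: "bdd_rv A \<Longrightarrow> bdd_rv (\<lambda>\<omega>. sin (A \<omega>))"
  by (rule bdd_rvI[where L=1]) (auto dest: bdd_rv_measurable)

text \<open>The phase before the new noise is added. It is determined by the state at time
  \<open>n\<close>, so the Markov property applies with its sine and cosine as multipliers.\<close>

definition al :: "nat \<Rightarrow> real \<Rightarrow> 'a \<Rightarrow> real" where "al n s \<omega> = s * (be n * scaled n \<omega>) + ph"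

lemma bdd_rv_al: "bdd_rv (al n s)"
  unfolding al_def by (intro bdd_rv_intros bdd_rv_scaled)

text \<open>\<open>al\<close> as a function of the current state, the form in which
  \<open>markov\<close> takes its multiplier.\<close>

definition af :: "nat \<Rightarrow> real \<Rightarrow> real ^ 'd \<Rightarrow> 'x \<Rightarrow> real" where
  "af n s \<theta> x = s * (be n * ((t \<bullet> (\<theta> - ts) + gamma n * corr t \<theta> x) / sqrt (gamma n))) + ph"

lemma al_af: "al n s \<omega> = af n s (th n \<omega>) (X n \<omega>)"
  by (simp add: al_def af_def scaled_def corrected_def)

lemma af_measurable: "(\<lambda>z. af n s (fst z) (snd z)) \<in> borel_measurable (borel \<Otimes>\<^sub>M borel)"
proof -
  have [measurable]: "(\<lambda>z. corr t (fst z) (snd z)) \<in> borel_measurable (borel \<Otimes>\<^sub>M borel)"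
    using regular_measurable_pair[OF regular_corr] by (simp add: split_beta)
  show ?thesis unfolding af_def by measurable
qed

lemma cos_af_measurable: "(\<lambda>(\<theta>, x). cos (af n s \<theta> x)) \<in> borel_measurable (borel \<Otimes>\<^sub>M borel)"
  using measurable_compose[OF af_measurable[of n s] borel_measurable_cos] by (simp add: split_beta)

lemma sin_af_measurable: "(\<lambda>(\<theta>, x). sin (af n s \<theta> x)) \<in> borel_measurable (borel \<Otimes>\<^sub>M borel)"
  using measurable_compose[OF af_measurable[of n s] borel_measurable_sin] by (simp add: split_beta)

text \<open>\<open>corr\<close> is the conditional expectation of \<open>ghat\<close> at the next
  position, so \<open>mincr\<close> is a martingale difference and the first-order term
  vanishes.\<close>

lemma expectation_sin_e: "expectation (\<lambda>\<omega>. sin (al n s \<omega>) * mincr n \<omega>) = 0"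
proof -
  have "expectation (\<lambda>\<omega>. sin (al n s \<omega>) * mincr n \<omega>) =
     expectation (\<lambda>\<omega>. sin (al n s \<omega>) * ghat (th n \<omega>) (X (Suc n) \<omega>)) - expectation (\<lambda>\<omega>. sin (al n s \<omega>) * corr t (th n \<omega>) (X n \<omega>))"
    unfolding mincr_def right_diff_distrib
    by (intro expectation_diff_bdd bdd_rv_mult bdd_rv_sin bdd_rv_al bdd_rv_regular[OF regular_corr] bdd_rv_regular[OF regular_ghat])
  also have "expectation (\<lambda>\<omega>. sin (al n s \<omega>) * ghat (th n \<omega>) (X (Suc n) \<omega>)) = expectation (\<lambda>\<omega>. sin (al n s \<omega>) * corr t (th n \<omega>) (X n \<omega>))"
    unfolding al_af corr_def ghat_def[symmetric]
    by (rule markov[OF sin_af_measurable _ regular_ghat, where L=1]) simp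
  finally show ?thesis by simp
qed

text \<open>When the square is expanded, the mixed term reduces to the squared conditional mean,
  which leaves the conditional variance.\<close>

lemma expectation_cos_e2:
  "expectation (\<lambda>\<omega>. cos (al n s \<omega>) * (mincr n \<omega>)\<^sup>2) = expectation (\<lambda>\<omega>. cos (al n s \<omega>) * var_fun t (th n \<omega>) (X n \<omega>))"
proof -
  let ?c = "\<lambda>\<omega>. cos (al n s \<omega>)" and ?D = "\<lambda>\<omega>. corr t (th n \<omega>) (X n \<omega>)"
  let ?g = "\<lambda>\<omega>. ghat (th n \<omega>) (X (Suc n) \<omega>)"
  let ?P = "\<lambda>\<omega>. P (th n \<omega>) (\<lambda>x. (ghat (th n \<omega>) x)\<^sup>2) (X n \<omega>)"
  have rg2: "regular (\<lambda>\<theta> x. (ghat \<theta> x)\<^sup>2)" by (rule regular_power2[OF regular_ghat])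
  have bc: "bdd_rv ?c" by (intro bdd_rv_cos bdd_rv_al)
  have bD: "bdd_rv ?D" by (rule bdd_rv_regular[OF regular_corr])
  have bg: "bdd_rv ?g" by (rule bdd_rv_regular[OF regular_ghat])
  have bg2: "bdd_rv (\<lambda>\<omega>. (?g \<omega>)\<^sup>2)" by (rule bdd_rv_power2[OF bg])
  have bP: "bdd_rv ?P" by (rule bdd_rv_regular[OF regular_P[OF rg2]])
  have 1: "expectation (\<lambda>\<omega>. ?c \<omega> * (?g \<omega>)\<^sup>2) = expectation (\<lambda>\<omega>. ?c \<omega> * ?P \<omega>)"
    unfolding al_af by (rule markov[OF cos_af_measurable _ rg2, where L=1]) simp
  have cDm: "(\<lambda>(\<theta>, x). cos (af n s \<theta> x) * corr t \<theta> x) \<in> borel_measurable (borel \<Otimes>\<^sub>M borel)"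
    using cos_af_measurable[of n s] regular_measurable_pair[OF regular_corr[of t]] by (simp add: split_beta)
  have bcD: "bdd_rv (\<lambda>\<omega>. ?c \<omega> * ?D \<omega>)" by (rule bdd_rv_mult[OF bc bD])
  then obtain L where L: "\<And>\<omega>. \<omega> \<in> space M \<Longrightarrow> \<bar>?c \<omega> * ?D \<omega>\<bar> \<le> L" unfolding bdd_rv_def by blast
  have 2: "expectation (\<lambda>\<omega>. (?c \<omega> * ?D \<omega>) * ?g \<omega>) = expectation (\<lambda>\<omega>. (?c \<omega> * ?D \<omega>) * ?D \<omega>)"
    using markov[OF cDm L[unfolded al_af] regular_ghat] unfolding al_af corr_def[of t] ghat_def[symmetric] by simp
  have "expectation (\<lambda>\<omega>. ?c \<omega> * (mincr n \<omega>)\<^sup>2) = expectation (\<lambda>\<omega>. ?c \<omega> * (?g \<omega>)\<^sup>2 - 2 * ((?c \<omega> * ?D \<omega>) * ?g \<omega>) + (?c \<omega> * ?D \<omega>) * ?D \<omega>)"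
    by (intro Bochner_Integration.integral_cong refl) (simp add: mincr_def power2_eq_square algebra_simps)
  also have "\<dots> = expectation (\<lambda>\<omega>. ?c \<omega> * (?g \<omega>)\<^sup>2) - 2 * expectation (\<lambda>\<omega>. (?c \<omega> * ?D \<omega>) * ?g \<omega>) + expectation (\<lambda>\<omega>. (?c \<omega> * ?D \<omega>) * ?D \<omega>)"
    unfolding expectation_add_bdd[OF bdd_rv_diff[OF bdd_rv_mult[OF bc bg2] bdd_rv_mult[OF bdd_rv_const bdd_rv_mult[OF bcD bg]]] bdd_rv_mult[OF bcD bD]]
      expectation_diff_bdd[OF bdd_rv_mult[OF bc bg2] bdd_rv_mult[OF bdd_rv_const bdd_rv_mult[OF bcD bg]]] integral_mult_right_zero ..
  also have "\<dots> = expectation (\<lambda>\<omega>. ?c \<omega> * ?P \<omega>) - expectation (\<lambda>\<omega>. (?c \<omega> * ?D \<omega>) * ?D \<omega>)"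
    unfolding 1 2 by simp
  also have "\<dots> = expectation (\<lambda>\<omega>. ?c \<omega> * ?P \<omega> - (?c \<omega> * ?D \<omega>) * ?D \<omega>)"
    by (rule expectation_diff_bdd[symmetric]) (intro bdd_rv_mult bc bP bD)+
  also have "\<dots> = expectation (\<lambda>\<omega>. ?c \<omega> * var_fun t (th n \<omega>) (X n \<omega>))"
    by (intro Bochner_Integration.integral_cong refl)
      (simp add: var_fun_def ghat_def power2_eq_square algebra_simps)
  finally show ?thesis .
qed

text \<open>One step of the chain acts on the corrected characteristic function \<open>phit\<close> by contraction of
  the argument and multiplication with \<open>1 - gamma s^2 uu / 2\<close>, up to a relatively negligible error.\<close>

lemma phit_step:
  obtains C N where "0 \<le> C" "1 \<le> N"
    "\<And>n s. n \<ge> N \<Longrightarrow> \<bar>s\<bar> \<le> 1 \<Longrightarrow>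
      \<bar>phit (Suc n) s - (1 - gamma (Suc n) * s\<^sup>2 * uu / 2) * phit n (s * be n)\<bar>
        \<le> \<bar>s\<bar> * gamma (Suc n) * (C * sqrt (gamma (Suc n)))"
proof -
  obtain B R N where BN: "0 \<le> B" "0 \<le> R" "1 \<le> N"
    "\<And>n. n \<ge> N \<Longrightarrow> gamma n \<le> 1/2" "\<And>n. n \<ge> N \<Longrightarrow> gamma n \<le> 2 * gamma (Suc n)"
    "\<And>n. n \<ge> N \<Longrightarrow> v n \<le> B * gamma n" "\<And>n. n \<ge> N \<Longrightarrow> 0 \<le> rr n \<and> rr n \<le> R"
    by (rule v_le_gamma) (rule that)
  obtain K1 where K1: "0 \<le> K1" "\<And>\<theta> x. \<theta> \<in> Theta \<Longrightarrow> \<bar>corr t \<theta> x\<bar> \<le> K1"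
    "\<And>\<theta> \<theta>' \<delta> x. \<theta> \<in> Theta \<Longrightarrow> \<theta>' \<in> Theta \<Longrightarrow> 0 \<le> \<delta> \<Longrightarrow> \<delta> \<le> 1 \<Longrightarrow> ratio_close \<delta> \<theta> \<theta>' \<Longrightarrow>
      \<bar>corr t \<theta> x - corr t \<theta>' x\<bar> \<le> K1 * \<delta>"
    by (rule regularE[OF regular_corr]) (rule that)
  obtain K2 where K2: "0 \<le> K2" "\<And>\<theta> x. \<theta> \<in> Theta \<Longrightarrow> \<bar>ghat \<theta> x\<bar> \<le> K2"
    by (rule regularE[OF regular_ghat]) (rule that)
  obtain K3 where K3: "0 \<le> K3" "\<And>\<theta> x. \<theta> \<in> Theta \<Longrightarrow> \<bar>vhat \<theta> x\<bar> \<le> K3"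
    "\<And>n A A'. gamma (Suc n) \<le> 1/2 \<Longrightarrow> bdd_rv A \<Longrightarrow> bdd_rv A' \<Longrightarrow>
      \<bar>expectation (\<lambda>\<omega>. A' \<omega> * vhat (th (Suc n) \<omega>) (X (Suc n) \<omega>)) - expectation (\<lambda>\<omega>. A \<omega> * vhat (th n \<omega>) (X (Suc n) \<omega>))\<bar>
      \<le> K3 * expectation (\<lambda>\<omega>. \<bar>A' \<omega> - A \<omega>\<bar>) + 2 * K3 * gamma (Suc n) * expectation (\<lambda>\<omega>. \<bar>A \<omega>\<bar>)"
    by (rule telescope[OF regular_vhat]) (rule that)
  obtain K4 where K4: "0 \<le> K4" "\<And>\<theta>. \<theta> \<in> Theta \<Longrightarrow> \<bar>mean (var_fun t) \<theta> - uu\<bar> \<le> K4 * sqrt (V \<theta>)"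
    by (rule mean_diff_le[OF regular_var_fun[of t]]) (rule that, assumption, simp add: uu_def)
  define K where "K = K1 + K2"
  have K0: "0 \<le> K" using K1(1) K2(1) by (simp add: K_def)
  define T where "T = 4 * norm t / tmin"
  have T0: "0 \<le> T" using tmin(1) by (simp add: T_def)
  define C1 where "C1 = 2 * T * B + (R + 2) * K1 + 2 * K1"
  have C1: "0 \<le> C1" using T0 BN K1(1) by (simp add: C1_def)
  \<comment> \<open>\<open>C1\<close> and \<open>K ^ 3\<close> pay for the remainder and the Taylor
    error, the \<open>K3\<close> part for the variance correction, the \<open>K4\<close> part for
    replacing the stationary variance at \<open>th n\<close> by \<open>uu\<close>. \<open>C3\<close>
    pays for the different prefactors of the variance correction at successive times.\<close>
  define C2 where "C2 = C1 + K ^ 3 + (K3 * (K + C1) + 2 * K3) / 2 + K4 * (2 * B + 1) / 4"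
  define C3 where "C3 = K3 * (3 * (R + 1) + 2 * uu) / 2"
  have main: "\<bar>phit (Suc n) s - (1 - gamma (Suc n) * s\<^sup>2 * uu / 2) * phit n (s * be n)\<bar>
        \<le> \<bar>s\<bar> * gamma (Suc n) * ((C2 + C3) * sqrt (gamma (Suc n)))" if n: "n \<ge> N" and s: "\<bar>s\<bar> \<le> 1" and Rg': "R * gamma (Suc n) \<le> 1" for n s
  proof -
    define g where "g = gamma (Suc n)"
    define r where "r = sqrt g"
    have Rg: "R * g \<le> 1" using Rg' by (simp add: g_def)
    have n1: "1 \<le> n" using n BN(3) by simp
    have g: "0 < g" "g \<le> gamma n" "gamma n \<le> 2 * g" "g \<le> 1/2" "gamma n \<le> 1/2" "gamma n = g * (1 + rr n * g)"
    proof -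
      show "0 < g" "g \<le> gamma n" "gamma n \<le> 2 * g" "gamma n \<le> 1/2" "gamma n = g * (1 + rr n * g)"
        unfolding g_def by (rule gamma_pos gamma_mono[OF n1] BN(4)[OF n] BN(5)[OF n] gamma_rr | simp)+
      thus "g \<le> 1/2" by linarith
    qed
    have r: "0 < r" "g = r * r" "r \<le> 1" using g by (auto simp: r_def real_sqrt_le_1_iff)
    have gr: "g \<le> r" using r mult_left_le[of r r] by simp
    have s2: "s\<^sup>2 \<le> \<bar>s\<bar>" "0 \<le> s\<^sup>2"
      using mult_left_le[of "\<bar>s\<bar>" "\<bar>s\<bar>"] s by (auto simp: power2_eq_square abs_mult_self_eq simp flip: abs_mult)
    have rrn: "0 \<le> rr n" "rr n \<le> R" using BN(7)[OF n] by auto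
    have d: "1 \<le> real CARD('d)" using d2 by simp
    have rem1: "\<bar>rem n \<omega>\<bar> \<le> g * T * V (th n \<omega>) + ((R + 2) * K1 + 2 * K1) * g\<^sup>2" if w: "\<omega> \<in> space M" for \<omega>
    proof -
      have 1: "\<bar>g * ((t \<bullet> (th n \<omega> - ts)) * (1 / CARD('d) - 1 / ssum (th n \<omega>)))\<bar> \<le> g * (T * V (th n \<omega>))"
        unfolding abs_mult[of g] T_def using nonlinearity_le[OF th_Theta[OF w], of t n] g(1)
        by (intro mult_mono) auto
      have "\<bar>g - gamma n + g * gamma n / CARD('d)\<bar> \<le> (R + 2) * g\<^sup>2"
      proof -
        have a: "g - gamma n = - (rr n * g\<^sup>2)" using g(6) by (simp add: power2_eq_square algebra_simps)
        have "rr n * g\<^sup>2 \<le> R * g\<^sup>2" "0 \<le> rr n * g\<^sup>2" using rrn by (auto intro: mult_right_mono)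
        moreover have "g * gamma n / CARD('d) \<le> 2 * g\<^sup>2"
        proof -
          have "g * gamma n / CARD('d) \<le> g * gamma n / 1"
            using g d by (intro divide_left_mono) auto
          also have "\<dots> \<le> g * (2 * g)" using g by simp
          finally show ?thesis by (simp add: power2_eq_square)
        qed
        moreover have "0 \<le> g * gamma n / CARD('d)" using g by simp
        moreover have "(R + 2) * g\<^sup>2 = R * g\<^sup>2 + 2 * g\<^sup>2" by (simp add: algebra_simps)
        ultimately show ?thesis unfolding a by linarith
      qed
      hence 2: "\<bar>(g - gamma n + g * gamma n / CARD('d)) * corr t (th n \<omega>) (X n \<omega>)\<bar> \<le> ((R + 2) * g\<^sup>2) * K1"
        unfolding abs_mult using K1(2)[OF th_Theta[OF w]] BN(2) by (intro mult_mono) auto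
      have "\<bar>corr t (th (Suc n) \<omega>) (X (Suc n) \<omega>) - corr t (th n \<omega>) (X (Suc n) \<omega>)\<bar> \<le> K1 * (2 * g)"
        unfolding g_def
        by (rule K1(3)[OF th_Theta[OF w] th_Theta[OF w] _ _ ratio_close_sym[OF th_step_close[OF w]]])
          (use g in \<open>auto simp: g_def\<close>)
      hence 3: "\<bar>g * (corr t (th (Suc n) \<omega>) (X (Suc n) \<omega>) - corr t (th n \<omega>) (X (Suc n) \<omega>))\<bar> \<le> g * (K1 * (2 * g))"
        unfolding abs_mult[of g] using g(1) by (intro mult_mono) auto
      have "\<bar>rem n \<omega>\<bar> \<le> g * (T * V (th n \<omega>)) + ((R + 2) * g\<^sup>2) * K1 + g * (K1 * (2 * g))"
        unfolding rem_eq[OF w] g_def[symmetric] using 1 2 3 by linarith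
      thus ?thesis by (simp add: power2_eq_square algebra_simps)
    qed
    have Erem: "expectation (\<lambda>\<omega>. \<bar>rem n \<omega>\<bar>) \<le> C1 * g\<^sup>2"
    proof -
      have "expectation (\<lambda>\<omega>. \<bar>rem n \<omega>\<bar>) \<le> expectation (\<lambda>\<omega>. g * T * V (th n \<omega>) + ((R + 2) * K1 + 2 * K1) * g\<^sup>2)"
        by (intro expectation_mono_bdd bdd_rv_abs bdd_rv_rem bdd_rv_add bdd_rv_mult bdd_rv_const bdd_rv_V rem1)
      also have "\<dots> = g * T * v n + ((R + 2) * K1 + 2 * K1) * g\<^sup>2"
        using bdd_rv_integrable[OF bdd_rv_V] by (simp add: v_def prob_space)
      also have "g * T * v n \<le> g * T * (B * (2 * g))"
        using BN(6)[OF n] mult_left_mono[OF g(3) BN(1)] g(1) T0 by (intro mult_left_mono) auto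
      finally show ?thesis by (simp add: C1_def power2_eq_square algebra_simps)
    qed
    have Erem_r: "expectation (\<lambda>\<omega>. \<bar>rem n \<omega>\<bar>) / r \<le> C1 * (g * r)"
    proof -
      have "expectation (\<lambda>\<omega>. \<bar>rem n \<omega>\<bar>) / r \<le> C1 * g\<^sup>2 / r" using Erem r(1) by (intro divide_right_mono) auto
      also have "C1 * g\<^sup>2 / r = C1 * (g * r)" unfolding r(2) using r(1) by (simp add: power2_eq_square)
      finally show ?thesis .
    qed
    have eK: "\<bar>mincr n \<omega>\<bar> \<le> K" if w: "\<omega> \<in> space M" for \<omega>
      unfolding mincr_def K_def using K2(2)[OF th_Theta[OF w], of n "X (Suc n) \<omega>"] K1(2)[OF th_Theta[OF w], of n "X n \<omega>"] by linarith
    define c where "c \<omega> = cos (al n s \<omega>)" for \<omega>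
    have bc: "bdd_rv c" unfolding c_def by (intro bdd_rv_cos bdd_rv_al)
    have c1: "\<bar>c \<omega>\<bar> \<le> 1" for \<omega> by (simp add: c_def)
    have Ec: "expectation c = phi n (s * be n)" by (simp add: c_def[abs_def] al_def phi_def mult.assoc)
    have by': "bdd_rv (\<lambda>\<omega>. cos (s * scaled (Suc n) \<omega> + ph))" by (intro bdd_rv_cos bdd_rv_add bdd_rv_mult bdd_rv_const bdd_rv_scaled)
    have y': "s * scaled (Suc n) \<omega> + ph = al n s \<omega> + s * r * mincr n \<omega> + s * (rem n \<omega> / r)" for \<omega>
      by (simp add: scaled_rec[OF n1] al_def r_def g_def algebra_simps)
    \<comment> \<open>Second-order Taylor polynomial in the martingale increment alone;
      \<open>rem\<close> is split off by the Lipschitz bound of the cosine.\<close>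
    define Q where "Q \<omega> = c \<omega> - s * r * (sin (al n s \<omega>) * mincr n \<omega>) - s\<^sup>2 * g / 2 * (c \<omega> * (mincr n \<omega>)\<^sup>2)" for \<omega>
    have bQ: "bdd_rv Q" unfolding Q_def
      by (intro bdd_rv_diff bc bdd_rv_mult bdd_rv_const bdd_rv_sin bdd_rv_al bdd_rv_mincr bdd_rv_power2)
    have tay: "\<bar>cos (s * scaled (Suc n) \<omega> + ph) - Q \<omega>\<bar> \<le> \<bar>s\<bar> * (g * r) * K ^ 3 + \<bar>s\<bar> * (\<bar>rem n \<omega>\<bar> / r)" if w: "\<omega> \<in> space M" for \<omega>
    proof -
      have 1: "\<bar>cos (s * scaled (Suc n) \<omega> + ph) - cos (al n s \<omega> + s * r * mincr n \<omega>)\<bar> \<le> \<bar>s\<bar> * (\<bar>rem n \<omega>\<bar> / r)"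
        using abs_cos_diff_le[of "s * scaled (Suc n) \<omega> + ph" "al n s \<omega> + s * r * mincr n \<omega>"] r(1)
        unfolding y' by (simp add: abs_mult abs_divide)
      have q1: "s * r * mincr n \<omega> * sin (al n s \<omega>) = s * r * (sin (al n s \<omega>) * mincr n \<omega>)" by simp
      have q2: "(s * r * mincr n \<omega>)\<^sup>2 / 2 * cos (al n s \<omega>) = s\<^sup>2 * g / 2 * (c \<omega> * (mincr n \<omega>)\<^sup>2)"
        unfolding r(2) c_def by (simp add: power2_eq_square mult_ac)
      have 2: "\<bar>cos (al n s \<omega> + s * r * mincr n \<omega>) - Q \<omega>\<bar> \<le> \<bar>s * r * mincr n \<omega>\<bar> ^ 3"
        using cos_taylor2[of "al n s \<omega>" "s * r * mincr n \<omega>"] unfolding q1 q2 Q_def c_def .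
      have "r ^ 3 = g * r" unfolding r(2) by (simp add: power3_eq_cube)
      hence "\<bar>s * r * mincr n \<omega>\<bar> ^ 3 = \<bar>s\<bar> ^ 3 * (g * r) * \<bar>mincr n \<omega>\<bar> ^ 3"
        using r(1) by (simp add: abs_mult power_mult_distrib)
      \<comment> \<open>Every error has to keep one factor \<open>abs s\<close>, since the final
        induction is relative to it; higher powers are lowered by
        \<open>abs s \<le> 1\<close>.\<close>
      also have "\<dots> \<le> \<bar>s\<bar> * (g * r) * K ^ 3"
      proof (intro mult_mono power_mono eK w)
        show "\<bar>s\<bar> ^ 3 \<le> \<bar>s\<bar>" using power_decreasing[of 1 3 "\<bar>s\<bar>"] s by simp
      qed (use g r in auto)
      finally show ?thesis using 1 2 by linarith
    qed
    have E1: "\<bar>phi (Suc n) s - expectation Q\<bar> \<le> \<bar>s\<bar> * (g * r) * (K ^ 3 + C1)"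
    proof -
      have "\<bar>phi (Suc n) s - expectation Q\<bar> = \<bar>expectation (\<lambda>\<omega>. cos (s * scaled (Suc n) \<omega> + ph) - Q \<omega>)\<bar>"
        unfolding phi_def expectation_diff_bdd[OF by' bQ] ..
      also have "\<dots> \<le> expectation (\<lambda>\<omega>. \<bar>s\<bar> * (g * r) * K ^ 3 + \<bar>s\<bar> * (\<bar>rem n \<omega>\<bar> * (1 / r)))"
      proof (rule abs_expectation_le_bdd)
        fix \<omega> assume "\<omega> \<in> space M"
        from tay[OF this] show "\<bar>cos (s * scaled (Suc n) \<omega> + ph) - Q \<omega>\<bar> \<le> \<bar>s\<bar> * (g * r) * K ^ 3 + \<bar>s\<bar> * (\<bar>rem n \<omega>\<bar> * (1 / r))"
          by simp
      qed (intro bdd_rv_diff by' bQ bdd_rv_add bdd_rv_mult bdd_rv_const bdd_rv_abs bdd_rv_rem)+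
      also have "\<dots> = \<bar>s\<bar> * (g * r) * K ^ 3 + \<bar>s\<bar> * (expectation (\<lambda>\<omega>. \<bar>rem n \<omega>\<bar>) / r)"
        using bdd_rv_integrable[OF bdd_rv_abs[OF bdd_rv_rem]] by (simp add: prob_space)
      also have "\<dots> \<le> \<bar>s\<bar> * (g * r) * K ^ 3 + \<bar>s\<bar> * (C1 * (g * r))"
        using Erem_r by (intro add_left_mono mult_left_mono) auto
      finally show ?thesis by (simp add: algebra_simps)
    qed
    define W where "W = expectation (\<lambda>\<omega>. c \<omega> * var_fun t (th n \<omega>) (X n \<omega>))"
    have EQ: "expectation Q = phi n (s * be n) - s\<^sup>2 * g / 2 * W"
    proof -
      have "expectation Q = expectation c - s * r * expectation (\<lambda>\<omega>. sin (al n s \<omega>) * mincr n \<omega>)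
          - s\<^sup>2 * g / 2 * expectation (\<lambda>\<omega>. c \<omega> * (mincr n \<omega>)\<^sup>2)"
        unfolding Q_def
        using bdd_rv_integrable[OF bc] bdd_rv_integrable[OF bdd_rv_mult[OF bdd_rv_sin[OF bdd_rv_al] bdd_rv_mincr]]
          bdd_rv_integrable[OF bdd_rv_mult[OF bc bdd_rv_power2[OF bdd_rv_mincr]]]
        by simp
      thus ?thesis unfolding expectation_sin_e expectation_cos_e2[of n s, folded c_def] Ec W_def by simp
    qed
    have m: "(\<lambda>(\<theta>, x). cos (af n s \<theta> x)) \<in> borel_measurable (borel \<Otimes>\<^sub>M borel)" by (rule cos_af_measurable)
    \<comment> \<open>The conditional variance is averaged by its own Poisson solution; the boundary
      terms are, up to small errors, the values of \<open>cc\<close> at successive times.\<close>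
    have W: "W = expectation (\<lambda>\<omega>. c \<omega> * mean (var_fun t) (th n \<omega>)) + cc n (s * be n)
        - expectation (\<lambda>\<omega>. c \<omega> * vhat (th n \<omega>) (X (Suc n) \<omega>))"
    proof -
      have "cc n (s * be n) = expectation (\<lambda>\<omega>. c \<omega> * vhat (th n \<omega>) (X n \<omega>))"
        by (simp add: cc_def c_def al_def mult.assoc)
      thus ?thesis
        using average_now[OF regular_var_fun[of t] m bc[unfolded c_def al_af]]
        unfolding W_def c_def al_af vhat_def[symmetric] by simp
    qed
    \<comment> \<open>In one step the phase moves by \<open>O(sqrt gamma)\<close> only, and that is
      enough because \<open>cc\<close> enters with a further factor \<open>gamma\<close>.\<close>
    have dc: "expectation (\<lambda>\<omega>. \<bar>cos (s * scaled (Suc n) \<omega> + ph) - c \<omega>\<bar>) \<le> \<bar>s\<bar> * r * (K + C1)"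
    proof -
      have "expectation (\<lambda>\<omega>. \<bar>cos (s * scaled (Suc n) \<omega> + ph) - c \<omega>\<bar>) \<le> expectation (\<lambda>\<omega>. \<bar>s\<bar> * r * K + \<bar>s\<bar> * (\<bar>rem n \<omega>\<bar> * (1 / r)))"
      proof (intro expectation_mono_bdd bdd_rv_abs bdd_rv_diff by' bc bdd_rv_add bdd_rv_mult bdd_rv_const bdd_rv_rem)
        fix \<omega> assume w: "\<omega> \<in> space M"
        have "\<bar>cos (s * scaled (Suc n) \<omega> + ph) - c \<omega>\<bar> \<le> \<bar>s * r * mincr n \<omega> + s * (rem n \<omega> / r)\<bar>"
          using abs_cos_diff_le[of "s * scaled (Suc n) \<omega> + ph" "al n s \<omega>"] unfolding c_def y' by (simp add: add.assoc)
        also have "\<dots> \<le> \<bar>s\<bar> * r * \<bar>mincr n \<omega>\<bar> + \<bar>s\<bar> * (\<bar>rem n \<omega>\<bar> / r)"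
          using r(1) abs_triangle_ineq[of "s * r * mincr n \<omega>" "s * (rem n \<omega> / r)"] by (simp add: abs_mult abs_divide)
        also have "\<bar>s\<bar> * r * \<bar>mincr n \<omega>\<bar> \<le> \<bar>s\<bar> * r * K" using eK[OF w] r(1) by (intro mult_left_mono) auto
        finally show "\<bar>cos (s * scaled (Suc n) \<omega> + ph) - c \<omega>\<bar> \<le> \<bar>s\<bar> * r * K + \<bar>s\<bar> * (\<bar>rem n \<omega>\<bar> * (1 / r))" by simp
      qed
      also have "\<dots> = \<bar>s\<bar> * r * K + \<bar>s\<bar> * (expectation (\<lambda>\<omega>. \<bar>rem n \<omega>\<bar>) / r)"
        using bdd_rv_integrable[OF bdd_rv_abs[OF bdd_rv_rem]] by (simp add: prob_space)
      also have "\<dots> \<le> \<bar>s\<bar> * r * K + \<bar>s\<bar> * (C1 * r)"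
      proof (intro add_left_mono mult_left_mono)
        have "C1 * (g * r) \<le> C1 * (1 * r)" using g r C1 by (intro mult_left_mono mult_right_mono) auto
        thus "expectation (\<lambda>\<omega>. \<bar>rem n \<omega>\<bar>) / r \<le> C1 * r" using Erem_r by simp
      qed simp
      finally show ?thesis by (simp add: algebra_simps)
    qed
    have E2: "\<bar>cc (Suc n) s - expectation (\<lambda>\<omega>. c \<omega> * vhat (th n \<omega>) (X (Suc n) \<omega>))\<bar> \<le> r * (K3 * (K + C1) + 2 * K3)"
    proof -
      have "\<bar>cc (Suc n) s - expectation (\<lambda>\<omega>. c \<omega> * vhat (th n \<omega>) (X (Suc n) \<omega>))\<bar> \<le>
         K3 * expectation (\<lambda>\<omega>. \<bar>cos (s * scaled (Suc n) \<omega> + ph) - c \<omega>\<bar>) + 2 * K3 * g * expectation (\<lambda>\<omega>. \<bar>c \<omega>\<bar>)"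
        unfolding cc_def g_def by (rule K3(3)[OF _ bc by']) (use g in \<open>simp add: g_def\<close>)
      also have "\<dots> \<le> K3 * (1 * r * (K + C1)) + 2 * K3 * r * 1"
      proof (intro add_mono mult_mono)
        have "\<bar>s\<bar> * r * (K + C1) \<le> 1 * r * (K + C1)" using s r K0 C1 by (intro mult_right_mono) auto
        thus "expectation (\<lambda>\<omega>. \<bar>cos (s * scaled (Suc n) \<omega> + ph) - c \<omega>\<bar>) \<le> 1 * r * (K + C1)" using dc by linarith
        have "expectation (\<lambda>\<omega>. \<bar>c \<omega>\<bar>) \<le> expectation (\<lambda>\<omega>. 1)"
          by (intro expectation_mono_bdd bdd_rv_abs bc bdd_rv_const c1)
        thus "expectation (\<lambda>\<omega>. \<bar>c \<omega>\<bar>) \<le> 1" by (simp add: prob_space)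
      qed (use K3(1) g r gr in \<open>auto intro!: Bochner_Integration.integral_nonneg\<close>)
      finally show ?thesis by (simp add: algebra_simps)
    qed
    have E3: "\<bar>expectation (\<lambda>\<omega>. c \<omega> * mean (var_fun t) (th n \<omega>)) - uu * phi n (s * be n)\<bar> \<le> r * (K4 * (2 * B + 1) / 2)"
    proof -
      have bm: "bdd_rv (\<lambda>\<omega>. mean (var_fun t) (th n \<omega>))" by (rule bdd_rv_mean[OF regular_var_fun])
      have "expectation (\<lambda>\<omega>. c \<omega> * mean (var_fun t) (th n \<omega>)) - uu * phi n (s * be n) =
          expectation (\<lambda>\<omega>. c \<omega> * mean (var_fun t) (th n \<omega>) - uu * c \<omega>)"
        unfolding Ec[symmetric] integral_mult_right_zero[symmetric]
        by (rule expectation_diff_bdd[symmetric]) (intro bdd_rv_mult bdd_rv_const bc bm)+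
      moreover have "\<bar>expectation (\<lambda>\<omega>. c \<omega> * mean (var_fun t) (th n \<omega>) - uu * c \<omega>)\<bar> \<le>
          expectation (\<lambda>\<omega>. K4 / (2 * r) * V (th n \<omega>) + K4 * r / 2)"
      proof (rule abs_expectation_le_bdd)
        fix \<omega> assume w: "\<omega> \<in> space M"
        have "\<bar>c \<omega> * mean (var_fun t) (th n \<omega>) - uu * c \<omega>\<bar> = \<bar>c \<omega>\<bar> * \<bar>mean (var_fun t) (th n \<omega>) - uu\<bar>"
          unfolding abs_mult[symmetric] by (simp add: algebra_simps)
        also have "\<dots> \<le> 1 * (K4 * sqrt (V (th n \<omega>)))"
          by (intro mult_mono c1 K4(2)[OF th_Theta[OF w]]) auto
        finally have l: "\<bar>c \<omega> * mean (var_fun t) (th n \<omega>) - uu * c \<omega>\<bar> \<le> 1 * (K4 * sqrt (V (th n \<omega>)))" .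
        \<comment> \<open>Arithmetic-geometric mean inequality with weight \<open>r\<close>; it
          leaves only the expectation of \<open>V\<close>, which is of order
          \<open>r * r\<close>.\<close>
        have "sqrt (V (th n \<omega>)) \<le> V (th n \<omega>) / (2 * r) + r / 2"
        proof -
          define z where "z = sqrt (V (th n \<omega>))"
          have z: "V (th n \<omega>) = z * z" using V_nonneg by (simp add: z_def)
          have "0 \<le> (z - r)\<^sup>2 / (2 * r)" using r(1) by simp
          also have "(z - r)\<^sup>2 / (2 * r) = z * z / (2 * r) + r / 2 - z"
            using r(1) by (simp add: power2_eq_square field_simps)
          finally have "z \<le> V (th n \<omega>) / (2 * r) + r / 2" unfolding z by simp
          thus ?thesis unfolding z_def .
        qed
        hence "1 * (K4 * sqrt (V (th n \<omega>))) \<le> K4 * (V (th n \<omega>) / (2 * r) + r / 2)"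
          using K4(1) by (simp add: mult_left_mono)
        with l show "\<bar>c \<omega> * mean (var_fun t) (th n \<omega>) - uu * c \<omega>\<bar> \<le> K4 / (2 * r) * V (th n \<omega>) + K4 * r / 2"
          by (simp add: distrib_left)
      qed (intro bdd_rv_add bdd_rv_diff bdd_rv_mult bdd_rv_const bc bm bdd_rv_V)+
      moreover have "expectation (\<lambda>\<omega>. K4 / (2 * r) * V (th n \<omega>) + K4 * r / 2) = K4 / (2 * r) * v n + K4 * r / 2"
        using bdd_rv_integrable[OF bdd_rv_V] by (simp add: v_def prob_space)
      moreover have "K4 / (2 * r) * v n \<le> K4 / (2 * r) * (B * (2 * (r * r)))"
        using BN(6)[OF n] mult_left_mono[OF g(3) BN(1)] K4(1) r(1,2) by (intro mult_left_mono) auto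
      moreover have "K4 / (2 * r) * (B * (2 * (r * r))) + K4 * r / 2 = r * (K4 * (2 * B + 1) / 2)"
        using r(1) by (simp add: field_simps)
      ultimately show ?thesis by linarith
    qed
    define F where "F = phi n (s * be n)"
    define G where "G = cc n (s * be n)"
    define E where "E = r * (K3 * (K + C1) + 2 * K3) + r * (K4 * (2 * B + 1) / 2)"
    have WE: "\<bar>W - (uu * F + G - cc (Suc n) s)\<bar> \<le> E"
      unfolding W F_def[symmetric] G_def[symmetric] E_def
      using E2 E3[folded F_def] by linarith
    have E0: "0 \<le> E" using WE by linarith
    have sg: "0 \<le> s\<^sup>2 * g / 2" using g by simp
    have "\<bar>s\<^sup>2 * g / 2 * (W - (uu * F + G - cc (Suc n) s))\<bar> \<le> (s\<^sup>2 * g / 2) * E"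
      unfolding abs_mult using WE sg by (intro mult_mono) auto
    also have "\<dots> \<le> (\<bar>s\<bar> * g / 2) * E"
      using s2 g E0 by (intro mult_right_mono divide_right_mono) auto
    finally have A: "\<bar>s\<^sup>2 * g / 2 * (W - (uu * F + G - cc (Suc n) s))\<bar> \<le> (\<bar>s\<bar> * g / 2) * E" .
    have A': "\<bar>phi (Suc n) s - s\<^sup>2 * g / 2 * cc (Suc n) s - (F - s\<^sup>2 * g / 2 * (uu * F + G))\<bar> \<le> \<bar>s\<bar> * g * (C2 * r)"
    proof -
      have "\<bar>phi (Suc n) s - (F - s\<^sup>2 * g / 2 * W)\<bar> \<le> \<bar>s\<bar> * (g * r) * (K ^ 3 + C1)"
        using E1 unfolding EQ F_def .
      moreover have "s\<^sup>2 * g / 2 * (W - (uu * F + G - cc (Suc n) s)) = s\<^sup>2 * g / 2 * W - s\<^sup>2 * g / 2 * (uu * F + G) + s\<^sup>2 * g / 2 * cc (Suc n) s"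
        by (simp add: right_diff_distrib distrib_left)
      moreover have "\<bar>s\<bar> * (g * r) * (K ^ 3 + C1) + (\<bar>s\<bar> * g / 2) * E = \<bar>s\<bar> * g * (C2 * r)"
        unfolding E_def C2_def by (simp add: field_simps)
      ultimately show ?thesis using A by linarith
    qed
    define q where "q = g * s\<^sup>2 * uu / 2"
    \<comment> \<open>The prefactor of the variance correction in \<open>phit n (s * be n)\<close>,
      apart from \<open>s^2 / 2\<close>; it has to agree with \<open>g\<close> up to
      \<open>O(g^2)\<close>.\<close>
    define bg where "bg = (be n)\<^sup>2 * gamma n"
    have bgg: "\<bar>bg - g\<bar> \<le> 3 * (R + 1) * (g * g) \<and> 0 \<le> bg \<and> bg \<le> 4 * g" if "R * g \<le> 1"
    proof -
      define x where "x = (1 - g / CARD('d)) * (1 + rr n * g)"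
      have gd: "0 \<le> g / CARD('d)" "g / CARD('d) \<le> g" using g d by (auto simp: field_simps mult_le_cancel_left1)
      have rg: "0 \<le> rr n * g" "rr n * g \<le> R * g" using rrn g by (auto intro: mult_right_mono)
      have e: "bg = g * (x * x)"
      proof -
        have "(be n)\<^sup>2 = (1 - g / CARD('d))\<^sup>2 * (gamma n / g)"
          using g unfolding be_def g_def[symmetric] by (simp add: power_mult_distrib power_divide)
        thus ?thesis unfolding bg_def x_def using g(1) g(6) by (simp add: power2_eq_square)
      qed
      have xe: "x - 1 = rr n * g * (1 - g / CARD('d)) - g / CARD('d)" by (simp add: x_def algebra_simps)
      have h: "0 \<le> 1 - g / CARD('d)" "1 - g / CARD('d) \<le> 1" using gd g(4) by linarith+
      have "0 \<le> rr n * g * (1 - g / CARD('d))" by (intro mult_nonneg_nonneg[OF rg(1) h(1)])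
      moreover have "(rr n * g) * (1 - g / CARD('d)) \<le> (R * g) * 1"
        by (rule mult_mono[OF rg(2) h(2) order_trans[OF rg] h(1)])
      moreover have "(R + 1) * g = R * g + g" by (simp add: algebra_simps)
      ultimately have x1: "\<bar>x - 1\<bar> \<le> (R + 1) * g" unfolding xe using gd rg by linarith
      have x2: "0 \<le> x" "x \<le> 2"
      proof -
        show "0 \<le> x" unfolding x_def using h rg by (intro mult_nonneg_nonneg) auto
        have "x \<le> 1 * (1 + rr n * g)" unfolding x_def using h rg by (intro mult_right_mono) auto
        moreover have "rr n * g \<le> 1" by (rule order_trans[OF rg(2) that])
        ultimately show "x \<le> 2" by simp
      qed
      have "bg - g = g * ((x - 1) * (x + 1))" unfolding e by (simp add: algebra_simps)
      hence "\<bar>bg - g\<bar> = g * (\<bar>x - 1\<bar> * \<bar>x + 1\<bar>)" using g by (simp add: abs_mult)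
      also have "\<dots> \<le> g * (((R + 1) * g) * 3)" using x1 x2 g BN(2) by (intro mult_left_mono mult_mono) auto
      finally have 1: "\<bar>bg - g\<bar> \<le> 3 * (R + 1) * (g * g)" by (simp add: algebra_simps)
      have "x * x \<le> 2 * 2" using x2 by (intro mult_mono) auto
      thus ?thesis using 1 g(1) x2 unfolding e by (auto intro!: mult_nonneg_nonneg)
    qed
    have Gb: "\<bar>G\<bar> \<le> K3"
    proof -
      have "\<bar>G\<bar> \<le> expectation (\<lambda>\<omega>. K3)"
        unfolding G_def cc_def
      proof (rule abs_expectation_le_bdd)
        fix \<omega> assume w: "\<omega> \<in> space M"
        have "\<bar>cos (s * be n * scaled n \<omega> + ph)\<bar> * \<bar>vhat (th n \<omega>) (X n \<omega>)\<bar> \<le> 1 * K3"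
          using K3(2)[OF th_Theta[OF w]] by (intro mult_mono) auto
        thus "\<bar>cos (s * be n * scaled n \<omega> + ph) * vhat (th n \<omega>) (X n \<omega>)\<bar> \<le> K3" by (simp add: abs_mult)
      qed (intro bdd_rv_mult bdd_rv_cos bdd_rv_add bdd_rv_const bdd_rv_scaled bdd_rv_regular[OF regular_vhat])+
      thus ?thesis by (simp add: prob_space)
    qed
    have s1: "s\<^sup>2 \<le> 1" using s2 s by linarith
    have q: "0 \<le> q" "q \<le> g * uu / 2"
      using g(1) uu_nonneg s1 mult_left_mono[OF s1, of "g * uu"] by (auto simp: q_def mult_ac)
    have "\<bar>(1 - q) * bg - g\<bar> \<le> (3 * (R + 1) + 2 * uu) * (g * g)"
    proof -
      have "q * bg \<le> (g * uu / 2) * (4 * g)" using q bgg[OF Rg] g uu_nonneg by (intro mult_mono) auto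
      moreover have "0 \<le> q * bg" using q bgg[OF Rg] by simp
      moreover have "(1 - q) * bg - g = (bg - g) - q * bg" by (simp add: algebra_simps)
      moreover have "(3 * (R + 1) + 2 * uu) * (g * g) = 3 * (R + 1) * (g * g) + (g * uu / 2) * (4 * g)"
        by (simp add: algebra_simps)
      ultimately show ?thesis using bgg[OF Rg] by linarith
    qed
    hence "\<bar>G * ((1 - q) * bg - g)\<bar> \<le> K3 * ((3 * (R + 1) + 2 * uu) * (g * g))"
      unfolding abs_mult using Gb K3(1) by (intro mult_mono) auto
    moreover have "0 \<le> K3 * ((3 * (R + 1) + 2 * uu) * (g * g))" using K3(1) BN(2) uu_nonneg by simp
    ultimately have "\<bar>s\<^sup>2 / 2 * (G * ((1 - q) * bg - g))\<bar> \<le> \<bar>s\<bar> / 2 * (K3 * ((3 * (R + 1) + 2 * uu) * (g * g)))"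
      unfolding abs_mult[of "s\<^sup>2 / 2"] using s2 by (intro mult_mono) auto
    also have "\<dots> = \<bar>s\<bar> * g * (C3 * g)" by (simp add: C3_def)
    also have "\<dots> \<le> \<bar>s\<bar> * g * (C3 * r)"
      using gr g(1) K3(1) BN(2) uu_nonneg by (intro mult_left_mono) (auto simp: C3_def)
    finally have Bd: "\<bar>s\<^sup>2 / 2 * (G * ((1 - q) * bg - g))\<bar> \<le> \<bar>s\<bar> * g * (C3 * r)" .
    have p1: "phit (Suc n) s = phi (Suc n) s - s\<^sup>2 * g / 2 * cc (Suc n) s" by (simp add: phit_def g_def)
    have p2: "phit n (s * be n) = F - s\<^sup>2 / 2 * (bg * G)"
      by (simp add: phit_def F_def G_def bg_def power_mult_distrib)
    have p3: "F - s\<^sup>2 * g / 2 * (uu * F + G) - (1 - q) * (F - s\<^sup>2 / 2 * (bg * G)) = s\<^sup>2 / 2 * (G * ((1 - q) * bg - g))"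
      by (simp add: q_def field_simps)
    have "\<bar>phit (Suc n) s - (1 - q) * phit n (s * be n)\<bar> \<le> \<bar>s\<bar> * g * (C2 * r) + \<bar>s\<bar> * g * (C3 * r)"
      unfolding p1 p2 using A' Bd p3 by linarith
    also have "\<dots> = \<bar>s\<bar> * g * ((C2 + C3) * r)" by (simp add: algebra_simps)
    finally show ?thesis unfolding q_def g_def r_def .
  qed
  have "(\<lambda>n. R * gamma (Suc n)) \<longlonglongrightarrow> 0" using tendsto_mult[OF tendsto_const gamma_Suc_lim] by simp
  from order_tendstoD(2)[OF this, of 1] obtain N2 where N2: "\<And>n. n \<ge> N2 \<Longrightarrow> R * gamma (Suc n) < 1"
    by (auto simp: eventually_sequentially)
  have "0 \<le> C2" "0 \<le> C3" using K0 C1 K3(1) K4(1) BN(1,2) uu_nonneg by (simp_all add: C2_def C3_def)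
  thus ?thesis using main N2 BN(3) by (intro that[of "C2 + C3" "max N N2"]) (auto simp: less_imp_le)
qed

end

section \<open>Convergence to the Gaussian fixed point\<close>

context
  fixes t :: "real ^ 'd" and ph :: real
begin

text \<open>The squared contraction factor is \<open>1 - kn n * gamma (Suc n)\<close>, and
  \<open>kn\<close> tends to \<open>kap\<close>.\<close>

definition kn :: "nat \<Rightarrow> real" where "kn n = (1 - (be n)\<^sup>2) / gamma (Suc n)"

lemma kn_lim: "kn \<longlonglongrightarrow> kap"
proof -
  define j where "j = 1 / real CARD('d)"
  define l where "l n = 2 * j - rr n + 2 * (rr n * gamma (Suc n)) * j - gamma (Suc n) * j\<^sup>2 - rr n * (gamma (Suc n))\<^sup>2 * j\<^sup>2" for n
  have "l \<longlonglongrightarrow> 2 * j - rho + 2 * (rho * 0) * j - 0 * j\<^sup>2 - rho * 0\<^sup>2 * j\<^sup>2"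
    unfolding l_def[abs_def] by (intro tendsto_intros rr_lim gamma_Suc_lim)
  hence "l \<longlonglongrightarrow> kap" by (simp add: kap_def j_def)
  moreover have "eventually (\<lambda>n. l n = kn n) sequentially"
    using eventually_ge_at_top[of 1]
  proof eventually_elim
    case (elim n)
    define g where "g = gamma (Suc n)"
    have g: "0 < g" "gamma n = g * (1 + rr n * g)" "0 < gamma n"
      using gamma_pos[of "Suc n"] gamma_pos[OF elim] gamma_rr[of n] by (auto simp: g_def)
    have "(be n)\<^sup>2 = (1 - g * j)\<^sup>2 * (gamma n / g)"
      using g unfolding be_def g_def[symmetric] by (simp add: power_mult_distrib power_divide j_def)
    also have "gamma n / g = 1 + rr n * g" using g(1,2) by simp
    finally have "1 - (be n)\<^sup>2 = g * l n"
      by (simp add: l_def g_def[symmetric] power2_eq_square algebra_simps)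
    thus ?case using g(1) by (simp add: kn_def g_def)
  qed
  ultimately show ?thesis by (rule Lim_transform_eventually)
qed

text \<open>Characteristic function of the centred normal law of variance \<open>uu t / kap\<close>:
  the law for which the loss of variance at rate \<open>kap\<close> balances the gain at rate
  \<open>uu t\<close>.\<close>

definition psi :: "real \<Rightarrow> real" where "psi s = exp (- (s\<^sup>2 * uu t / (2 * kap)))"

lemma psi_le_1: "psi s \<le> 1"
  using uu_nonneg[of t] kap_pos by (simp add: psi_def)

text \<open>Shrinking the argument multiplies \<open>psi\<close> by \<open>exp (q * h)\<close> and
  the noise factor is \<open>1 - q\<close>; since \<open>h\<close> tends to 1, they cancel to first
  order. The whole error contains a factor \<open>q\<close>, hence \<open>abs s\<close>.\<close>

lemma psi_step:
  assumes s: "\<bar>s\<bar> \<le> 1" and k: "0 \<le> kn n" and small: "gamma (Suc n) * uu t * kn n \<le> 2 * kap" and gu: "gamma (Suc n) * uu t \<le> 2"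
  defines "h \<equiv> kn n / kap"
  shows "\<bar>(1 - gamma (Suc n) * s\<^sup>2 * uu t / 2) * psi (s * be n) - psi s\<bar> \<le>
    \<bar>s\<bar> * gamma (Suc n) * (uu t / 2 * (\<bar>h - 1\<bar> + gamma (Suc n) * uu t / 2 * (h + h\<^sup>2)))"
proof -
  define g where "g = gamma (Suc n)"
  define q where "q = g * s\<^sup>2 * uu t / 2"
  have g: "0 < g" using gamma_pos[of "Suc n"] by (simp add: g_def)
  have u: "0 \<le> uu t" by (rule uu_nonneg)
  have s2: "s\<^sup>2 \<le> \<bar>s\<bar>" "s\<^sup>2 \<le> 1"
  proof -
    have "\<bar>s\<bar> * \<bar>s\<bar> \<le> \<bar>s\<bar> * 1" using s by (intro mult_left_mono) auto
    thus "s\<^sup>2 \<le> \<bar>s\<bar>" by (simp add: power2_eq_square)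
    thus "s\<^sup>2 \<le> 1" using s by linarith
  qed
  have gu0: "0 \<le> g * uu t / 2" using g u by simp
  have q: "0 \<le> q" "q \<le> g * uu t / 2" "q \<le> \<bar>s\<bar> * (g * uu t / 2)"
    using mult_right_mono[OF s2(2) gu0] mult_right_mono[OF s2(1) gu0] g u by (auto simp: q_def mult_ac)
  have h: "0 \<le> h" using k kap_pos by (simp add: h_def)
  define x where "x = q * h"
  have x0: "0 \<le> x" using q h by (simp add: x_def)
  have x1: "x \<le> 1"
  proof -
    have "x \<le> (g * uu t / 2) * h" unfolding x_def using q h by (intro mult_right_mono) auto
    also have "\<dots> = g * uu t * kn n / (2 * kap)" by (simp add: h_def)
    also have "\<dots> \<le> 1" using small kap_pos by (simp add: g_def pos_divide_le_eq)
    finally show ?thesis .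
  qed
  have q1: "q \<le> 1" using q(2) gu by (simp add: g_def)
  have be2: "(be n)\<^sup>2 = 1 - kn n * g" using g by (simp add: kn_def g_def)
  have "psi (s * be n) = psi s * exp x"
  proof -
    have "- ((s * be n)\<^sup>2 * uu t / (2 * kap)) = - (s\<^sup>2 * uu t / (2 * kap)) + x"
      unfolding power_mult_distrib be2 x_def q_def h_def using kap_pos by (simp add: field_simps)
    thus ?thesis unfolding psi_def by (simp only: exp_add)
  qed
  hence "(1 - q) * psi (s * be n) - psi s = psi s * ((1 - q) * exp x - 1)" by (simp add: algebra_simps)
  hence "\<bar>(1 - q) * psi (s * be n) - psi s\<bar> = psi s * \<bar>(1 - q) * exp x - 1\<bar>" by (simp add: abs_mult psi_def)
  also have "\<dots> \<le> 1 * \<bar>(1 - q) * exp x - 1\<bar>" using psi_le_1 by (intro mult_right_mono) auto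
  also have "\<dots> \<le> \<bar>x - q\<bar> + x * q + x\<^sup>2"
  proof -
    define E where "E = exp x - 1 - x"
    have E: "0 \<le> E" "E \<le> x\<^sup>2" using exp_ge_add_one_self[of x] exp_bound[OF x0 x1] unfolding E_def by linarith+
    have e: "(1 - q) * exp x - 1 = (x - q) - x * q + (1 - q) * E" by (simp add: E_def algebra_simps)
    have "0 \<le> (1 - q) * E" using E(1) q1 by simp
    moreover have "(1 - q) * E \<le> 1 * x\<^sup>2"
      by (rule mult_mono) (use E q(1) in simp_all)
    moreover have "0 \<le> x * q" using x0 q by simp
    ultimately show ?thesis unfolding e mult_1_left by linarith
  qed
  also have "\<dots> = q * (\<bar>h - 1\<bar> + q * (h + h\<^sup>2))"
  proof -
    have "\<bar>x - q\<bar> = q * \<bar>h - 1\<bar>"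
    proof -
      have "x - q = q * (h - 1)" by (simp add: x_def algebra_simps)
      thus ?thesis using q(1) by (simp add: abs_mult)
    qed
    thus ?thesis by (simp add: x_def power2_eq_square algebra_simps)
  qed
  also have "\<dots> \<le> (\<bar>s\<bar> * (g * uu t / 2)) * (\<bar>h - 1\<bar> + (g * uu t / 2) * (h + h\<^sup>2))"
    using q h gu0 by (intro mult_mono add_left_mono mult_right_mono add_nonneg_nonneg) auto
  also have "\<dots> = \<bar>s\<bar> * g * (uu t / 2 * (\<bar>h - 1\<bar> + g * uu t / 2 * (h + h\<^sup>2)))" by (simp add: algebra_simps)
  finally show ?thesis unfolding q_def g_def .
qed

lemma cc_bounded: obtains K where "0 \<le> K" "\<And>n s. \<bar>cc t ph n s\<bar> \<le> K"
proof -
  obtain K where K: "0 \<le> K" "\<And>\<theta> x. \<theta> \<in> Theta \<Longrightarrow> \<bar>vhat t \<theta> x\<bar> \<le> K"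
    by (rule regularE[OF regular_vhat]) (rule that)
  have "\<bar>cc t ph n s\<bar> \<le> K" for n s
  proof -
    have "\<bar>cc t ph n s\<bar> \<le> expectation (\<lambda>\<omega>. K)"
      unfolding cc_def
    proof (rule abs_expectation_le_bdd)
      fix \<omega> assume w: "\<omega> \<in> space M"
      have "\<bar>cos (s * scaled t n \<omega> + ph)\<bar> * \<bar>vhat t (th n \<omega>) (X n \<omega>)\<bar> \<le> 1 * K"
        using K(2)[OF th_Theta[OF w]] by (intro mult_mono) auto
      thus "\<bar>cos (s * scaled t n \<omega> + ph) * vhat t (th n \<omega>) (X n \<omega>)\<bar> \<le> K" by (simp add: abs_mult)
    qed (intro bdd_rv_mult bdd_rv_cos bdd_rv_add bdd_rv_const bdd_rv_scaled bdd_rv_regular[OF regular_vhat])+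
    thus ?thesis by (simp add: prob_space)
  qed
  thus ?thesis using that K(1) by blast
qed

text \<open>At \<open>s = 0\<close> both functions equal \<open>cos ph\<close>, so their distance is
  at most a multiple of \<open>abs s\<close>. This starts the induction of
  \<open>phit_tendsto\<close> at any finite time.\<close>

lemma phit_base:
  assumes n: "n \<ge> 1"
  shows "\<exists>D\<ge>0. \<forall>s. \<bar>s\<bar> \<le> 1 \<longrightarrow> \<bar>phit t ph n s - psi s * cos ph\<bar> \<le> D * \<bar>s\<bar>"
proof -
  obtain K where K: "0 \<le> K" "\<And>n s. \<bar>cc t ph n s\<bar> \<le> K" by (rule cc_bounded) (rule that)
  define D where "D = expectation (\<lambda>\<omega>. \<bar>scaled t n \<omega>\<bar>) + gamma n / 2 * K + uu t / (2 * kap)"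
  have g: "0 < gamma n" by (rule gamma_pos[OF n])
  have uk: "0 \<le> uu t / (2 * kap)" using uu_nonneg[of t] kap_pos by simp
  have E0: "0 \<le> expectation (\<lambda>\<omega>. \<bar>scaled t n \<omega>\<bar>)" by (intro Bochner_Integration.integral_nonneg) simp
  have "\<bar>phit t ph n s - psi s * cos ph\<bar> \<le> D * \<bar>s\<bar>" if s: "\<bar>s\<bar> \<le> 1" for s
  proof -
    have "\<bar>s\<bar> * \<bar>s\<bar> \<le> \<bar>s\<bar> * 1" using s by (intro mult_left_mono) auto
    hence s2: "s\<^sup>2 \<le> \<bar>s\<bar>" by (simp add: power2_eq_square)
    have "phi t ph n s - cos ph = expectation (\<lambda>\<omega>. cos (s * scaled t n \<omega> + ph) - cos ph)"
      unfolding phi_def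
      by (subst expectation_diff_bdd)
        (auto intro!: bdd_rv_cos bdd_rv_add bdd_rv_mult bdd_rv_const bdd_rv_scaled simp: prob_space)
    moreover have "\<bar>expectation (\<lambda>\<omega>. cos (s * scaled t n \<omega> + ph) - cos ph)\<bar> \<le> expectation (\<lambda>\<omega>. \<bar>s\<bar> * \<bar>scaled t n \<omega>\<bar>)"
    proof (rule abs_expectation_le_bdd)
      fix \<omega> show "\<bar>cos (s * scaled t n \<omega> + ph) - cos ph\<bar> \<le> \<bar>s\<bar> * \<bar>scaled t n \<omega>\<bar>"
        using abs_cos_diff_le[of "s * scaled t n \<omega> + ph" ph] by (simp add: abs_mult)
    qed (intro bdd_rv_diff bdd_rv_cos bdd_rv_add bdd_rv_mult bdd_rv_const bdd_rv_abs bdd_rv_scaled)+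
    ultimately have 1: "\<bar>phi t ph n s - cos ph\<bar> \<le> \<bar>s\<bar> * expectation (\<lambda>\<omega>. \<bar>scaled t n \<omega>\<bar>)" by simp
    have 2: "\<bar>s\<^sup>2 * gamma n / 2 * cc t ph n s\<bar> \<le> \<bar>s\<bar> * (gamma n / 2 * K)"
    proof -
      have "\<bar>s\<^sup>2 * gamma n / 2 * cc t ph n s\<bar> = s\<^sup>2 * (gamma n / 2 * \<bar>cc t ph n s\<bar>)" using g by (simp add: abs_mult)
      also have "\<dots> \<le> \<bar>s\<bar> * (gamma n / 2 * K)" using s2 g K by (intro mult_mono) auto
      finally show ?thesis .
    qed
    have 3: "\<bar>cos ph - psi s * cos ph\<bar> \<le> \<bar>s\<bar> * (uu t / (2 * kap))"
    proof -
      have "1 - psi s \<le> s\<^sup>2 * uu t / (2 * kap)"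
        using exp_ge_add_one_self[of "- (s\<^sup>2 * uu t / (2 * kap))"] by (simp add: psi_def)
      also have "\<dots> = s\<^sup>2 * (uu t / (2 * kap))" by simp
      also have "\<dots> \<le> \<bar>s\<bar> * (uu t / (2 * kap))" using s2 uk by (intro mult_right_mono)
      finally have a: "\<bar>1 - psi s\<bar> \<le> \<bar>s\<bar> * (uu t / (2 * kap))" using psi_le_1[of s] by simp
      have "\<bar>cos ph - psi s * cos ph\<bar> = \<bar>1 - psi s\<bar> * \<bar>cos ph\<bar>"
        unfolding abs_mult[symmetric] by (simp add: algebra_simps)
      also have "\<dots> \<le> \<bar>1 - psi s\<bar> * 1" by (intro mult_left_mono) auto
      finally show ?thesis using a by simp
    qed
    have "\<bar>phit t ph n s - psi s * cos ph\<bar> \<le> \<bar>s\<bar> * expectation (\<lambda>\<omega>. \<bar>scaled t n \<omega>\<bar>) + \<bar>s\<bar> * (gamma n / 2 * K) + \<bar>s\<bar> * (uu t / (2 * kap))"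
      unfolding phit_def using 1 2 3 by linarith
    also have "\<dots> = D * \<bar>s\<bar>" by (simp add: D_def algebra_simps)
    finally show ?thesis .
  qed
  moreover have "0 \<le> D" unfolding D_def using E0 uk g K(1) by (intro add_nonneg_nonneg) auto
  ultimately show ?thesis by blast
qed

text \<open>A bound \<open>D * abs s\<close> is propagated for all \<open>abs s \<le> 1\<close> at
  once, because the value at \<open>s\<close> refers to the previous value at
  \<open>s * be n\<close>. The shorter argument makes \<open>D\<close> contract; the noise factor is
  merely bounded by 1, so a direction of zero variance is no exception.\<close>

lemma phit_tendsto: "(\<lambda>n. phit t ph n 1) \<longlonglongrightarrow> psi 1 * cos ph"
proof -
  obtain C N0 where C: "0 \<le> C" "1 \<le> N0"
    "\<And>n s. n \<ge> N0 \<Longrightarrow> \<bar>s\<bar> \<le> 1 \<Longrightarrow>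
      \<bar>phit t ph (Suc n) s - (1 - gamma (Suc n) * s\<^sup>2 * uu t / 2) * phit t ph n (s * be n)\<bar>
        \<le> \<bar>s\<bar> * gamma (Suc n) * (C * sqrt (gamma (Suc n)))"
    by (rule phit_step[of t ph]) (rule that)
  define h where "h n = kn n / kap" for n
  \<comment> \<open>Error of one step relative to \<open>abs s * gamma\<close>: first that of
    \<open>phit_step\<close>, then that of the approximate invariance of \<open>psi\<close>.\<close>
  define ep where "ep n = C * sqrt (gamma (Suc n)) + uu t / 2 * (\<bar>h n - 1\<bar> + gamma (Suc n) * uu t / 2 * (h n + (h n)\<^sup>2))" for n
  have hl: "h \<longlonglongrightarrow> 1"
    unfolding h_def[abs_def] using tendsto_divide[OF kn_lim tendsto_const, of kap] kap_pos by simp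
  have "ep \<longlonglongrightarrow> C * sqrt 0 + uu t / 2 * (\<bar>1 - 1\<bar> + 0 * uu t / 2 * (1 + 1\<^sup>2))"
    unfolding ep_def[abs_def] by (intro tendsto_intros gamma_Suc_lim hl) auto
  hence epl: "ep \<longlonglongrightarrow> 0" by simp
  have l1: "(\<lambda>n. gamma (Suc n) * uu t * kn n) \<longlonglongrightarrow> 0 * uu t * kap" by (intro tendsto_intros gamma_Suc_lim kn_lim)
  have l2: "(\<lambda>n. gamma (Suc n) * uu t) \<longlonglongrightarrow> 0 * uu t" by (intro tendsto_intros gamma_Suc_lim)
  have l3: "(\<lambda>n. kap * gamma (Suc n)) \<longlonglongrightarrow> kap * 0" by (intro tendsto_intros gamma_Suc_lim)
  have "eventually (\<lambda>n. N0 \<le> n \<and> kap / 2 < kn n \<and> gamma (Suc n) * uu t * kn n < 2 * kap \<and> gamma (Suc n) * uu t < 2 \<and> kap * gamma (Suc n) < 1) sequentially"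
    using kap_pos
    by (intro eventually_conj eventually_ge_at_top order_tendstoD(1)[OF kn_lim] order_tendstoD(2)[OF l1]
      order_tendstoD(2)[OF l2] order_tendstoD(2)[OF l3]) auto
  then obtain N where N: "\<And>n. n \<ge> N \<Longrightarrow> N0 \<le> n \<and> kap / 2 < kn n \<and> gamma (Suc n) * uu t * kn n < 2 * kap \<and> gamma (Suc n) * uu t < 2 \<and> kap * gamma (Suc n) < 1"
    by (auto simp: eventually_sequentially)
  \<comment> \<open>Half of \<open>kap\<close> is given up for the convergence of \<open>kn\<close>,
    and half of the rest for taking the square root.\<close>
  have be: "0 \<le> be n \<and> be n \<le> 1 - kap / 4 * gamma (Suc n)" if n: "n \<ge> N" for n
  proof -
    define g where "g = gamma (Suc n)"
    have g: "0 < g" "g < 1" using gamma_pos[of "Suc n"] gamma_less_1[of "Suc n"] by (auto simp: g_def)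
    have gk: "kap * g < 1" using N[OF n] by (simp add: g_def)
    have "g / real CARD('d) \<le> g * 1" using g mult_left_mono[OF inv_card_le(2), of g] by simp
    moreover have "0 < gamma n" using gamma_pos[of n] N[OF n] C(2) by simp
    moreover have "0 \<le> 1 - g / real CARD('d)" using calculation g by linarith
    ultimately have be0: "0 \<le> be n"
      unfolding be_def g_def using gamma_pos[of "Suc n"] by (intro mult_nonneg_nonneg divide_nonneg_nonneg) auto
    have "(be n)\<^sup>2 = 1 - kn n * g" using g by (simp add: kn_def g_def)
    also have "\<dots> \<le> 1 - kap / 2 * g" using N[OF n] g(1) by (simp add: mult_right_mono less_imp_le)
    also have "\<dots> \<le> (1 - kap / 4 * g)\<^sup>2"
    proof -
      have "(1 - kap / 4 * g)\<^sup>2 = 1 - kap / 2 * g + (kap / 4 * g)\<^sup>2" unfolding power2_diff by simp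
      thus ?thesis by simp
    qed
    finally have "be n \<le> 1 - kap / 4 * g" by (rule power2_le_imp_le) (use gk in simp)
    thus ?thesis using be0 by (simp add: g_def)
  qed
  obtain D0 where D0: "0 \<le> D0" "\<And>s. \<bar>s\<bar> \<le> 1 \<Longrightarrow> \<bar>phit t ph N s - psi s * cos ph\<bar> \<le> D0 * \<bar>s\<bar>"
    using phit_base[of N] N[of N] C(2) by auto
  \<comment> \<open>The recursion is taken with equality, which gives an explicit majorant for
    \<open>contraction_tendsto_0\<close>.\<close>
  define D where "D = rec_nat D0 (\<lambda>k z. (1 - kap / 4 * gamma (Suc (N + k))) * z + gamma (Suc (N + k)) * ep (N + k))"
  have D_0: "D 0 = D0" and D_Suc: "D (Suc k) = (1 - kap / 4 * gamma (Suc (N + k))) * D k + gamma (Suc (N + k)) * ep (N + k)" for k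
    by (simp_all add: D_def)
  have ep0: "0 \<le> ep n" if "n \<ge> N" for n
  proof -
    have "0 \<le> h n" using N[OF that] kap_pos by (simp add: h_def)
    thus ?thesis unfolding ep_def using C(1) uu_nonneg[of t] gamma_pos[of "Suc n"]
      by (intro add_nonneg_nonneg mult_nonneg_nonneg) auto
  qed
  have main: "0 \<le> D k \<and> (\<forall>s. \<bar>s\<bar> \<le> 1 \<longrightarrow> \<bar>phit t ph (N + k) s - psi s * cos ph\<bar> \<le> D k * \<bar>s\<bar>)" for k
  proof (induction k)
    case 0
    show ?case using D0 by (simp add: D_0)
  next
    case (Suc k)
    define n where "n = N + k"
    define g where "g = gamma (Suc n)"
    have n: "n \<ge> N" by (simp add: n_def)
    have g: "0 < g" using gamma_pos[of "Suc n"] by (simp add: g_def)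
    note b = be[OF n]
    have b1: "be n \<le> 1" using b mult_pos_pos[OF kap_pos g] unfolding g_def by linarith
    have "\<bar>phit t ph (Suc n) s - psi s * cos ph\<bar> \<le> D (Suc k) * \<bar>s\<bar>" if s: "\<bar>s\<bar> \<le> 1" for s
    proof -
      define q where "q = g * s\<^sup>2 * uu t / 2"
      have "\<bar>s * be n\<bar> = \<bar>s\<bar> * be n" using b by (simp add: abs_mult)
      hence sb: "\<bar>s * be n\<bar> \<le> 1" "\<bar>s * be n\<bar> \<le> \<bar>s\<bar> * (1 - kap / 4 * g)"
        using b b1 s mult_mono[of "\<bar>s\<bar>" 1 "be n" 1] mult_left_mono[of "be n" "1 - kap / 4 * g" "\<bar>s\<bar>"] by (auto simp: g_def)
      have q: "0 \<le> q" "q \<le> 1"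
      proof -
        show "0 \<le> q" using g uu_nonneg[of t] by (simp add: q_def)
        have "s\<^sup>2 \<le> 1" using s by (simp add: abs_square_le_1)
        hence "g * uu t * s\<^sup>2 \<le> g * uu t * 1" using g uu_nonneg[of t] by (intro mult_left_mono) auto
        thus "q \<le> 1" using N[OF n] by (simp add: q_def g_def mult_ac)
      qed
      have 1: "\<bar>phit t ph (Suc n) s - (1 - q) * phit t ph n (s * be n)\<bar> \<le> \<bar>s\<bar> * g * (C * sqrt g)"
        unfolding q_def g_def using N[OF n] s by (intro C(3)) auto
      have "\<bar>phit t ph n (s * be n) - psi (s * be n) * cos ph\<bar> \<le> D k * \<bar>s * be n\<bar>" using Suc sb(1) by (simp add: n_def)
      also have "\<dots> \<le> D k * (\<bar>s\<bar> * (1 - kap / 4 * g))" using Suc sb(2) by (intro mult_left_mono) auto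
      finally have "\<bar>phit t ph n (s * be n) - psi (s * be n) * cos ph\<bar> \<le> D k * (\<bar>s\<bar> * (1 - kap / 4 * g))" .
      hence 2: "\<bar>(1 - q) * (phit t ph n (s * be n) - psi (s * be n) * cos ph)\<bar> \<le> 1 * (D k * (\<bar>s\<bar> * (1 - kap / 4 * g)))"
        unfolding abs_mult[of "1 - q"] using q by (intro mult_mono) auto
      have 3: "\<bar>((1 - q) * psi (s * be n) - psi s) * cos ph\<bar> \<le>
          \<bar>s\<bar> * g * (uu t / 2 * (\<bar>h n - 1\<bar> + g * uu t / 2 * (h n + (h n)\<^sup>2)))"
      proof -
        have "\<bar>(1 - q) * psi (s * be n) - psi s\<bar> \<le> \<bar>s\<bar> * g * (uu t / 2 * (\<bar>h n - 1\<bar> + g * uu t / 2 * (h n + (h n)\<^sup>2)))"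
          unfolding q_def g_def h_def
          by (rule psi_step[OF s]) (use N[OF n] kap_pos in auto)
        moreover have "\<bar>((1 - q) * psi (s * be n) - psi s) * cos ph\<bar> \<le> \<bar>(1 - q) * psi (s * be n) - psi s\<bar> * 1"
          unfolding abs_mult[of _ "cos ph"] by (intro mult_left_mono) auto
        ultimately show ?thesis unfolding mult_1_right by (rule order_trans[rotated])
      qed
      have e: "phit t ph (Suc n) s - psi s * cos ph = (phit t ph (Suc n) s - (1 - q) * phit t ph n (s * be n))
          + (1 - q) * (phit t ph n (s * be n) - psi (s * be n) * cos ph) + ((1 - q) * psi (s * be n) - psi s) * cos ph"
        by (simp add: algebra_simps)
      have "\<bar>phit t ph (Suc n) s - psi s * cos ph\<bar> \<le> \<bar>s\<bar> * g * (C * sqrt g) + 1 * (D k * (\<bar>s\<bar> * (1 - kap / 4 * g)))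
          + \<bar>s\<bar> * g * (uu t / 2 * (\<bar>h n - 1\<bar> + g * uu t / 2 * (h n + (h n)\<^sup>2)))"
        unfolding e
        by (rule order_trans[OF abs_triangle_ineq add_mono[OF order_trans[OF abs_triangle_ineq add_mono[OF 1 2]] 3]])
      also have "\<dots> = D (Suc k) * \<bar>s\<bar>"
        unfolding D_Suc n_def[symmetric] g_def[symmetric] ep_def by (simp add: algebra_simps)
      finally show ?thesis .
    qed
    moreover have "0 \<le> D (Suc k)"
      unfolding D_Suc n_def[symmetric] g_def[symmetric]
      using Suc ep0[OF n] g N[OF n] by (intro add_nonneg_nonneg mult_nonneg_nonneg) (auto simp: g_def)
    ultimately show ?case by (simp add: n_def)
  qed
  have D0lim: "D \<longlonglongrightarrow> 0"
  proof (rule contraction_tendsto_0[where N=0 and k="kap / 4" and g="\<lambda>k. gamma (Suc (N + k))" and e="\<lambda>k. ep (N + k)"])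
    show "D (Suc k) \<le> (1 - kap / 4 * gamma (Suc (N + k))) * D k + gamma (Suc (N + k)) * ep (N + k)" for k by (simp add: D_Suc)
    show "0 \<le> gamma (Suc (N + k))" for k using gamma_pos[of "Suc (N + k)"] by simp
    show "kap / 4 * gamma (Suc (N + k)) \<le> 1" for k
      using N[of "N + k"] mult_pos_pos[OF kap_pos gamma_pos[of "Suc (N + k)"]] by simp
    show "(\<lambda>k. ep (N + k)) \<longlonglongrightarrow> 0" using LIMSEQ_ignore_initial_segment[OF epl, of N] by (simp add: add.commute)
    show "\<not> summable (\<lambda>k. gamma (Suc (N + k)))"
      using gamma_div summable_iff_shift[of "\<lambda>n. gamma (Suc n)" N] by (simp add: add.commute)
  qed (use main kap_pos in auto)
  have n0: "norm (phit t ph (N + k) 1 - psi 1 * cos ph) \<le> D k" for k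
    using main[of k] spec[OF conjunct2[OF main[of k]], of 1] by simp
  have "(\<lambda>k. phit t ph (N + k) 1 - psi 1 * cos ph) \<longlonglongrightarrow> 0"
    by (rule Lim_null_comparison[OF always_eventually D0lim]) (rule allI n0)+
  hence "(\<lambda>k. phit t ph (k + N) 1) \<longlonglongrightarrow> psi 1 * cos ph"
    by (simp add: LIM_zero_iff add.commute)
  thus ?thesis by (rule LIMSEQ_offset)
qed

lemma expectation_const_eq: "expectation (\<lambda>_. r) = (r :: real)" by (simp add: prob_space)

text \<open>Both corrections disappear in the limit: the one in the phase is
  \<open>sqrt gamma\<close> times a bounded function, the one for the variance is
  \<open>gamma\<close> times a bounded quantity.\<close>

lemma expectation_cos_tendsto:
  "(\<lambda>n. expectation (\<lambda>\<omega>. cos (t \<bullet> ((1 / sqrt (gamma n)) *\<^sub>R (th n \<omega> - ts)) + ph))) \<longlonglongrightarrow> exp (- (uu t / kap) / 2) * cos ph"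
proof -
  obtain K where K: "0 \<le> K" "\<And>n s. \<bar>cc t ph n s\<bar> \<le> K" by (rule cc_bounded) (rule that)
  obtain L where L: "0 \<le> L" "\<And>\<theta> x. \<theta> \<in> Theta \<Longrightarrow> \<bar>corr t \<theta> x\<bar> \<le> L"
    by (rule regularE[OF regular_corr]) (rule that)
  have "(\<lambda>n. gamma n / 2 * K) \<longlonglongrightarrow> 0 / 2 * K" by (intro tendsto_intros gamma_lim) simp
  hence K0: "(\<lambda>n. gamma n / 2 * K) \<longlonglongrightarrow> 0" by (simp only: div_0 mult_zero_left)
  have c0: "(\<lambda>n. gamma n / 2 * cc t ph n 1) \<longlonglongrightarrow> 0"
  proof (rule Lim_null_comparison[OF _ K0])
    show "eventually (\<lambda>n. norm (gamma n / 2 * cc t ph n 1) \<le> gamma n / 2 * K) sequentially"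
      using eventually_ge_at_top[of 1]
    proof eventually_elim
      case (elim n)
      have g: "0 \<le> gamma n / 2" using gamma_pos[OF elim] by simp
      show ?case unfolding real_norm_def abs_mult abs_of_nonneg[OF g] by (rule mult_left_mono[OF K(2) g])
    qed
  qed
  have e1: "phit t ph n 1 + gamma n / 2 * cc t ph n 1 = phi t ph n 1" for n unfolding phit_def by simp
  have phi: "(\<lambda>n. phi t ph n 1) \<longlonglongrightarrow> psi 1 * cos ph"
    using tendsto_add[OF phit_tendsto c0] unfolding e1 by (simp only: add_0_right)
  let ?E = "\<lambda>n. expectation (\<lambda>\<omega>. cos (t \<bullet> ((1 / sqrt (gamma n)) *\<^sub>R (th n \<omega> - ts)) + ph))"
  have "(\<lambda>n. ?E n - phi t ph n 1) \<longlonglongrightarrow> 0"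
  proof (rule Lim_null_comparison[of _ "\<lambda>n. sqrt (gamma n) * L"])
    have "(\<lambda>n. sqrt (gamma n) * L) \<longlonglongrightarrow> sqrt 0 * L" by (intro tendsto_intros gamma_lim)
    thus "(\<lambda>n. sqrt (gamma n) * L) \<longlonglongrightarrow> 0" by simp
    show "eventually (\<lambda>n. norm (?E n - phi t ph n 1) \<le> sqrt (gamma n) * L) sequentially"
      using eventually_ge_at_top[of 1]
    proof eventually_elim
      case (elim n)
      define r where "r = sqrt (gamma n)"
      have r: "0 < r" "gamma n = r * r" using gamma_pos[OF elim] by (auto simp: r_def)
      have b1: "bdd_rv (\<lambda>\<omega>. cos (t \<bullet> ((1 / r) *\<^sub>R (th n \<omega> - ts)) + ph))"
        unfolding inner_scaleR_right by (intro bdd_rv_cos bdd_rv_add bdd_rv_mult bdd_rv_const bdd_rv_Delta)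
      have b2: "bdd_rv (\<lambda>\<omega>. cos (1 * scaled t n \<omega> + ph))"
        by (intro bdd_rv_cos bdd_rv_add bdd_rv_mult bdd_rv_const bdd_rv_scaled)
      have "\<bar>expectation (\<lambda>\<omega>. cos (t \<bullet> ((1 / r) *\<^sub>R (th n \<omega> - ts)) + ph) - cos (1 * scaled t n \<omega> + ph))\<bar> \<le> expectation (\<lambda>\<omega>. r * L)"
      proof (rule abs_expectation_le_bdd[OF bdd_rv_diff[OF b1 b2] bdd_rv_const])
        fix \<omega> assume w: "\<omega> \<in> space M"
        have "t \<bullet> ((1 / r) *\<^sub>R (th n \<omega> - ts)) - scaled t n \<omega> = - (r * corr t (th n \<omega>) (X n \<omega>))"
          unfolding scaled_def corrected_def r_def[symmetric] r(2) using r(1) by (simp add: add_divide_distrib)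
        hence "\<bar>t \<bullet> ((1 / r) *\<^sub>R (th n \<omega> - ts)) - scaled t n \<omega>\<bar> \<le> r * L"
          using L(2)[OF th_Theta[OF w], of n "X n \<omega>"] r(1) by (simp add: abs_mult)
        thus "\<bar>cos (t \<bullet> ((1 / r) *\<^sub>R (th n \<omega> - ts)) + ph) - cos (1 * scaled t n \<omega> + ph)\<bar> \<le> r * L"
          using abs_cos_diff_le[of "t \<bullet> ((1 / r) *\<^sub>R (th n \<omega> - ts)) + ph" "1 * scaled t n \<omega> + ph"] by simp
      qed
      hence "\<bar>expectation (\<lambda>\<omega>. cos (t \<bullet> ((1 / r) *\<^sub>R (th n \<omega> - ts)) + ph)) - phi t ph n 1\<bar> \<le> r * L"
        unfolding expectation_diff_bdd[OF b1 b2] phi_def[symmetric] expectation_const_eq .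
      thus ?case unfolding r_def real_norm_def .
    qed
  qed
  from tendsto_add[OF this phi] have "?E \<longlonglongrightarrow> 0 + psi 1 * cos ph" unfolding diff_add_cancel .
  moreover have "psi 1 = exp (- (uu t / kap) / 2)" by (simp add: psi_def)
  ultimately show ?thesis by (simp only: add_0_left)
qed

end

section \<open>The limit theorem for initial weights bounded below\<close>

lemma char_tendsto:
  "(\<lambda>n. \<integral>\<omega>. cis (t \<bullet> ((1 / sqrt (gamma n)) *\<^sub>R (th n \<omega> - ts))) \<partial>M) \<longlonglongrightarrow> complex_of_real (exp (- (uu t / kap) / 2))"
proof (rule tendsto_complex_iff[THEN iffD2], intro conjI)
  let ?Y = "\<lambda>n \<omega>. t \<bullet> ((1 / sqrt (gamma n)) *\<^sub>R (th n \<omega> - ts))"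
  have i: "integrable M (\<lambda>\<omega>. cis (?Y n \<omega>))" for n
  proof (rule integrable_const_bound[where B=1])
    have [measurable]: "(\<lambda>x. cis x) \<in> borel_measurable borel"
      by (intro borel_measurable_continuous_onI continuous_intros)
    show "(\<lambda>\<omega>. cis (?Y n \<omega>)) \<in> borel_measurable M" by measurable
  qed simp
  have "Re (\<integral>\<omega>. cis (?Y n \<omega>) \<partial>M) = expectation (\<lambda>\<omega>. cos (?Y n \<omega> + 0))" for n
    using integral_Re[OF i[of n]] by simp
  thus "(\<lambda>n. Re (\<integral>\<omega>. cis (?Y n \<omega>) \<partial>M)) \<longlonglongrightarrow> Re (complex_of_real (exp (- (uu t / kap) / 2)))"
    using expectation_cos_tendsto[of t 0] by simp
  have "Im (\<integral>\<omega>. cis (?Y n \<omega>) \<partial>M) = expectation (\<lambda>\<omega>. cos (?Y n \<omega> + (- (pi / 2))))" for n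
    using integral_Im[OF i[of n]] by (simp add: cos_diff)
  thus "(\<lambda>n. Im (\<integral>\<omega>. cis (?Y n \<omega>) \<partial>M)) \<longlonglongrightarrow> Im (complex_of_real (exp (- (uu t / kap) / 2)))"
    using expectation_cos_tendsto[of t "- (pi / 2)"] by simp
qed

text \<open>Chebyshev's inequality with the mean-square rate; \<open>V\<close> dominates the squared
  norm through \<open>l1\<close>.\<close>

lemma tight:
  assumes e: "0 < e"
  shows "\<exists>R. eventually (\<lambda>n. measure M {\<omega>\<in>space M. R < norm ((1 / sqrt (gamma n)) *\<^sub>R (th n \<omega> - ts))} \<le> e) sequentially"
proof -
  obtain B R N where BN: "0 \<le> B" "0 \<le> R" "1 \<le> N"
    "\<And>n. n \<ge> N \<Longrightarrow> gamma n \<le> 1/2" "\<And>n. n \<ge> N \<Longrightarrow> gamma n \<le> 2 * gamma (Suc n)"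
    "\<And>n. n \<ge> N \<Longrightarrow> v n \<le> B * gamma n" "\<And>n. n \<ge> N \<Longrightarrow> 0 \<le> rr n \<and> rr n \<le> R"
    by (rule v_le_gamma) (rule that)
  \<comment> \<open>The square root makes \<open>4 * B / S^2\<close> at most \<open>e\<close>;
    adding 1 keeps \<open>S\<close> positive when \<open>B = 0\<close>.\<close>
  define S where "S = sqrt (4 * B / e) + 1"
  have S: "0 < S" "4 * B / e \<le> S\<^sup>2"
  proof -
    have "0 \<le> 4 * B / e" using BN(1) e by simp
    thus "0 < S" by (simp add: S_def add_nonneg_pos)
    have "(sqrt (4 * B / e))\<^sup>2 \<le> S\<^sup>2" unfolding S_def using \<open>0 \<le> 4 * B / e\<close> by (intro power_mono) auto
    thus "4 * B / e \<le> S\<^sup>2" using \<open>0 \<le> 4 * B / e\<close> by simp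
  qed
  have "measure M {\<omega>\<in>space M. S < norm ((1 / sqrt (gamma n)) *\<^sub>R (th n \<omega> - ts))} \<le> e" if n: "n \<ge> N" for n
  proof -
    define A where "A = {\<omega>\<in>space M. S < norm ((1 / sqrt (gamma n)) *\<^sub>R (th n \<omega> - ts))}"
    have A [measurable]: "A \<in> events" unfolding A_def by measurable
    have g: "0 < gamma n" using gamma_pos n BN(3) by simp
    have "prob A = expectation (indicator A)" using A by simp
    also have "\<dots> \<le> expectation (\<lambda>\<omega>. 4 / (gamma n * S\<^sup>2) * V (th n \<omega>))"
    proof (rule expectation_mono_bdd)
      show "bdd_rv (indicator A :: 'a \<Rightarrow> real)" by (rule bdd_rvI[where L=1]) auto
      fix \<omega> assume w: "\<omega> \<in> space M"
      show "indicator A \<omega> \<le> 4 / (gamma n * S\<^sup>2) * V (th n \<omega>)"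
      proof (cases "\<omega> \<in> A")
        case True
        have "norm (th n \<omega> - ts) \<le> l1 (th n \<omega>)"
          using norm_le_l1_cart[of "th n \<omega> - ts"] by (simp add: l1_def)
        moreover have "S < norm (th n \<omega> - ts) / sqrt (gamma n)" using True g by (simp add: A_def)
        hence "S * sqrt (gamma n) < norm (th n \<omega> - ts)" using g by (simp add: pos_less_divide_eq)
        ultimately have "S * sqrt (gamma n) \<le> l1 (th n \<omega>)" by linarith
        hence "(S * sqrt (gamma n))\<^sup>2 \<le> (l1 (th n \<omega>))\<^sup>2" using S(1) g by (intro power_mono) auto
        hence "S\<^sup>2 * gamma n \<le> 4 * V (th n \<omega>)"
          using l1_sq_le[OF th_Theta[OF w], of n] g by (simp add: power_mult_distrib)
        hence "1 \<le> 4 * V (th n \<omega>) / (gamma n * S\<^sup>2)" using g S(1) by (simp add: pos_le_divide_eq mult.commute)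
        thus ?thesis using True by simp
      next
        case False
        thus ?thesis using g S(1) V_nonneg[of "th n \<omega>"] by simp
      qed
    qed (intro bdd_rv_mult bdd_rv_const bdd_rv_V)
    also have "\<dots> = 4 / (gamma n * S\<^sup>2) * v n" by (simp add: v_def)
    also have "\<dots> \<le> 4 / (gamma n * S\<^sup>2) * (B * gamma n)" using BN(6)[OF n] g by (intro mult_left_mono) auto
    also have "\<dots> = 4 * B / S\<^sup>2" using g by simp
    also have "\<dots> \<le> e"
    proof -
      have "4 * B \<le> S\<^sup>2 * e" using S(2) e by (simp add: pos_divide_le_eq)
      thus ?thesis using S(1) by (simp add: pos_divide_le_eq mult.commute)
    qed
    finally show ?thesis by (simp add: A_def)
  qed
  thus ?thesis by (auto simp: eventually_sequentially)
qed

theorem clt: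
  assumes mu: "centered_gaussian mu ((1 / kap) *\<^sub>R U_star lam p I q)"
  shows "conv_in_distribution M (\<lambda>n \<omega>. (1 / sqrt (gamma n)) *\<^sub>R (th n \<omega> - ts)) mu"
proof (rule conv_in_distribution_of_char)
  show "prob_space M" by unfold_locales
  show "prob_space mu" "sets mu = sets borel" using mu by (auto simp: centered_gaussian_def)
  show "(\<lambda>\<omega>. (1 / sqrt (gamma n)) *\<^sub>R (th n \<omega> - ts)) \<in> borel_measurable M" for n by measurable
  show "(\<lambda>n. \<integral>\<omega>. cis (t \<bullet> ((1 / sqrt (gamma n)) *\<^sub>R (th n \<omega> - ts))) \<partial>M) \<longlonglongrightarrow> (\<integral>x. cis (t \<bullet> x) \<partial>mu)" for t
  proof -
    have "t \<bullet> (((1 / kap) *\<^sub>R U_star lam p I q) *v t) = uu t / kap"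
      by (simp add: scaleR_matrix_vector_assoc[symmetric] U_star_quadratic[OF ts_in] uu_def)
    hence "(\<integral>x. cis (t \<bullet> x) \<partial>mu) = complex_of_real (exp (- (uu t / kap) / 2))"
      using mu unfolding centered_gaussian_def by simp
    thus ?thesis using char_tendsto[of t] by simp
  qed
qed (rule tight)

end

section \<open>Conditioning on the initial weights\<close>

text \<open>The conditional law is moreover restricted to \<open>B\<close> as its space, so that a
  lower bound valid on \<open>B\<close> holds at every point, as \<open>wl_process\<close>
  demands.\<close>

lemma (in prob_space) conditional_measure:
  assumes B [measurable]: "B \<in> events" and pos: "0 < prob B"
  defines "N \<equiv> restrict_space (uniform_measure M B) B"
  shows prob_space_conditional: "prob_space N"
    and space_conditional: "space N = B"
    and measurable_conditional: "\<And>f :: 'a \<Rightarrow> 'b. \<And>K. f \<in> measurable M K \<Longrightarrow> f \<in> measurable N K"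
    and measure_conditional: "\<And>A. A \<in> events \<Longrightarrow> A \<subseteq> B \<Longrightarrow> measure N A = prob A / prob B"
    and integral_conditional: "\<And>f :: 'a \<Rightarrow> real. f \<in> borel_measurable M \<Longrightarrow>
      (\<integral>\<omega>. f \<omega> \<partial>N) = (\<integral>\<omega>. indicator B \<omega> * f \<omega> \<partial>M) / prob B"
proof -
  have sB: "B \<subseteq> space M" using sets.sets_into_space[OF B] .
  have e: "emeasure M B \<noteq> 0" "emeasure M B \<noteq> \<infinity>" using pos by (auto simp: emeasure_eq_measure)
  show "space N = B" using sB by (auto simp: N_def space_restrict_space)
  show "f \<in> measurable M K \<Longrightarrow> f \<in> measurable N K" for f :: "'a \<Rightarrow> 'b" and K
    unfolding N_def by (intro measurable_restrict_space1) simp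
  have BN: "B \<inter> space (uniform_measure M B) \<in> sets (uniform_measure M B)" using sB B by (simp add: Int_absorb2)
  show "prob_space N"
    unfolding N_def
    by (rule prob_spaceI)
      (use sB B in \<open>simp add: space_restrict_space emeasure_restrict_space[OF BN] Int_absorb2 emeasure_uniform_measure_1[OF e]\<close>)
  show "measure N A = prob A / prob B" if "A \<in> events" "A \<subseteq> B" for A
    unfolding N_def using that measure_restrict_space[OF BN that(2)] measure_uniform_measure[OF e that(1)]
    by (simp add: Int_absorb1)
  show "(\<integral>\<omega>. f \<omega> \<partial>N) = (\<integral>\<omega>. indicator B \<omega> * f \<omega> \<partial>M) / prob B"
    if [measurable]: "f \<in> borel_measurable M" for f :: "'a \<Rightarrow> real"
  proof -
    have "indicator B \<omega> / emeasure M B = ennreal (indicator B \<omega> / prob B)" for \<omega>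
      using pos by (simp add: emeasure_eq_measure divide_ennreal[symmetric] ennreal_indicator)
    hence u: "uniform_measure M B = density M (\<lambda>\<omega>. ennreal (indicator B \<omega> / prob B))"
      by (simp add: uniform_measure_def)
    have "(\<integral>\<omega>. f \<omega> \<partial>N) = (\<integral>\<omega>. indicator B \<omega> *\<^sub>R f \<omega> \<partial>uniform_measure M B)"
      unfolding N_def by (rule integral_restrict_space[OF BN])
    also have "\<dots> = (\<integral>\<omega>. (indicator B \<omega> / prob B) *\<^sub>R (indicator B \<omega> *\<^sub>R f \<omega>) \<partial>M)"
      unfolding u by (rule integral_density) auto
    also have "\<dots> = (\<integral>\<omega>. (indicator B \<omega> * f \<omega>) / prob B \<partial>M)"
      by (intro Bochner_Integration.integral_cong) (auto simp: indicator_def)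
    finally show ?thesis by simp
  qed
qed

lemma Theta_I:
  fixes \<theta> :: "real ^ 'd::finite"
  assumes d: "CARD('d) \<ge> 2" and pos: "\<And>i. 0 < \<theta> $ i" and sum: "(\<Sum>i\<in>UNIV. \<theta> $ i) = 1"
  shows "\<theta> \<in> Theta"
proof -
  have "\<theta> $ i < 1" for i
  proof -
    have "\<exists>j. j \<noteq> i"
    proof (rule ccontr)
      assume "\<not> (\<exists>j. j \<noteq> i)"
      hence "UNIV = {i}" by auto
      hence "CARD('d) = card {i}" by (simp only:)
      thus False using d by simp
    qed
    then obtain j where j: "j \<noteq> i" by blast
    have "\<theta> $ i + \<theta> $ j = (\<Sum>k\<in>{i, j}. \<theta> $ k)" using j by simp
    also have "\<dots> \<le> (\<Sum>k\<in>UNIV. \<theta> $ k)" by (rule sum_mono2) (auto intro: less_imp_le pos)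
    finally show ?thesis using sum pos[of j] by simp
  qed
  thus ?thesis using pos sum by (simp add: Theta_def)
qed

text \<open>Each weight is multiplied by one plus \<open>g\<close> times its relative growth, which
  is positive because \<open>g < 1\<close>; the increments sum to zero because the weights sum to
  one.\<close>

lemma WL_step_Theta:
  fixes \<theta> :: "real ^ 'd::finite"
  assumes d: "CARD('d) \<ge> 2" and th: "\<theta> \<in> Theta" and g: "0 \<le> g" "g < 1"
  shows "\<theta> + g *\<^sub>R WL_field I x \<theta> \<in> Theta"
proof (rule Theta_I[OF d])
  fix i
  have "g * (\<theta> $ I x - indicator {y. I y = i} x) \<le> g * 1"
    using g Theta_less_1[OF th, of "I x"] by (intro mult_left_mono) (auto simp: indicator_def)
  hence "0 < 1 + g * (indicator {y. I y = i} x - \<theta> $ I x)" using g by (simp add: right_diff_distrib)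
  hence "0 < \<theta> $ i * (1 + g * (indicator {y. I y = i} x - \<theta> $ I x))" using Theta_pos[OF th] by simp
  thus "0 < (\<theta> + g *\<^sub>R WL_field I x \<theta>) $ i" by (simp add: WL_field_def algebra_simps)
next
  have "(\<Sum>i\<in>UNIV. WL_field I x \<theta> $ i) = (\<Sum>i\<in>UNIV. (if I x = i then \<theta> $ i else 0)) - (\<Sum>i\<in>UNIV. \<theta> $ i) * \<theta> $ I x"
    unfolding WL_field_def sum_distrib_right sum_subtractf[symmetric]
    by (intro sum.cong) (auto simp: indicator_def algebra_simps)
  also have "\<dots> = 0" by (simp add: Theta_sum[OF th])
  finally show "(\<Sum>i\<in>UNIV. (\<theta> + g *\<^sub>R WL_field I x \<theta>) $ i) = 1"
    by (simp add: sum.distrib sum_distrib_left[symmetric] Theta_sum[OF th])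
qed

section \<open>The limit theorem for arbitrary initial weights\<close>

text \<open>Here the transition law is conditional on the whole history. This is what permits
  conditioning on an event about the initial weights without disturbing later transitions.\<close>

locale wl_algorithm = wl_model lam p I q a b c + prob_space M
  for lam :: "'x::polish_space measure" and p and I :: "'x \<Rightarrow> 'd::finite" and q a b c
    and M :: "'a measure" +
  fixes gamma :: "nat \<Rightarrow> real" and X :: "nat \<Rightarrow> 'a \<Rightarrow> 'x" and th :: "nat \<Rightarrow> 'a \<Rightarrow> real ^ 'd"
    and rho :: real
  assumes d2: "CARD('d) \<ge> 2"
    and gamma_pos: "\<And>n. n \<ge> 1 \<Longrightarrow> 0 < gamma n"
    and gamma_less_1: "\<And>n. n \<ge> 1 \<Longrightarrow> gamma n < 1"
    and gamma_mono: "\<And>n. n \<ge> 1 \<Longrightarrow> gamma (Suc n) \<le> gamma n"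
    and gamma_lim: "gamma \<longlonglongrightarrow> 0"
    and gamma_div: "\<not> summable (\<lambda>n. gamma (Suc n))"
    and gamma_ratio: "(\<lambda>n. (gamma n / gamma (Suc n) - 1) / gamma (Suc n)) \<longlonglongrightarrow> rho"
    and rho_less: "rho < 2 / CARD('d)"
    and X_meas [measurable]: "\<And>n. X n \<in> measurable M borel"
    and th0_meas [measurable]: "th 0 \<in> borel_measurable M"
    and th0_Theta: "\<And>\<omega>. \<omega> \<in> space M \<Longrightarrow> th 0 \<omega> \<in> Theta"
    and X_trans: "\<And>n B A. B \<in> nat_filtration M (th 0) X n \<Longrightarrow> A \<in> sets borel \<Longrightarrow>
      measure M (B \<inter> {\<omega> \<in> space M. X (Suc n) \<omega> \<in> A})
        = (\<integral>\<omega>. indicator B \<omega> * MH_prob lam p I q (th n \<omega>) (X n \<omega>) A \<partial>M)"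
    and th_rec: "\<And>n \<omega>. \<omega> \<in> space M \<Longrightarrow>
      th (Suc n) \<omega> = th n \<omega> + gamma (Suc n) *\<^sub>R WL_field I (X (Suc n) \<omega>) (th n \<omega>)"
begin

lemma th_Theta: "\<omega> \<in> space M \<Longrightarrow> th n \<omega> \<in> Theta"
proof (induction n)
  case (Suc n)
  show ?case unfolding th_rec[OF Suc.prems]
    by (rule WL_step_Theta[OF d2 Suc.IH[OF Suc.prems]])
      (use gamma_pos[of "Suc n"] gamma_less_1[of "Suc n"] in simp_all)
qed (rule th0_Theta)

lemma th_adapted:
  assumes s: "space N = space M" and th0: "th 0 \<in> borel_measurable N"
    and X: "\<And>k. k \<le> n \<Longrightarrow> X k \<in> measurable N borel" and k: "k \<le> n"
  shows "th k \<in> borel_measurable N"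
  using k
proof (induction k)
  case 0
  show ?case by (rule th0)
next
  case (Suc k)
  have [measurable]: "th k \<in> borel_measurable N" "X (Suc k) \<in> measurable N borel"
    using Suc X by auto
  have "th (Suc k) \<in> borel_measurable N \<longleftrightarrow>
      (\<lambda>\<omega>. th k \<omega> + gamma (Suc k) *\<^sub>R WL_field I (X (Suc k) \<omega>) (th k \<omega>)) \<in> borel_measurable N"
    by (rule measurable_cong) (simp add: th_rec s)
  thus ?case by simp
qed

lemma th_meas [measurable]: "th n \<in> borel_measurable M"
  by (rule th_adapted[OF refl th0_meas X_meas order_refl])

text \<open>The filtration as a measure space, so that membership of an event becomes a question of
  measurability.\<close>

definition history :: "nat \<Rightarrow> 'a measure" where "history n = sigma (space M) (nat_filtration M (th 0) X n)"

lemma space_history [simp]: "space (history n) = space M"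
  and sets_history: "sets (history n) = nat_filtration M (th 0) X n"
proof -
  let ?G = "{th 0 -` B \<inter> space M | B. B \<in> sets (borel :: (real ^ 'd) measure)} \<union>
      (\<Union>k\<le>n. {X k -` A \<inter> space M | A. A \<in> sets (borel :: 'x measure)})"
  have G: "?G \<subseteq> Pow (space M)" by auto
  have F: "nat_filtration M (th 0) X n \<subseteq> Pow (space M)"
    unfolding nat_filtration_def using sigma_sets_into_sp[OF G] by auto
  show "space (history n) = space M" unfolding history_def by (simp add: space_measure_of[OF F])
  show "sets (history n) = nat_filtration M (th 0) X n"
    unfolding history_def sets_measure_of[OF F] unfolding nat_filtration_def by (rule sigma_sets_sigma_sets_eq[OF G])
qed

lemma X_history: "k \<le> n \<Longrightarrow> X k \<in> measurable (history n) borel"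
  and th0_history: "th 0 \<in> borel_measurable (history n)"
  unfolding measurable_def mem_Collect_eq sets_history space_history nat_filtration_def
  by (auto intro!: sigma_sets.Basic)

lemma th_history: "k \<le> n \<Longrightarrow> th k \<in> borel_measurable (history n)"
  by (rule th_adapted[OF space_history th0_history X_history])

definition large :: "nat \<Rightarrow> 'a set" where
  "large m = {\<omega> \<in> space M. \<forall>i. inverse (real (Suc m)) \<le> th 0 \<omega> $ i}"

lemma large_history: "large m \<in> sets (history n)"
proof -
  note [measurable] = th0_history
  have "{\<omega> \<in> space (history n). \<forall>i. inverse (real (Suc m)) \<le> th 0 \<omega> $ i} \<in> sets (history n)" by measurable
  thus ?thesis by (simp add: large_def)
qed

lemma large_meas [measurable]: "large m \<in> events"
  unfolding large_def by measurable

text \<open>Finitely many positive weights have a positive minimum, so these events increase to the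
  whole space.\<close>

lemma prob_large: "(\<lambda>m. prob (large m)) \<longlonglongrightarrow> 1"
proof -
  have "(\<lambda>m. prob (large m)) \<longlonglongrightarrow> prob (\<Union>m. large m)"
  proof (rule finite_Lim_measure_incseq)
    show "incseq large"
    proof (rule incseq_SucI, rule subsetI)
      fix m \<omega> assume "\<omega> \<in> large m"
      moreover have "inverse (real (Suc (Suc m))) \<le> inverse (real (Suc m))" by (rule le_imp_inverse_le) auto
      ultimately show "\<omega> \<in> large (Suc m)" unfolding large_def mem_Collect_eq by (blast intro: order_trans)
    qed
  qed auto
  also have "(\<Union>m. large m) = space M"
  proof
    show "(\<Union>m. large m) \<subseteq> space M" by (auto simp: large_def)
    show "space M \<subseteq> (\<Union>m. large m)"
    proof
      fix \<omega> assume w: "\<omega> \<in> space M"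
      define r where "r = Min (range (\<lambda>i. th 0 \<omega> $ i))"
      have "0 < r" unfolding r_def using Theta_pos[OF th0_Theta[OF w]] by simp
      then obtain m where m: "inverse (real (Suc m)) < r" by (rule reals_Archimedean[elim_format]) blast
      have "r \<le> th 0 \<omega> $ i" for i unfolding r_def by simp
      hence "\<omega> \<in> large m" using w m by (auto simp: large_def intro: order_trans less_imp_le)
      thus "\<omega> \<in> (\<Union>m. large m)" by blast
    qed
  qed
  finally show ?thesis by (simp add: prob_space)
qed

text \<open>\<open>large m\<close> is an event of the initial sigma-algebra, so its intersection
  with a past event is a past event; conditioning divides both sides of the transition formula by
  the same probability.\<close>

lemma conditioned_process:
  assumes pos: "0 < prob (large m)"
  shows "wl_process lam p I q a b c (restrict_space (uniform_measure M (large m)) (large m)) gamma X th (inverse (real (Suc m))) rho"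
proof -
  let ?B = "large m" and ?N = "restrict_space (uniform_measure M (large m)) (large m)"
  note cond = conditional_measure[OF large_meas pos]
  interpret N: prob_space ?N by (rule cond(1))
  have sN: "space ?N = ?B" by (rule cond(2))
  have inM: "\<omega> \<in> space M" if "\<omega> \<in> space ?N" for \<omega> using that unfolding sN by (simp add: large_def)
  show ?thesis
  proof unfold_locales
    show "X n \<in> measurable ?N borel" for n by (rule measurable_conditional[OF large_meas pos X_meas])
    show "th n \<in> borel_measurable ?N" for n by (rule measurable_conditional[OF large_meas pos th_meas])
    show "inverse (real (Suc m)) \<le> th 0 \<omega> $ i" if "\<omega> \<in> space ?N" for \<omega> i
      using that unfolding sN by (simp add: large_def)
    show "th n \<omega> \<in> Theta" "th (Suc n) \<omega> = th n \<omega> + gamma (Suc n) *\<^sub>R WL_field I (X (Suc n) \<omega>) (th n \<omega>)"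
      if "\<omega> \<in> space ?N" for n \<omega> using th_Theta[OF inM[OF that]] th_rec[OF inM[OF that]] by blast+
    fix n and B :: "((real ^ 'd) \<times> 'x) set" and A :: "'x set"
    assume B [measurable]: "B \<in> sets (borel \<Otimes>\<^sub>M borel)" and A [measurable]: "A \<in> sets borel"
    define C where "C = {\<omega> \<in> space M. \<omega> \<in> ?B \<and> (th n \<omega>, X n \<omega>) \<in> B}"
    have C: "C \<in> nat_filtration M (th 0) X n"
    proof -
      note [measurable] = th_history[OF order_refl[of n]] X_history[OF order_refl[of n]] large_history[of m n]
      have "{\<omega> \<in> space (history n). \<omega> \<in> ?B \<and> (th n \<omega>, X n \<omega>) \<in> B} \<in> sets (history n)" by measurable
      thus ?thesis by (simp add: C_def sets_history)
    qed
    have Ce: "{\<omega>\<in>space ?N. (th n \<omega>, X n \<omega>) \<in> B \<and> X (Suc n) \<omega> \<in> A} = C \<inter> {\<omega> \<in> space M. X (Suc n) \<omega> \<in> A}"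
      unfolding sN C_def large_def by auto
    have Cm: "C \<inter> {\<omega> \<in> space M. X (Suc n) \<omega> \<in> A} \<in> events" unfolding C_def by measurable
    have Pm: "(\<lambda>\<omega>. indicator B (th n \<omega>, X n \<omega>) * P (th n \<omega>) (indicator A) (X n \<omega>)) \<in> borel_measurable M"
      by (intro borel_measurable_times P_measurable[where g="\<lambda>_. indicator A"]) measurable
    have "measure ?N {\<omega>\<in>space ?N. (th n \<omega>, X n \<omega>) \<in> B \<and> X (Suc n) \<omega> \<in> A} =
        prob (C \<inter> {\<omega> \<in> space M. X (Suc n) \<omega> \<in> A}) / prob ?B"
      unfolding Ce by (rule measure_conditional[OF large_meas pos Cm]) (auto simp: C_def)
    also have "prob (C \<inter> {\<omega> \<in> space M. X (Suc n) \<omega> \<in> A}) =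
        (\<integral>\<omega>. indicator C \<omega> * P (th n \<omega>) (indicator A) (X n \<omega>) \<partial>M)"
      unfolding X_trans[OF C A] MH_prob_def ..
    also have "\<dots> = (\<integral>\<omega>. indicator ?B \<omega> * (indicator B (th n \<omega>, X n \<omega>) * P (th n \<omega>) (indicator A) (X n \<omega>)) \<partial>M)"
      by (intro Bochner_Integration.integral_cong refl) (auto simp: C_def indicator_def)
    also have "\<dots> / prob ?B = (\<integral>\<omega>. indicator B (th n \<omega>, X n \<omega>) * P (th n \<omega>) (indicator A) (X n \<omega>) \<partial>?N)"
      by (rule integral_conditional[OF large_meas pos Pm, symmetric])
    finally show "measure ?N {\<omega>\<in>space ?N. (th n \<omega>, X n \<omega>) \<in> B \<and> X (Suc n) \<omega> \<in> A} =
        (\<integral>\<omega>. indicator B (th n \<omega>, X n \<omega>) * P (th n \<omega>) (indicator A) (X n \<omega>) \<partial>?N)" .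
  qed (use d2 gamma_pos gamma_less_1 gamma_mono gamma_lim gamma_div gamma_ratio rho_less in auto)
qed

text \<open>The conditional limit law is the same for every \<open>m\<close>. It suffices to fix one
  \<open>m\<close> for which the complement of \<open>large m\<close> is improbable, since the
  complement changes expectations of a bounded \<open>f\<close> by a multiple of its
  probability.\<close>

theorem clt:
  assumes mu: "centered_gaussian mu ((1 / (2 / real CARD('d) - rho)) *\<^sub>R U_star lam p I q)"
  shows "conv_in_distribution M (\<lambda>n \<omega>. (1 / sqrt (gamma n)) *\<^sub>R (th n \<omega> - ts)) mu"
  unfolding conv_in_distribution_def
proof (intro allI impI, elim conjE)
  fix f :: "real ^ 'd \<Rightarrow> real"
  assume cont: "continuous_on UNIV f" and bdd: "bounded (range f)"
  have [measurable]: "f \<in> borel_measurable borel" by (rule borel_measurable_continuous_onI[OF cont])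
  obtain L where L: "0 < L" "\<And>y. \<bar>f y\<bar> \<le> L" using bdd unfolding bounded_pos by auto
  define Y where "Y n \<omega> = (1 / sqrt (gamma n)) *\<^sub>R (th n \<omega> - ts)" for n \<omega>
  have [measurable]: "Y n \<in> borel_measurable M" for n unfolding Y_def[abs_def] by measurable
  have fY: "(\<lambda>\<omega>. f (Y n \<omega>)) \<in> borel_measurable M" for n by measurable
  have ifY: "integrable M (\<lambda>\<omega>. f (Y n \<omega>))" for n
    by (rule integrable_const_bound[where B=L]) (auto simp: L)
  define l where "l = (\<integral>x. f x \<partial>mu)"
  interpret mu: prob_space mu using mu by (simp add: centered_gaussian_def)
  have lL: "\<bar>l\<bar> \<le> L"
  proof -
    have "sets mu = sets borel" using mu by (simp add: centered_gaussian_def)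
    hence [measurable_cong]: "sets mu = sets borel" .
    have "integrable mu f" by (rule mu.integrable_const_bound[where B=L]) (auto simp: L)
    hence "\<bar>l\<bar> \<le> (\<integral>x. L \<partial>mu)"
      unfolding l_def by (intro order_trans[OF integral_abs_bound integral_mono]) (auto simp: L)
    thus ?thesis by (simp add: mu.prob_space)
  qed
  show "(\<lambda>n. \<integral>\<omega>. f ((1 / sqrt (gamma n)) *\<^sub>R (th n \<omega> - ts)) \<partial>M) \<longlonglongrightarrow> (\<integral>x. f x \<partial>mu)"
    unfolding Y_def[symmetric] l_def[symmetric]
  proof (rule LIMSEQ_I)
    fix e :: real assume e: "0 < e"
    \<comment> \<open>\<open>1/2\<close> keeps the conditioning event of positive probability;
      \<open>e / (4 * L)\<close> bounds the two contributions of the complement, at most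
      \<open>L * dl\<close> each, by \<open>e / 2\<close> together.\<close>
    define dl where "dl = min (1/2) (e / (4 * L))"
    have dl: "0 < dl" "dl \<le> 1/2" "dl * (4 * L) \<le> e" using e L(1) by (auto simp: dl_def min_def field_simps)
    have "eventually (\<lambda>m. 1 - dl < prob (large m)) sequentially"
      using dl(1) by (intro order_tendstoD(1)[OF prob_large]) simp
    then obtain m where m: "1 - dl < prob (large m)" using eventually_happens'[OF sequentially_bot] by blast
    have pos: "0 < prob (large m)" using m dl(2) by simp
    let ?N = "restrict_space (uniform_measure M (large m)) (large m)"
    interpret N: wl_process lam p I q a b c ?N gamma X th "inverse (real (Suc m))" rho
      by (rule conditioned_process[OF pos])
    have "conv_in_distribution ?N (\<lambda>n \<omega>. (1 / sqrt (gamma n)) *\<^sub>R (th n \<omega> - ts)) mu"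
      by (rule N.clt) (use mu in \<open>simp add: N.kap_def\<close>)
    hence "(\<lambda>n. \<integral>\<omega>. f (Y n \<omega>) \<partial>?N) \<longlonglongrightarrow> l"
      using cont bdd unfolding conv_in_distribution_def Y_def l_def by blast
    then obtain n0 where n0: "\<And>n. n \<ge> n0 \<Longrightarrow> \<bar>(\<integral>\<omega>. f (Y n \<omega>) \<partial>?N) - l\<bar> < e / 2"
      using LIMSEQ_D[of _ l "e / 2"] e unfolding real_norm_def by (meson half_gt_zero)
    show "\<exists>n0. \<forall>n\<ge>n0. norm ((\<integral>\<omega>. f (Y n \<omega>) \<partial>M) - l) < e"
    proof (intro exI allI impI)
      fix n assume n: "n \<ge> n0"
      define J where "J = (\<integral>\<omega>. f (Y n \<omega>) \<partial>?N)"
      define R where "R = (\<integral>\<omega>. indicator (space M - large m) \<omega> * f (Y n \<omega>) \<partial>M)"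
      have iB: "integrable M (\<lambda>\<omega>. indicator (large m) \<omega> * f (Y n \<omega>))"
        using integrable_mult_indicator[OF large_meas ifY] by simp
      have cB: "space M - large m \<in> events" by measurable
      have iC: "integrable M (\<lambda>\<omega>. indicator (space M - large m) \<omega> * f (Y n \<omega>))"
        using integrable_mult_indicator[OF cB ifY] by simp
      have J: "(\<integral>\<omega>. indicator (large m) \<omega> * f (Y n \<omega>) \<partial>M) = prob (large m) * J"
        unfolding J_def integral_conditional[OF large_meas pos fY] using pos by simp
      have "(\<integral>\<omega>. f (Y n \<omega>) \<partial>M) = (\<integral>\<omega>. indicator (large m) \<omega> * f (Y n \<omega>) + indicator (space M - large m) \<omega> * f (Y n \<omega>) \<partial>M)"
        by (intro Bochner_Integration.integral_cong refl) (auto simp: indicator_def)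
      also have "\<dots> = prob (large m) * J + R"
        unfolding R_def Bochner_Integration.integral_add[OF iB iC] J ..
      finally have s: "(\<integral>\<omega>. f (Y n \<omega>) \<partial>M) - l = prob (large m) * (J - l) + (R - (1 - prob (large m)) * l)"
        by (simp add: algebra_simps)
      have "\<bar>R\<bar> \<le> (\<integral>\<omega>. L * indicator (space M - large m) \<omega> \<partial>M)"
        unfolding R_def
      proof (rule order_trans[OF integral_abs_bound integral_mono])
        show "integrable M (\<lambda>\<omega>. L * indicator (space M - large m) \<omega>)"
          using cB by (intro integrable_mult_right integrable_real_indicator) (auto simp: emeasure_eq_measure)
      qed (use integrable_abs[OF iC] in \<open>auto simp: abs_mult L indicator_def\<close>)
      also have "\<dots> = L * (1 - prob (large m))" using cB by (simp add: prob_compl)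
      finally have R: "\<bar>R\<bar> \<le> L * (1 - prob (large m))" .
      have 1: "\<bar>prob (large m) * (J - l)\<bar> < e / 2"
      proof -
        have "\<bar>prob (large m) * (J - l)\<bar> \<le> 1 * \<bar>J - l\<bar>" unfolding abs_mult by (intro mult_right_mono) auto
        thus ?thesis using n0[OF n] by (simp add: J_def)
      qed
      have 2: "\<bar>(1 - prob (large m)) * l\<bar> \<le> L * (1 - prob (large m))"
        using mult_right_mono[OF lL, of "1 - prob (large m)"] by (simp add: abs_mult mult.commute)
      have "L * (1 - prob (large m)) < L * dl" using m L(1) by (intro mult_strict_left_mono) auto
      moreover have "4 * (L * dl) \<le> e" using dl(3) by (simp add: mult_ac)
      ultimately have 3: "4 * (L * (1 - prob (large m))) < e" by linarith
      show "norm ((\<integral>\<omega>. f (Y n \<omega>) \<partial>M) - l) < e"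
        unfolding s real_norm_def using 1 2 3 R by linarith
    qed
  qed
qed

end

section \<open>From (A4) to the limit of the step-size ratios\<close>

text \<open>With \<open>l\<close> the logarithm of the ratio, \<open>exp l - 1\<close> lies between
  \<open>l\<close> and \<open>l * exp l\<close>, and \<open>l\<close> tends to zero because it is
  comparable to \<open>gamma\<close>. Replacing \<open>gamma n\<close> by
  \<open>gamma (Suc n)\<close> in the denominator costs one more factor \<open>exp l\<close>, which
  tends to 1.\<close>

lemma log_ratio_tendsto:
  fixes gamma :: "nat \<Rightarrow> real"
  assumes pos: "\<And>n. n \<ge> 1 \<Longrightarrow> 0 < gamma n" and mono: "\<And>n. n \<ge> 1 \<Longrightarrow> gamma (Suc n) \<le> gamma n"
    and lim: "gamma \<longlonglongrightarrow> 0" and r: "(\<lambda>n. ln (gamma n / gamma (Suc n)) / gamma n) \<longlonglongrightarrow> rho"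
  shows "(\<lambda>n. (gamma n / gamma (Suc n) - 1) / gamma (Suc n)) \<longlonglongrightarrow> rho"
proof -
  define l where "l n = ln (gamma n / gamma (Suc n))" for n
  have ex: "exp (l n) = gamma n / gamma (Suc n)" if "n \<ge> 1" for n
    using pos[OF that] pos[of "Suc n"] by (simp add: l_def)
  have l0: "0 \<le> l n" if "n \<ge> 1" for n
    using pos[of "Suc n"] mono[OF that] by (simp add: l_def)
  have rl: "(\<lambda>n. l n / gamma n) \<longlonglongrightarrow> rho" using r by (simp add: l_def)
  have "(\<lambda>n. l n / gamma n * gamma n) \<longlonglongrightarrow> rho * 0" by (rule tendsto_mult[OF rl lim])
  moreover have "eventually (\<lambda>n. l n / gamma n * gamma n = l n) sequentially"
    using eventually_ge_at_top[of 1]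
  proof eventually_elim
    case (elim n)
    show ?case using pos[OF elim] by simp
  qed
  ultimately have "l \<longlonglongrightarrow> 0" using Lim_transform_eventually by fastforce
  hence el: "(\<lambda>n. exp (l n)) \<longlonglongrightarrow> 1" using tendsto_exp[of l 0] by simp
  have "(\<lambda>n. (exp (l n) - 1) / gamma n) \<longlonglongrightarrow> rho"
  proof (rule tendsto_sandwich[OF _ _ rl])
    show "(\<lambda>n. l n / gamma n * exp (l n)) \<longlonglongrightarrow> rho" using tendsto_mult[OF rl el] by simp
    show "eventually (\<lambda>n. l n / gamma n \<le> (exp (l n) - 1) / gamma n) sequentially"
      using eventually_ge_at_top[of 1]
    proof eventually_elim
      case (elim n)
      have "l n \<le> exp (l n) - 1" using exp_ge_add_one_self[of "l n"] by linarith
      thus ?case using pos[OF elim] by (intro divide_right_mono) auto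
    qed
    show "eventually (\<lambda>n. (exp (l n) - 1) / gamma n \<le> l n / gamma n * exp (l n)) sequentially"
      using eventually_ge_at_top[of 1]
    proof eventually_elim
      case (elim n)
      have "(1 - l n) * exp (l n) \<le> exp (- l n) * exp (l n)"
        using exp_ge_add_one_self[of "- l n"] by (intro mult_right_mono) auto
      hence "exp (l n) - 1 \<le> l n * exp (l n)" by (simp add: exp_add[symmetric] algebra_simps)
      hence "(exp (l n) - 1) / gamma n \<le> (l n * exp (l n)) / gamma n" using pos[OF elim] by (intro divide_right_mono) auto
      thus ?case by simp
    qed
  qed
  from tendsto_mult[OF this el] have "(\<lambda>n. (exp (l n) - 1) / gamma n * exp (l n)) \<longlonglongrightarrow> rho" by simp
  moreover have "eventually (\<lambda>n. (exp (l n) - 1) / gamma n * exp (l n) = (gamma n / gamma (Suc n) - 1) / gamma (Suc n)) sequentially"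
    using eventually_ge_at_top[of 1]
  proof eventually_elim
    case (elim n)
    show ?case unfolding ex[OF elim] using pos[OF elim] by simp
  qed
  ultimately show ?thesis by (rule Lim_transform_eventually)
qed

theorem theorem5:
  fixes lam :: "'x::polish_space measure"
    and p :: "'x \<Rightarrow> real"
    and I :: "'x \<Rightarrow> 'd::finite"
    and q :: "'x \<Rightarrow> 'x \<Rightarrow> real"
    and gamma :: "nat \<Rightarrow> real"
    and gs sig2 :: real
    and M :: "'a measure"
    and X :: "nat \<Rightarrow> 'a \<Rightarrow> 'x"
    and th :: "nat \<Rightarrow> 'a \<Rightarrow> real ^ 'd"
  assumes d2: "CARD('d) \<ge> 2"
    \<comment> \<open>setting\<close>
    and lam_sets: "sets lam = sets borel"
    and lam_sf: "sigma_finite_measure lam"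
    and pi_meas: "p \<in> borel_measurable lam"
    and pi_nonneg: "\<And>x. 0 \<le> p x"
    and pi_dens: "(\<integral>\<^sup>+ x. ennreal (p x) \<partial>lam) = 1"
    and I_meas: "I \<in> measurable lam (count_space UNIV)"
    \<comment> \<open>(A1)\<close>
    and A1_pi: "\<exists>a b. 0 < a \<and> (\<forall>x. a \<le> p x \<and> p x \<le> b)"
    and A1_th: "\<And>i. 0 < theta_star lam p I $ i"
    \<comment> \<open>(A2): symmetric proposal density q w.r.t. lam, bounded below\<close>
    and q_meas: "(\<lambda>(x, y). q x y) \<in> borel_measurable (lam \<Otimes>\<^sub>M lam)"
    and q_sym: "\<And>x y. q x y = q y x"
    and q_dens: "\<And>x. (\<integral>\<^sup>+ y. ennreal (q x y) \<partial>lam) = 1"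
    and q_pos: "\<exists>c>0. \<forall>x y. c \<le> q x y"
    \<comment> \<open>(A3)\<close>
    and A3_range: "\<And>n. n \<ge> 1 \<Longrightarrow> 0 \<le> gamma n \<and> gamma n < 1"
    and A3_mono: "\<And>n. n \<ge> 1 \<Longrightarrow> gamma (Suc n) \<le> gamma n"
    and A3_lim: "gamma \<longlonglongrightarrow> 0"
    and A3_div: "\<not> summable (\<lambda>n. gamma (Suc n))"
    and A3_sq: "summable (\<lambda>n. (gamma (Suc n))\<^sup>2)"
    \<comment> \<open>(A4), with sig2 the corresponding variance factor\<close>
    and A4_sqrt: "(\<lambda>n. gamma n * sqrt (real n)) \<longlonglongrightarrow> 0"
    and A4_cases:
      "((\<lambda>n. ln (gamma n / gamma (Suc n))) \<in> o(\<lambda>n. gamma n) \<and> sig2 = real CARD('d) / 2)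
       \<or> (gs > real CARD('d) / 2 \<and>
          (\<lambda>n. ln (gamma n / gamma (Suc n))) \<sim>[at_top] (\<lambda>n. gamma n / gs) \<and>
          sig2 = gs * real CARD('d) / (2 * gs - real CARD('d)))"
    \<comment> \<open>the linearized Wang--Landau algorithm on a probability space M\<close>
    and M_prob: "prob_space M"
    and X_meas: "\<And>n. X n \<in> measurable M borel"
    and th0_meas: "th 0 \<in> borel_measurable M"
    and th0_Theta: "\<And>\<omega>. \<omega> \<in> space M \<Longrightarrow> th 0 \<omega> \<in> Theta"
    and X_trans: "\<And>n B A. B \<in> nat_filtration M (th 0) X n \<Longrightarrow> A \<in> sets (borel :: 'x measure) \<Longrightarrow>
        measure M (B \<inter> {\<omega> \<in> space M. X (Suc n) \<omega> \<in> A})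
          = (\<integral>\<omega>. indicator B \<omega> * MH_prob lam p I q (th n \<omega>) (X n \<omega>) A \<partial>M)"
    and th_rec: "\<And>n \<omega>. \<omega> \<in> space M \<Longrightarrow>
        th (Suc n) \<omega> = th n \<omega> + gamma (Suc n) *\<^sub>R WL_field I (X (Suc n) \<omega>) (th n \<omega>)"
  shows "\<exists>mu. centered_gaussian mu (sig2 *\<^sub>R U_star lam p I q) \<and>
           conv_in_distribution M
             (\<lambda>n \<omega>. (1 / sqrt (gamma n)) *\<^sub>R (th n \<omega> - theta_star lam p I)) mu"
proof -
  obtain a b where ab: "0 < a" "\<And>x. a \<le> p x" "\<And>x. p x \<le> b" using A1_pi by blast
  obtain c where c: "0 < c" "\<And>x y. c \<le> q x y" using q_pos by blast
  \<comment> \<open>(A3) allows zero steps, but by monotonicity a zero step would be followed by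
    zero steps only, and the sum would converge.\<close>
  have gpos: "0 < gamma n" if n: "n \<ge> 1" for n
  proof (rule ccontr)
    assume "\<not> 0 < gamma n"
    hence 0: "gamma n = 0" using A3_range[OF n] by linarith
    have z: "gamma (Suc (k + n)) = 0" for k
    proof (induction k)
      case 0
      show ?case using A3_mono[OF n] A3_range[of "Suc n"] \<open>gamma n = 0\<close> by simp
    next
      case (Suc k)
      show ?case using A3_mono[of "Suc (k + n)"] A3_range[of "Suc (Suc (k + n))"] Suc by simp
    qed
    have "summable (\<lambda>k. gamma (Suc (k + n)))" unfolding z by (rule summable_zero)
    thus False using A3_div summable_iff_shift[of "\<lambda>n. gamma (Suc n)" n] by simp
  qed
  have dpos: "0 < real CARD('d)" using d2 by simp
  \<comment> \<open>\<open>rho\<close> is 0 in case (i) and \<open>1 / gs\<close> in case (ii); in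
    both, \<open>1 / (2/d - rho)\<close> is the stated variance factor, and \<open>gs > d/2\<close>
    amounts to \<open>rho < 2/d\<close>.\<close>
  obtain rho where r: "(\<lambda>n. ln (gamma n / gamma (Suc n)) / gamma n) \<longlonglongrightarrow> rho"
    and rho: "rho < 2 / real CARD('d)" and s2: "sig2 = 1 / (2 / real CARD('d) - rho)"
    using A4_cases
  proof (elim disjE conjE)
    assume "(\<lambda>n. ln (gamma n / gamma (Suc n))) \<in> o(\<lambda>n. gamma n)" and s: "sig2 = real CARD('d) / 2"
    hence "(\<lambda>n. ln (gamma n / gamma (Suc n)) / gamma n) \<longlonglongrightarrow> 0" by (intro smalloD_tendsto)
    thus thesis using that[of 0] dpos s by simp
  next
    assume gs: "gs > real CARD('d) / 2" and s: "sig2 = gs * real CARD('d) / (2 * gs - real CARD('d))"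
      and e: "(\<lambda>n. ln (gamma n / gamma (Suc n))) \<sim>[at_top] (\<lambda>n. gamma n / gs)"
    have gs0: "0 < gs" using gs dpos by linarith
    \<comment> \<open>Asymptotic equivalence gives a limit of the plain quotient once the two sides
      are not both zero.\<close>
    have "eventually (\<lambda>n. ln (gamma n / gamma (Suc n)) \<noteq> 0 \<or> gamma n / gs \<noteq> 0) sequentially"
      using eventually_ge_at_top[of 1]
    proof eventually_elim
      case (elim n)
      show ?case using gpos[OF elim] gs0 by simp
    qed
    from asymp_equivD_strong[OF e this]
    have "(\<lambda>n. ln (gamma n / gamma (Suc n)) / (gamma n / gs) * (1 / gs)) \<longlonglongrightarrow> 1 * (1 / gs)"
      by (intro tendsto_mult tendsto_const)
    hence "(\<lambda>n. ln (gamma n / gamma (Suc n)) / gamma n) \<longlonglongrightarrow> 1 / gs" using gs0 by simp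
    moreover have "1 / gs < 2 / real CARD('d)" using gs gs0 dpos by (simp add: field_simps)
    moreover have "sig2 = 1 / (2 / real CARD('d) - 1 / gs)"
    proof -
      have "2 / real CARD('d) - 1 / gs = (2 * gs - real CARD('d)) / (gs * real CARD('d))"
        using gs0 dpos by (simp add: field_simps)
      thus ?thesis by (simp add: s)
    qed
    ultimately show thesis by (rule that)
  qed
  have s0: "0 \<le> sig2" using rho by (simp add: s2)
  have ratio: "(\<lambda>n. (gamma n / gamma (Suc n) - 1) / gamma (Suc n)) \<longlonglongrightarrow> rho"
    by (rule log_ratio_tendsto[of gamma, OF _ _ A3_lim r]) (fact gpos A3_mono)+
  interpret prob_space M by (rule M_prob)
  interpret wl_algorithm lam p I q a b c M gamma X th rho
    by unfold_locales
      (fact lam_sets pi_meas pi_dens I_meas ab A1_th q_meas q_sym q_dens c d2 gpos A3_mono A3_lim A3_div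
        ratio rho X_meas th0_meas th0_Theta X_trans th_rec conjunct2[OF A3_range])+
  have ts: "ts \<in> Theta" by (rule ts_Theta[OF d2])
  \<comment> \<open>The limit law has to be exhibited separately, as \<open>clt\<close> takes it as
    given; symmetry and nonnegativity of \<open>U_star\<close>, with \<open>sig2\<close>
    nonnegative, supply it.\<close>
  have "\<exists>mu. centered_gaussian mu (sig2 *\<^sub>R U_star lam p I q)"
  proof (rule centered_gaussian_exists)
    show "(sig2 *\<^sub>R U_star lam p I q) $ i $ j = (sig2 *\<^sub>R U_star lam p I q) $ j $ i" for i j
      using U_star_sym[OF ts, of i j] by simp
    show "0 \<le> t \<bullet> ((sig2 *\<^sub>R U_star lam p I q) *v t)" for t
      using U_star_psd[OF ts, of t] s0 by (simp add: scaleR_matrix_vector_assoc[symmetric])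
  qed
  then obtain mu where mu: "centered_gaussian mu (sig2 *\<^sub>R U_star lam p I q)" by blast
  show ?thesis using mu clt[OF mu[unfolded s2]] by blast
qed

end
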